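(* Let $(X,g,\mu_g)$ be a complete, admissible Riemannian polyhedron (with $\partial X=\emptyset$), and let $f\in W^{1,2}_{\mathrm{loc}}(X)\cap L^2(X)$ be a non-negative, weakly subharmonic function. Then $f$ is constant.
   Context: Riemannian polyhedra. A polyhedron is a connected locally compact separable Hausdorff space $X$ homeomorphic, via some $\theta:|K|\to X$, to the space $|K|$ of a countable, locally finite simplicial complex $K$ of finite dimension; $(K,\theta)$ is a triangulation. $|K|$ carries the barycentric distance $\rho(\alpha,\beta)=(\sum_v(\alpha(v)-\beta(v))^2)^{1/2}$ and is affinely Lipschitz-homeomorphically embedded as a closed subset of a Euclidean space. $X$ is a Lipschitz polyhedron if it is a metric space and $\theta$ is a Lipschitz homeomorphism. A Riemannian polyhedron is a Lipschitz polyhedron $X$ such that, for some triangulation, each maximal simplex $s$ (viewed in the Euclidean space) carries a measurable Riemannian metric $g^s=g_{ij}dx^idx^j$ with $\Lambda^{-2}\|\xi\|^2\le g_{ij}(x)\xi^i\xi^j\le\Lambda^2\|\xi\|^2$ for a.e. $x\in s$, with $\Lambda$ independent of $s$. $d_X=d_X^g$ is the associated intrinsic distance: $d_X^g(x,y)$ is the supremum, over null sets $Z$, of the infimum of $g$-lengths of Lipschitz paths from $x$ to $y$ meeting $Z$ only on a parameter set of measure zero. Complete means $(X,d_X^g)$ is complete. The volume measure $\mu_g$ is given simplexwise by $d\mu_g=\sqrt{\det(g_{ij})}\,dx_1\cdots dx_n$. $X^{k}$ denotes the $k$-skeleton. Admissible: in some (hence any) triangulation, all maximal simplexes have the same dimension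 $n=\dim X$, and $X$ is locally $(n-1)$-chainable, i.e. for every connected open $U\subset X$ the set $U\setminus X^{n-2}$ is connected. $\partial X$ is the union of all non-maximal simplexes contained in only one maximal simplex; it is always assumed that $\partial X=\emptyset$. Sobolev spaces. $W^{1,2}(X)$ is the completion of the space of Lipschitz functions $u:(X,d_X)\to\mathbb R$ with finite norm $\|u\|_{1,2}^2=\int_X(u^2+|\nabla u|^2)\,d\mu_g$, where $\nabla u$ is the Riemannian gradient, defined a.e. on each $n$-simplex. $\mathrm{Lip}_c(X)$: Lipschitz functions with compact support. $W^{1,2}_{\mathrm{loc}}(X)$: all $u\in L^2_{\mathrm{loc}}(X)$ with $u\in W^{1,2}(U)$ for all relatively compact subdomains $U\subset X$. $f\in W^{1,2}_{\mathrm{loc}}(X)$ is weakly subharmonic if $\int_X\langle\nabla f,\nabla\rho\rangle\,d\mu_g\le 0$ for every non-negative $\rho\in\mathrm{Lip}_c(X)$. *)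

theory Defs
  imports "HOL-Analysis.Analysis"
begin

section \<open>Simplicial complexes, their realizations, Lipschitz homeomorphisms\<close>

definition simplicial_complex :: "'v set set \<Rightarrow> bool" where
  "simplicial_complex K \<longleftrightarrow>
     (\<forall>s\<in>K. finite s \<and> s \<noteq> {}) \<and> (\<forall>s\<in>K. \<forall>t. t \<subseteq> s \<and> t \<noteq> {} \<longrightarrow> t \<in> K)"

definition locally_finite_complex :: "'v set set \<Rightarrow> bool" where
  "locally_finite_complex K \<longleftrightarrow> (\<forall>v. finite {s \<in> K. v \<in> s})"

definition finite_dimensional_complex :: "'v set set \<Rightarrow> bool" where
  "finite_dimensional_complex K \<longleftrightarrow> (\<exists>N. \<forall>s\<in>K. card s \<le> N)"

definition maximal_simplexes :: "'v set set \<Rightarrow> 'v set set" where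
  "maximal_simplexes K = {s \<in> K. \<forall>t\<in>K. s \<subseteq> t \<longrightarrow> t = s}"

definition supp :: "('v \<Rightarrow> real) \<Rightarrow> 'v set" where
  "supp \<alpha> = {v. \<alpha> v \<noteq> 0}"

definition realization :: "'v set set \<Rightarrow> ('v \<Rightarrow> real) set" where
  "realization K = {\<alpha>. supp \<alpha> \<in> K \<and> (\<forall>v. 0 \<le> \<alpha> v) \<and> sum \<alpha> (supp \<alpha>) = 1}"

definition bary_dist :: "('v \<Rightarrow> real) \<Rightarrow> ('v \<Rightarrow> real) \<Rightarrow> real" where
  "bary_dist \<alpha> \<beta> = sqrt (\<Sum>v\<in>supp \<alpha> \<union> supp \<beta>. (\<alpha> v - \<beta> v)\<^sup>2)"

text \<open>Lipschitz homeomorphisms are understood locally. The barycentric distance is bounded,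
  so for an infinite complex no globally bi-Lipschitz map onto a closed subset of a
  Euclidean space exists.\<close>

definition locally_lipschitz ::
    "'p set \<Rightarrow> ('p \<Rightarrow> 'p \<Rightarrow> real) \<Rightarrow> ('q \<Rightarrow> 'q \<Rightarrow> real) \<Rightarrow> ('p \<Rightarrow> 'q) \<Rightarrow> bool" where
  "locally_lipschitz M d d' h \<longleftrightarrow>
     (\<forall>x\<in>M. \<exists>r>0. \<exists>L. \<forall>y\<in>M. \<forall>z\<in>M. d x y < r \<and> d x z < r \<longrightarrow> d' (h y) (h z) \<le> L * d y z)"

definition lipschitz_homeomorphism ::
    "'p set \<Rightarrow> ('p \<Rightarrow> 'p \<Rightarrow> real) \<Rightarrow> 'q set \<Rightarrow> ('q \<Rightarrow> 'q \<Rightarrow> real) \<Rightarrow> ('p \<Rightarrow> 'q) \<Rightarrow> bool" where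
  "lipschitz_homeomorphism M d N d' h \<longleftrightarrow>
     bij_betw h M N \<and> locally_lipschitz M d d' h \<and> locally_lipschitz N d' d (inv_into M h)"


section \<open>Riemannian polyhedra\<close>

text \<open>The polyhedron \<open>X\<close> is the whole type \<open>'a\<close>. The data are a complex \<open>rp_complex\<close>, a
  triangulation \<open>rp_triang\<close>, the positions \<open>rp_vertex\<close> of the vertices under an affine
  embedding in the Euclidean space \<open>'e\<close>, Euclidean coordinates on the affine hull of
  each maximal simplex (\<open>rp_origin\<close> and an orthonormal frame \<open>rp_frame\<close>), and the matrix
  \<open>(g\<^sub>i\<^sub>j)\<close> of the Riemannian metric in these coordinates, \<open>rp_metric\<close>.
  The coordinate space is \<open>real ^ 'n\<close>, so all maximal simplexes have the dimension \<open>n = CARD('n)\<close>.\<close>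

record ('a, 'v, 'e, 'n::finite) riem_poly =
  rp_complex :: "'v set set"
  rp_triang :: "('v \<Rightarrow> real) \<Rightarrow> 'a"
  rp_vertex :: "'v \<Rightarrow> 'e"
  rp_origin :: "'v set \<Rightarrow> 'e"
  rp_frame :: "'v set \<Rightarrow> 'n \<Rightarrow> 'e"
  rp_metric :: "'v set \<Rightarrow> real^'n \<Rightarrow> real^'n^'n"

definition rp_space :: "('a, 'v, 'e, 'n::finite) riem_poly \<Rightarrow> ('v \<Rightarrow> real) set" where
  "rp_space P = realization (rp_complex P)"

definition rp_max :: "('a, 'v, 'e, 'n::finite) riem_poly \<Rightarrow> 'v set set" where
  "rp_max P = maximal_simplexes (rp_complex P)"

definition rp_embed ::
    "('a, 'v, 'e::euclidean_space, 'n::finite) riem_poly \<Rightarrow> ('v \<Rightarrow> real) \<Rightarrow> 'e" where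
  "rp_embed P \<alpha> = (\<Sum>v\<in>supp \<alpha>. \<alpha> v *\<^sub>R rp_vertex P v)"

definition rp_chart ::
    "('a, 'v, 'e::euclidean_space, 'n::finite) riem_poly \<Rightarrow> 'v set \<Rightarrow> real^'n \<Rightarrow> 'e" where
  "rp_chart P s x = rp_origin P s + (\<Sum>i\<in>UNIV. (x $ i) *\<^sub>R rp_frame P s i)"

text \<open>The simplex \<open>s\<close> in its Euclidean coordinates, and the parametrization of the
  corresponding part of \<open>X\<close>.\<close>

definition rp_dom ::
    "('a, 'v, 'e::euclidean_space, 'n::finite) riem_poly \<Rightarrow> 'v set \<Rightarrow> (real^'n) set" where
  "rp_dom P s = {x. rp_chart P s x \<in> convex hull (rp_vertex P ` s)}"

definition rp_param ::
    "('a, 'v, 'e::euclidean_space, 'n::finite) riem_poly \<Rightarrow> 'v set \<Rightarrow> real^'n \<Rightarrow> 'a" where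
  "rp_param P s x = rp_triang P (inv_into (rp_space P) (rp_embed P) (rp_chart P s x))"

definition rp_bary :: "('a, 'v, 'e, 'n::finite) riem_poly \<Rightarrow> 'a \<Rightarrow> ('v \<Rightarrow> real)" where
  "rp_bary P y = inv_into (rp_space P) (rp_triang P) y"

text \<open>The simplex containing \<open>y\<close> in its relative interior.\<close>

definition rp_carrier :: "('a, 'v, 'e, 'n::finite) riem_poly \<Rightarrow> 'a \<Rightarrow> 'v set" where
  "rp_carrier P y = supp (rp_bary P y)"

definition rp_coord ::
    "('a, 'v, 'e::euclidean_space, 'n::finite) riem_poly \<Rightarrow> 'v set \<Rightarrow> 'a \<Rightarrow> real^'n" where
  "rp_coord P s y = (\<chi> i. (rp_embed P (rp_bary P y) - rp_origin P s) \<bullet> rp_frame P s i)"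

definition polyhedron_triangulation ::
    "('a::metric_space, 'v, 'e::euclidean_space, 'n::finite) riem_poly \<Rightarrow> bool" where
  "polyhedron_triangulation P \<longleftrightarrow>
     connected (UNIV :: 'a set) \<and>
     locally_compact_space (euclidean :: 'a topology) \<and>
     (\<exists>D :: 'a set. countable D \<and> closure D = UNIV) \<and>
     simplicial_complex (rp_complex P) \<and>
     countable (rp_complex P) \<and>
     locally_finite_complex (rp_complex P) \<and>
     finite_dimensional_complex (rp_complex P) \<and>
     lipschitz_homeomorphism (rp_space P) bary_dist UNIV dist (rp_triang P)"

definition euclidean_embedding ::
    "('a, 'v, 'e::euclidean_space, 'n::finite) riem_poly \<Rightarrow> bool" where
  "euclidean_embedding P \<longleftrightarrow>
     lipschitz_homeomorphism (rp_space P) bary_dist (rp_embed P ` rp_space P) dist (rp_embed P) \<and>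
     closed (rp_embed P ` rp_space P)"

definition riemannian_polyhedron ::
    "('a::metric_space, 'v, 'e::euclidean_space, 'n::finite) riem_poly \<Rightarrow> bool" where
  "riemannian_polyhedron P \<longleftrightarrow>
     polyhedron_triangulation P \<and>
     euclidean_embedding P \<and>
     (\<forall>s\<in>rp_max P.
        (\<forall>i j. rp_frame P s i \<bullet> rp_frame P s j = (if i = j then 1 else 0)) \<and>
        range (rp_chart P s) = affine hull (rp_vertex P ` s) \<and>
        rp_metric P s \<in> borel_measurable (lebesgue_on (rp_dom P s))) \<and>
     (\<exists>\<Lambda>>0. \<forall>s\<in>rp_max P. AE x in lebesgue_on (rp_dom P s).
        transpose (rp_metric P s x) = rp_metric P s x \<and>
        (\<forall>\<xi>. (norm \<xi>)\<^sup>2 / \<Lambda>\<^sup>2 \<le> \<xi> \<bullet> (rp_metric P s x *v \<xi>) \<and>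
             \<xi> \<bullet> (rp_metric P s x *v \<xi>) \<le> \<Lambda>\<^sup>2 * (norm \<xi>)\<^sup>2))"


section \<open>Volume, length and intrinsic distance\<close>

text \<open>A set is measurable if its trace on every maximal simplex is Lebesgue measurable.\<close>

definition rp_vol ::
    "('a, 'v, 'e::euclidean_space, 'n::finite) riem_poly \<Rightarrow> 'a measure" where
  "rp_vol P = measure_of UNIV
     {A. \<forall>s\<in>rp_max P. {x \<in> rp_dom P s. rp_param P s x \<in> A} \<in> sets lebesgue}
     (\<lambda>A. \<integral>\<^sup>+s. (\<integral>\<^sup>+x\<in>{x \<in> rp_dom P s. rp_param P s x \<in> A}.
                       ennreal (sqrt (det (rp_metric P s x))) \<partial>lebesgue)
                 \<partial>count_space (rp_max P))"

lemma closed_rp_dom: 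
  fixes P :: "('a, 'v, 'e::euclidean_space, 'n::finite) riem_poly"
  assumes "finite s" shows "closed (rp_dom P s)"
proof -
  have c: "closed (convex hull (rp_vertex P ` s))"
    using assms by (simp add: compact_imp_closed finite_imp_compact_convex_hull)
  have "continuous_on UNIV (rp_chart P s)"
    unfolding rp_chart_def by (intro continuous_intros)
  then have "closed (rp_chart P s -` (convex hull (rp_vertex P ` s)))"
    using c by (simp add: continuous_closed_vimage continuous_on_eq_continuous_at)
  then show ?thesis by (simp add: rp_dom_def vimage_def)
qed

lemma
  fixes P :: "('a::metric_space, 'v, 'e::euclidean_space, 'n::finite) riem_poly"
  assumes "riemannian_polyhedron P"
  defines "F \<equiv> {A. \<forall>s\<in>rp_max P. {x \<in> rp_dom P s. rp_param P s x \<in> A} \<in> sets lebesgue}"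
  shows sets_rp_vol: "sets (rp_vol P) = F"
  and emeasure_rp_vol: "A \<in> F \<Longrightarrow> emeasure (rp_vol P) A = (\<integral>\<^sup>+s. (\<integral>\<^sup>+x\<in>{x \<in> rp_dom P s. rp_param P s x \<in> A}.
                       ennreal (sqrt (det (rp_metric P s x))) \<partial>lebesgue)
                 \<partial>count_space (rp_max P))"
proof -
  have fin: "finite s" if "s \<in> rp_max P" for s
  proof -
    have "simplicial_complex (rp_complex P)"
      using assms(1) unfolding riemannian_polyhedron_def polyhedron_triangulation_def by (elim conjE)
    moreover have "s \<in> rp_complex P" using that by (simp add: rp_max_def maximal_simplexes_def)
    ultimately show ?thesis by (simp add: simplicial_complex_def)
  qed
  have D: "rp_dom P s \<in> sets lebesgue" if "s \<in> rp_max P" for s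
    using borel_closed[OF closed_rp_dom[OF fin[OF that], of P]] by simp
  have sa: "sigma_algebra UNIV F"
    unfolding sigma_algebra_iff2
  proof (intro conjI ballI allI impI)
    show "F \<subseteq> Pow UNIV" by simp
    show "{} \<in> F" by (simp add: F_def)
  next
    fix A assume A: "A \<in> F"
    show "UNIV - A \<in> F" unfolding F_def
    proof (intro CollectI ballI)
      fix s assume s: "s \<in> rp_max P"
      have "{x \<in> rp_dom P s. rp_param P s x \<in> UNIV - A} = rp_dom P s - {x \<in> rp_dom P s. rp_param P s x \<in> A}" by auto
      then show "{x \<in> rp_dom P s. rp_param P s x \<in> UNIV - A} \<in> sets lebesgue"
        using D[OF s] A s by (auto simp: F_def)
    qed
  next
    fix A :: "nat \<Rightarrow> 'a set" assume A: "range A \<subseteq> F"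
    show "(\<Union>i. A i) \<in> F" unfolding F_def
    proof (intro CollectI ballI)
      fix s assume s: "s \<in> rp_max P"
      have e: "{x \<in> rp_dom P s. rp_param P s x \<in> (\<Union>i. A i)} = (\<Union>i. {x \<in> rp_dom P s. rp_param P s x \<in> A i})" by auto
      show "{x \<in> rp_dom P s. rp_param P s x \<in> (\<Union>i. A i)} \<in> sets lebesgue"
        unfolding e using A s by (intro sets.countable_UN) (auto simp: F_def)
    qed
  qed
  have ss: "sigma_sets UNIV F = F" using sa by (rule sigma_algebra.sigma_sets_eq)
  show "sets (rp_vol P) = F" unfolding rp_vol_def F_def[symmetric] using ss by simp
  define \<mu> where "\<mu> = (\<lambda>A. \<integral>\<^sup>+s. (\<integral>\<^sup>+x\<in>{x \<in> rp_dom P s. rp_param P s x \<in> A}.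
                       ennreal (sqrt (det (rp_metric P s x))) \<partial>lebesgue)
                 \<partial>count_space (rp_max P))"
  have meas: "(\<lambda>x. ennreal (sqrt (det (rp_metric P s x))) * indicator B x) \<in> borel_measurable lebesgue" 
    if s: "s \<in> rp_max P" and B: "B \<in> sets lebesgue" "B \<subseteq> rp_dom P s" for s B
  proof -
    have m: "rp_metric P s \<in> borel_measurable (lebesgue_on (rp_dom P s))"
      using assms(1) s unfolding riemannian_polyhedron_def by (elim conjE) simp
    have "(\<lambda>A::real^'n^'n. det A) \<in> borel_measurable borel"
      unfolding det_def by (intro borel_measurable_continuous_onI continuous_intros)
    from measurable_compose[OF m this]
    have "(\<lambda>x. ennreal (sqrt (det (rp_metric P s x)))) \<in> borel_measurable (lebesgue_on (rp_dom P s))"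
      by (intro measurable_compose[OF _ measurable_ennreal] borel_measurable_sqrt) (simp add: o_def)
    then have "(\<lambda>x. ennreal (sqrt (det (rp_metric P s x))) * indicator (rp_dom P s) x) \<in> borel_measurable lebesgue"
      using D[OF s] borel_measurable_restrict_space_iff_ennreal[of "rp_dom P s" lebesgue] by auto
    then have "(\<lambda>x. (ennreal (sqrt (det (rp_metric P s x))) * indicator (rp_dom P s) x) * indicator B x) \<in> borel_measurable lebesgue"
      using B(1) by (rule borel_measurable_times_ennreal[OF _ borel_measurable_indicator])
    moreover have "(\<lambda>x. (ennreal (sqrt (det (rp_metric P s x))) * indicator (rp_dom P s) x) * indicator B x) = (\<lambda>x. ennreal (sqrt (det (rp_metric P s x))) * indicator B x)"
      using B(2) by (intro ext) (auto split: split_indicator)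
    ultimately show ?thesis by simp
  qed
  have ca: "countably_additive F \<mu>"
  proof (rule countably_additiveI)
    fix A :: "nat \<Rightarrow> 'a set" assume A: "range A \<subseteq> F" "disjoint_family A" "\<Union>(range A) \<in> F"
    let ?B = "\<lambda>s i. {x \<in> rp_dom P s. rp_param P s x \<in> A i}"
    have "(\<Sum>i. \<mu> (A i)) = (\<integral>\<^sup>+s. (\<Sum>i. (\<integral>\<^sup>+x\<in>?B s i. ennreal (sqrt (det (rp_metric P s x))) \<partial>lebesgue)) \<partial>count_space (rp_max P))"
      unfolding \<mu>_def by (rule nn_integral_suminf[symmetric]) simp
    also have "\<dots> = \<mu> (\<Union>(range A))" unfolding \<mu>_def
    proof (intro nn_integral_cong)
      fix s assume "s \<in> space (count_space (rp_max P))"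
      then have s: "s \<in> rp_max P" by simp
      have "(\<Sum>i. (\<integral>\<^sup>+x\<in>?B s i. ennreal (sqrt (det (rp_metric P s x))) \<partial>lebesgue)) = (\<integral>\<^sup>+x. (\<Sum>i. ennreal (sqrt (det (rp_metric P s x))) * indicator (?B s i) x) \<partial>lebesgue)"
      proof (rule nn_integral_suminf[symmetric], rule meas[OF s])
        fix i
        have "A i \<in> F" using A(1) by auto
        then show "?B s i \<in> sets lebesgue" using s unfolding F_def by simp
      qed simp
      also have "\<dots> = (\<integral>\<^sup>+x\<in>{x \<in> rp_dom P s. rp_param P s x \<in> \<Union>(range A)}. ennreal (sqrt (det (rp_metric P s x))) \<partial>lebesgue)"
      proof (intro nn_integral_cong)
        fix x :: "real^'n"
        have "disjoint_family (?B s)" using A(2) by (auto simp: disjoint_family_on_def)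
        then have "(\<Sum>i. indicator (?B s i) x) = (indicator (\<Union>i. ?B s i) x :: ennreal)"
          by (rule suminf_indicator)
        moreover have "(\<Union>i. ?B s i) = {x \<in> rp_dom P s. rp_param P s x \<in> \<Union>(range A)}" by auto
        ultimately show "(\<Sum>i. ennreal (sqrt (det (rp_metric P s x))) * indicator (?B s i) x) = ennreal (sqrt (det (rp_metric P s x))) * indicator {x \<in> rp_dom P s. rp_param P s x \<in> \<Union>(range A)} x"
          by simp
      qed
      finally show "(\<Sum>i. (\<integral>\<^sup>+x\<in>?B s i. ennreal (sqrt (det (rp_metric P s x))) \<partial>lebesgue)) = (\<integral>\<^sup>+x\<in>{x \<in> rp_dom P s. rp_param P s x \<in> \<Union>(range A)}. ennreal (sqrt (det (rp_metric P s x))) \<partial>lebesgue)" .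
    qed
    finally show "(\<Sum>i. \<mu> (A i)) = \<mu> (\<Union>(range A))" .
  qed
  have pos: "positive F \<mu>" by (simp add: positive_def \<mu>_def)
  assume AF: "A \<in> F"
  show "emeasure (rp_vol P) A = (\<integral>\<^sup>+s. (\<integral>\<^sup>+x\<in>{x \<in> rp_dom P s. rp_param P s x \<in> A}.
                       ennreal (sqrt (det (rp_metric P s x))) \<partial>lebesgue)
                 \<partial>count_space (rp_max P))"
    using emeasure_measure_of_sigma[OF sa pos ca AF] unfolding rp_vol_def F_def[symmetric] \<mu>_def by simp
qed

text \<open>Tangent vectors at a point in the interior of a maximal simplex are given by their
  components in the coordinates of that simplex. On the \<open>(n-1)\<close>-skeleton, a null set,
  the following notions have no meaning.\<close>

definition rp_g ::
    "('a, 'v, 'e::euclidean_space, 'n::finite) riem_poly \<Rightarrow> 'a \<Rightarrow> real^'n^'n" where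
  "rp_g P y = rp_metric P (rp_carrier P y) (rp_coord P (rp_carrier P y) y)"

definition rp_inner ::
    "('a, 'v, 'e::euclidean_space, 'n::finite) riem_poly \<Rightarrow> 'a \<Rightarrow> real^'n \<Rightarrow> real^'n \<Rightarrow> real" where
  "rp_inner P y v w = v \<bullet> (rp_g P y *v w)"

definition rp_speed ::
    "('a, 'v, 'e::euclidean_space, 'n::finite) riem_poly \<Rightarrow> (real \<Rightarrow> 'a) \<Rightarrow> real \<Rightarrow> real" where
  "rp_speed P \<gamma> t =
     (if rp_carrier P (\<gamma> t) \<in> rp_max P
      then let w = vector_derivative (\<lambda>\<tau>. rp_coord P (rp_carrier P (\<gamma> t)) (\<gamma> \<tau>)) (at t)
           in sqrt (rp_inner P (\<gamma> t) w w)
      else 0)"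

definition rp_length ::
    "('a, 'v, 'e::euclidean_space, 'n::finite) riem_poly \<Rightarrow> (real \<Rightarrow> 'a) \<Rightarrow> ennreal" where
  "rp_length P \<gamma> = (\<integral>\<^sup>+t\<in>{0..1}. ennreal (rp_speed P \<gamma> t) \<partial>lebesgue)"

definition transversal_paths :: "'a::metric_space set \<Rightarrow> 'a \<Rightarrow> 'a \<Rightarrow> (real \<Rightarrow> 'a) set" where
  "transversal_paths Z x y =
     {\<gamma>. (\<exists>L. L-lipschitz_on {0..1} \<gamma>) \<and> \<gamma> 0 = x \<and> \<gamma> 1 = y \<and>
         {t \<in> {0..1}. \<gamma> t \<in> Z} \<in> null_sets lebesgue}"

text \<open>The infimum increases with \<open>Z\<close>, so only null sets containing the \<open>(n-1)\<close>-skeleton and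
  the points where the metric is degenerate contribute to the supremum. The convention for
  the speed on the skeleton is therefore immaterial.\<close>

definition rp_edist ::
    "('a::metric_space, 'v, 'e::euclidean_space, 'n::finite) riem_poly \<Rightarrow> 'a \<Rightarrow> 'a \<Rightarrow> ennreal" where
  "rp_edist P x y =
     (SUP Z\<in>null_sets (rp_vol P). INF \<gamma>\<in>transversal_paths Z x y. rp_length P \<gamma>)"

definition rp_dist ::
    "('a::metric_space, 'v, 'e::euclidean_space, 'n::finite) riem_poly \<Rightarrow> 'a \<Rightarrow> 'a \<Rightarrow> real" where
  "rp_dist P x y = enn2real (rp_edist P x y)"

definition rp_complete ::
    "('a::metric_space, 'v, 'e::euclidean_space, 'n::finite) riem_poly \<Rightarrow> bool" where
  "rp_complete P \<longleftrightarrow> Metric_space.mcomplete UNIV (rp_dist P)"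


section \<open>Admissibility and boundary\<close>

definition rp_cell :: "('a, 'v, 'e, 'n::finite) riem_poly \<Rightarrow> 'v set \<Rightarrow> 'a set" where
  "rp_cell P s = rp_triang P ` {\<alpha> \<in> rp_space P. supp \<alpha> \<subseteq> s}"

text \<open>The dimension \<open>k\<close> is an integer because the \<open>(n-2)\<close>-skeleton is needed for \<open>n = 1\<close>.\<close>

definition rp_skeleton :: "('a, 'v, 'e, 'n::finite) riem_poly \<Rightarrow> int \<Rightarrow> 'a set" where
  "rp_skeleton P k = (\<Union>s\<in>{s \<in> rp_complex P. int (card s) \<le> k + 1}. rp_cell P s)"

definition rp_admissible ::
    "('a::metric_space, 'v, 'e, 'n::finite) riem_poly \<Rightarrow> bool" where
  "rp_admissible P \<longleftrightarrow>
     (\<forall>s\<in>rp_max P. card s = CARD('n) + 1) \<and>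
     (\<forall>U. open U \<and> connected U \<longrightarrow> connected (U - rp_skeleton P (int CARD('n) - 2)))"

definition rp_boundary :: "('a, 'v, 'e, 'n::finite) riem_poly \<Rightarrow> 'a set" where
  "rp_boundary P =
     (\<Union>t\<in>{t \<in> rp_complex P. t \<notin> rp_max P \<and> (\<exists>!s. s \<in> rp_max P \<and> t \<subseteq> s)}. rp_cell P t)"


section \<open>Sobolev spaces and weakly subharmonic functions\<close>

text \<open>The gradient of a Lipschitz function has the components \<open>g\<^sup>i\<^sup>j \<partial>\<^sub>j u\<close>.\<close>

definition rp_grad ::
    "('a, 'v, 'e::euclidean_space, 'n::finite) riem_poly \<Rightarrow> ('a \<Rightarrow> real) \<Rightarrow> 'a \<Rightarrow> real^'n" where
  "rp_grad P u y =
     (let s = rp_carrier P y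
      in matrix_inv (rp_g P y) *v
           (\<chi> j. deriv (\<lambda>t. u (rp_param P s (rp_coord P s y + t *\<^sub>R axis j 1))) 0))"

definition rp_lipschitz_on ::
    "('a::metric_space, 'v, 'e::euclidean_space, 'n::finite) riem_poly \<Rightarrow>
     'a set \<Rightarrow> ('a \<Rightarrow> real) \<Rightarrow> bool" where
  "rp_lipschitz_on P U u \<longleftrightarrow> (\<exists>L. \<forall>x\<in>U. \<forall>y\<in>U. \<bar>u x - u y\<bar> \<le> L * rp_dist P x y)"

text \<open>The squared Sobolev norm over \<open>U\<close> of a function \<open>u\<close> with the gradient field \<open>G\<close>.\<close>

definition sobolev_norm2 ::
    "('a, 'v, 'e::euclidean_space, 'n::finite) riem_poly \<Rightarrow>
     'a set \<Rightarrow> ('a \<Rightarrow> real) \<Rightarrow> ('a \<Rightarrow> real^'n) \<Rightarrow> ennreal" where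
  "sobolev_norm2 P U u G = (\<integral>\<^sup>+y\<in>U. ennreal ((u y)\<^sup>2 + rp_inner P y (G y) (G y)) \<partial>rp_vol P)"

text \<open>The completion of the Lipschitz functions of finite norm is realized inside
  \<open>L\<^sup>2\<close>: its elements are the limits \<open>f\<close> of sequences whose gradients converge as well,
  and the limit \<open>G\<close> of the gradients, which \<open>f\<close> determines almost everywhere,
  is the gradient of \<open>f\<close>.\<close>

definition sobolev_gradient ::
    "('a::metric_space, 'v, 'e::euclidean_space, 'n::finite) riem_poly \<Rightarrow>
     'a set \<Rightarrow> ('a \<Rightarrow> real) \<Rightarrow> ('a \<Rightarrow> real^'n) \<Rightarrow> bool" where
  "sobolev_gradient P U f G \<longleftrightarrow>
     set_borel_measurable (rp_vol P) U f \<and>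
     set_borel_measurable (rp_vol P) U G \<and>
     (\<exists>u :: nat \<Rightarrow> 'a \<Rightarrow> real.
        (\<forall>k. rp_lipschitz_on P U (u k) \<and> sobolev_norm2 P U (u k) (rp_grad P (u k)) < \<infinity>) \<and>
        (\<lambda>k. sobolev_norm2 P U (\<lambda>y. u k y - f y) (\<lambda>y. rp_grad P (u k) y - G y)) \<longlonglongrightarrow> 0)"

definition W12 ::
    "('a::metric_space, 'v, 'e::euclidean_space, 'n::finite) riem_poly \<Rightarrow>
     'a set \<Rightarrow> ('a \<Rightarrow> real) set" where
  "W12 P U = {f. \<exists>G. sobolev_gradient P U f G}"

definition rel_compact_subdomain :: "'a::metric_space set \<Rightarrow> bool" where
  "rel_compact_subdomain U \<longleftrightarrow> open U \<and> connected U \<and> compact (closure U)"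

definition L2 ::
    "('a, 'v, 'e::euclidean_space, 'n::finite) riem_poly \<Rightarrow> ('a \<Rightarrow> real) set" where
  "L2 P = {f \<in> borel_measurable (rp_vol P). integrable (rp_vol P) (\<lambda>y. (f y)\<^sup>2)}"

definition L2_loc ::
    "('a::metric_space, 'v, 'e::euclidean_space, 'n::finite) riem_poly \<Rightarrow> ('a \<Rightarrow> real) set" where
  "L2_loc P = {f \<in> borel_measurable (rp_vol P).
     \<forall>C. compact C \<longrightarrow> set_integrable (rp_vol P) C (\<lambda>y. (f y)\<^sup>2)}"

definition W12_loc ::
    "('a::metric_space, 'v, 'e::euclidean_space, 'n::finite) riem_poly \<Rightarrow> ('a \<Rightarrow> real) set" where
  "W12_loc P = {f \<in> L2_loc P. \<forall>U. rel_compact_subdomain U \<longrightarrow> f \<in> W12 P U}"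

definition local_gradient ::
    "('a::metric_space, 'v, 'e::euclidean_space, 'n::finite) riem_poly \<Rightarrow>
     ('a \<Rightarrow> real) \<Rightarrow> ('a \<Rightarrow> real^'n) \<Rightarrow> bool" where
  "local_gradient P f G \<longleftrightarrow> (\<forall>U. rel_compact_subdomain U \<longrightarrow> sobolev_gradient P U f G)"

definition Lip_c ::
    "('a::metric_space, 'v, 'e::euclidean_space, 'n::finite) riem_poly \<Rightarrow> ('a \<Rightarrow> real) set" where
  "Lip_c P = {\<rho>. rp_lipschitz_on P UNIV \<rho> \<and> compact (closure {y. \<rho> y \<noteq> 0})}"

definition weakly_subharmonic ::
    "('a::metric_space, 'v, 'e::euclidean_space, 'n::finite) riem_poly \<Rightarrow> ('a \<Rightarrow> real) \<Rightarrow> bool" where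
  "weakly_subharmonic P f \<longleftrightarrow>
     f \<in> W12_loc P \<and>
     (\<exists>G. local_gradient P f G \<and>
        (\<forall>\<rho>\<in>Lip_c P. (\<forall>y. 0 \<le> \<rho> y) \<longrightarrow>
           (\<integral>y. rp_inner P y (G y) (rp_grad P \<rho> y) \<partial>rp_vol P) \<le> 0))"

end

theory Submission
  imports Defs
begin

text \<open>
  Uniform ellipticity makes the embedding of \<open>X\<close> in the Euclidean space \<open>\<Lambda>\<close>-Lipschitz for the
  intrinsic distance, so every function of the Euclidean distance to a point is a legitimate
  cutoff, compactly supported because the image of \<open>X\<close> is closed. Testing weak subharmonicity with
  \<open>\<eta>\<^sup>2 \<phi>(u\<^sub>k)\<close>, where \<open>u\<^sub>k\<close> are Lipschitz approximations of \<open>f\<close> and \<open>\<phi>\<close> is a smooth positive function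
  close to the positive part with \<open>\<phi>' \<ge> 1/2\<close> on the half line where \<open>f\<close> lives, gives the Caccioppoli
  inequality \<open>\<integral> \<eta>\<^sup>2 |\<nabla>f|\<^sup>2 \<le> C R\<^bsup>-2\<^esup> \<integral> f\<^sup>2\<close>, hence \<open>\<nabla>f = 0\<close> as \<open>R\<close> grows. Then \<open>f\<close> is constant on each
  maximal simplex. The constants on two maximal simplexes with a common \<open>(n-1)\<close>-face agree since the
  \<open>u\<^sub>k\<close> are continuous across the face and converge to the constant along almost every line
  transversal to it. Local chainability connects all maximal simplexes through such faces.
\<close>

section \<open>Lipschitz functions of one real variable\<close>

text \<open>The gradient of f is known only as an L^2 limit of gradients of Lipschitz functions, and
  these only through partial derivatives in charts. Hence neither weak derivatives nor a chain rule
  for f occur: the test functions are built from \<open>u k\<close>, and an auxiliary parameter,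
  sent to 0 after k has gone to infinity, balances the energy against the approximation errors. The
  vanishing of the gradient is likewise used through an L^1 bound for translates of
  \<open>u k\<close>. All differentiability comes from one real variable, where the derivative of a
  Lipschitz function is a Radon-Nikodym density; Fubini along parallel lines carries it to the
  charts. The intrinsic distance is compared with the Euclidean one in both directions. The lower
  bound makes cutoffs Lipschitz for \<open>rp_dist\<close>; the upper bound makes \<open>u k\<close>
  Lipschitz in the charts. For the upper bound the supremum over null sets is the obstacle: a
  straight segment may lie in the given null set, so paths bend at a generic point, at the cost of a
  factor 2.\<close>

lemma negligible_lipschitz_image:
  fixes f :: "'m::euclidean_space \<Rightarrow> 'n::euclidean_space"
  assumes "negligible S" "L-lipschitz_on UNIV f" "DIM('m) \<le> DIM('n)"
  shows "negligible (f ` S)"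
  by (rule negligible_locally_Lipschitz_image[OF assms(3,1)])
    (use lipschitz_onD[OF assms(2)] in \<open>auto simp: dist_norm intro!: exI[of _ UNIV] exI[of _ L]\<close>)

text \<open>The density of the image of Lebesgue measure under the inverse of \<open>F\<close>, which is absolutely continuous
  because \<open>F\<close> maps null sets to null sets.\<close>

lemma lipschitz_real_expanding_density:
  fixes F :: "real \<Rightarrow> real"
  assumes exp: "\<And>a b. a \<le> b \<Longrightarrow> b - a \<le> F b - F a" and lip: "L-lipschitz_on UNIV F"
  obtains h :: "real \<Rightarrow> real" where "h \<in> borel_measurable borel" "\<And>t. 0 \<le> h t"
    "\<And>a b. a \<le> b \<Longrightarrow> (\<integral>\<^sup>+t. ennreal (h t * indicator {a..b} t) \<partial>lborel) = F b - F a"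
proof -
  have mono: "strict_mono F" using exp by (intro strict_monoI) (smt (verit))
  have inj: "inj F" using mono strict_mono_eq by (auto simp: inj_on_def)
  have cont: "continuous_on UNIV F" using lip by (rule lipschitz_on_continuous_on)
  have surj: "surj F"
  proof -
    have "\<exists>x. F x = y" for y
    proof -
      define r where "r = \<bar>y - F 0\<bar>"
      have "F (-r) \<le> y" "y \<le> F r" using exp[of "-r" 0] exp[of 0 r] by (auto simp: r_def)
      then show ?thesis using IVT'[of F "-r" y r] cont by (auto simp: r_def intro: continuous_on_subset)
    qed
    then show ?thesis by (metis surjI)
  qed
  define \<Phi> where "\<Phi> = inv F"
  have \<Phi>F: "\<Phi> (F x) = x" "F (\<Phi> x) = x" for x using inj surj by (auto simp: \<Phi>_def surj_f_inv_f)
  have "mono \<Phi>" by (rule monoI) (metis \<Phi>F mono strict_mono_less_eq)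
  then have [measurable]: "\<Phi> \<in> borel_measurable borel" by (rule borel_measurable_mono)
  define \<nu> where "\<nu> = distr lborel borel \<Phi>"
  have vim: "\<Phi> -` A = F ` A" for A using \<Phi>F by (auto simp: image_iff) metis+
  have ac: "absolutely_continuous lborel \<nu>" unfolding absolutely_continuous_def
  proof
    fix A assume A: "A \<in> null_sets (lborel :: real measure)"
    then have "negligible A" using negligible_iff_null_sets null_sets_completionI by blast
    then have "negligible (F ` A)"
      by (rule negligible_lipschitz_image[OF _ lip]) simp
    moreover have "F ` A \<in> sets lborel"
      using measurable_sets[of \<Phi> borel borel A] A vim by auto
    ultimately have "emeasure lborel (F ` A) = 0"
      using negligible_iff_emeasure0 by (simp add: negligible_iff_emeasure0)
    then show "A \<in> null_sets \<nu>" using A by (auto simp: \<nu>_def null_sets_def emeasure_distr vim)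
  qed
  have "\<exists>f\<in>borel_measurable lborel. density lborel f = \<nu>"
    by (rule sigma_finite_measure.Radon_Nikodym[OF sigma_finite_lborel ac]) (simp add: \<nu>_def)
  then obtain f where f[measurable]: "f \<in> borel_measurable borel" and d: "density lborel f = \<nu>" by auto
  have fint: "(\<integral>\<^sup>+t. f t * indicator {a..b} t \<partial>lborel) = F b - F a" if "a \<le> b" for a b
  proof -
    have "\<Phi> -` {a..b} = {F a..F b}"
      using \<Phi>F mono by auto (metis strict_mono_less_eq)+
    then have "emeasure \<nu> {a..b} = F b - F a"
      using that exp[of a b] by (simp add: \<nu>_def emeasure_distr)
    then show ?thesis by (simp add: d[symmetric] emeasure_density)
  qed
  \<comment> \<open>A Radon-Nikodym density may be infinite somewhere, and \<open>enn2real\<close>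
    would turn that value into 0; its finite integrals over bounded intervals confine this to a null
    set.\<close>
  have fin: "AE t in lborel. f t < \<infinity>"
  proof -
    have "AE t in lborel. f t * indicator {- real n..real n} t \<noteq> \<infinity>" for n
      by (rule nn_integral_PInf_AE) (auto simp: fint)
    then have "AE t in lborel. \<forall>n. f t * indicator {- real n..real n} t \<noteq> \<infinity>" by (simp add: AE_all_countable)
    then show ?thesis
    proof (eventually_elim)
      case (elim t)
      obtain n where "\<bar>t\<bar> \<le> real n" using real_arch_simple by blast
      then show ?case using elim[rule_format, of n] by (auto simp: indicator_def abs_le_iff top.not_eq_extremum split: if_splits)
    qed
  qed
  show ?thesis
  proof (rule that[of "\<lambda>t. enn2real (f t)"])
    fix a b :: real assume ab: "a \<le> b"
    have "(\<integral>\<^sup>+t. ennreal (enn2real (f t) * indicator {a..b} t) \<partial>lborel) = (\<integral>\<^sup>+t. f t * indicator {a..b} t \<partial>lborel)"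
    proof (rule nn_integral_cong_AE)
      show "AE t in lborel. ennreal (enn2real (f t) * indicator {a..b} t) = f t * indicator {a..b} t"
        using fin by (rule AE_mp) (auto simp: indicator_def)
    qed
    then show "(\<integral>\<^sup>+t. ennreal (enn2real (f t) * indicator {a..b} t) \<partial>lborel) = F b - F a"
      using fint[OF ab] by simp
  next
    show "(\<lambda>t. enn2real (f t)) \<in> borel_measurable borel" by measurable
  qed simp
qed

text \<open>Adding the linear function of slope L + 1 makes F expanding, so the preceding lemma
  supplies a density of the increments. Lebesgue differentiation of this density gives the
  derivative, and subtracting L + 1 returns to F.\<close>

lemma lipschitz_real_derivative:
  fixes F :: "real \<Rightarrow> real"
  assumes lip: "L-lipschitz_on UNIV F"
  obtains k :: "real \<Rightarrow> real" where "k \<in> borel_measurable borel"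
    "AE t in lborel. (F has_real_derivative k t) (at t)"
    "\<And>a b. a \<le> b \<Longrightarrow> ennreal \<bar>F b - F a\<bar> \<le> (\<integral>\<^sup>+t. ennreal \<bar>k t\<bar> * indicator {a..b} t \<partial>lborel)"
proof -
  define F1 where "F1 t = F t + (L + 1) * t" for t
  have L: "L \<ge> 0" using lip by (rule lipschitz_on_nonneg)
  have "b - a \<le> F1 b - F1 a" if "a \<le> b" for a b
  proof -
    have "\<bar>F b - F a\<bar> \<le> L * (b - a)" using lipschitz_onD[OF lip, of b a] that by (simp add: dist_real_def)
    then show ?thesis unfolding F1_def abs_le_iff by argo
  qed
  note exp1 = this
  have lip1: "(L + (L+1))-lipschitz_on UNIV F1"
    unfolding F1_def
  proof (rule lipschitz_on_add[OF lip], rule lipschitz_onI)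
    fix x y :: real
    have "(L+1) * x - (L+1) * y = (L+1) * (x - y)" by (simp add: algebra_simps)
    then show "dist ((L+1) * x) ((L+1) * y) \<le> (L+1) * dist x y"
      using L by (simp add: dist_real_def abs_mult)
  qed (use L in simp)
  have "\<exists>h::real \<Rightarrow> real. h \<in> borel_measurable borel \<and> (\<forall>t. 0 \<le> h t) \<and>
      (\<forall>a b. a \<le> b \<longrightarrow> (\<integral>\<^sup>+t. ennreal (h t * indicator {a..b} t) \<partial>lborel) = F1 b - F1 a)"
    by (rule lipschitz_real_expanding_density[OF exp1 lip1]) auto
  then obtain h where h[measurable]: "h \<in> borel_measurable borel" and h0: "\<And>t. 0 \<le> h t"
    and hi: "\<And>a b. a \<le> b \<Longrightarrow> (\<integral>\<^sup>+t. ennreal (h t * indicator {a..b} t) \<partial>lborel) = F1 b - F1 a"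
    by auto
  have mono: "F1 a \<le> F1 b" if "a \<le> b" for a b
    using exp1[OF that] that by simp
  have HK: "(h has_integral (F1 b - F1 a)) {a..b}" if "a \<le> b" for a b
  proof -
    have "((\<lambda>t. h t * indicator {a..b} t) has_integral (F1 b - F1 a)) UNIV"
      by (rule nn_integral_has_integral) (use hi[OF that] h0 mono[OF that] in auto)
    moreover have "(\<lambda>t. h t * indicator {a..b} t) = (\<lambda>t. if t \<in> {a..b} then h t else 0)" by (auto simp: indicator_def)
    ultimately show ?thesis by (metis has_integral_restrict_UNIV)
  qed
  have hint: "h integrable_on cbox a b" for a b
    using HK[of a b] by (cases "a \<le> b") (auto intro: has_integral_integrable)
  \<comment> \<open>The averages that are differentiated extend to the right of a point, so the left
    derivative comes from the reflected density.\<close>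
  have hint': "(\<lambda>t. h (-t)) integrable_on cbox a b" for a b
    using hint[of "-b" "-a"] integrable_reflect[of h "-a" "-b"] by simp
  obtain N1 where N1: "negligible N1" "\<And>x e. x \<notin> N1 \<Longrightarrow> 0 < e \<Longrightarrow> \<exists>d>0. \<forall>\<delta>. 0 < \<delta> \<and> \<delta> < d \<longrightarrow>
        norm (integral (cbox x (x + \<delta> *\<^sub>R One)) h /\<^sub>R \<delta> ^ DIM(real) - h x) < e"
    using integrable_ccontinuous_explicit[OF hint] by blast
  obtain N2 where N2: "negligible N2" "\<And>x e. x \<notin> N2 \<Longrightarrow> 0 < e \<Longrightarrow> \<exists>d>0. \<forall>\<delta>. 0 < \<delta> \<and> \<delta> < d \<longrightarrow>
        norm (integral (cbox x (x + \<delta> *\<^sub>R One)) (\<lambda>t. h (-t)) /\<^sub>R \<delta> ^ DIM(real) - h (-x)) < e"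
    using integrable_ccontinuous_explicit[OF hint'] by blast
  have I1: "integral (cbox x (x + \<delta> *\<^sub>R One)) h = F1 (x + \<delta>) - F1 x" if "\<delta> > 0" for x \<delta>
    using HK[of x "x + \<delta>"] that by (simp add: integral_unique)
  have I2: "integral (cbox (-x) (-x + \<delta> *\<^sub>R One)) (\<lambda>t. h (-t)) = F1 x - F1 (x - \<delta>)" if "\<delta> > 0" for x \<delta>
  proof -
    have "integral (cbox (-x) (-(x-\<delta>))) (\<lambda>t. h (-t)) = integral (cbox (x-\<delta>) x) h"
      by (rule integral_reflect)
    then show ?thesis using HK[of "x-\<delta>" x] that by (simp add: integral_unique)
  qed
  have der: "(F1 has_real_derivative h t) (at t)" if t: "t \<notin> N1" "-t \<notin> N2" for t
    unfolding has_field_derivative_def has_derivative_at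
  proof (intro conjI)
    show "bounded_linear ((*) (h t))" by (rule bounded_linear_mult_right)
    show "(\<lambda>x. norm (F1 (t + x) - F1 t - h t * x) / norm x) \<midarrow>0\<rightarrow> 0"
    proof (rule LIM_I)
      fix e :: real assume e: "e > 0"
      obtain d1 where d1: "d1 > 0" "\<And>\<delta>. 0 < \<delta> \<Longrightarrow> \<delta> < d1 \<Longrightarrow> \<bar>(F1 (t+\<delta>) - F1 t) / \<delta> - h t\<bar> < e"
        using N1(2)[OF t(1) e] I1 by (auto simp: divide_inverse mult.commute)
      obtain d2 where d2: "d2 > 0" "\<And>\<delta>. 0 < \<delta> \<Longrightarrow> \<delta> < d2 \<Longrightarrow> \<bar>(F1 t - F1 (t-\<delta>)) / \<delta> - h t\<bar> < e"
        using N2(2)[OF t(2) e] I2[of _ t] by (auto simp: divide_inverse mult.commute)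
      have "norm (norm (F1 (t + x) - F1 t - h t * x) / norm x - 0) < e" if x: "x \<noteq> 0" "norm x < min d1 d2" for x
      proof -
        have eq: "norm (F1 (t + x) - F1 t - h t * x) / norm x = \<bar>(F1 (t+x) - F1 t) / x - h t\<bar>"
          using x by (simp add: divide_simps abs_divide flip: abs_mult)
        show ?thesis
        proof (cases "x > 0")
          case True then show ?thesis using d1(2)[of x] x eq by auto
        next
          case False
          have "(F1 (t+x) - F1 t) / x = (F1 t - F1 (t - (-x))) / (-x)" using x by (simp add: divide_simps)
          then show ?thesis using d2(2)[of "-x"] x eq False by auto
        qed
      qed
      then show "\<exists>s>0. \<forall>x. x \<noteq> 0 \<and> norm (x - 0) < s \<longrightarrow> norm (norm (F1 (t + x) - F1 t - h t * x) / norm x - 0) < e"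
        using d1 d2 by (intro exI[of _ "min d1 d2"]) auto
    qed
  qed
  have neg: "negligible (N1 \<union> uminus ` N2)" using N1 N2 negligible_lipschitz_image[of N2 1 "uminus :: real \<Rightarrow> real"]
    by (auto simp: lipschitz_on_def dist_real_def)
  have ae: "AE t in lborel. (F1 has_real_derivative h t) (at t)"
  proof -
    have "AE t in lebesgue. t \<notin> N1 \<union> uminus ` N2"
      using neg by (intro AE_not_in) (simp add: negligible_iff_null_sets)
    then have "AE t in lebesgue. (F1 has_real_derivative h t) (at t)"
      by eventually_elim (auto intro!: der simp: image_iff)
    then show ?thesis by (simp add: AE_completion_iff)
  qed
  show ?thesis
  proof (rule that[of "\<lambda>t. h t - (L+1)"])
    have "F = (\<lambda>t. F1 t - (L+1) * t)" by (auto simp: F1_def)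
    then show "AE t in lborel. (F has_real_derivative h t - (L+1)) (at t)"
      using ae by (auto elim!: eventually_mono intro!: derivative_eq_intros)
    fix a b :: real assume ab: "a \<le> b"
    have i1: "has_bochner_integral lborel (\<lambda>t. h t * indicator {a..b} t) (F1 b - F1 a)"
      by (rule has_bochner_integral_nn_integral) (use hi[OF ab] mono[OF ab] h0 in auto)
    have i2: "has_bochner_integral lborel (\<lambda>t. (L+1) * indicator {a..b} t) ((L+1) * (b-a))"
      using has_bochner_integral_real_indicator[of "{a..b}" lborel] ab
      by (intro has_bochner_integral_mult_right) auto
    have i3: "has_bochner_integral lborel (\<lambda>t. (h t - (L+1)) * indicator {a..b} t) (F b - F a)"
      using has_bochner_integral_diff[OF i1 i2] by (simp add: F1_def algebra_simps)
    have "\<bar>F b - F a\<bar> \<le> (\<integral>t. \<bar>(h t - (L+1)) * indicator {a..b} t\<bar> \<partial>lborel)"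
      using integral_abs_bound[of lborel "\<lambda>t. (h t - (L+1)) * indicator {a..b} t"]
      unfolding has_bochner_integral_integral_eq[OF i3] .
    then have "ennreal \<bar>F b - F a\<bar> \<le> ennreal (\<integral>t. \<bar>(h t - (L+1)) * indicator {a..b} t\<bar> \<partial>lborel)" by (rule ennreal_leI)
    also have "\<dots> = (\<integral>\<^sup>+t. ennreal \<bar>(h t - (L+1)) * indicator {a..b} t\<bar> \<partial>lborel)"
      using i3 by (intro nn_integral_eq_integral[symmetric]) (auto simp: has_bochner_integral_iff)
    also have "\<dots> = (\<integral>\<^sup>+t. ennreal \<bar>h t - (L+1)\<bar> * indicator {a..b} t \<partial>lborel)"
      by (intro nn_integral_cong) (auto simp: indicator_def)
    finally show "ennreal \<bar>F b - F a\<bar> \<le> (\<integral>\<^sup>+t. ennreal \<bar>h t - (L+1)\<bar> * indicator {a..b} t \<partial>lborel)" .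
  qed auto
qed

section \<open>Directional derivatives of Lipschitz functions\<close>

text \<open>A sequential limit, so that the function is defined and Borel everywhere; for Lipschitz \<open>u\<close> it
  is the derivative in the direction \<open>w\<close> almost everywhere.\<close>

definition dir_deriv :: "'a::real_normed_vector \<Rightarrow> ('a \<Rightarrow> real) \<Rightarrow> 'a \<Rightarrow> real" where
  "dir_deriv w u x = lim (\<lambda>n. (u (x + (1 / real (Suc n)) *\<^sub>R w) - u x) * real (Suc n))"

lemma dir_deriv_eq:
  assumes "((\<lambda>t. u (x + t *\<^sub>R w)) has_real_derivative D) (at 0)"
  shows "dir_deriv w u x = D"
proof -
  have "((\<lambda>t. (u (x + t *\<^sub>R w) - u x) / t) \<longlongrightarrow> D) (at 0)"
    using assms by (simp add: has_field_derivative_iff)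
  moreover have "filterlim (\<lambda>n. 1 / real (Suc n)) (at 0) sequentially"
    unfolding filterlim_at using LIMSEQ_inverse_real_of_nat by (auto simp: inverse_eq_divide)
  ultimately have "(\<lambda>n. (u (x + (1 / real (Suc n)) *\<^sub>R w) - u x) / (1 / real (Suc n))) \<longlonglongrightarrow> D"
    by (rule filterlim_compose)
  then show ?thesis unfolding dir_deriv_def by (intro limI) simp
qed

lemma dir_deriv_measurable:
  fixes u :: "'a::euclidean_space \<Rightarrow> real"
  assumes "continuous_on UNIV u"
  shows "dir_deriv w u \<in> borel_measurable borel"
proof -
  have [measurable]: "u \<in> borel_measurable borel" using assms by (rule borel_measurable_continuous_onI)
  show ?thesis unfolding dir_deriv_def by measurable
qed

section \<open>Fubini along lines with a fixed direction\<close>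

lemma nn_integral_lborel_translate:
  fixes f :: "'a::euclidean_space \<Rightarrow> ennreal"
  assumes [measurable]: "f \<in> borel_measurable borel"
  shows "(\<integral>\<^sup>+x. f (x + c) \<partial>lborel) = (\<integral>\<^sup>+x. f x \<partial>lborel)"
proof -
  have "(\<integral>\<^sup>+x. f x \<partial>lborel) = (\<integral>\<^sup>+x. f x \<partial>distr lborel borel ((+) c))" by (simp add: lborel_distr_plus)
  also have "\<dots> = (\<integral>\<^sup>+x. f (c + x) \<partial>lborel)" by (rule nn_integral_distr) auto
  finally show ?thesis by (simp add: add.commute)
qed

text \<open>After exchanging the integrals, the inner one is the integral of a translate of f for
  every t, and t ranges over an interval of length 1.\<close>

lemma nn_integral_along_segments:
  fixes f :: "'a::euclidean_space \<Rightarrow> ennreal"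
  assumes [measurable]: "f \<in> borel_measurable borel"
  shows "(\<integral>\<^sup>+x. (\<integral>\<^sup>+t. f (x + t *\<^sub>R w) * indicator {0..1::real} t \<partial>lborel) \<partial>lborel) = (\<integral>\<^sup>+x. f x \<partial>lborel)"
proof -
  have "(\<integral>\<^sup>+x. (\<integral>\<^sup>+t. f (x + t *\<^sub>R w) * indicator {0..1::real} t \<partial>lborel) \<partial>lborel)
     = (\<integral>\<^sup>+t. (\<integral>\<^sup>+x. f (x + t *\<^sub>R w) * indicator {0..1::real} t \<partial>lborel) \<partial>lborel)"
    by (rule lborel_pair.Fubini') measurable
  also have "\<dots> = (\<integral>\<^sup>+t. (\<integral>\<^sup>+x. f x \<partial>lborel) * indicator {0..1::real} t \<partial>lborel)"
    by (intro nn_integral_cong) (simp add: nn_integral_multc nn_integral_lborel_translate)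
  also have "\<dots> = (\<integral>\<^sup>+x. f x \<partial>lborel)" by (simp add: nn_integral_cmult)
  finally show ?thesis .
qed

text \<open>A Fubini argument for lines in the direction w that avoids splitting the space into w
  and a complement: averaging over the segment from x to x + w replaces the integral over whole
  lines.\<close>

lemma null_sets_along_lines:
  fixes B :: "'a::euclidean_space set"
  assumes [measurable]: "B \<in> sets borel" and null: "\<And>x. AE t in lborel. x + t *\<^sub>R w \<notin> B"
  shows "B \<in> null_sets lborel"
proof -
  have "(\<integral>\<^sup>+t. indicator B (x + t *\<^sub>R w) * indicator {0..1::real} t \<partial>lborel) = (0::ennreal)" for x
    using null[of x] by (subst nn_integral_0_iff_AE) (auto elim!: eventually_mono)
  then have "(\<integral>\<^sup>+x. indicator B x \<partial>(lborel :: 'a measure)) = (0::ennreal)"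
    using nn_integral_along_segments[of "indicator B" w] by simp
  then show ?thesis by (simp add: null_sets_def)
qed

text \<open>Countable quantifiers describe differentiability, which makes the exceptional set in
  \<open>AE_dir_deriv\<close> Borel. Continuity extends the inequality from rational to real
  increments.\<close>

lemma has_real_derivative_iff_rat:
  fixes F :: "real \<Rightarrow> real"
  assumes cont: "continuous_on UNIV F"
  shows "(F has_real_derivative D) (at 0) \<longleftrightarrow>
    (\<forall>j::nat. \<exists>m::nat. \<forall>q::rat. \<bar>real_of_rat q\<bar> < 1 / real (Suc m) \<longrightarrow>
       \<bar>F (real_of_rat q) - F 0 - D * real_of_rat q\<bar> \<le> \<bar>real_of_rat q\<bar> / real (Suc j))" (is "_ \<longleftrightarrow> ?R")
proof
  assume d: "(F has_real_derivative D) (at 0)"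
  show ?R
  proof
    fix j :: nat
    have "(\<lambda>h. (F (0 + h) - F 0) / h) \<midarrow>0\<rightarrow> D" using d by (simp add: has_field_derivative_iff)
    then obtain s where s: "s > 0" "\<And>h. h \<noteq> 0 \<Longrightarrow> \<bar>h\<bar> < s \<Longrightarrow> \<bar>(F h - F 0) / h - D\<bar> < 1 / real (Suc j)"
      using LIM_D[of "\<lambda>h. (F (0 + h) - F 0) / h" D 0 "1 / real (Suc j)"] by auto
    obtain m where m: "1 / real (Suc m) < s" using s(1) nat_approx_posE by blast
    show "\<exists>m::nat. \<forall>q::rat. \<bar>real_of_rat q\<bar> < 1 / real (Suc m) \<longrightarrow>
       \<bar>F (real_of_rat q) - F 0 - D * real_of_rat q\<bar> \<le> \<bar>real_of_rat q\<bar> / real (Suc j)"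
    proof (intro exI[of _ m] allI impI)
      fix q :: rat assume q: "\<bar>real_of_rat q\<bar> < 1 / real (Suc m)"
      define h where "h = real_of_rat q"
      show "\<bar>F h - F 0 - D * h\<bar> \<le> \<bar>h\<bar> / real (Suc j)"
      proof (cases "h = 0")
        case False
        have "F h - F 0 - D * h = h * ((F h - F 0) / h - D)" using False by (simp add: field_simps)
        then have "\<bar>F h - F 0 - D * h\<bar> = \<bar>h\<bar> * \<bar>(F h - F 0) / h - D\<bar>"
          by (simp only: abs_mult)
        also have "\<dots> \<le> \<bar>h\<bar> * (1 / real (Suc j))"
          using s(2)[OF False] q m by (intro mult_left_mono) (auto simp: h_def)
        finally show ?thesis by simp
      qed simp
    qed
  qed
next
  assume R: ?R
  show "(F has_real_derivative D) (at 0)" unfolding DERIV_def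
  proof (rule LIM_I)
    fix e :: real assume "e > 0"
    then obtain j where j: "1 / real (Suc j) < e" using nat_approx_posE by blast
    obtain m where m: "\<And>q::rat. \<bar>real_of_rat q\<bar> < 1 / real (Suc m) \<Longrightarrow>
       \<bar>F (real_of_rat q) - F 0 - D * real_of_rat q\<bar> \<le> \<bar>real_of_rat q\<bar> / real (Suc j)" using R by blast
    have all: "\<bar>F h - F 0 - D * h\<bar> \<le> \<bar>h\<bar> / real (Suc j)" if h: "\<bar>h\<bar> < 1 / real (Suc m)" for h
    proof -
      let ?g = "\<lambda>h. \<bar>F h - F 0 - D * h\<bar> - \<bar>h\<bar> / real (Suc j)"
      have cg: "continuous_on UNIV ?g" by (intro continuous_intros cont) simp
      let ?I = "{-(1 / real (Suc m))<..<1 / real (Suc m)}"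
      have "\<rat> \<inter> ?I \<subseteq> {h. ?g h \<le> 0}"
      proof (safe elim!: Rats_cases)
        fix q assume "real_of_rat q \<in> ?I"
        then have "\<bar>real_of_rat q\<bar> < 1 / real (Suc m)" by (meson abs_less_iff greaterThanLessThan_iff minus_less_iff)
        from m[OF this] show "?g (real_of_rat q) \<le> 0" by linarith
      qed
      moreover have "closed {h. ?g h \<le> 0}"
        using closed_Collect_le[OF cg continuous_on_const[of UNIV 0]] by simp
      ultimately have "closure (\<rat> \<inter> ?I) \<subseteq> {h. ?g h \<le> 0}" by (rule closure_minimal)
      moreover have "?I \<subseteq> closure (\<rat> \<inter> ?I)"
        using open_Int_closure_subset[of ?I "\<rat> :: real set"] by (simp add: Rats_closure_real Int_commute)
      moreover have "h \<in> ?I" using h by (meson abs_less_iff greaterThanLessThan_iff minus_less_iff)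
      ultimately have "h \<in> {h. ?g h \<le> 0}" by blast
      then show ?thesis by simp
    qed
    have "norm ((F (0 + x) - F 0) / x - D) < e" if x: "x \<noteq> 0" "norm (x - 0) < 1 / real (Suc m)" for x
    proof -
      have "\<bar>(F x - F 0) / x - D\<bar> = \<bar>F x - F 0 - D * x\<bar> / \<bar>x\<bar>" using x
        by (simp add: divide_simps flip: abs_divide abs_mult)
      also have "\<dots> \<le> 1 / real (Suc j)" using all[of x] x by (simp add: divide_simps)
      finally show ?thesis using j by simp
    qed
    then show "\<exists>s>0. \<forall>x. x \<noteq> 0 \<and> norm (x - 0) < s \<longrightarrow> norm ((F (0 + x) - F 0) / x - D) < e"
      by (intro exI[of _ "1 / real (Suc m)"]) auto
  qed
qed

lemma lipschitz_along_line:
  fixes u :: "'a::real_normed_vector \<Rightarrow> real"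
  assumes "L-lipschitz_on UNIV u"
  shows "(L * norm w)-lipschitz_on UNIV (\<lambda>t. u (x + t *\<^sub>R w))"
proof (rule lipschitz_onI)
  show "0 \<le> L * norm w" using lipschitz_on_nonneg[OF assms] by simp
  fix t s :: real
  have "x + t *\<^sub>R w - (x + s *\<^sub>R w) = (t - s) *\<^sub>R w" by (simp add: algebra_simps)
  then show "dist (u (x + t *\<^sub>R w)) (u (x + s *\<^sub>R w)) \<le> L * norm w * dist t s"
    using lipschitz_onD[OF assms, of "x + t *\<^sub>R w" "x + s *\<^sub>R w"] by (simp add: dist_norm mult_ac)
qed

text \<open>The derivative supplied in one variable depends on the chosen line. Rewriting it with
  \<open>dir_deriv\<close> gives a single Borel function on the whole space, to which Fubini
  applies.\<close>

lemma lipschitz_segment_bound: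
  fixes u :: "'a::real_normed_vector \<Rightarrow> real"
  assumes lip: "L-lipschitz_on UNIV u"
  shows "AE t in lborel. ((\<lambda>s. u (x + t *\<^sub>R w + s *\<^sub>R w)) has_real_derivative dir_deriv w u (x + t *\<^sub>R w)) (at 0)"
    and "ennreal \<bar>u (x + w) - u x\<bar> \<le> (\<integral>\<^sup>+t. ennreal \<bar>dir_deriv w u (x + t *\<^sub>R w)\<bar> * indicator {0..1} t \<partial>lborel)"
proof -
  let ?F = "\<lambda>t. u (x + t *\<^sub>R w)"
  have "\<exists>k::real\<Rightarrow>real. k \<in> borel_measurable borel \<and> (AE t in lborel. (?F has_real_derivative k t) (at t)) \<and>
    (\<forall>a b. a \<le> b \<longrightarrow> ennreal \<bar>?F b - ?F a\<bar> \<le> (\<integral>\<^sup>+t. ennreal \<bar>k t\<bar> * indicator {a..b} t \<partial>lborel))"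
    by (rule lipschitz_real_derivative[OF lipschitz_along_line[OF lip, of w x]]) auto
  then obtain k :: "real \<Rightarrow> real" where k: "k \<in> borel_measurable borel"
    "AE t in lborel. (?F has_real_derivative k t) (at t)"
    "\<forall>a b. a \<le> b \<longrightarrow> ennreal \<bar>?F b - ?F a\<bar> \<le> (\<integral>\<^sup>+t. ennreal \<bar>k t\<bar> * indicator {a..b} t \<partial>lborel)"
    by blast
  have shift: "((\<lambda>s. u (x + t *\<^sub>R w + s *\<^sub>R w)) has_real_derivative k t) (at 0)"
    if "(?F has_real_derivative k t) (at t)" for t
    using DERIV_shift[of ?F "k t" 0 t] that by (simp add: algebra_simps)
  have eq: "AE t in lborel. k t = dir_deriv w u (x + t *\<^sub>R w)"
    using k(2) by eventually_elim (use shift dir_deriv_eq in metis)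
  show "AE t in lborel. ((\<lambda>s. u (x + t *\<^sub>R w + s *\<^sub>R w)) has_real_derivative dir_deriv w u (x + t *\<^sub>R w)) (at 0)"
    using k(2) eq by eventually_elim (use shift in metis)
  have "(\<integral>\<^sup>+t. ennreal \<bar>k t\<bar> * indicator {0..1} t \<partial>lborel) = (\<integral>\<^sup>+t. ennreal \<bar>dir_deriv w u (x + t *\<^sub>R w)\<bar> * indicator {0..1} t \<partial>lborel)"
    using eq by (intro nn_integral_cong_AE) (auto elim: eventually_mono)
  then show "ennreal \<bar>u (x + w) - u x\<bar> \<le> (\<integral>\<^sup>+t. ennreal \<bar>dir_deriv w u (x + t *\<^sub>R w)\<bar> * indicator {0..1} t \<partial>lborel)"
    using k(3)[rule_format, of 0 1] by simp
qed

text \<open>The exceptional set is Borel and meets every line in the direction w in a null set. Only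
  the derivative in this one direction is concerned, not a total derivative.\<close>

lemma AE_dir_deriv:
  fixes u :: "'a::euclidean_space \<Rightarrow> real"
  assumes lip: "L-lipschitz_on UNIV u"
  shows "AE x in lborel. ((\<lambda>t. u (x + t *\<^sub>R w)) has_real_derivative dir_deriv w u x) (at 0)"
proof -
  have cont: "continuous_on UNIV u" using lip by (rule lipschitz_on_continuous_on)
  have [measurable]: "u \<in> borel_measurable borel" using cont by (rule borel_measurable_continuous_onI)
  have [measurable]: "dir_deriv w u \<in> borel_measurable borel" using cont by (rule dir_deriv_measurable)
  define B where "B = {x. \<not> ((\<lambda>t. u (x + t *\<^sub>R w)) has_real_derivative dir_deriv w u x) (at 0)}"
  have c: "continuous_on UNIV (\<lambda>t. u (x + t *\<^sub>R w))" for x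
    by (intro continuous_on_compose2[OF cont] continuous_intros) auto
  have "B = {x. \<not> (\<forall>j::nat. \<exists>m::nat. \<forall>q::rat. \<bar>real_of_rat q\<bar> < 1 / real (Suc m) \<longrightarrow>
       \<bar>u (x + real_of_rat q *\<^sub>R w) - u (x + 0 *\<^sub>R w) - dir_deriv w u x * real_of_rat q\<bar> \<le> \<bar>real_of_rat q\<bar> / real (Suc j))}"
    unfolding B_def by (subst has_real_derivative_iff_rat[OF c]) simp
  also have "\<dots> \<in> sets borel" by measurable
  finally have "B \<in> null_sets lborel"
    using lipschitz_segment_bound(1)[OF lip] by (intro null_sets_along_lines[where w = w]) (auto simp: B_def)
  from AE_not_in[OF this] show ?thesis by (simp add: B_def)
qed

text \<open>The increment is at most the integral of the derivative over the segment from x to x +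
  w. Convexity keeps the segment in S, and \<open>nn_integral_along_segments\<close> removes the
  average along it.\<close>

lemma translation_L1_bound:
  fixes u :: "'a::euclidean_space \<Rightarrow> real"
  assumes lip: "L-lipschitz_on UNIV u" and S: "convex S" and [measurable]: "S \<in> sets borel"
  shows "(\<integral>\<^sup>+x. ennreal \<bar>u (x + w) - u x\<bar> * indicator S x * indicator S (x + w) \<partial>lborel)
     \<le> (\<integral>\<^sup>+x. ennreal \<bar>dir_deriv w u x\<bar> * indicator S x \<partial>lborel)"
proof -
  have cont: "continuous_on UNIV u" using lip by (rule lipschitz_on_continuous_on)
  have [measurable]: "dir_deriv w u \<in> borel_measurable borel" using cont by (rule dir_deriv_measurable)
  have "(\<integral>\<^sup>+x. ennreal \<bar>u (x + w) - u x\<bar> * indicator S x * indicator S (x + w) \<partial>lborel)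
    \<le> (\<integral>\<^sup>+x. (\<integral>\<^sup>+t. (ennreal \<bar>dir_deriv w u (x + t *\<^sub>R w)\<bar> * indicator S (x + t *\<^sub>R w)) * indicator {0..1::real} t \<partial>lborel) \<partial>lborel)"
  proof (rule nn_integral_mono)
    fix x
    show "ennreal \<bar>u (x + w) - u x\<bar> * indicator S x * indicator S (x + w)
      \<le> (\<integral>\<^sup>+t. (ennreal \<bar>dir_deriv w u (x + t *\<^sub>R w)\<bar> * indicator S (x + t *\<^sub>R w)) * indicator {0..1::real} t \<partial>lborel)"
    proof (cases "x \<in> S \<and> x + w \<in> S")
      case True
      have "x + t *\<^sub>R w \<in> S" if "0 \<le> t" "t \<le> 1" for t
        using convexD_alt[OF S, of x "x + w" t] True that by (simp add: algebra_simps)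
      then have "(\<integral>\<^sup>+t. (ennreal \<bar>dir_deriv w u (x + t *\<^sub>R w)\<bar> * indicator S (x + t *\<^sub>R w)) * indicator {0..1::real} t \<partial>lborel)
        = (\<integral>\<^sup>+t. ennreal \<bar>dir_deriv w u (x + t *\<^sub>R w)\<bar> * indicator {0..1::real} t \<partial>lborel)"
        by (intro nn_integral_cong) (auto simp: indicator_def)
      then show ?thesis using lipschitz_segment_bound(2)[OF lip, of x w] True by simp
    qed auto
  qed
  also have "\<dots> = (\<integral>\<^sup>+x. ennreal \<bar>dir_deriv w u x\<bar> * indicator S x \<partial>lborel)"
    by (rule nn_integral_along_segments) measurable
  finally show ?thesis .
qed

text \<open>The increment of f is compared with that of \<open>v k\<close>. The two errors at x and
  at x + w have the same L^1 bound after a translation, and the increment of \<open>v k\<close> is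
  bounded by its derivative. This takes the place of an argument with weak derivatives of f.\<close>

lemma translation_invariant_limit:
  fixes v :: "nat \<Rightarrow> 'a::euclidean_space \<Rightarrow> real" and f :: "'a \<Rightarrow> real"
  assumes lip: "\<And>k. \<exists>L. L-lipschitz_on UNIV (v k)" and S: "convex S" and [measurable]: "S \<in> sets borel"
    and [measurable]: "f \<in> borel_measurable borel"
    and d0: "(\<lambda>k. \<integral>\<^sup>+x. ennreal \<bar>dir_deriv w (v k) x\<bar> * indicator S x \<partial>lborel) \<longlonglongrightarrow> 0"
    and f0: "(\<lambda>k. \<integral>\<^sup>+x. ennreal \<bar>v k x - f x\<bar> * indicator S x \<partial>lborel) \<longlonglongrightarrow> 0"
  shows "AE x in lborel. x \<in> S \<and> x + w \<in> S \<longrightarrow> f (x + w) = f x"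
proof -
  have [measurable]: "v k \<in> borel_measurable borel" for k
    using lip[of k] lipschitz_on_continuous_on borel_measurable_continuous_onI by metis
  define I where "I = (\<integral>\<^sup>+x. ennreal \<bar>f (x + w) - f x\<bar> * indicator S x * indicator S (x + w) \<partial>lborel)"
  define a where "a k = (\<integral>\<^sup>+x. ennreal \<bar>v k x - f x\<bar> * indicator S x \<partial>lborel)" for k
  define b where "b k = (\<integral>\<^sup>+x. ennreal \<bar>dir_deriv w (v k) x\<bar> * indicator S x \<partial>lborel)" for k
  have le: "I \<le> a k + b k + a k" for k
  proof -
    obtain L where L: "L-lipschitz_on UNIV (v k)" using lip by blast
    have "I \<le> (\<integral>\<^sup>+x. (ennreal \<bar>v k (x + w) - f (x + w)\<bar> * indicator S (x + w)
      + ennreal \<bar>v k (x + w) - v k x\<bar> * indicator S x * indicator S (x + w)) + ennreal \<bar>v k x - f x\<bar> * indicator S x \<partial>lborel)"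
      unfolding I_def
    proof (intro nn_integral_mono)
      fix x
      have "ennreal \<bar>f (x + w) - f x\<bar> \<le> ennreal (\<bar>v k (x + w) - f (x + w)\<bar> + \<bar>v k (x + w) - v k x\<bar> + \<bar>v k x - f x\<bar>)"
        by (rule ennreal_leI) arith
      then show "ennreal \<bar>f (x + w) - f x\<bar> * indicator S x * indicator S (x + w) \<le> (ennreal \<bar>v k (x + w) - f (x + w)\<bar> * indicator S (x + w)
      + ennreal \<bar>v k (x + w) - v k x\<bar> * indicator S x * indicator S (x + w)) + ennreal \<bar>v k x - f x\<bar> * indicator S x"
        by (cases "x \<in> S"; cases "x + w \<in> S") simp_all
    qed
    also have "\<dots> = (\<integral>\<^sup>+x. ennreal \<bar>v k (x + w) - f (x + w)\<bar> * indicator S (x + w)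
      + ennreal \<bar>v k (x + w) - v k x\<bar> * indicator S x * indicator S (x + w) \<partial>lborel) + a k"
      unfolding a_def by (rule nn_integral_add) measurable
    also have "(\<integral>\<^sup>+x. ennreal \<bar>v k (x + w) - f (x + w)\<bar> * indicator S (x + w)
      + ennreal \<bar>v k (x + w) - v k x\<bar> * indicator S x * indicator S (x + w) \<partial>lborel)
      = (\<integral>\<^sup>+x. ennreal \<bar>v k (x + w) - f (x + w)\<bar> * indicator S (x + w) \<partial>lborel)
      + (\<integral>\<^sup>+x. ennreal \<bar>v k (x + w) - v k x\<bar> * indicator S x * indicator S (x + w) \<partial>lborel)"
      by (rule nn_integral_add) measurable
    also have "(\<integral>\<^sup>+x. ennreal \<bar>v k (x + w) - f (x + w)\<bar> * indicator S (x + w) \<partial>lborel) = a k"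
      unfolding a_def by (rule nn_integral_lborel_translate) measurable
    also have "(\<integral>\<^sup>+x. ennreal \<bar>v k (x + w) - v k x\<bar> * indicator S x * indicator S (x + w) \<partial>lborel) \<le> b k"
      unfolding b_def by (rule translation_L1_bound[OF L S]) measurable
    finally show ?thesis by (simp add: add_mono)
  qed
  have "(\<lambda>k. a k + b k + a k) \<longlonglongrightarrow> 0 + 0 + 0"
    using d0 f0 unfolding a_def b_def by (intro tendsto_add)
  then have "I \<le> 0" using le by (intro LIMSEQ_le_const[where X = "\<lambda>k. a k + b k + a k"]) auto
  then have "I = 0" by simp
  moreover have "(I = 0) = (AE x in lborel. ennreal \<bar>f (x + w) - f x\<bar> * indicator S x * indicator S (x + w) = 0)"
    unfolding I_def by (rule nn_integral_0_iff_AE) measurable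
  ultimately have "AE x in lborel. ennreal \<bar>f (x + w) - f x\<bar> * indicator S x * indicator S (x + w) = 0" by simp
  then show ?thesis by eventually_elim (auto simp: indicator_def)
qed

section \<open>Constancy from translation invariance\<close>

lemma AE_lborel_null:
  assumes "AE x in lborel. Q x"
  shows "\<exists>N\<in>null_sets lborel. \<forall>x. x \<notin> N \<longrightarrow> Q x"
  using assms unfolding eventually_ae_filter by auto

text \<open>Invariance along the axes composes, one coordinate at a time, to invariance under every
  short vector h. Fubini in (h, x) then yields one point x1 such that almost every nearby point has
  the form x1 + h with the same value of f.\<close>

lemma AE_const_ball:
  fixes f :: "'a::euclidean_space \<Rightarrow> real"
  assumes [measurable]: "f \<in> borel_measurable borel" and r: "r > 0"
    and inv: "\<And>b t. b \<in> Basis \<Longrightarrow> AE x in lborel. x \<in> ball x0 (2*r) \<and> x + t *\<^sub>R b \<in> ball x0 (2*r) \<longrightarrow> f (x + t *\<^sub>R b) = f x"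
  shows "\<exists>c. AE x in lborel. x \<in> ball x0 (r/2) \<longrightarrow> f x = c"
proof -
  have shift: "AE x in lborel. Q (x + c)" if Q: "AE x in lborel. Q x" for Q and c :: 'a
  proof -
    obtain N where N: "N \<in> null_sets lborel" "\<And>x. x \<notin> N \<Longrightarrow> Q x" using AE_lborel_null[OF Q] by blast
    have "(\<lambda>x. x + c) -` N \<in> sets borel" using N(1) by (intro measurable_sets_borel[of _ borel]) auto
    moreover have "(\<integral>\<^sup>+x. indicator N (x + c) \<partial>lborel) = (0::ennreal)"
      using N(1) by (subst nn_integral_lborel_translate) (auto simp: null_sets_def)
    moreover have "indicator N (x + c) = (indicator ((\<lambda>x. x + c) -` N) x :: ennreal)" for x by (auto simp: indicator_def)
    ultimately have "(\<lambda>x. x + c) -` N \<in> null_sets lborel" by (auto simp: null_sets_def)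
    from AE_not_in[OF this] show ?thesis by eventually_elim (use N in auto)
  qed
  have psum: "norm (\<Sum>b\<in>A. (h \<bullet> b) *\<^sub>R b) \<le> norm h" if "A \<subseteq> Basis" for A and h :: 'a
  proof (rule norm_le_componentwise)
    fix b :: 'a assume b: "b \<in> Basis"
    have "(\<Sum>c\<in>A. (h \<bullet> c) *\<^sub>R c) \<bullet> b = (\<Sum>c\<in>A. if c = b then h \<bullet> b else 0)"
      unfolding inner_sum_left using that b by (intro sum.cong) (auto simp: inner_Basis)
    also have "\<dots> = (if b \<in> A then h \<bullet> b else 0)"
      using finite_subset[OF that] by simp
    finally have "(\<Sum>b\<in>A. (h \<bullet> b) *\<^sub>R b) \<bullet> b = (if b \<in> A then h \<bullet> b else 0)" .
    then show "\<bar>(\<Sum>b\<in>A. (h \<bullet> b) *\<^sub>R b) \<bullet> b\<bar> \<le> \<bar>h \<bullet> b\<bar>" by auto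
  qed
  \<comment> \<open>Every partial sum of the coordinate expansion of h is at most as long as h, so a
    path that starts in the ball of radius r stays in the ball of radius 2 r, where
    \<open>inv\<close> applies.\<close>
  have inv': "AE x in lborel. x \<in> ball x0 r \<longrightarrow> f (x + (\<Sum>b\<in>A. (h \<bullet> b) *\<^sub>R b)) = f x" if h: "norm h < r" and "A \<subseteq> Basis" for A h
  proof -
    have "finite A" using \<open>A \<subseteq> Basis\<close> by (rule finite_subset) simp
    then show ?thesis using \<open>A \<subseteq> Basis\<close>
    proof (induction A rule: finite_induct)
      case (insert b A)
      let ?p = "\<lambda>A. \<Sum>b\<in>A. (h \<bullet> b) *\<^sub>R b"
      have mem: "x + ?p B \<in> ball x0 (2*r)" if "x \<in> ball x0 r" "B \<subseteq> Basis" for x B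
      proof -
        have "dist x0 (x + ?p B) \<le> dist x0 x + norm (?p B)"
          using norm_triangle_ineq4[of "x0 - x" "?p B"] by (simp add: dist_norm diff_diff_add)
        then show ?thesis using that psum[of B h] h by simp
      qed
      have p: "?p (insert b A) = ?p A + (h \<bullet> b) *\<^sub>R b" using insert by simp
      have "AE x in lborel. x + ?p A \<in> ball x0 (2*r) \<and> x + ?p A + (h \<bullet> b) *\<^sub>R b \<in> ball x0 (2*r) \<longrightarrow> f (x + ?p A + (h \<bullet> b) *\<^sub>R b) = f (x + ?p A)"
        using shift[OF inv[of b "h \<bullet> b"], of "?p A"] insert by simp
      moreover have "AE x in lborel. x \<in> ball x0 r \<longrightarrow> f (x + ?p A) = f x" using insert by simp
      ultimately show ?case
      proof eventually_elim
        case (elim x)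
        show ?case
        proof
          assume x: "x \<in> ball x0 r"
          have "x + ?p A \<in> ball x0 (2*r)" "x + ?p A + (h \<bullet> b) *\<^sub>R b \<in> ball x0 (2*r)"
            using mem[OF x, of A] mem[OF x, of "insert b A"] insert.prems unfolding p by (auto simp: add.assoc)
          then have "f (x + ?p A + (h \<bullet> b) *\<^sub>R b) = f (x + ?p A)" using elim(1) by blast
          then show "f (x + ?p (insert b A)) = f x" using elim(2) x unfolding p by (simp add: add.assoc)
        qed
      qed
    qed simp
  qed
  have "AE h in lborel. AE x in lborel. norm h < r \<and> x \<in> ball x0 r \<longrightarrow> f (x + h) = f x"
  proof (rule AE_I2)
    fix h :: 'a
    show "AE x in lborel. norm h < r \<and> x \<in> ball x0 r \<longrightarrow> f (x + h) = f x"
      using inv'[of h Basis] by (cases "norm h < r") (auto simp: euclidean_representation)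
  qed
  then have "AE x in lborel. AE h in lborel. norm h < r \<and> x \<in> ball x0 r \<longrightarrow> f (x + h) = f x"
  proof (rule iffD1[OF lborel_pair.AE_commute, rotated])
    show "{z \<in> space (lborel \<Otimes>\<^sub>M lborel). norm (fst z) < r \<and> snd z \<in> ball x0 r \<longrightarrow> f (snd z + fst z) = f (snd z)}
      \<in> sets (lborel \<Otimes>\<^sub>M lborel)"
      unfolding mem_ball by measurable
  qed
  from AE_lborel_null[OF this] obtain N where N: "N \<in> null_sets lborel"
    "\<forall>x. x \<notin> N \<longrightarrow> (AE h in lborel. norm h < r \<and> x \<in> ball x0 r \<longrightarrow> f (x + h) = f x)" by (rule bexE)
  have "\<not> ball x0 (r/2) \<subseteq> N"
  proof
    assume "ball x0 (r/2) \<subseteq> N"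
    then have "ball x0 (r/2) \<in> null_sets lborel" using null_sets_subset[OF N(1)] by simp
    then have "negligible (ball x0 (r/2))" using negligible_iff_null_sets null_sets_completionI by blast
    then show False using r open_not_negligible[of "ball x0 (r/2)"] by simp
  qed
  then obtain x1 where x1: "x1 \<in> ball x0 (r/2)" "x1 \<notin> N" by blast
  \<comment> \<open>The substitution h = y - x1. Two points of the ball of radius r / 2 have
    distance less than r, so h is short enough.\<close>
  have "AE y in lborel. norm (y + (-x1)) < r \<and> x1 \<in> ball x0 r \<longrightarrow> f (x1 + (y + (-x1))) = f x1"
    using shift[OF N(2)[rule_format, OF x1(2)], of "-x1"] .
  then have "AE y in lborel. y \<in> ball x0 (r/2) \<longrightarrow> f y = f x1"
  proof eventually_elim
    case (elim y)
    show ?case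
    proof
      assume y: "y \<in> ball x0 (r/2)"
      have "dist y x1 < r" using y x1 dist_triangle_half_r[of x0 y r x1] by simp
      moreover have "x1 \<in> ball x0 r" using x1 r by simp
      ultimately show "f y = f x1" using elim by (simp add: dist_norm)
    qed
  qed
  then show ?thesis by blast
qed

text \<open>An open set on which f is almost everywhere c0 cannot meet one on which it is another
  constant, because a nonempty open set is not null. Connectedness leaves only c0, and Lindelof
  keeps the union of the exceptional sets null.\<close>

lemma AE_const_connected:
  fixes f :: "'a::euclidean_space \<Rightarrow> real"
  assumes D: "open D" "connected D"
    and loc: "\<And>x. x \<in> D \<Longrightarrow> \<exists>r>0. \<exists>c. AE y in lborel. y \<in> ball x r \<longrightarrow> f y = c"
  shows "\<exists>c. AE y in lborel. y \<in> D \<longrightarrow> f y = c"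
proof (cases "D = {}")
  case False
  then obtain x0 where x0: "x0 \<in> D" by blast
  obtain r0 c0 where r0: "r0 > 0" "AE y in lborel. y \<in> ball x0 r0 \<longrightarrow> f y = c0" using loc[OF x0] by blast
  define T where "T c = {V. open V \<and> (AE y in lborel. y \<in> V \<longrightarrow> f y = c)}" for c
  define A where "A = \<Union>(T c0)"
  define B where "B = \<Union>(\<Union>c\<in>-{c0}. T c)"
  have op: "open A" "open B" unfolding A_def B_def T_def by auto
  have "A \<inter> B = {}"
  proof (rule ccontr)
    assume "A \<inter> B \<noteq> {}"
    then obtain z U V c where z: "z \<in> U" "z \<in> V" "U \<in> T c0" "V \<in> T c" "c \<noteq> c0" unfolding A_def B_def by blast
    have "AE y in lborel. y \<in> U \<longrightarrow> f y = c0" "AE y in lborel. y \<in> V \<longrightarrow> f y = c" using z by (auto simp: T_def)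
    then have "AE y in lborel. y \<notin> U \<inter> V" by eventually_elim (use z in auto)
    moreover have "U \<inter> V \<in> sets lborel" using z by (auto simp: T_def)
    ultimately have "U \<inter> V \<in> null_sets lborel" by (subst AE_iff_null_sets) auto
    then have "negligible (U \<inter> V)" using negligible_iff_null_sets null_sets_completionI by blast
    moreover have "open (U \<inter> V)" using z by (auto simp: T_def)
    ultimately show False using open_not_negligible z by blast
  qed
  moreover have "D \<subseteq> A \<union> B"
  proof
    fix x assume "x \<in> D"
    then obtain r c where "r > 0" "AE y in lborel. y \<in> ball x r \<longrightarrow> f y = c" using loc by blast
    then have "x \<in> ball x r" "ball x r \<in> T c" by (auto simp: T_def)
    then show "x \<in> A \<union> B" unfolding A_def B_def by (cases "c = c0") blast+
  qed
  moreover have "x0 \<in> A \<inter> D" using r0 x0 unfolding A_def T_def by (auto intro!: exI[of _ "ball x0 r0"])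
  ultimately have DA: "D \<subseteq> A" using D(2) op unfolding connected_def by blast
  obtain F where F: "F \<subseteq> T c0" "countable F" "\<Union>F = A"
    using Lindelof[of "T c0"] unfolding A_def T_def by blast
  have "AE y in lborel. \<forall>V\<in>F. y \<in> V \<longrightarrow> f y = c0"
    using F by (subst AE_ball_countable) (auto simp: T_def)
  then have "AE y in lborel. y \<in> D \<longrightarrow> f y = c0" by eventually_elim (use F DA in blast)
  then show ?thesis by blast
qed auto

lemma AE_curve_derivative:
  fixes c :: "real \<Rightarrow> 'e::euclidean_space"
  assumes c: "L-lipschitz_on UNIV c"
  shows "\<exists>k. AE t in lborel. (c has_vector_derivative k t) (at t)"
proof -
  have "\<exists>f. AE t in lborel. ((\<lambda>t. c t \<bullet> b) has_real_derivative f t) (at t)" if b: "b \<in> Basis" for b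
  proof -
    have "L-lipschitz_on UNIV (\<lambda>t. c t \<bullet> b)"
    proof (rule lipschitz_onI)
      fix x y
      have "dist (c x \<bullet> b) (c y \<bullet> b) \<le> dist (c x) (c y)"
        using Basis_le_norm[OF b, of "c x - c y"] by (simp add: dist_norm inner_diff_left)
      also have "\<dots> \<le> L * dist x y" by (rule lipschitz_onD[OF c]) auto
      finally show "dist (c x \<bullet> b) (c y \<bullet> b) \<le> L * dist x y" .
    qed (rule lipschitz_on_nonneg[OF c])
    then show ?thesis by (rule lipschitz_real_derivative) blast
  qed
  then obtain f where f: "\<And>b. b \<in> Basis \<Longrightarrow> AE t in lborel. ((\<lambda>t. c t \<bullet> b) has_real_derivative f b t) (at t)" by metis
  have "AE t in lborel. \<forall>b\<in>Basis. ((\<lambda>t. c t \<bullet> b) has_real_derivative f b t) (at t)"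
    using f by (intro AE_finite_allI) auto
  then have "AE t in lborel. (c has_vector_derivative (\<Sum>b\<in>Basis. f b t *\<^sub>R b)) (at t)"
  proof eventually_elim
    case (elim t)
    have "((\<lambda>t. \<Sum>b\<in>Basis. (c t \<bullet> b) *\<^sub>R b) has_vector_derivative (\<Sum>b\<in>Basis. f b t *\<^sub>R b)) (at t)"
    proof (rule has_vector_derivative_sum)
      fix b :: 'e assume "b \<in> Basis"
      then have "((\<lambda>t. c t \<bullet> b) has_vector_derivative f b t) (at t)"
        using elim by (simp add: has_real_derivative_iff_has_vector_derivative)
      then show "((\<lambda>t. (c t \<bullet> b) *\<^sub>R b) has_vector_derivative f b t *\<^sub>R b) (at t)"
        by (rule bounded_linear.has_vector_derivative[OF bounded_linear_scaleR_left])
    qed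
    then show ?case by (simp add: euclidean_representation)
  qed
  then show ?thesis by (rule exI[of _ "\<lambda>t. \<Sum>b\<in>Basis. f b t *\<^sub>R b"])
qed

section \<open>Elliptic matrices\<close>

definition elliptic :: "real \<Rightarrow> real^'n^'n::finite \<Rightarrow> bool" where
  "elliptic \<Lambda> A \<longleftrightarrow> transpose A = A \<and>
     (\<forall>\<xi>. (norm \<xi>)\<^sup>2 / \<Lambda>\<^sup>2 \<le> \<xi> \<bullet> (A *v \<xi>) \<and> \<xi> \<bullet> (A *v \<xi>) \<le> \<Lambda>\<^sup>2 * (norm \<xi>)\<^sup>2)"

lemma elliptic_sym:
  assumes "elliptic \<Lambda> A" shows "x \<bullet> (A *v y) = (A *v x) \<bullet> y"
proof -
  have "(A *v x) \<bullet> y = (x v* transpose A) \<bullet> y" by (simp add: transpose_matrix_vector[symmetric] transpose_transpose)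
  also have "\<dots> = (x v* A) \<bullet> y" using assms by (simp add: elliptic_def)
  also have "\<dots> = x \<bullet> (A *v y)" by (rule dot_lmul_matrix)
  finally show ?thesis by simp
qed

lemma elliptic_lower:
  assumes "elliptic \<Lambda> A" "\<Lambda> > 0" shows "(norm x)\<^sup>2 \<le> \<Lambda>\<^sup>2 * (x \<bullet> (A *v x))"
  using assms unfolding elliptic_def by (auto simp: field_simps)

lemma elliptic_upper:
  assumes "elliptic \<Lambda> A" shows "x \<bullet> (A *v x) \<le> \<Lambda>\<^sup>2 * (norm x)\<^sup>2"
  using assms unfolding elliptic_def by auto

lemma elliptic_nonneg:
  assumes "elliptic \<Lambda> A" shows "0 \<le> x \<bullet> (A *v x)"
proof -
  have "0 \<le> (norm x)\<^sup>2 / \<Lambda>\<^sup>2" by simp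
  also have "\<dots> \<le> x \<bullet> (A *v x)" using assms unfolding elliptic_def by auto
  finally show ?thesis .
qed

lemma elliptic_pos:
  assumes "elliptic \<Lambda> A" "\<Lambda> > 0" "x \<noteq> 0" shows "0 < x \<bullet> (A *v x)"
proof -
  have "0 < (norm x)\<^sup>2 / \<Lambda>\<^sup>2" using assms by simp
  also have "\<dots> \<le> x \<bullet> (A *v x)" using assms unfolding elliptic_def by auto
  finally show ?thesis .
qed

lemma elliptic_expand:
  assumes "elliptic \<Lambda> A"
  shows "(x + t *\<^sub>R y) \<bullet> (A *v (x + t *\<^sub>R y)) = x \<bullet> (A *v x) + 2 * t * (x \<bullet> (A *v y)) + t\<^sup>2 * (y \<bullet> (A *v y))"
  using elliptic_sym[OF assms, of x y]
  by (simp add: matrix_vector_right_distrib matrix_vector_mult_scaleR inner_add_left inner_add_right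
      power2_eq_square inner_commute algebra_simps)

lemma elliptic_cauchy_schwarz:
  assumes A: "elliptic \<Lambda> A" and L: "\<Lambda> > 0"
  shows "(x \<bullet> (A *v y))\<^sup>2 \<le> (x \<bullet> (A *v x)) * (y \<bullet> (A *v y))"
proof (cases "y = 0")
  case False
  define a b c where "a = x \<bullet> (A *v x)" and "b = x \<bullet> (A *v y)" and "c = y \<bullet> (A *v y)"
  have c: "c > 0" unfolding c_def by (rule elliptic_pos[OF A L False])
  \<comment> \<open>The quadratic polynomial in t from \<open>elliptic_expand\<close>, taken at its
    minimum t = -b/c.\<close>
  have "0 \<le> a + 2 * (-b/c) * b + (-b/c)\<^sup>2 * c"
    using elliptic_nonneg[OF A, of "x + (-b/c) *\<^sub>R y"] unfolding elliptic_expand[OF A] a_def b_def c_def .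
  also have "\<dots> = (a * c - b\<^sup>2) / c" using c by (simp add: field_simps power2_eq_square)
  finally show ?thesis using c unfolding a_def b_def c_def by (simp add: zero_le_divide_iff)
qed simp

text \<open>The Cauchy-Schwarz inequality for the form of A, applied to A x and x. It bounds the
  coordinate derivatives of a function by the energy of its gradient.\<close>

lemma elliptic_norm_mult:
  assumes A: "elliptic \<Lambda> A" and L: "\<Lambda> > 0"
  shows "(norm (A *v x))\<^sup>2 \<le> \<Lambda>\<^sup>2 * (x \<bullet> (A *v x))"
proof (cases "A *v x = 0")
  case False
  let ?y = "A *v x"
  have "((norm ?y)\<^sup>2)\<^sup>2 \<le> (?y \<bullet> (A *v ?y)) * (x \<bullet> (A *v x))"
    using elliptic_cauchy_schwarz[OF A L, of ?y x] by (simp add: power2_norm_eq_inner)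
  also have "\<dots> \<le> (\<Lambda>\<^sup>2 * (norm ?y)\<^sup>2) * (x \<bullet> (A *v x))"
    by (intro mult_right_mono elliptic_upper[OF A] elliptic_nonneg[OF A])
  finally have "(norm ?y)\<^sup>2 * (norm ?y)\<^sup>2 \<le> (norm ?y)\<^sup>2 * (\<Lambda>\<^sup>2 * (x \<bullet> (A *v x)))"
    unfolding power2_eq_square[of "(norm ?y)\<^sup>2"] by argo
  moreover have "0 < (norm ?y)\<^sup>2" using False by simp
  ultimately show ?thesis by (rule mult_left_le_imp_le)
next
  case True then show ?thesis using elliptic_nonneg[OF A, of x] by simp
qed

lemma matrix_entry_inner: "(A::real^'n^'n::finite) $ i $ j = axis i 1 \<bullet> (A *v axis j 1)"
  by (simp add: inner_axis' matrix_vector_mult_basis column_def)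

lemma elliptic_entry:
  assumes A: "elliptic \<Lambda> A" and L: "\<Lambda> > 0"
  shows "\<bar>A $ i $ j\<bar> \<le> \<Lambda>\<^sup>2"
proof -
  have q: "axis i 1 \<bullet> (A *v axis i 1) \<le> \<Lambda>\<^sup>2" for i using elliptic_upper[OF A, of "axis i 1"] by simp
  have "(A $ i $ j)\<^sup>2 \<le> (axis i 1 \<bullet> (A *v axis i 1)) * (axis j 1 \<bullet> (A *v axis j 1))"
    unfolding matrix_entry_inner[of A i j] by (rule elliptic_cauchy_schwarz[OF A L])
  also have "\<dots> \<le> \<Lambda>\<^sup>2 * \<Lambda>\<^sup>2" by (intro mult_mono q elliptic_nonneg[OF A]) simp
  finally have "(A $ i $ j)\<^sup>2 \<le> (\<Lambda>\<^sup>2)\<^sup>2" by (simp add: power2_eq_square[of "\<Lambda>\<^sup>2"])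
  then have "\<bar>A $ i $ j\<bar> \<le> \<bar>\<Lambda>\<^sup>2\<bar>" unfolding abs_le_square_iff .
  then show ?thesis by simp
qed

lemma abs_det_le:
  fixes A :: "real^'n^'n::finite"
  assumes "\<And>i j. \<bar>A $ i $ j\<bar> \<le> b"
  shows "\<bar>det A\<bar> \<le> fact CARD('n) * b ^ CARD('n)"
proof -
  have "\<bar>det A\<bar> \<le> (\<Sum>p\<in>{p. p permutes (UNIV::'n set)}. \<bar>of_int (sign p) * (\<Prod>i\<in>UNIV. A $ i $ p i)\<bar>)"
    unfolding det_def by (rule sum_abs)
  also have "\<dots> \<le> (\<Sum>p\<in>{p. p permutes (UNIV::'n set)}. b ^ CARD('n))"
  proof (rule sum_mono)
    fix p :: "'n \<Rightarrow> 'n"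
    have "\<bar>of_int (sign p) * (\<Prod>i\<in>UNIV. A $ i $ p i)\<bar> = (\<Prod>i\<in>UNIV. \<bar>A $ i $ p i\<bar>)"
      by (simp add: abs_mult abs_prod sign_def)
    also have "\<dots> \<le> (\<Prod>i\<in>(UNIV::'n set). b)" by (intro prod_mono) (auto simp: assms)
    finally show "\<bar>of_int (sign p) * (\<Prod>i\<in>UNIV. A $ i $ p i)\<bar> \<le> b ^ CARD('n)" by simp
  qed
  also have "\<dots> = fact CARD('n) * b ^ CARD('n)" by (simp add: card_permutations[OF refl finite])
  finally show ?thesis .
qed

section \<open>Determinants and inverses of elliptic matrices\<close>

lemma elliptic_invertible:
  assumes A: "elliptic \<Lambda> A" and L: "\<Lambda> > 0"
  shows "invertible A"
proof -
  have "x = 0" if "A *v x = 0" for x using elliptic_pos[OF A L, of x] that by force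
  then show ?thesis unfolding invertible_left_inverse matrix_left_invertible_ker by blast
qed

text \<open>Every matrix on the segment from the identity to A is positive definite, hence
  invertible, so the determinant cannot vanish on the way from the value 1.\<close>

lemma elliptic_det_pos:
  assumes A: "elliptic \<Lambda> A" and L: "\<Lambda> > 0"
  shows "det A > 0"
proof (rule ccontr)
  assume "\<not> det A > 0"
  let ?M = "\<lambda>t::real. (1 - t) *\<^sub>R mat 1 + t *\<^sub>R A"
  have "continuous_on {0..1} (\<lambda>t. det (?M t))" unfolding det_def by (intro continuous_intros)
  then obtain t where t: "0 \<le> t" "t \<le> 1" "det (?M t) = 0"
    using IVT2'[of "\<lambda>t. det (?M t)" 1 0 0] \<open>\<not> det A > 0\<close> by auto
  have "x = 0" if "?M t *v x = 0" for x
  proof (rule ccontr)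
    assume "x \<noteq> 0"
    have "0 = x \<bullet> (?M t *v x)" using that by simp
    also have "\<dots> = (1 - t) * (x \<bullet> x) + t * (x \<bullet> (A *v x))"
      by (simp add: matrix_vector_mult_add_rdistrib scaleR_matrix_vector_assoc[symmetric] inner_add_right)
    also have "\<dots> > 0"
    proof (cases "t = 1")
      case True then show ?thesis using elliptic_pos[OF A L \<open>x \<noteq> 0\<close>] by simp
    next
      case False
      then show ?thesis using t \<open>x \<noteq> 0\<close> elliptic_nonneg[OF A, of x] by (intro add_pos_nonneg) auto
    qed
    finally show False by simp
  qed
  then have "invertible (?M t)" unfolding invertible_left_inverse matrix_left_invertible_ker by blast
  then show False using t invertible_det_nz by blast
qed

lemma matrix_inv_right:
  fixes A :: "real^'n^'n::finite"
  assumes "invertible A" shows "A ** matrix_inv A = mat 1"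
  using someI_ex[OF assms[unfolded invertible_def]] unfolding matrix_inv_def by blast

lemma elliptic_mult_inv:
  assumes A: "elliptic \<Lambda> A" and L: "\<Lambda> > 0"
  shows "A *v (matrix_inv A *v p) = p"
  using matrix_inv_right[OF elliptic_invertible[OF A L]] by (simp add: matrix_vector_mul_assoc)

lemma elliptic_norm_inv:
  assumes A: "elliptic \<Lambda> A" and L: "\<Lambda> > 0"
  shows "norm (matrix_inv A *v p) \<le> \<Lambda>\<^sup>2 * norm p"
proof (cases "matrix_inv A *v p = 0")
  case False
  let ?v = "matrix_inv A *v p"
  have "norm ?v * norm ?v \<le> \<Lambda>\<^sup>2 * (?v \<bullet> p)"
    using elliptic_lower[OF A L, of ?v] elliptic_mult_inv[OF A L, of p] by (simp add: power2_eq_square)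
  also have "\<dots> \<le> \<Lambda>\<^sup>2 * (norm ?v * norm p)" by (intro mult_left_mono norm_cauchy_schwarz) simp
  finally show ?thesis using False by (simp add: mult_ac)
qed simp

text \<open>The upper bound is the Leibniz formula with bounded entries. The lower bound is the same
  estimate for the inverse, whose entries are bounded by \<Lambda>^2 as well.\<close>

lemma elliptic_det_bounds:
  assumes A: "elliptic \<Lambda> (A::real^'n^'n::finite)" and L: "\<Lambda> > 0"
  shows "det A \<le> fact CARD('n) * (\<Lambda>\<^sup>2) ^ CARD('n)"
    and "1 / (fact CARD('n) * (\<Lambda>\<^sup>2) ^ CARD('n)) \<le> det A"
proof -
  let ?c = "fact CARD('n) * (\<Lambda>\<^sup>2) ^ CARD('n)"
  show "det A \<le> ?c" using abs_det_le[of A "\<Lambda>\<^sup>2"] elliptic_entry[OF A L] by fastforce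
  have e: "\<bar>matrix_inv A $ i $ j\<bar> \<le> \<Lambda>\<^sup>2" for i j
  proof -
    have "\<bar>matrix_inv A $ i $ j\<bar> \<le> norm (matrix_inv A *v axis j 1)"
      using component_le_norm_cart[of "matrix_inv A *v axis j 1" i] by (simp add: matrix_vector_mult_basis column_def)
    also have "\<dots> \<le> \<Lambda>\<^sup>2" using elliptic_norm_inv[OF A L, of "axis j 1"] by simp
    finally show ?thesis .
  qed
  have "A ** matrix_inv A = mat 1" using matrix_inv_right[OF elliptic_invertible[OF A L]] by simp
  then have "det A * det (matrix_inv A) = 1" by (metis det_I det_mul)
  moreover have "\<bar>det (matrix_inv A)\<bar> \<le> ?c" by (rule abs_det_le[OF e])
  moreover have "det A > 0" by (rule elliptic_det_pos[OF A L])
  ultimately have "1 \<le> det A * ?c" using mult_left_mono[of "det (matrix_inv A)" ?c "det A"] by linarith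
  moreover have "?c > 0" using L by simp
  ultimately show "1 / ?c \<le> det A" by (simp add: field_simps)
qed

text \<open>Cramer's rule expresses the inverse by quotients of polynomials in the entries, which is
  the form in which the gradient is seen to be measurable.\<close>

lemma elliptic_inv_cramer:
  assumes A: "elliptic \<Lambda> A" and L: "\<Lambda> > 0"
  shows "matrix_inv A *v p = (\<chi> k. det (\<chi> i j. if j = k then p $ i else A $ i $ j) / det A)"
  using cramer[of A "matrix_inv A *v p" p] elliptic_mult_inv[OF A L, of p] elliptic_det_pos[OF A L] by simp

section \<open>Locally Lipschitz maps\<close>

text \<open>The distances are arbitrary functions because \<open>bary_dist\<close> is not the
  distance of a metric type class.\<close>

lemma locally_lipschitz_compose:
  assumes h: "locally_lipschitz M d d' h" and k: "locally_lipschitz N d' d'' k" and "h ` M \<subseteq> N"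
    and d0: "\<And>x. d x x = 0" and dp: "\<And>x y. 0 \<le> d x y" and dp': "\<And>x y. 0 \<le> d' x y"
  shows "locally_lipschitz M d d'' (k \<circ> h)"
  unfolding locally_lipschitz_def
proof
  fix x assume x: "x \<in> M"
  then have hx: "h x \<in> N" using assms(3) by blast
  obtain r1 L1 where 1: "r1 > 0" "\<And>y z. y \<in> M \<Longrightarrow> z \<in> M \<Longrightarrow> d x y < r1 \<Longrightarrow> d x z < r1 \<Longrightarrow> d' (h y) (h z) \<le> L1 * d y z"
    using h[unfolded locally_lipschitz_def, rule_format, OF x] by blast
  obtain r2 L2 where 2: "r2 > 0" "\<And>y z. y \<in> N \<Longrightarrow> z \<in> N \<Longrightarrow> d' (h x) y < r2 \<Longrightarrow> d' (h x) z < r2 \<Longrightarrow> d'' (k y) (k z) \<le> L2 * d' y z"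
    using k[unfolded locally_lipschitz_def, rule_format, OF hx] by blast
  \<comment> \<open>The second entry makes h map the ball of radius r around x into the ball of
    radius r2 around h x; adding 1 avoids a division by 0.\<close>
  define r where "r = min r1 (r2 / (\<bar>L1\<bar> + 1))"
  have near: "d' (h x) (h y) < r2" if "y \<in> M" "d x y < r" for y
  proof -
    have "d' (h x) (h y) \<le> L1 * d x y" using 1(2)[of x y] 1(1) that x d0 by (auto simp: r_def)
    also have "\<dots> \<le> (\<bar>L1\<bar> + 1) * d x y" using dp by (intro mult_right_mono) auto
    also have "\<dots> < (\<bar>L1\<bar> + 1) * (r2 / (\<bar>L1\<bar> + 1))" using that by (intro mult_strict_left_mono) (auto simp: r_def)
    also have "\<dots> = r2" by simp
    finally show ?thesis .
  qed
  have "d'' ((k \<circ> h) y) ((k \<circ> h) z) \<le> (\<bar>L2\<bar> * \<bar>L1\<bar>) * d y z" if "y \<in> M" "z \<in> M" "d x y < r" "d x z < r" for y z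
  proof -
    have "d'' (k (h y)) (k (h z)) \<le> L2 * d' (h y) (h z)"
      using that assms(3) by (intro 2(2) near) auto
    also have "\<dots> \<le> \<bar>L2\<bar> * d' (h y) (h z)" using dp' by (intro mult_right_mono) auto
    also have "\<dots> \<le> \<bar>L2\<bar> * (L1 * d y z)" using that by (intro mult_left_mono 1(2)) (auto simp: r_def)
    also have "\<dots> \<le> \<bar>L2\<bar> * (\<bar>L1\<bar> * d y z)" using dp by (intro mult_left_mono mult_right_mono) auto
    finally show ?thesis by (simp add: mult.assoc)
  qed
  moreover have "r > 0" using 1 2 by (simp add: r_def add_nonneg_pos)
  ultimately show "\<exists>r>0. \<exists>L. \<forall>y\<in>M. \<forall>z\<in>M. d x y < r \<and> d x z < r \<longrightarrow> d'' ((k \<circ> h) y) ((k \<circ> h) z) \<le> L * d y z"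
    by blast
qed

lemma locally_lipschitz_continuous:
  fixes h :: "'p::metric_space \<Rightarrow> 'q::metric_space"
  assumes "locally_lipschitz M dist dist h" shows "continuous_on M h"
  unfolding continuous_on_iff
proof (intro ballI allI impI)
  fix x e assume x: "x \<in> M" and e: "(0::real) < e"
  obtain r L where r: "r > 0" "\<And>y z. y \<in> M \<Longrightarrow> z \<in> M \<Longrightarrow> dist x y < r \<Longrightarrow> dist x z < r \<Longrightarrow> dist (h y) (h z) \<le> L * dist y z"
    using assms[unfolded locally_lipschitz_def, rule_format, OF x] by blast
  show "\<exists>d>0. \<forall>x'\<in>M. dist x' x < d \<longrightarrow> dist (h x') (h x) < e"
  proof (intro exI conjI ballI impI)
    show "0 < min r (e / (\<bar>L\<bar> + 1))" using r e by (simp add: add_nonneg_pos)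
    fix y assume y: "y \<in> M" "dist y x < min r (e / (\<bar>L\<bar> + 1))"
    have "dist (h y) (h x) \<le> L * dist y x" using r y x by (simp add: dist_commute)
    also have "\<dots> \<le> (\<bar>L\<bar> + 1) * dist y x" by (intro mult_right_mono) auto
    also have "\<dots> < (\<bar>L\<bar> + 1) * (e / (\<bar>L\<bar> + 1))" using y by (intro mult_strict_left_mono) auto
    also have "\<dots> = e" by simp
    finally show "dist (h y) (h x) < e" .
  qed
qed

text \<open>Finitely many balls of half the local radius cover M. If two points are close compared
  with the radius at the first of them, the local constant applies; otherwise the diameter of the
  image divided by half the radius does. The sum over the cover bounds both.\<close>

lemma locally_lipschitz_compact:
  fixes h :: "'p::metric_space \<Rightarrow> 'q::metric_space"
  assumes loc: "locally_lipschitz M dist dist h" and M: "compact M"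
  shows "\<exists>L. L-lipschitz_on M h"
proof -
  have "\<forall>x\<in>M. \<exists>r>0. \<exists>L. \<forall>y\<in>M. \<forall>z\<in>M. dist x y < r \<and> dist x z < r \<longrightarrow> dist (h y) (h z) \<le> L * dist y z"
    using loc unfolding locally_lipschitz_def .
  then obtain r where r: "\<forall>x\<in>M. 0 < r x \<and> (\<exists>L. \<forall>y\<in>M. \<forall>z\<in>M. dist x y < r x \<and> dist x z < r x \<longrightarrow> dist (h y) (h z) \<le> L * dist y z)"
    by (metis (no_types))
  then obtain L where L: "\<forall>x\<in>M. \<forall>y\<in>M. \<forall>z\<in>M. dist x y < r x \<and> dist x z < r x \<longrightarrow> dist (h y) (h z) \<le> L x * dist y z"
    by (metis (no_types))
  have "M \<subseteq> (\<Union>x\<in>M. ball x (r x / 2))" using r by force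
  then obtain F where F: "F \<subseteq> M" "finite F" "M \<subseteq> (\<Union>x\<in>F. ball x (r x / 2))"
    using compactE_image[OF M, of M "\<lambda>x. ball x (r x / 2)"] by auto
  have "bounded (h ` M)" using compact_continuous_image[OF locally_lipschitz_continuous[OF loc] M] by (rule compact_imp_bounded)
  then obtain B where B: "\<And>y z. y \<in> M \<Longrightarrow> z \<in> M \<Longrightarrow> dist (h y) (h z) \<le> B"
    unfolding bounded_two_points by blast
  define C where "C = (\<Sum>x\<in>F. \<bar>L x\<bar> + \<bar>B\<bar> / (r x / 2))"
  have nn: "0 \<le> \<bar>L x\<bar> + \<bar>B\<bar> / (r x / 2)" if "x \<in> F" for x
    using that F(1) r by (intro add_nonneg_nonneg divide_nonneg_nonneg) (auto intro: less_imp_le)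
  have C1: "\<bar>L x\<bar> + \<bar>B\<bar> / (r x / 2) \<le> C" if "x \<in> F" for x
    unfolding C_def using that F(2) nn by (intro member_le_sum) auto
  have C0: "0 \<le> C" unfolding C_def using nn by (intro sum_nonneg) auto
  have "dist (h y) (h z) \<le> C * dist y z" if y: "y \<in> M" and z: "z \<in> M" for y z
  proof -
    obtain x where x: "x \<in> F" "dist x y < r x / 2" using F y by auto
    have xM: "x \<in> M" and rx: "0 < r x" using x F r by auto
    show ?thesis
    proof (cases "dist y z < r x / 2")
      case True
      have "dist x z < r x" using dist_triangle_half_r[of y x "r x" z] x True by (simp add: dist_commute)
      then have "dist (h y) (h z) \<le> L x * dist y z" using L xM y z x rx by simp
      also have "\<dots> \<le> C * dist y z"
      proof (rule mult_right_mono)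
        have "0 \<le> \<bar>B\<bar> / (r x / 2)" using rx by simp
        then show "L x \<le> C" using C1[OF x(1)] by linarith
      qed simp
      finally show ?thesis .
    next
      case False
      have "dist (h y) (h z) \<le> \<bar>B\<bar>" using B[OF y z] by simp
      also have "\<dots> = \<bar>B\<bar> / (r x / 2) * (r x / 2)" using rx by simp
      also have "\<dots> \<le> C * dist y z"
      proof (rule mult_mono)
        show "\<bar>B\<bar> / (r x / 2) \<le> C" using C1[OF x(1)] by linarith
      qed (use False C0 rx in auto)
      finally show ?thesis .
    qed
  qed
  then show ?thesis using C0 by (intro exI[of _ C]) (auto simp: lipschitz_on_def)
qed

section \<open>Almost everywhere statements under affine maps and along segments\<close>

lemma AE_lborel_affine:
  fixes a :: "'a::euclidean_space"
  assumes Q: "AE x in lborel. Q x" and c: "c \<noteq> 0"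
  shows "AE x in lborel. Q (a + c *\<^sub>R x)"
proof -
  obtain N where N: "N \<in> null_sets lborel" "\<forall>x. x \<notin> N \<longrightarrow> Q x" using AE_lborel_null[OF Q] by blast
  let ?f = "\<lambda>x. (1 / c) *\<^sub>R (x - a)"
  have "negligible N" using N(1) negligible_iff_null_sets null_sets_completionI by blast
  moreover have "\<bar>1 / c\<bar>-lipschitz_on UNIV ?f"
    by (intro lipschitz_onI) (auto simp: dist_norm simp flip: scaleR_diff_right)
  ultimately have "negligible (?f ` N)" by (rule negligible_lipschitz_image) simp
  then have "AE x in lebesgue. x \<notin> ?f ` N" by (intro AE_not_in) (simp add: negligible_iff_null_sets)
  then have "AE x in lborel. x \<notin> ?f ` N" by (simp add: AE_completion_iff)
  then show ?thesis
  proof eventually_elim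
    case (elim x)
    have "?f (a + c *\<^sub>R x) = x" using c by simp
    then have "a + c *\<^sub>R x \<notin> N" using elim by (metis imageI)
    then show ?case using N(2) by blast
  qed
qed

text \<open>For fixed t > 0 the homothety with centre p and ratio t pulls null sets back to null
  sets; Fubini exchanges t and z. A generic z thus yields a segment from p that avoids N for almost
  every parameter.\<close>

lemma AE_segments_avoid:
  fixes p :: "'a::euclidean_space"
  assumes N: "N \<in> null_sets lborel"
  shows "AE z in lborel. AE t in lborel. (0::real) < t \<longrightarrow> p + t *\<^sub>R (z - p) \<notin> N"
proof -
  have [measurable]: "N \<in> sets borel" using N by (auto simp: null_sets_def)
  have "AE t in lborel. AE z in lborel. (0::real) < t \<longrightarrow> p + t *\<^sub>R (z - p) \<notin> N"
  proof (rule AE_I2)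
    fix t :: real
    show "AE z in lborel. 0 < t \<longrightarrow> p + t *\<^sub>R (z - p) \<notin> N"
    proof (cases "0 < t")
      case True
      have "AE z in lborel. (p - t *\<^sub>R p) + t *\<^sub>R z \<notin> N"
        using True by (intro AE_lborel_affine AE_not_in[OF N]) auto
      then show ?thesis by eventually_elim (simp add: algebra_simps)
    qed simp
  qed
  then show ?thesis
  proof (rule iffD1[OF lborel_pair.AE_commute, rotated])
    show "{z \<in> space (lborel \<Otimes>\<^sub>M lborel). 0 < fst z \<longrightarrow> p + fst z *\<^sub>R (snd z - p) \<notin> N} \<in> sets (lborel \<Otimes>\<^sub>M lborel)"
      by measurable
  qed
qed

lemma AE_lborel_open_witness:
  fixes U :: "'a::euclidean_space set"
  assumes "AE x in lborel. Q x" "open U" "U \<noteq> {}"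
  shows "\<exists>x\<in>U. Q x"
proof (rule ccontr)
  assume no: "\<not> ?thesis"
  obtain N where N: "N \<in> null_sets lborel" "\<forall>x. x \<notin> N \<longrightarrow> Q x" using AE_lborel_null[OF assms(1)] by blast
  then have "U \<subseteq> N" using no by blast
  moreover have "negligible N" using N(1) negligible_iff_null_sets null_sets_completionI by blast
  ultimately show False using open_not_negligible[OF assms(2,3)] negligible_subset by blast
qed

lemma AE_lebesgue_negligible:
  assumes "AE x in lebesgue. x \<notin> A" shows "negligible A"
proof -
  obtain N where "N \<in> null_sets lebesgue" "A \<subseteq> N"
    using assms unfolding eventually_ae_filter by auto
  then show ?thesis using negligible_subset negligible_iff_null_sets by blast
qed

lemma bary_dist_nonneg: "0 \<le> bary_dist \<alpha> \<beta>" and bary_dist_refl: "bary_dist \<alpha> \<alpha> = 0"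
  by (simp_all add: bary_dist_def sum_nonneg)

lemma lipschitz_imp_locally_lipschitz: "L-lipschitz_on M h \<Longrightarrow> locally_lipschitz M dist dist h"
  unfolding locally_lipschitz_def using lipschitz_onD by (metis zero_less_one)

lemma has_vector_derivative_near:
  assumes "(f has_vector_derivative D) (at t)" "open T" "t \<in> T" "\<And>\<tau>. \<tau> \<in> T \<Longrightarrow> g \<tau> = f \<tau>"
  shows "(g has_vector_derivative D) (at t)"
  using has_vector_derivative_transform_within_open[OF assms(1-3), of g] assms(4) by simp

lemma lipschitz_unit_join:
  fixes \<gamma>1 \<gamma>2 :: "real \<Rightarrow> 'p::metric_space"
  assumes 1: "L-lipschitz_on {0..1} \<gamma>1" and 2: "M-lipschitz_on {0..1} \<gamma>2" and "\<gamma>1 1 = \<gamma>2 0"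
  shows "\<exists>K. K-lipschitz_on {0..1} (\<lambda>t. if t \<le> 1/2 then \<gamma>1 (2 * t) else \<gamma>2 (2 * t - 1))"
proof -
  have "(2 * L)-lipschitz_on {0..1/2} (\<lambda>t. \<gamma>1 (2 * t))"
  proof (rule lipschitz_onI)
    fix x y :: real assume "x \<in> {0..1/2}" "y \<in> {0..1/2}"
    then have "dist (\<gamma>1 (2 * x)) (\<gamma>1 (2 * y)) \<le> L * dist (2 * x) (2 * y)" by (intro lipschitz_onD[OF 1]) auto
    moreover have "dist (2 * x) (2 * y) = 2 * dist x y"
    proof -
      have "2 * x - 2 * y = 2 * (x - y)" by simp
      then show ?thesis by (simp only: dist_real_def abs_mult abs_numeral)
    qed
    ultimately show "dist (\<gamma>1 (2 * x)) (\<gamma>1 (2 * y)) \<le> 2 * L * dist x y" by simp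
  qed (use lipschitz_on_nonneg[OF 1] in simp)
  moreover have "(2 * M)-lipschitz_on {1/2..1} (\<lambda>t. \<gamma>2 (2 * t - 1))"
  proof (rule lipschitz_onI)
    fix x y :: real assume "x \<in> {1/2..1}" "y \<in> {1/2..1}"
    then have "dist (\<gamma>2 (2 * x - 1)) (\<gamma>2 (2 * y - 1)) \<le> M * dist (2 * x - 1) (2 * y - 1)" by (intro lipschitz_onD[OF 2]) auto
    moreover have "dist (2 * x - 1) (2 * y - 1) = 2 * dist x y"
    proof -
      have "2 * x - 1 - (2 * y - 1) = 2 * (x - y)" by simp
      then show ?thesis by (simp only: dist_real_def abs_mult abs_numeral)
    qed
    ultimately show "dist (\<gamma>2 (2 * x - 1)) (\<gamma>2 (2 * y - 1)) \<le> 2 * M * dist x y" by simp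
  qed (use lipschitz_on_nonneg[OF 2] in simp)
  ultimately have "(max (2 * L) (2 * M))-lipschitz_on {0..1} (\<lambda>t. if t \<le> 1/2 then \<gamma>1 (2 * t) else \<gamma>2 (2 * t - 1))"
    by (rule lipschitz_on_concat_max) (use assms(3) in simp)
  then show ?thesis by blast
qed

section \<open>A Caccioppoli estimate\<close>

text \<open>Since the derivative is at least \<open>1/2\<close> on \<open>[0, \<infinity>)\<close>, there is no need to know that the gradient
  of \<open>f\<close> vanishes where \<open>f\<close> does, as there would be for the positive part itself.\<close>

definition smooth_pos :: "real \<Rightarrow> real \<Rightarrow> real" where "smooth_pos e t = (t + sqrt (t\<^sup>2 + e\<^sup>2)) / 2"
definition smooth_pos_deriv :: "real \<Rightarrow> real \<Rightarrow> real" where "smooth_pos_deriv e t = (1 + t / sqrt (t\<^sup>2 + e\<^sup>2)) / 2"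

lemma smooth_pos_sqrt_pos: "e > 0 \<Longrightarrow> 0 < sqrt (t\<^sup>2 + e\<^sup>2)" for e t :: real
  by (simp add: add_nonneg_pos)

lemma smooth_pos_abs_le: "\<bar>t\<bar> \<le> sqrt (t\<^sup>2 + e\<^sup>2)" for e t :: real
  by (rule real_le_rsqrt) simp

lemma smooth_pos_nonneg: "0 \<le> smooth_pos e t"
  using smooth_pos_abs_le[of t e] unfolding smooth_pos_def by (auto simp: abs_le_iff)

lemma smooth_pos_deriv: assumes "e > 0" shows "(smooth_pos e has_real_derivative smooth_pos_deriv e t) (at t)"
proof -
  have "t\<^sup>2 + e\<^sup>2 > 0" using assms by (simp add: add_nonneg_pos)
  then show ?thesis unfolding smooth_pos_def[abs_def] smooth_pos_deriv_def
    by (auto intro!: derivative_eq_intros simp: divide_simps)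
qed

lemma smooth_pos_deriv_bounds: assumes "e > 0" shows "0 \<le> smooth_pos_deriv e t" "smooth_pos_deriv e t \<le> 1" "0 \<le> t \<Longrightarrow> 1/2 \<le> smooth_pos_deriv e t"
proof -
  have "\<bar>t / sqrt (t\<^sup>2 + e\<^sup>2)\<bar> \<le> 1"
    using smooth_pos_abs_le[of t e] smooth_pos_sqrt_pos[OF assms, of t] by (simp add: abs_divide divide_le_eq)
  note b = abs_le_D1[OF this] abs_le_D2[OF this]
  define x where "x = t / sqrt (t\<^sup>2 + e\<^sup>2)"
  show "0 \<le> smooth_pos_deriv e t" "smooth_pos_deriv e t \<le> 1" using b unfolding smooth_pos_deriv_def x_def[symmetric] by auto
  assume "0 \<le> t"
  then have "0 \<le> t / sqrt (t\<^sup>2 + e\<^sup>2)" by simp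
  then show "1/2 \<le> smooth_pos_deriv e t" unfolding smooth_pos_deriv_def by simp
qed

lemma smooth_pos_le: assumes "e > 0" "0 \<le> t" shows "smooth_pos e t \<le> t + e"
proof -
  have "sqrt (t\<^sup>2 + e\<^sup>2) \<le> t + e" using assms by (intro real_le_lsqrt) (auto simp: power2_sum)
  then show ?thesis unfolding smooth_pos_def using assms by simp
qed

lemma smooth_pos_lipschitz: assumes "e > 0" shows "\<bar>smooth_pos e s - smooth_pos e t\<bar> \<le> \<bar>s - t\<bar>"
proof -
  have "norm (smooth_pos e s - smooth_pos e t) \<le> 1 * norm (s - t)"
    by (rule field_differentiable_bound[of UNIV "smooth_pos e" "smooth_pos_deriv e"])
      (use smooth_pos_deriv[OF assms] smooth_pos_deriv_bounds[OF assms] in \<open>auto simp: abs_le_iff intro: order_trans[of _ 0]\<close>)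
  then show ?thesis by simp
qed

lemma smooth_pos_continuous: "e > 0 \<Longrightarrow> continuous_on UNIV (smooth_pos e)" and smooth_pos_deriv_continuous: "e > 0 \<Longrightarrow> continuous_on UNIV (smooth_pos_deriv e)"
  using smooth_pos_sqrt_pos[of e] unfolding smooth_pos_def[abs_def] smooth_pos_deriv_def[abs_def]
  by (auto intro!: continuous_intros simp: less_imp_neq[symmetric])

lemma amgm: assumes "(0::real) \<le> a" "0 \<le> b" "d > 0" shows "sqrt (a * b) \<le> d * a + b / (4 * d)"
proof (rule real_le_lsqrt)
  have "(d * a + b / (4 * d))\<^sup>2 - a * b = (d * a - b / (4 * d))\<^sup>2"
    using assms(3) by (simp add: power2_eq_square field_simps)
  then show "a * b \<le> (d * a + b / (4 * d))\<^sup>2" using zero_le_power2[of "d * a - b / (4 * d)"] by linarith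
qed (use assms in auto)

text \<open>A and B are the squared lengths of the gradient of f and of its difference from the
  gradient of an approximation u, I is the inner product of the gradients of f and u, and c pairs
  the gradient of f with that of \<eta>^2. Passing from I to A and from u to f in the factor of c
  costs d A twice, plus errors that vanish as u approaches f.\<close>

lemma caccioppoli_pointwise:
  fixes A B D d e \<eta> c f u I :: real
  assumes e: "e > 0" and d: "d > 0" and D: "D > 0" and A: "0 \<le> A" and B: "0 \<le> B" and \<eta>: "0 \<le> \<eta>" "\<eta> \<le> 1"
    and I: "\<bar>I - A\<bar> \<le> sqrt (A * B)" and c: "\<bar>c\<bar> \<le> D * \<eta> * sqrt A"
  shows "\<eta>\<^sup>2 * smooth_pos_deriv e u * A + smooth_pos e f * c - 2 * d * A - B / (4 * d) - D\<^sup>2 * (u - f)\<^sup>2 / (4 * d) \<le> \<eta>\<^sup>2 * smooth_pos_deriv e u * I + smooth_pos e u * c"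
proof -
  have w: "0 \<le> \<eta>\<^sup>2 * smooth_pos_deriv e u" "\<eta>\<^sup>2 * smooth_pos_deriv e u \<le> 1"
    using \<eta> smooth_pos_deriv_bounds[OF e, of u] by (auto intro!: mult_le_one power_le_one)
  have "\<bar>\<eta>\<^sup>2 * smooth_pos_deriv e u * (I - A)\<bar> = (\<eta>\<^sup>2 * smooth_pos_deriv e u) * \<bar>I - A\<bar>"
    by (simp only: abs_mult[of "\<eta>\<^sup>2 * smooth_pos_deriv e u"] abs_of_nonneg[OF w(1)])
  also have "\<dots> \<le> 1 * sqrt (A * B)" using w I by (intro mult_mono) auto
  also have "\<dots> \<le> d * A + B / (4 * d)" using amgm[OF A B d] by simp
  finally have 1: "- (d * A + B / (4 * d)) \<le> \<eta>\<^sup>2 * smooth_pos_deriv e u * (I - A)" by (simp add: abs_le_iff)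
  have "\<bar>(smooth_pos e u - smooth_pos e f) * c\<bar> \<le> \<bar>u - f\<bar> * (D * 1 * sqrt A)"
    unfolding abs_mult using smooth_pos_lipschitz[OF e, of u f] c \<eta> D A
    by (intro mult_mono order_trans[OF c] mult_right_mono mult_left_mono) auto
  also have "\<dots> = sqrt (A * (D\<^sup>2 * (u - f)\<^sup>2))" using D by (simp add: real_sqrt_mult)
  also have "\<dots> \<le> d * A + D\<^sup>2 * (u - f)\<^sup>2 / (4 * d)" by (rule amgm[OF A _ d]) simp
  finally have 2: "- (d * A + D\<^sup>2 * (u - f)\<^sup>2 / (4 * d)) \<le> (smooth_pos e u - smooth_pos e f) * c" by (simp add: abs_le_iff)
  show ?thesis using 1 2 by (simp add: algebra_simps)
qed

text \<open>First k tends to infinity at a fixed d, then d tends to 0, while e stays fixed. The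
  remaining inequality for f itself is the usual Caccioppoli argument, with the cross term absorbed
  into the energy.\<close>

lemma caccioppoli_limit:
  fixes Q :: "'x measure" and f A c \<eta> :: "'x \<Rightarrow> real" and u I B :: "nat \<Rightarrow> 'x \<Rightarrow> real"
  assumes fin: "finite_measure Q"
    and [measurable]: "f \<in> borel_measurable Q" "A \<in> borel_measurable Q" "c \<in> borel_measurable Q" "\<eta> \<in> borel_measurable Q"
      "\<And>k. u k \<in> borel_measurable Q" "\<And>k. I k \<in> borel_measurable Q" "\<And>k. B k \<in> borel_measurable Q"
    and f2: "integrable Q (\<lambda>x. (f x)\<^sup>2)" and Ai: "integrable Q A"
    and u: "\<And>k. integrable Q (\<lambda>x. (u k x - f x)\<^sup>2)" "(\<lambda>k. \<integral>x. (u k x - f x)\<^sup>2 \<partial>Q) \<longlonglongrightarrow> 0"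
    and B: "\<And>k. integrable Q (B k)" "(\<lambda>k. \<integral>x. B k x \<partial>Q) \<longlonglongrightarrow> 0"
    and f0: "AE x in Q. 0 \<le> f x" and A0: "AE x in Q. 0 \<le> A x" and B0: "\<And>k. AE x in Q. 0 \<le> B k x"
    and I: "\<And>k. AE x in Q. \<bar>I k x - A x\<bar> \<le> sqrt (A x * B k x)"
    and c: "AE x in Q. \<bar>c x\<bar> \<le> D * \<eta> x * sqrt (A x)"
    and \<eta>: "\<And>x. 0 \<le> \<eta> x" "\<And>x. \<eta> x \<le> 1" and D: "D > 0" and e: "e > 0"
    and ineq: "\<And>k. (\<integral>x. (\<eta> x)\<^sup>2 * smooth_pos_deriv e (u k x) * I k x + smooth_pos e (u k x) * c x \<partial>Q) \<le> 0"
  shows "(\<integral>x. (\<eta> x)\<^sup>2 * A x \<partial>Q) \<le> 4 * D\<^sup>2 * (\<integral>x. (f x + e)\<^sup>2 \<partial>Q)"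
proof -
  interpret finite_measure Q by (rule fin)
  have [measurable]: "smooth_pos e \<in> borel_measurable borel" "smooth_pos_deriv e \<in> borel_measurable borel"
    using smooth_pos_continuous[OF e] smooth_pos_deriv_continuous[OF e] by (auto intro: borel_measurable_continuous_onI)
  have fe: "integrable Q (\<lambda>x. (f x + e)\<^sup>2)"
  proof (rule Bochner_Integration.integrable_bound)
    show "integrable Q (\<lambda>x. 2 * (f x)\<^sup>2 + 2 * e\<^sup>2)" using f2 by simp
    have "(a + e)\<^sup>2 \<le> 2 * a\<^sup>2 + 2 * e\<^sup>2" for a using sum_squares_ge_zero[of "a - e" 0] by (simp add: power2_eq_square algebra_simps)
    then show "AE x in Q. norm ((f x + e)\<^sup>2) \<le> norm (2 * (f x)\<^sup>2 + 2 * e\<^sup>2)" by simp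
  qed measurable
  have w: "0 \<le> (\<eta> x)\<^sup>2 * smooth_pos_deriv e t" "(\<eta> x)\<^sup>2 * smooth_pos_deriv e t \<le> 1" for x t
    using \<eta> smooth_pos_deriv_bounds[OF e, of t] by (auto intro!: mult_le_one power_le_one)
  have iA: "integrable Q (\<lambda>x. (\<eta> x)\<^sup>2 * smooth_pos_deriv e (v x) * A x)" if [measurable]: "v \<in> borel_measurable Q" for v
  proof (rule Bochner_Integration.integrable_bound[OF Ai])
    show "AE x in Q. norm ((\<eta> x)\<^sup>2 * smooth_pos_deriv e (v x) * A x) \<le> norm (A x)"
      using w by (intro AE_I2) (simp add: abs_mult[of _ "A _"] mult_left_le_one_le)
  qed measurable
  have i\<eta>A: "integrable Q (\<lambda>x. (\<eta> x)\<^sup>2 * A x)"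
  proof (rule Bochner_Integration.integrable_bound[OF Ai])
    have "\<bar>(\<eta> x)\<^sup>2 * A x\<bar> \<le> \<bar>A x\<bar>" for x using \<eta>[of x] by (simp add: abs_mult mult_left_le_one_le power_le_one)
    then show "AE x in Q. norm ((\<eta> x)\<^sup>2 * A x) \<le> norm (A x)" by simp
  qed measurable
  have ic: "integrable Q (\<lambda>x. smooth_pos e (v x) * c x)" if [measurable]: "v \<in> borel_measurable Q"
    and v: "integrable Q (\<lambda>x. (smooth_pos e (v x))\<^sup>2)" for v
  proof (rule Bochner_Integration.integrable_bound)
    show "integrable Q (\<lambda>x. D\<^sup>2 * (smooth_pos e (v x))\<^sup>2 + A x)" using v Ai by simp
    show "AE x in Q. norm (smooth_pos e (v x) * c x) \<le> norm (D\<^sup>2 * (smooth_pos e (v x))\<^sup>2 + A x)"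
      using c A0
    proof eventually_elim
      case (elim x)
      have "\<bar>smooth_pos e (v x) * c x\<bar> \<le> smooth_pos e (v x) * (D * 1 * sqrt (A x))"
        unfolding abs_mult using smooth_pos_nonneg[of e "v x"] elim \<eta>[of x] D
        by (intro mult_mono order_trans[OF elim(1)] mult_right_mono mult_left_mono) auto
      also have "\<dots> = sqrt (A x * (D\<^sup>2 * (smooth_pos e (v x))\<^sup>2))" using D smooth_pos_nonneg[of e "v x"] by (simp add: real_sqrt_mult)
      also have "\<dots> \<le> 1 * A x + (D\<^sup>2 * (smooth_pos e (v x))\<^sup>2) / (4 * 1)" by (rule amgm) (use elim in auto)
      also have "\<dots> \<le> D\<^sup>2 * (smooth_pos e (v x))\<^sup>2 + A x" by simp
      finally show ?case by simp
    qed
  qed measurable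
  have regf: "integrable Q (\<lambda>x. (smooth_pos e (f x))\<^sup>2)"
  proof (rule Bochner_Integration.integrable_bound[OF fe])
    show "AE x in Q. norm ((smooth_pos e (f x))\<^sup>2) \<le> norm ((f x + e)\<^sup>2)"
      using f0 by eventually_elim (use smooth_pos_nonneg smooth_pos_le[OF e] in \<open>auto intro!: power_mono\<close>)
  qed measurable
  have regu: "integrable Q (\<lambda>x. (smooth_pos e (u k x))\<^sup>2)" for k
  proof (rule Bochner_Integration.integrable_bound)
    show "integrable Q (\<lambda>x. 2 * (smooth_pos e (f x))\<^sup>2 + 2 * (u k x - f x)\<^sup>2)" using regf u(1) by simp
    have "(smooth_pos e s)\<^sup>2 \<le> 2 * (smooth_pos e t)\<^sup>2 + 2 * (s - t)\<^sup>2" for s t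
    proof -
      have "(smooth_pos e s - smooth_pos e t)\<^sup>2 \<le> (s - t)\<^sup>2" using smooth_pos_lipschitz[OF e, of s t] by (simp add: abs_le_square_iff)
      moreover have "(smooth_pos e s)\<^sup>2 \<le> 2 * (smooth_pos e t)\<^sup>2 + 2 * (smooth_pos e s - smooth_pos e t)\<^sup>2"
        using zero_le_power2[of "2 * smooth_pos e t - smooth_pos e s"] by (simp add: power2_eq_square algebra_simps)
      ultimately show ?thesis by linarith
    qed
    then show "AE x in Q. norm ((smooth_pos e (u k x))\<^sup>2) \<le> norm (2 * (smooth_pos e (f x))\<^sup>2 + 2 * (u k x - f x)\<^sup>2)" by simp
  qed measurable
  have iI: "integrable Q (\<lambda>x. (\<eta> x)\<^sup>2 * smooth_pos_deriv e (u k x) * I k x)" for k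
  proof (rule Bochner_Integration.integrable_bound)
    show "integrable Q (\<lambda>x. 2 * A x + B k x)" using Ai B(1) by simp
    show "AE x in Q. norm ((\<eta> x)\<^sup>2 * smooth_pos_deriv e (u k x) * I k x) \<le> norm (2 * A x + B k x)"
      using I[of k] A0 B0[of k]
    proof eventually_elim
      case (elim x)
      have "\<bar>(\<eta> x)\<^sup>2 * smooth_pos_deriv e (u k x) * I k x\<bar> \<le> \<bar>I k x\<bar>"
        using w by (simp add: abs_mult[of _ "I k x"] mult_left_le_one_le)
      also have "\<dots> \<le> A x + sqrt (A x * B k x)" using elim by (simp add: abs_le_iff)
      also have "\<dots> \<le> A x + (1 * A x + B k x / (4 * 1))" using amgm[of "A x" "B k x" 1] elim by simp
      also have "\<dots> \<le> 2 * A x + B k x" using elim by simp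
      finally show ?case by simp
    qed
  qed measurable
  \<comment> \<open>The weight \<open>smooth_pos_deriv e (u k x)\<close> converges only where
    \<open>u k x\<close> does, and convergence in L^2 provides this almost everywhere along a
    subsequence.\<close>
  obtain r where r: "strict_mono r" "AE x in Q. (\<lambda>n. (u (r n) x - f x)\<^sup>2) \<longlonglongrightarrow> 0"
    using tendsto_L1_AE_subseq[of Q "\<lambda>n x. (u n x - f x)\<^sup>2"] u by auto
  have lim: "(\<lambda>n. \<integral>x. (\<eta> x)\<^sup>2 * smooth_pos_deriv e (u (r n) x) * A x \<partial>Q) \<longlonglongrightarrow> (\<integral>x. (\<eta> x)\<^sup>2 * smooth_pos_deriv e (f x) * A x \<partial>Q)"
  proof (rule integral_dominated_convergence[where w = "\<lambda>x. \<bar>A x\<bar>"])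
    show "AE x in Q. (\<lambda>n. (\<eta> x)\<^sup>2 * smooth_pos_deriv e (u (r n) x) * A x) \<longlonglongrightarrow> (\<eta> x)\<^sup>2 * smooth_pos_deriv e (f x) * A x"
      using r(2)
    proof eventually_elim
      case (elim x)
      have "(\<lambda>n. \<bar>u (r n) x - f x\<bar>) \<longlonglongrightarrow> 0" using tendsto_real_sqrt[OF elim] by simp
      then have "(\<lambda>n. u (r n) x) \<longlonglongrightarrow> f x" by (simp add: LIM_zero_iff tendsto_rabs_zero_iff)
      moreover have "isCont (smooth_pos_deriv e) (f x)" using smooth_pos_deriv_continuous[OF e] by (simp add: continuous_on_eq_continuous_at)
      ultimately have "(\<lambda>n. smooth_pos_deriv e (u (r n) x)) \<longlonglongrightarrow> smooth_pos_deriv e (f x)" by (rule isCont_tendsto_compose[rotated])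
      then show ?case by (intro tendsto_intros)
    qed
    show "\<And>n. AE x in Q. norm ((\<eta> x)\<^sup>2 * smooth_pos_deriv e (u (r n) x) * A x) \<le> \<bar>A x\<bar>"
      using w by (intro AE_I2) (simp add: abs_mult[of _ "A _"] mult_left_le_one_le)
    show "integrable Q (\<lambda>x. \<bar>A x\<bar>)" using Ai by simp
  qed measurable
  let ?X = "\<integral>x. (\<eta> x)\<^sup>2 * smooth_pos_deriv e (f x) * A x \<partial>Q" and ?C = "\<integral>x. smooth_pos e (f x) * c x \<partial>Q" and ?A = "\<integral>x. A x \<partial>Q"
  have ifc: "integrable Q (\<lambda>x. smooth_pos e (f x) * c x)" by (rule ic[OF _ regf]) measurable
  \<comment> \<open>Here d must stay fixed: the approximation errors carry the factor 1 / d, while 2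
    d times the total energy does not shrink with k.\<close>
  have bound: "?X + ?C - 2 * d * ?A \<le> 0" if d: "d > 0" for d
  proof -
    have k: "(\<integral>x. (\<eta> x)\<^sup>2 * smooth_pos_deriv e (u k x) * A x \<partial>Q) + ?C - 2 * d * ?A - (\<integral>x. B k x \<partial>Q) / (4 * d) - D\<^sup>2 * (\<integral>x. (u k x - f x)\<^sup>2 \<partial>Q) / (4 * d) \<le> 0" for k
    proof -
      have ik: "integrable Q (\<lambda>x. (\<eta> x)\<^sup>2 * smooth_pos_deriv e (u k x) * A x)" by (rule iA) measurable
      have "(\<integral>x. (\<eta> x)\<^sup>2 * smooth_pos_deriv e (u k x) * A x \<partial>Q) + ?C - 2 * d * ?A - (\<integral>x. B k x \<partial>Q) / (4 * d) - D\<^sup>2 * (\<integral>x. (u k x - f x)\<^sup>2 \<partial>Q) / (4 * d)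
        = (\<integral>x. (\<eta> x)\<^sup>2 * smooth_pos_deriv e (u k x) * A x + smooth_pos e (f x) * c x - 2 * d * A x - B k x / (4 * d) - D\<^sup>2 * (u k x - f x)\<^sup>2 / (4 * d) \<partial>Q)"
        using ik ifc Ai B(1)[of k] u(1)[of k] by simp
      also have "\<dots> \<le> (\<integral>x. (\<eta> x)\<^sup>2 * smooth_pos_deriv e (u k x) * I k x + smooth_pos e (u k x) * c x \<partial>Q)"
      proof (rule integral_mono_AE)
        show "integrable Q (\<lambda>x. (\<eta> x)\<^sup>2 * smooth_pos_deriv e (u k x) * A x + smooth_pos e (f x) * c x - 2 * d * A x - B k x / (4 * d) - D\<^sup>2 * (u k x - f x)\<^sup>2 / (4 * d))"
          using ik ifc Ai B(1)[of k] u(1)[of k] by simp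
        show "integrable Q (\<lambda>x. (\<eta> x)\<^sup>2 * smooth_pos_deriv e (u k x) * I k x + smooth_pos e (u k x) * c x)"
          using iI[of k] ic[OF _ regu[of k]] by simp
        show "AE x in Q. (\<eta> x)\<^sup>2 * smooth_pos_deriv e (u k x) * A x + smooth_pos e (f x) * c x - 2 * d * A x - B k x / (4 * d) - D\<^sup>2 * (u k x - f x)\<^sup>2 / (4 * d)
           \<le> (\<eta> x)\<^sup>2 * smooth_pos_deriv e (u k x) * I k x + smooth_pos e (u k x) * c x"
          using A0 B0[of k] I[of k] c by eventually_elim (rule caccioppoli_pointwise[OF e d D], use \<eta> in auto)
      qed
      also have "\<dots> \<le> 0" by (rule ineq)
      finally show ?thesis .
    qed
    have "(\<lambda>n. (\<integral>x. (\<eta> x)\<^sup>2 * smooth_pos_deriv e (u (r n) x) * A x \<partial>Q) + ?C - 2 * d * ?A - (\<integral>x. B (r n) x \<partial>Q) / (4 * d) - D\<^sup>2 * (\<integral>x. (u (r n) x - f x)\<^sup>2 \<partial>Q) / (4 * d))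
      \<longlonglongrightarrow> ?X + ?C - 2 * d * ?A - 0 / (4 * d) - D\<^sup>2 * 0 / (4 * d)"
      using lim LIMSEQ_subseq_LIMSEQ[OF u(2) r(1)] LIMSEQ_subseq_LIMSEQ[OF B(2) r(1)] d
      by (intro tendsto_intros) (auto simp: o_def)
    then have "?X + ?C - 2 * d * ?A - 0 / (4 * d) - D\<^sup>2 * 0 / (4 * d) \<le> 0"
      using k by (intro LIMSEQ_le_const2[where a = 0]) auto
    then show ?thesis by simp
  qed
  have "?X + ?C \<le> 0"
  proof (rule field_le_epsilon)
    fix z :: real assume z: "z > 0"
    have A: "?A \<ge> 0" using A0 by (rule integral_nonneg_AE)
    \<comment> \<open>The denominator contains 1 because the total energy may be 0.\<close>
    have "?X + ?C \<le> 2 * (z / (2 * (?A + 1))) * ?A" using bound[of "z / (2 * (?A + 1))"] z A by simp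
    also have "\<dots> \<le> z" using z A by (simp add: divide_le_eq)
    finally show "?X + ?C \<le> 0 + z" by simp
  qed
  \<comment> \<open>Where f is non-negative the weight is at least 1/2. The cross term consumes a
    quarter of the weighted energy and D^2 (f + e)^2, which leaves a quarter and explains the factor
    4 in the conclusion.\<close>
  moreover have "(\<integral>x. (1/4) * ((\<eta> x)\<^sup>2 * A x) - D\<^sup>2 * (f x + e)\<^sup>2 \<partial>Q) \<le> (\<integral>x. (\<eta> x)\<^sup>2 * smooth_pos_deriv e (f x) * A x + smooth_pos e (f x) * c x \<partial>Q)"
  proof (rule integral_mono_AE)
    show "integrable Q (\<lambda>x. (1/4) * ((\<eta> x)\<^sup>2 * A x) - D\<^sup>2 * (f x + e)\<^sup>2)" using i\<eta>A fe by simp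
    show "integrable Q (\<lambda>x. (\<eta> x)\<^sup>2 * smooth_pos_deriv e (f x) * A x + smooth_pos e (f x) * c x)" using iA[of f] ifc by simp
    show "AE x in Q. (1/4) * ((\<eta> x)\<^sup>2 * A x) - D\<^sup>2 * (f x + e)\<^sup>2 \<le> (\<eta> x)\<^sup>2 * smooth_pos_deriv e (f x) * A x + smooth_pos e (f x) * c x"
      using f0 A0 c
    proof eventually_elim
      case (elim x)
      have nA: "0 \<le> (\<eta> x)\<^sup>2 * A x" using elim by simp
      have "(1/2) * ((\<eta> x)\<^sup>2 * A x) \<le> smooth_pos_deriv e (f x) * ((\<eta> x)\<^sup>2 * A x)"
        using smooth_pos_deriv_bounds(3)[OF e, of "f x"] elim by (intro mult_right_mono nA) auto
      moreover have "\<bar>smooth_pos e (f x) * c x\<bar> \<le> (f x + e) * (D * \<eta> x * sqrt (A x))"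
        unfolding abs_mult using elim smooth_pos_le[OF e, of "f x"] smooth_pos_nonneg[of e "f x"] e by (intro mult_mono) auto
      moreover have "(f x + e) * (D * \<eta> x * sqrt (A x)) = sqrt (((\<eta> x)\<^sup>2 * A x) * (D\<^sup>2 * (f x + e)\<^sup>2))"
        using elim e D \<eta>[of x] by (simp add: real_sqrt_mult)
      moreover have "\<dots> \<le> (1/4) * ((\<eta> x)\<^sup>2 * A x) + (D\<^sup>2 * (f x + e)\<^sup>2) / (4 * (1/4))"
        by (rule amgm[OF nA]) auto
      ultimately show ?case by (simp add: abs_le_iff mult_ac)
    qed
  qed
  moreover have "(\<integral>x. (1/4) * ((\<eta> x)\<^sup>2 * A x) - D\<^sup>2 * (f x + e)\<^sup>2 \<partial>Q) = (1/4) * (\<integral>x. (\<eta> x)\<^sup>2 * A x \<partial>Q) - D\<^sup>2 * (\<integral>x. (f x + e)\<^sup>2 \<partial>Q)"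
    using i\<eta>A fe by simp
  moreover have "(\<integral>x. (\<eta> x)\<^sup>2 * smooth_pos_deriv e (f x) * A x + smooth_pos e (f x) * c x \<partial>Q) = ?X + ?C"
    using iA[of f] ifc by simp
  ultimately show ?thesis by simp
qed

text \<open>Squaring removes the corner of the positive part at 0: the remainder of the linear
  approximation is at most h^2 in every case. The squared cutoff is therefore differentiable also
  where it reaches 0.\<close>

lemma max_square_deriv: "((\<lambda>z::real. (max 0 z)\<^sup>2) has_real_derivative 2 * max 0 z) (at z)"
proof -
  have bd: "\<bar>(max 0 (z + h))\<^sup>2 - (max 0 z)\<^sup>2 - 2 * max 0 z * h\<bar> \<le> h\<^sup>2" for h
  proof (cases "z \<ge> 0")
    case z: True
    show ?thesis
    proof (cases "z + h \<ge> 0")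
      case False
      then have "z\<^sup>2 \<le> h\<^sup>2" using z abs_le_square_iff[of z h] by simp
      moreover have "0 \<le> z * (- h - z)" using False z by (intro mult_nonneg_nonneg) auto
      moreover have "- (z\<^sup>2) - 2 * z * h - h\<^sup>2 = - (z + h)\<^sup>2" by (simp add: power2_eq_square algebra_simps)
      then have "- (z\<^sup>2) - 2 * z * h \<le> h\<^sup>2" using zero_le_power2[of "z + h"] by linarith
      moreover have "z * h \<le> 0" using False z by (intro mult_nonneg_nonpos) auto
      moreover have "0 \<le> h * h" by simp
      ultimately show ?thesis using False z by (simp add: max_def abs_le_iff power2_eq_square algebra_simps)
    qed (use z in \<open>simp add: max_def power2_eq_square algebra_simps\<close>)
  next
    case z: False
    show ?thesis
    proof (cases "z + h \<ge> 0")
      case True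
      then have "(z + h)\<^sup>2 \<le> h\<^sup>2" using z by (intro power_mono) auto
      then show ?thesis using True z by (simp add: max_def)
    qed (use z in \<open>simp add: max_def\<close>)
  qed
  show ?thesis unfolding DERIV_def
  proof (rule LIM_I)
    fix r :: real assume r: "r > 0"
    have "norm (((max 0 (z + h))\<^sup>2 - (max 0 z)\<^sup>2) / h - 2 * max 0 z) < r" if h: "h \<noteq> 0" "norm (h - 0) < r" for h
    proof -
      have "((max 0 (z + h))\<^sup>2 - (max 0 z)\<^sup>2) / h - 2 * max 0 z = ((max 0 (z + h))\<^sup>2 - (max 0 z)\<^sup>2 - 2 * max 0 z * h) / h"
        using h by (simp add: field_simps)
      then have "\<bar>((max 0 (z + h))\<^sup>2 - (max 0 z)\<^sup>2) / h - 2 * max 0 z\<bar> \<le> h\<^sup>2 / \<bar>h\<bar>"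
        using bd[of h] by (simp add: abs_divide divide_right_mono)
      also have "\<dots> = \<bar>h\<bar>" using h by (cases "h > 0") (simp_all add: power2_eq_square)
      finally show ?thesis using h by simp
    qed
    then show "\<exists>s>0. \<forall>x. x \<noteq> 0 \<and> norm (x - 0) < s \<longrightarrow> norm (((max 0 (z + x))\<^sup>2 - (max 0 z)\<^sup>2) / x - 2 * max 0 z) < r"
      using r by blast
  qed
qed

lemma elliptic_diff:
  assumes A: "elliptic \<Lambda> A" shows "(x - y) \<bullet> (A *v (x - y)) \<le> 2 * (x \<bullet> (A *v x)) + 2 * (y \<bullet> (A *v y))"
  using elliptic_expand[OF A, of x "-1" y] elliptic_expand[OF A, of x 1 y] elliptic_nonneg[OF A, of "x + y"] by simp

section \<open>Convergence of integrals\<close>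

lemma lebesgue_on_measurable_AE:
  fixes h k :: "'a::euclidean_space \<Rightarrow> 'b::euclidean_space"
  assumes D: "D \<in> sets lebesgue" and h: "h \<in> borel_measurable (lebesgue_on D)" and eq: "AE x in lebesgue. x \<in> D \<longrightarrow> h x = k x"
  shows "k \<in> borel_measurable (lebesgue_on D)"
proof -
  have "(\<lambda>x. if x \<in> D then h x else 0) \<in> borel_measurable lebesgue" using h D by (simp add: borel_measurable_if)
  moreover have "AE x in lebesgue. (if x \<in> D then h x else 0) = (if x \<in> D then k x else 0)" using eq by eventually_elim auto
  ultimately have "(\<lambda>x. if x \<in> D then k x else 0) \<in> borel_measurable lebesgue" by (rule borel_measurable_AE)
  then show ?thesis using D by (simp add: borel_measurable_if)
qed

lemma vec_borel_measurable:
  fixes F :: "'z \<Rightarrow> real^'n::finite"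
  assumes "\<And>i. (\<lambda>x. F x $ i) \<in> borel_measurable M" shows "F \<in> borel_measurable M"
  unfolding borel_measurable_euclidean_space[of F]
  using assms by (auto simp: Basis_vec_def inner_axis)

lemma vec_nth_borel_measurable:
  fixes F :: "'z \<Rightarrow> ('b::{second_countable_topology,real_normed_vector})^'n::finite"
  assumes "F \<in> borel_measurable M" shows "(\<lambda>x. F x $ i) \<in> borel_measurable M"
  using assms by (rule measurable_compose) (intro borel_measurable_continuous_onI continuous_intros)

lemma integral_tendsto_zero:
  fixes b :: "nat \<Rightarrow> 'x \<Rightarrow> real"
  assumes "\<And>k. integrable Q (b k)" "\<And>k. AE x in Q. 0 \<le> b k x" "\<And>k. (\<integral>\<^sup>+x. ennreal (b k x) \<partial>Q) \<le> E k" "E \<longlonglongrightarrow> 0"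
  shows "(\<lambda>k. \<integral>x. b k x \<partial>Q) \<longlonglongrightarrow> 0"
proof -
  have eq: "ennreal (\<integral>x. b k x \<partial>Q) = (\<integral>\<^sup>+x. ennreal (b k x) \<partial>Q)" for k
    using nn_integral_eq_integral[OF assms(1,2)] by simp
  have "(\<lambda>k. ennreal (\<integral>x. b k x \<partial>Q)) \<longlonglongrightarrow> 0"
    by (rule tendsto_sandwich[OF _ _ tendsto_const assms(4)]) (auto simp: eq assms(3))
  then have "(\<lambda>k. ennreal (\<integral>x. b k x \<partial>Q)) \<longlonglongrightarrow> ennreal 0" by simp
  then show ?thesis
    by (subst (asm) tendsto_ennreal_iff) (auto intro!: always_eventually integral_nonneg_AE assms(2))
qed

text \<open>Instead of the Cauchy-Schwarz inequality for integrals the pointwise bound of |t| by d +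
  t^2 / d is integrated, with d tending to 0 like the L^2 norm bound or slower.\<close>

lemma L2_imp_L1_tendsto:
  fixes t :: "nat \<Rightarrow> 'x \<Rightarrow> real"
  assumes Q: "emeasure Q (space Q) < \<infinity>" and [measurable]: "\<And>k. t k \<in> borel_measurable Q"
    and r: "\<And>k. 0 \<le> r k" "r \<longlonglongrightarrow> 0" and t: "\<And>k. (\<integral>\<^sup>+x. ennreal ((t k x)\<^sup>2) \<partial>Q) \<le> ennreal (r k)"
  shows "(\<lambda>k. \<integral>\<^sup>+x. ennreal \<bar>t k x\<bar> \<partial>Q) \<longlonglongrightarrow> 0"
proof -
  obtain v where v: "emeasure Q (space Q) = ennreal v" "v \<ge> 0" using Q by (cases "emeasure Q (space Q)") auto
  \<comment> \<open>The summand 1 / \<open>real (Suc k)\<close> keeps d positive when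
    \<open>r k\<close> is 0.\<close>
  define d where "d k = sqrt (r k + 1 / real (Suc k))" for k
  have d: "d k > 0" "r k \<le> (d k)\<^sup>2" for k using r(1)[of k] by (auto simp: d_def add_nonneg_pos)
  have le: "(\<integral>\<^sup>+x. ennreal \<bar>t k x\<bar> \<partial>Q) \<le> ennreal (d k * (v + 1))" for k
  proof -
    have "(\<integral>\<^sup>+x. ennreal \<bar>t k x\<bar> \<partial>Q) \<le> (\<integral>\<^sup>+x. ennreal (d k) + ennreal (1 / d k) * ennreal ((t k x)\<^sup>2) \<partial>Q)"
    proof (intro nn_integral_mono)
      fix x
      have "\<bar>t k x\<bar> \<le> d k + 1 / d k * (t k x)\<^sup>2"
      proof (cases "\<bar>t k x\<bar> \<le> d k")
        case True then show ?thesis using d(1)[of k] by (simp add: add_increasing2)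
      next
        case False
        have "d k * \<bar>t k x\<bar> \<le> \<bar>t k x\<bar> * \<bar>t k x\<bar>" using False by (intro mult_right_mono) auto
        then have "\<bar>t k x\<bar> \<le> 1 / d k * (t k x)\<^sup>2" using d(1)[of k] by (simp add: field_simps power2_eq_square)
        then show ?thesis using d(1)[of k] by simp
      qed
      then have "ennreal \<bar>t k x\<bar> \<le> ennreal (d k + 1 / d k * (t k x)\<^sup>2)" by (rule ennreal_leI)
      also have "\<dots> = ennreal (d k) + ennreal (1 / d k) * ennreal ((t k x)\<^sup>2)"
        using d(1)[of k] by (subst ennreal_plus) (auto simp: ennreal_mult'[symmetric])
      finally show "ennreal \<bar>t k x\<bar> \<le> ennreal (d k) + ennreal (1 / d k) * ennreal ((t k x)\<^sup>2)" .
    qed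
    also have "\<dots> = ennreal (d k) * ennreal v + ennreal (1 / d k) * (\<integral>\<^sup>+x. ennreal ((t k x)\<^sup>2) \<partial>Q)"
      by (subst nn_integral_add) (auto simp: v(1) nn_integral_cmult)
    also have "\<dots> \<le> ennreal (d k) * ennreal v + ennreal (1 / d k) * ennreal (r k)"
      using t by (intro add_left_mono mult_left_mono) auto
    also have "\<dots> = ennreal (d k * v + 1 / d k * r k)"
      using d(1)[of k] r(1)[of k] v(2) by (subst ennreal_plus) (auto simp: ennreal_mult'[symmetric])
    also have "\<dots> \<le> ennreal (d k * (v + 1))"
    proof (rule ennreal_leI)
      have "1 / d k * r k \<le> d k" using d[of k] by (simp add: divide_le_eq power2_eq_square)
      then show "d k * v + 1 / d k * r k \<le> d k * (v + 1)" by (simp add: algebra_simps)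
    qed
    finally show ?thesis .
  qed
  have "(\<lambda>k. sqrt (r k + 1 / real (Suc k)) * (v + 1)) \<longlonglongrightarrow> sqrt (0 + 0) * (v + 1)"
    using LIMSEQ_inverse_real_of_nat by (intro tendsto_intros r(2)) (auto simp: inverse_eq_divide)
  then have "(\<lambda>k. ennreal (d k * (v + 1))) \<longlonglongrightarrow> ennreal 0" unfolding d_def by (intro tendsto_ennrealI) simp
  then have "(\<lambda>k. ennreal (d k * (v + 1))) \<longlonglongrightarrow> 0" by simp
  then show ?thesis by (rule tendsto_sandwich[OF _ _ tendsto_const, rotated 2]) (auto simp: le)
qed

lemma nn_integral_tendsto_AE_subseq:
  fixes h :: "nat \<Rightarrow> 'x \<Rightarrow> real"
  assumes h: "\<And>k. h k \<in> borel_measurable Q" and lim: "(\<lambda>k. \<integral>\<^sup>+x. ennreal \<bar>h k x\<bar> \<partial>Q) \<longlonglongrightarrow> 0"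
  shows "\<exists>r::nat\<Rightarrow>nat. strict_mono r \<and> (AE x in Q. (\<lambda>k. h (r k) x) \<longlonglongrightarrow> 0)"
proof -
  \<comment> \<open>Finitely many of the integrals may be infinite; from k0 on the functions are
    integrable.\<close>
  have "eventually (\<lambda>k. (\<integral>\<^sup>+x. ennreal \<bar>h k x\<bar> \<partial>Q) < 1) sequentially" using lim by (rule order_tendstoD) simp
  then obtain k0 where k0: "\<And>k. k \<ge> k0 \<Longrightarrow> (\<integral>\<^sup>+x. ennreal \<bar>h k x\<bar> \<partial>Q) < 1" unfolding eventually_sequentially by blast
  have int: "integrable Q (h (k + k0))" for k
  proof (rule integrableI_bounded[OF h])
    have "(\<integral>\<^sup>+x. ennreal (norm (h (k + k0) x)) \<partial>Q) < 1" using k0[of "k + k0"] by simp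
    then show "(\<integral>\<^sup>+x. ennreal (norm (h (k + k0) x)) \<partial>Q) < \<infinity>" by (rule less_trans) simp
  qed
  have iabs: "integrable Q (\<lambda>x. \<bar>h (k + k0) x\<bar>)" for k using int by simp
  have "(\<lambda>k. \<integral>x. \<bar>h (k + k0) x\<bar> \<partial>Q) \<longlonglongrightarrow> 0"
    by (rule integral_tendsto_zero[OF iabs _ order_refl LIMSEQ_ignore_initial_segment[OF lim, of k0]]) simp
  then have "(\<lambda>k. \<integral>x. norm (h (k + k0) x) \<partial>Q) \<longlonglongrightarrow> 0" by simp
  from tendsto_L1_AE_subseq[OF int this]
  obtain r :: "nat \<Rightarrow> nat" where r: "strict_mono r" "AE x in Q. (\<lambda>k. h (r k + k0) x) \<longlonglongrightarrow> 0" by blast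
  have "strict_mono (\<lambda>k. r k + k0)" using r(1) by (simp add: strict_mono_def)
  then show ?thesis using r(2) by blast
qed

text \<open>The statement holds only almost everywhere: where the derivative along the line does not
  exist, the sequential limit in \<open>dir_deriv\<close> need not be homogeneous in the
  direction.\<close>

lemma dir_deriv_scale:
  fixes u :: "'a::euclidean_space \<Rightarrow> real"
  assumes "L-lipschitz_on UNIV u"
  shows "AE x in lborel. dir_deriv (t *\<^sub>R w) u x = t * dir_deriv w u x"
  using AE_dir_deriv[OF assms, of w]
proof eventually_elim
  case (elim x)
  have "((\<lambda>\<tau>. \<tau> * t) has_real_derivative t) (at 0)" by (auto intro!: derivative_eq_intros)
  moreover have "((\<lambda>s. u (x + s *\<^sub>R w)) has_real_derivative dir_deriv w u x) (at (0 * t))" using elim by simp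
  ultimately have "((\<lambda>\<tau>. u (x + (\<tau> * t) *\<^sub>R w)) has_real_derivative dir_deriv w u x * t) (at 0)"
    by (rule DERIV_chain2[rotated])
  then have "dir_deriv (t *\<^sub>R w) u x = dir_deriv w u x * t" by (intro dir_deriv_eq) simp
  then show ?case by simp
qed

lemma nn_integral_dir_deriv_scale:
  fixes u :: "'a::euclidean_space \<Rightarrow> real"
  assumes L: "L-lipschitz_on UNIV u" and [measurable]: "S \<in> sets borel"
  shows "(\<integral>\<^sup>+x. ennreal \<bar>dir_deriv (t *\<^sub>R w) u x\<bar> * indicator S x \<partial>lborel) = ennreal \<bar>t\<bar> * (\<integral>\<^sup>+x. ennreal \<bar>dir_deriv w u x\<bar> * indicator S x \<partial>lborel)"
proof -
  have [measurable]: "dir_deriv w u \<in> borel_measurable borel" using lipschitz_on_continuous_on[OF L] by (rule dir_deriv_measurable)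
  have "(\<integral>\<^sup>+x. ennreal \<bar>dir_deriv (t *\<^sub>R w) u x\<bar> * indicator S x \<partial>lborel) = (\<integral>\<^sup>+x. ennreal \<bar>t\<bar> * (ennreal \<bar>dir_deriv w u x\<bar> * indicator S x) \<partial>lborel)"
    using dir_deriv_scale[OF L, of t w]
    by (intro nn_integral_cong_AE) (auto elim!: eventually_mono simp: abs_mult ennreal_mult' mult.assoc)
  also have "\<dots> = ennreal \<bar>t\<bar> * (\<integral>\<^sup>+x. ennreal \<bar>dir_deriv w u x\<bar> * indicator S x \<partial>lborel)"
    by (rule nn_integral_cmult) measurable
  finally show ?thesis .
qed

lemma AE_const_of_sequence:
  fixes v :: "nat \<Rightarrow> real^'n::finite \<Rightarrow> real"
  assumes D: "open D" "convex D" and f: "f \<in> borel_measurable borel" and lip: "\<And>k. \<exists>L. L-lipschitz_on UNIV (v k)"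
    and d0: "\<And>j. (\<lambda>k. \<integral>\<^sup>+x. ennreal \<bar>dir_deriv (axis j 1) (v k) x\<bar> * indicator D x \<partial>lborel) \<longlonglongrightarrow> 0"
    and f0: "(\<lambda>k. \<integral>\<^sup>+x. ennreal \<bar>v k x - f x\<bar> * indicator D x \<partial>lborel) \<longlonglongrightarrow> 0"
  shows "\<exists>c. AE x in lborel. x \<in> D \<longrightarrow> f x = c"
proof (rule AE_const_connected[OF D(1) convex_connected[OF D(2)]])
  have Db: "D \<in> sets borel" using D(1) by simp
  have inv: "AE x in lborel. x \<in> D \<and> x + t *\<^sub>R b \<in> D \<longrightarrow> f (x + t *\<^sub>R b) = f x" if b: "b \<in> Basis" for b :: "real^'n" and t
  proof (rule translation_invariant_limit[OF lip D(2) Db f _ f0])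
    obtain j where j: "b = axis j 1" using b by (auto simp: Basis_vec_def)
    have "(\<integral>\<^sup>+x. ennreal \<bar>dir_deriv (t *\<^sub>R b) (v k) x\<bar> * indicator D x \<partial>lborel) = ennreal \<bar>t\<bar> * (\<integral>\<^sup>+x. ennreal \<bar>dir_deriv (axis j 1) (v k) x\<bar> * indicator D x \<partial>lborel)" for k
    proof -
      obtain L where L: "L-lipschitz_on UNIV (v k)" using lip by blast
      show ?thesis unfolding j by (rule nn_integral_dir_deriv_scale[OF L Db])
    qed
    moreover have "(\<lambda>k. ennreal \<bar>t\<bar> * (\<integral>\<^sup>+x. ennreal \<bar>dir_deriv (axis j 1) (v k) x\<bar> * indicator D x \<partial>lborel)) \<longlonglongrightarrow> ennreal \<bar>t\<bar> * 0"
      by (rule ennreal_tendsto_cmult[OF _ d0]) simp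
    ultimately show "(\<lambda>k. \<integral>\<^sup>+x. ennreal \<bar>dir_deriv (t *\<^sub>R b) (v k) x\<bar> * indicator D x \<partial>lborel) \<longlonglongrightarrow> 0" by simp
  qed
  fix x0 assume "x0 \<in> D"
  then obtain e where e: "e > 0" "ball x0 e \<subseteq> D" using D(1) openE by blast
  have "\<exists>c. AE x in lborel. x \<in> ball x0 ((e / 2) / 2) \<longrightarrow> f x = c"
  proof (rule AE_const_ball[OF f])
    show "e / 2 > 0" using e by simp
    fix b :: "real^'n" and t assume b: "b \<in> Basis"
    show "AE x in lborel. x \<in> ball x0 (2 * (e / 2)) \<and> x + t *\<^sub>R b \<in> ball x0 (2 * (e / 2)) \<longrightarrow> f (x + t *\<^sub>R b) = f x"
      using inv[OF b, of t] by eventually_elim (use e in auto)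
  qed
  then show "\<exists>r>0. \<exists>c. AE y in lborel. y \<in> ball x0 r \<longrightarrow> f y = c" using e(1) by (intro exI[of _ "e / 2 / 2"]) simp
qed

lemma lipschitz_on_sum_ex:
  fixes f :: "'i \<Rightarrow> 'a::metric_space \<Rightarrow> 'b::real_normed_vector"
  assumes "finite A" "\<And>i. i \<in> A \<Longrightarrow> \<exists>L. L-lipschitz_on X (f i)"
  shows "\<exists>L. L-lipschitz_on X (\<lambda>x. \<Sum>i\<in>A. f i x)"
  using assms
proof (induction A rule: finite_induct)
  case empty
  show ?case using lipschitz_on_constant[of X "0 :: 'b"] by auto
next
  case (insert i A)
  obtain L where L: "L-lipschitz_on X (f i)" using insert.prems by blast
  obtain M where M: "M-lipschitz_on X (\<lambda>x. \<Sum>i\<in>A. f i x)" using insert by blast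
  have "(L + M)-lipschitz_on X (\<lambda>x. f i x + (\<Sum>i\<in>A. f i x))" by (rule lipschitz_on_add[OF L M])
  then show ?case using insert.hyps by auto
qed

lemma subseq_AE_restrict:
  fixes h :: "nat \<Rightarrow> 'a::euclidean_space \<Rightarrow> real"
  assumes h: "\<And>k. h k \<in> borel_measurable borel" and S: "S \<in> sets borel"
    and lim: "(\<lambda>k. \<integral>\<^sup>+x. ennreal \<bar>h k x\<bar> * indicator S x \<partial>lborel) \<longlonglongrightarrow> 0"
  shows "\<exists>r::nat\<Rightarrow>nat. strict_mono r \<and> (AE x in lborel. x \<in> S \<longrightarrow> (\<lambda>k. h (r k) x) \<longlonglongrightarrow> 0)"
proof -
  have nnr: "(\<integral>\<^sup>+x. g x \<partial>restrict_space lborel S) = (\<integral>\<^sup>+x. g x * indicator S x \<partial>lborel)" for g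
    using S by (intro nn_integral_restrict_space) simp
  have m: "h k \<in> borel_measurable (restrict_space lborel S)" for k using h by (intro measurable_restrict_space1) simp
  have "(\<lambda>k. \<integral>\<^sup>+x. ennreal \<bar>h k x\<bar> \<partial>restrict_space lborel S) \<longlonglongrightarrow> 0" unfolding nnr by (rule lim)
  from nn_integral_tendsto_AE_subseq[OF m this]
  obtain r :: "nat \<Rightarrow> nat" where r: "strict_mono r" "AE x in restrict_space lborel S. (\<lambda>k. h (r k) x) \<longlonglongrightarrow> 0" by blast
  have "AE x in lborel. x \<in> S \<longrightarrow> (\<lambda>k. h (r k) x) \<longlonglongrightarrow> 0"
    using r(2) S by (subst (asm) AE_restrict_space_iff) auto
  then show ?thesis using r(1) by blast
qed

section \<open>Riemannian polyhedra\<close>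

locale riem_polyhedron =
  fixes P :: "('a::metric_space, 'v, 'e::euclidean_space, 'n::finite) riem_poly" and \<Lambda> :: real
  assumes rp: "riemannian_polyhedron P"
    and adm: "rp_admissible P"
    and Lambda: "\<Lambda> > 0"
    and elliptic_AE: "\<And>s. s \<in> rp_max P \<Longrightarrow> AE x in lebesgue_on (rp_dom P s). elliptic \<Lambda> (rp_metric P s x)"
begin

subsection \<open>Barycentric coordinates on the maximal simplexes\<close>

lemma card_max: "s \<in> rp_max P \<Longrightarrow> card s = CARD('n) + 1"
  using adm unfolding rp_admissible_def by blast

lemma triangulation: "polyhedron_triangulation P" and embedding: "euclidean_embedding P"
  using rp unfolding riemannian_polyhedron_def by blast+

lemma complex: "simplicial_complex (rp_complex P)" "countable (rp_complex P)" "locally_finite_complex (rp_complex P)"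
  and X_connected: "connected (UNIV :: 'a set)"
  and triang_homeo: "lipschitz_homeomorphism (rp_space P) bary_dist UNIV dist (rp_triang P)"
  using triangulation unfolding polyhedron_triangulation_def by blast+

lemma simplex_finite: "s \<in> rp_complex P \<Longrightarrow> finite s" and simplex_nonempty: "s \<in> rp_complex P \<Longrightarrow> s \<noteq> {}"
  and face_closed: "s \<in> rp_complex P \<Longrightarrow> t \<subseteq> s \<Longrightarrow> t \<noteq> {} \<Longrightarrow> t \<in> rp_complex P"
  using complex(1) unfolding simplicial_complex_def by blast+

lemma max_complex: "s \<in> rp_max P \<Longrightarrow> s \<in> rp_complex P"
  and max_maximal: "s \<in> rp_max P \<Longrightarrow> t \<in> rp_complex P \<Longrightarrow> s \<subseteq> t \<Longrightarrow> t = s"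
  unfolding rp_max_def maximal_simplexes_def by blast+

lemma max_finite: "s \<in> rp_max P \<Longrightarrow> finite s" using max_complex simplex_finite by blast

lemma finite_star: "finite {s \<in> rp_max P. v \<in> s}"
  using complex(3) unfolding locally_finite_complex_def
  by (rule_tac finite_subset[of _ "{s \<in> rp_complex P. v \<in> s}"]) (auto simp: max_complex)

text \<open>By local finiteness only finitely many simplexes contain t, so one of them is
  maximal.\<close>

lemma ex_max:
  assumes "t \<in> rp_complex P" shows "\<exists>s\<in>rp_max P. t \<subseteq> s"
proof -
  obtain v where v: "v \<in> t" using simplex_nonempty[OF assms] by blast
  have "finite {s \<in> rp_complex P. v \<in> s}" using complex(3) unfolding locally_finite_complex_def by blast
  then have fin: "finite {s \<in> rp_complex P. t \<subseteq> s}" using v by (auto elim: finite_subset[rotated])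
  obtain s where s: "s \<in> {s \<in> rp_complex P. t \<subseteq> s}" "t \<subseteq> s" "\<forall>b\<in>{s \<in> rp_complex P. t \<subseteq> s}. s \<subseteq> b \<longrightarrow> s = b"
    using finite_has_maximal2[OF fin, of t] assms by auto
  then have "s \<in> rp_max P" unfolding rp_max_def maximal_simplexes_def by blast
  then show ?thesis using s by blast
qed

lemma triang_bij: "bij_betw (rp_triang P) (rp_space P) UNIV"
  using triang_homeo unfolding lipschitz_homeomorphism_def by blast

lemma bary_space: "rp_bary P y \<in> rp_space P" and triang_bary: "rp_triang P (rp_bary P y) = y"
  using triang_bij unfolding rp_bary_def bij_betw_def by (metis UNIV_I inv_into_into f_inv_into_f)+

lemma bary_triang: "\<alpha> \<in> rp_space P \<Longrightarrow> rp_bary P (rp_triang P \<alpha>) = \<alpha>"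
  using triang_bij unfolding rp_bary_def bij_betw_def by simp

lemma bary_inject: "rp_bary P x = rp_bary P y \<Longrightarrow> x = y"
  by (metis triang_bary)

lemma carrier_complex: "rp_carrier P y \<in> rp_complex P" and bary_nonneg: "0 \<le> rp_bary P y v"
  and bary_sum_carrier: "sum (rp_bary P y) (rp_carrier P y) = 1"
  using bary_space[of y] unfolding rp_carrier_def rp_space_def realization_def by auto

lemma carrier_iff: "v \<in> rp_carrier P y \<longleftrightarrow> 0 < rp_bary P y v"
  using bary_nonneg[of y v] unfolding rp_carrier_def supp_def by auto

lemma bary_zero: "v \<notin> rp_carrier P y \<Longrightarrow> rp_bary P y v = 0"
  unfolding rp_carrier_def supp_def by auto

lemma bary_sum: "finite s \<Longrightarrow> rp_carrier P y \<subseteq> s \<Longrightarrow> sum (rp_bary P y) s = 1"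
  using bary_sum_carrier[of y] by (subst sum.mono_neutral_cong_right[of s "rp_carrier P y" "rp_bary P y" "rp_bary P y"]) (auto simp: bary_zero)

lemma spaceI:
  assumes "s \<in> rp_complex P" "\<And>v. 0 \<le> \<alpha> v" "\<And>v. v \<notin> s \<Longrightarrow> \<alpha> v = 0" "sum \<alpha> s = 1"
  shows "\<alpha> \<in> rp_space P" "supp \<alpha> \<subseteq> s"
proof -
  show sub: "supp \<alpha> \<subseteq> s" using assms(3) by (auto simp: supp_def)
  have fin: "finite s" by (rule simplex_finite[OF assms(1)])
  have "sum \<alpha> (supp \<alpha>) = sum \<alpha> s" using fin sub by (intro sum.mono_neutral_left) (auto simp: supp_def)
  moreover have "supp \<alpha> \<noteq> {}" using \<open>sum \<alpha> (supp \<alpha>) = sum \<alpha> s\<close> assms(4) by auto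
  ultimately show "\<alpha> \<in> rp_space P"
    using face_closed[OF assms(1) sub] assms by (simp add: rp_space_def realization_def)
qed

lemma embed_sum: "finite s \<Longrightarrow> supp \<alpha> \<subseteq> s \<Longrightarrow> rp_embed P \<alpha> = (\<Sum>v\<in>s. \<alpha> v *\<^sub>R rp_vertex P v)"
  unfolding rp_embed_def by (intro sum.mono_neutral_left) (auto simp: supp_def)

lemma embed_bij: "bij_betw (rp_embed P) (rp_space P) (rp_embed P ` rp_space P)"
  and embed_lip: "locally_lipschitz (rp_space P) bary_dist dist (rp_embed P)"
  and embed_inv_lip: "locally_lipschitz (rp_embed P ` rp_space P) dist bary_dist (inv_into (rp_space P) (rp_embed P))"
  and closed_embed: "closed (rp_embed P ` rp_space P)"
  using embedding unfolding euclidean_embedding_def lipschitz_homeomorphism_def by blast+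

lemma embed_inj: "inj_on (rp_embed P) (rp_space P)" using embed_bij unfolding bij_betw_def by blast

definition emb :: "'a \<Rightarrow> 'e" where "emb y = rp_embed P (rp_bary P y)"

lemma emb_range: "range emb = rp_embed P ` rp_space P"
  unfolding emb_def using bary_space bary_triang by (auto simp: image_iff) metis

lemma frame_orth: "s \<in> rp_max P \<Longrightarrow> rp_frame P s i \<bullet> rp_frame P s j = (if i = j then 1 else 0)"
  and chart_range: "s \<in> rp_max P \<Longrightarrow> range (rp_chart P s) = affine hull (rp_vertex P ` s)"
  and metric_measurable: "s \<in> rp_max P \<Longrightarrow> rp_metric P s \<in> borel_measurable (lebesgue_on (rp_dom P s))"
  using rp unfolding riemannian_polyhedron_def by blast+

lemma frame_sum_inner:
  assumes "s \<in> rp_max P"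
  shows "(\<Sum>i\<in>UNIV. (x $ i) *\<^sub>R rp_frame P s i) \<bullet> rp_frame P s j = x $ j"
  by (simp add: inner_sum_left frame_orth[OF assms] if_distrib sum.delta cong: if_cong)

lemma frame_sum_norm:
  assumes "s \<in> rp_max P"
  shows "norm (\<Sum>i\<in>UNIV. (x $ i) *\<^sub>R rp_frame P s i) = norm x"
proof -
  have "(\<Sum>i\<in>UNIV. (x $ i) *\<^sub>R rp_frame P s i) \<bullet> (\<Sum>i\<in>UNIV. (x $ i) *\<^sub>R rp_frame P s i) = x \<bullet> x"
    by (simp only: inner_sum_right inner_scaleR_right frame_sum_inner[OF assms] inner_vec_def inner_real_def)
  then show ?thesis by (simp add: norm_eq)
qed

lemma chart_inner: "s \<in> rp_max P \<Longrightarrow> (rp_chart P s x - rp_origin P s) \<bullet> rp_frame P s j = x $ j"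
  by (simp add: rp_chart_def frame_sum_inner)

lemma chart_diff: "rp_chart P s x - rp_chart P s y = (\<Sum>i\<in>UNIV. ((x - y) $ i) *\<^sub>R rp_frame P s i)"
  by (simp add: rp_chart_def scaleR_diff_left sum_subtractf)

lemma chart_dist: "s \<in> rp_max P \<Longrightarrow> dist (rp_chart P s x) (rp_chart P s y) = dist x y"
  unfolding dist_norm chart_diff by (rule frame_sum_norm)

lemma chart_inject: "s \<in> rp_max P \<Longrightarrow> rp_chart P s x = rp_chart P s y \<Longrightarrow> x = y"
  using chart_dist[of s x y] by simp

lemma chart_sum:
  assumes "sum c S = 1"
  shows "rp_chart P s (\<Sum>v\<in>S. c v *\<^sub>R q v) = (\<Sum>v\<in>S. c v *\<^sub>R rp_chart P s (q v))"
proof -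
  have "(\<Sum>v\<in>S. c v *\<^sub>R rp_chart P s (q v)) = sum c S *\<^sub>R rp_origin P s + (\<Sum>v\<in>S. c v *\<^sub>R (\<Sum>i\<in>UNIV. (q v $ i) *\<^sub>R rp_frame P s i))"
    unfolding rp_chart_def by (simp add: scaleR_add_right sum.distrib scaleR_left.sum)
  also have "(\<Sum>v\<in>S. c v *\<^sub>R (\<Sum>i\<in>UNIV. (q v $ i) *\<^sub>R rp_frame P s i)) = (\<Sum>i\<in>UNIV. (\<Sum>v\<in>S. c v * q v $ i) *\<^sub>R rp_frame P s i)"
    by (simp add: scaleR_sum_right scaleR_sum_left sum.swap[of _ S])
  finally show ?thesis using assms by (simp add: rp_chart_def)
qed

text \<open>The unit mass at v is a point of the realization with image
  \<open>rp_vertex P v\<close>, and the embedding is injective on the realization.\<close>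

lemma vertex_inj: assumes "s \<in> rp_complex P" shows "inj_on (rp_vertex P) s"
proof (rule inj_onI)
  fix v w assume vw: "v \<in> s" "w \<in> s" "rp_vertex P v = rp_vertex P w"
  define \<delta> where "\<delta> v = (\<lambda>w. if w = v then 1 else (0::real))" for v :: 'v
  have sp: "\<delta> v \<in> rp_space P" and em: "rp_embed P (\<delta> v) = rp_vertex P v" if "v \<in> s" for v
  proof -
    have "{v} \<in> rp_complex P" using face_closed[OF assms, of "{v}"] that by blast
    then show "\<delta> v \<in> rp_space P" by (rule spaceI) (auto simp: \<delta>_def)
    show "rp_embed P (\<delta> v) = rp_vertex P v"
      by (subst embed_sum[of "{v}"]) (auto simp: \<delta>_def supp_def split: if_splits)
  qed
  have "\<delta> v = \<delta> w" using embed_inj sp em vw unfolding inj_on_def by metis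
  then show "v = w" unfolding \<delta>_def by (metis zero_neq_one)
qed

definition vert :: "'v set \<Rightarrow> 'v \<Rightarrow> real^'n" where
  "vert s v = (\<chi> i. (rp_vertex P v - rp_origin P s) \<bullet> rp_frame P s i)"

lemma chart_vert: assumes "s \<in> rp_max P" "v \<in> s" shows "rp_chart P s (vert s v) = rp_vertex P v"
proof -
  have "rp_vertex P v \<in> affine hull (rp_vertex P ` s)" using assms by (simp add: hull_inc)
  then obtain x where x: "rp_vertex P v = rp_chart P s x" unfolding chart_range[OF assms(1), symmetric] by blast
  then have "vert s v = x" unfolding vert_def by (simp add: vec_eq_iff chart_inner[OF assms(1)])
  then show ?thesis using x by simp
qed

lemma chart_vert_sum:
  assumes "s \<in> rp_max P" "sum c s = 1"
  shows "rp_chart P s (\<Sum>v\<in>s. c v *\<^sub>R vert s v) = (\<Sum>v\<in>s. c v *\<^sub>R rp_vertex P v)"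
  unfolding chart_sum[OF assms(2)] using chart_vert[OF assms(1)] by simp

lemma ex_bary_coords:
  assumes s: "s \<in> rp_max P"
  shows "\<exists>c. sum c s = 1 \<and> x = (\<Sum>v\<in>s. c v *\<^sub>R vert s v)"
proof -
  have fin: "finite (rp_vertex P ` s)" and inj: "inj_on (rp_vertex P) s" using s max_finite vertex_inj max_complex by auto
  have "rp_chart P s x \<in> affine hull (rp_vertex P ` s)" using chart_range[OF s] by blast
  then obtain u where u: "sum u (rp_vertex P ` s) = 1" "(\<Sum>v\<in>rp_vertex P ` s. u v *\<^sub>R v) = rp_chart P s x"
    unfolding affine_hull_finite[OF fin] by blast
  have 1: "sum (u \<circ> rp_vertex P) s = 1" using u(1) by (simp add: sum.reindex[OF inj])
  have "rp_chart P s x = (\<Sum>v\<in>s. (u \<circ> rp_vertex P) v *\<^sub>R rp_vertex P v)" using u(2) by (simp add: sum.reindex[OF inj])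
  also have "\<dots> = rp_chart P s (\<Sum>v\<in>s. (u \<circ> rp_vertex P) v *\<^sub>R vert s v)" by (rule chart_vert_sum[OF s 1, symmetric])
  finally show ?thesis using 1 chart_inject[OF s] by blast
qed

text \<open>Affine independence of the vertices is not part of the data of the embedding but follows
  from its injectivity: a dependence c, scaled to be small, would move the barycenter of s to
  another point of s with the same image.\<close>

lemma vert_independent:
  assumes s: "s \<in> rp_max P" and c: "sum c s = 0" "(\<Sum>v\<in>s. c v *\<^sub>R vert s v) = 0" and v: "v \<in> s"
  shows "c v = 0"
proof -
  have fin: "finite s" using s by (rule max_finite)
  define m where "m = real (card s)"
  have m: "m > 0" using fin v by (auto simp: m_def card_gt_0_iff)
  \<comment> \<open>M exceeds every |c w|, so the weights 1 / m remain non-negative when c / (m M)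
    is added; the summand 1 makes M positive.\<close>
  define M where "M = 1 + (\<Sum>v\<in>s. \<bar>c v\<bar>)"
  have cM: "\<bar>c w\<bar> \<le> M" if "w \<in> s" for w
    unfolding M_def using member_le_sum[of w s "\<lambda>v. \<bar>c v\<bar>"] that fin by simp
  have M: "M > 0" unfolding M_def by (simp add: add_pos_nonneg sum_nonneg)
  define \<alpha> where "\<alpha> e = (\<lambda>w. if w \<in> s then 1 / m + e * c w else 0)" for e
  have sm: "sum (\<alpha> e) s = 1" for e
  proof -
    have "sum (\<alpha> e) s = (\<Sum>w\<in>s. 1 / m + e * c w)" by (simp add: \<alpha>_def)
    also have "\<dots> = 1" using m c(1) by (simp add: sum.distrib sum_distrib_left[symmetric] m_def)
    finally show ?thesis .
  qed
  have emb: "rp_embed P (\<alpha> e) = rp_chart P s (\<Sum>w\<in>s. (1/m) *\<^sub>R vert s w)" if "\<alpha> e \<in> rp_space P" "supp (\<alpha> e) \<subseteq> s" for e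
  proof -
    have "rp_embed P (\<alpha> e) = (\<Sum>w\<in>s. \<alpha> e w *\<^sub>R rp_vertex P w)" by (rule embed_sum[OF fin that(2)])
    also have "\<dots> = rp_chart P s (\<Sum>w\<in>s. \<alpha> e w *\<^sub>R vert s w)" by (rule chart_vert_sum[OF s sm, symmetric])
    also have "(\<Sum>w\<in>s. \<alpha> e w *\<^sub>R vert s w) = (\<Sum>w\<in>s. (1/m) *\<^sub>R vert s w) + e *\<^sub>R (\<Sum>w\<in>s. c w *\<^sub>R vert s w)"
      by (simp add: \<alpha>_def scaleR_add_left sum.distrib scaleR_sum_right)
    finally show ?thesis using c(2) by simp
  qed
  have sp: "\<alpha> e \<in> rp_space P" "supp (\<alpha> e) \<subseteq> s" if e: "0 \<le> e" "e \<le> 1 / (m * M)" for e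
  proof -
    have "0 \<le> \<alpha> e w" for w
    proof (cases "w \<in> s")
      case True
      have "\<bar>e * c w\<bar> \<le> 1 / (m * M) * M" using e cM[OF True] M m unfolding abs_mult by (intro mult_mono) auto
      also have "\<dots> = 1 / m" using M by simp
      finally show ?thesis using True by (simp add: \<alpha>_def)
    qed (simp add: \<alpha>_def)
    then show "\<alpha> e \<in> rp_space P" "supp (\<alpha> e) \<subseteq> s"
      using spaceI[OF max_complex[OF s], of "\<alpha> e"] sm by (auto simp: \<alpha>_def)
  qed
  let ?e = "1 / (m * M)"
  have "rp_embed P (\<alpha> ?e) = rp_embed P (\<alpha> 0)" using emb sp[of ?e] sp[of 0] m M by simp
  then have "\<alpha> ?e = \<alpha> 0" using embed_inj sp[of ?e] sp[of 0] m M unfolding inj_on_def by simp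
  then have "\<alpha> ?e v = \<alpha> 0 v" by simp
  then show ?thesis using v m M by (simp add: \<alpha>_def)
qed

text \<open>Barycentric coordinates with respect to \<open>s\<close>, extended affinely to the whole coordinate space;
  \<open>lamlin\<close> is their linear part.\<close>

definition lam :: "'v set \<Rightarrow> real^'n \<Rightarrow> 'v \<Rightarrow> real" where
  "lam s x = (SOME c. sum c s = 1 \<and> x = (\<Sum>v\<in>s. c v *\<^sub>R vert s v))"

lemma lam_sum: "s \<in> rp_max P \<Longrightarrow> sum (lam s x) s = 1"
  and lam_rep: "s \<in> rp_max P \<Longrightarrow> (\<Sum>v\<in>s. lam s x v *\<^sub>R vert s v) = x"
  using someI_ex[OF ex_bary_coords[of s x]] unfolding lam_def[symmetric] by auto

lemma lam_unique:
  assumes s: "s \<in> rp_max P" and c: "sum c s = 1" "x = (\<Sum>v\<in>s. c v *\<^sub>R vert s v)" and v: "v \<in> s"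
  shows "lam s x v = c v"
proof -
  have "lam s x v - c v = 0"
    by (rule vert_independent[OF s, of "\<lambda>v. lam s x v - c v"])
      (use lam_sum[OF s] lam_rep[OF s] c v in \<open>auto simp: sum_subtractf scaleR_diff_left\<close>)
  then show ?thesis by simp
qed

lemma lam_vert: assumes s: "s \<in> rp_max P" "v \<in> s" "w \<in> s" shows "lam s (vert s w) v = (if v = w then 1 else 0)"
proof (rule lam_unique[OF s(1) _ _ s(2)])
  show "(\<Sum>v\<in>s. if v = w then 1 else 0) = (1::real)" using s max_finite by simp
  have "(\<Sum>v\<in>s. (if v = w then 1 else 0) *\<^sub>R vert s v) = (\<Sum>v\<in>s. if v = w then vert s v else 0)" by (intro sum.cong) auto
  then show "vert s w = (\<Sum>v\<in>s. (if v = w then 1 else 0) *\<^sub>R vert s v)" using s max_finite by simp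
qed

lemma lam_combine:
  assumes s: "s \<in> rp_max P" and v: "v \<in> s"
  shows "lam s (x + a *\<^sub>R (y - z)) v = lam s x v + a * (lam s y v - lam s z v)"
proof (rule lam_unique[OF s _ _ v])
  show "(\<Sum>v\<in>s. lam s x v + a * (lam s y v - lam s z v)) = 1"
    using lam_sum[OF s] by (simp add: sum.distrib sum_subtractf sum_distrib_left[symmetric])
  have "(\<Sum>v\<in>s. (lam s x v + a * (lam s y v - lam s z v)) *\<^sub>R vert s v)
    = (\<Sum>v\<in>s. lam s x v *\<^sub>R vert s v) + a *\<^sub>R ((\<Sum>v\<in>s. lam s y v *\<^sub>R vert s v) - (\<Sum>v\<in>s. lam s z v *\<^sub>R vert s v))"
    by (simp add: scaleR_add_left scaleR_diff_left sum.distrib sum_subtractf scaleR_sum_right scaleR_diff_right right_diff_distrib)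
  then show "x + a *\<^sub>R (y - z) = (\<Sum>v\<in>s. (lam s x v + a * (lam s y v - lam s z v)) *\<^sub>R vert s v)"
    using lam_rep[OF s] by simp
qed

definition lamlin :: "'v set \<Rightarrow> 'v \<Rightarrow> real^'n \<Rightarrow> real" where
  "lamlin s v h = lam s h v - lam s 0 v"

lemma lam_add: "s \<in> rp_max P \<Longrightarrow> v \<in> s \<Longrightarrow> lam s (x + h) v = lam s x v + lamlin s v h"
  using lam_combine[of s v x 1 h 0] by (simp add: lamlin_def)

lemma linear_lamlin: assumes "s \<in> rp_max P" "v \<in> s" shows "linear (lamlin s v)"
proof (rule linearI)
  fix x y c
  show "lamlin s v (x + y) = lamlin s v x + lamlin s v y"
    using lam_add[OF assms, of x y] by (simp add: lamlin_def)
  show "lamlin s v (c *\<^sub>R x) = c *\<^sub>R lamlin s v x"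
    using lam_combine[OF assms, of 0 c x 0] by (simp add: lamlin_def)
qed

lemma lam_convex:
  assumes "s \<in> rp_max P" "v \<in> s"
  shows "lam s ((1 - t) *\<^sub>R x + t *\<^sub>R y) v = (1 - t) * lam s x v + t * lam s y v"
proof -
  have "(1 - t) *\<^sub>R x + t *\<^sub>R y = x + t *\<^sub>R (y - x)" by (simp add: algebra_simps)
  then show ?thesis using lam_combine[OF assms, of x t y x] by (simp add: algebra_simps)
qed

lemma continuous_lam:
  assumes "s \<in> rp_max P" "v \<in> s" shows "continuous_on S (\<lambda>x. lam s x v)"
proof -
  have "(\<lambda>x. lam s x v) = (\<lambda>x. lam s 0 v + lamlin s v x)" by (simp add: lamlin_def)
  moreover have "continuous_on S (lamlin s v)"
    using linear_lamlin[OF assms] linear_continuous_on linear_conv_bounded_linear by blast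
  ultimately show ?thesis by (simp only:) (intro continuous_on_add continuous_on_const)
qed

lemma dom_iff:
  assumes s: "s \<in> rp_max P" shows "x \<in> rp_dom P s \<longleftrightarrow> (\<forall>v\<in>s. 0 \<le> lam s x v)"
proof
  have fin: "finite (rp_vertex P ` s)" and inj: "inj_on (rp_vertex P) s" using s max_finite vertex_inj max_complex by auto
  {
    assume "x \<in> rp_dom P s"
    then have "rp_chart P s x \<in> convex hull (rp_vertex P ` s)" by (simp add: rp_dom_def)
    then obtain u where u: "\<forall>y\<in>rp_vertex P ` s. 0 \<le> u y" "sum u (rp_vertex P ` s) = 1" "(\<Sum>v\<in>rp_vertex P ` s. u v *\<^sub>R v) = rp_chart P s x"
      unfolding convex_hull_finite[OF fin] by blast
    have 1: "sum (u \<circ> rp_vertex P) s = 1" using u(2) by (simp add: sum.reindex[OF inj])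
    have "rp_chart P s x = (\<Sum>v\<in>s. (u \<circ> rp_vertex P) v *\<^sub>R rp_vertex P v)" using u(3) by (simp add: sum.reindex[OF inj])
    also have "\<dots> = rp_chart P s (\<Sum>v\<in>s. (u \<circ> rp_vertex P) v *\<^sub>R vert s v)" by (rule chart_vert_sum[OF s 1, symmetric])
    finally have "x = (\<Sum>v\<in>s. (u \<circ> rp_vertex P) v *\<^sub>R vert s v)" by (rule chart_inject[OF s])
    then show "\<forall>v\<in>s. 0 \<le> lam s x v" using lam_unique[OF s 1] u(1) by auto
  next
    assume pos: "\<forall>v\<in>s. 0 \<le> lam s x v"
    have "rp_chart P s x = (\<Sum>v\<in>s. lam s x v *\<^sub>R rp_vertex P v)"
      using chart_vert_sum[OF s lam_sum[OF s], of x] lam_rep[OF s] by simp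
    also have "\<dots> \<in> convex hull (rp_vertex P ` s)"
      using pos lam_sum[OF s] max_finite[OF s] by (intro convex_sum) (auto simp: hull_inc)
    finally show "x \<in> rp_dom P s" by (simp add: rp_dom_def)
  }
qed

lemma bary_param:
  assumes s: "s \<in> rp_max P" and x: "x \<in> rp_dom P s"
  shows "rp_bary P (rp_param P s x) v = (if v \<in> s then lam s x v else 0)"
proof -
  let ?\<alpha> = "\<lambda>v. if v \<in> s then lam s x v else 0"
  have sp: "?\<alpha> \<in> rp_space P" "supp ?\<alpha> \<subseteq> s"
    using spaceI[OF max_complex[OF s], of ?\<alpha>] x lam_sum[OF s] by (auto simp: dom_iff[OF s])
  have "rp_embed P ?\<alpha> = (\<Sum>v\<in>s. lam s x v *\<^sub>R rp_vertex P v)"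
    using embed_sum[OF max_finite[OF s] sp(2)] by simp
  also have "\<dots> = rp_chart P s x"
    using chart_vert_sum[OF s lam_sum[OF s], of x] lam_rep[OF s] by simp
  finally have "rp_chart P s x = rp_embed P ?\<alpha>" by simp
  then have "rp_param P s x = rp_triang P ?\<alpha>"
    unfolding rp_param_def using inv_into_f_f[OF embed_inj sp(1)] by simp
  then show ?thesis using bary_triang[OF sp(1)] by simp
qed

lemma emb_param:
  assumes s: "s \<in> rp_max P" and x: "x \<in> rp_dom P s"
  shows "emb (rp_param P s x) = rp_chart P s x"
proof -
  have "rp_bary P (rp_param P s x) = (\<lambda>v. if v \<in> s then lam s x v else 0)" using bary_param[OF assms] by auto
  then have "emb (rp_param P s x) = (\<Sum>v\<in>s. (if v \<in> s then lam s x v else 0) *\<^sub>R rp_vertex P v)"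
    unfolding emb_def by (simp only:) (rule embed_sum[OF max_finite[OF s]], auto simp: supp_def)
  then have "emb (rp_param P s x) = (\<Sum>v\<in>s. lam s x v *\<^sub>R rp_vertex P v)" by simp
  also have "\<dots> = rp_chart P s x"
    using chart_vert_sum[OF s lam_sum[OF s], of x] lam_rep[OF s] by simp
  finally show ?thesis .
qed

lemma carrier_param:
  assumes s: "s \<in> rp_max P" and x: "x \<in> rp_dom P s"
  shows "rp_carrier P (rp_param P s x) = {v \<in> s. 0 < lam s x v}"
  by (auto simp: carrier_iff bary_param[OF assms] split: if_splits)

lemma coord_eq: "s \<in> rp_max P \<Longrightarrow> emb y = rp_chart P s x \<Longrightarrow> rp_coord P s y = x"
  unfolding rp_coord_def emb_def[symmetric] by (simp add: vec_eq_iff chart_inner)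

lemma coord_param: "s \<in> rp_max P \<Longrightarrow> x \<in> rp_dom P s \<Longrightarrow> rp_coord P s (rp_param P s x) = x"
  by (rule coord_eq) (auto simp: emb_param)

lemma
  assumes s: "s \<in> rp_max P" and y: "rp_carrier P y \<subseteq> s"
  shows chart_coord: "rp_chart P s (rp_coord P s y) = emb y"
    and coord_dom: "rp_coord P s y \<in> rp_dom P s"
    and param_coord: "rp_param P s (rp_coord P s y) = y"
proof -
  define x where "x = (\<Sum>v\<in>s. rp_bary P y v *\<^sub>R vert s v)"
  have fin: "finite s" by (rule max_finite[OF s])
  have 1: "sum (rp_bary P y) s = 1" using fin y by (rule bary_sum)
  have "rp_chart P s x = (\<Sum>v\<in>s. rp_bary P y v *\<^sub>R rp_vertex P v)" unfolding x_def by (rule chart_vert_sum[OF s 1])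
  also have "\<dots> = emb y" unfolding emb_def by (rule embed_sum[OF fin, symmetric]) (use y in \<open>simp add: rp_carrier_def\<close>)
  finally have ch: "rp_chart P s x = emb y" .
  then have co: "rp_coord P s y = x" using coord_eq[OF s] by simp
  then show "rp_chart P s (rp_coord P s y) = emb y" using ch by simp
  have lm: "lam s x v = rp_bary P y v" if "v \<in> s" for v using lam_unique[OF s 1 _ that] x_def by simp
  then have x: "x \<in> rp_dom P s" using bary_nonneg by (simp add: dom_iff[OF s])
  then show "rp_coord P s y \<in> rp_dom P s" using co by simp
  have "rp_bary P (rp_param P s x) = rp_bary P y"
  proof
    fix v show "rp_bary P (rp_param P s x) v = rp_bary P y v"
      using bary_param[OF s x, of v] lm[of v] bary_zero[of v y] y by (cases "v \<in> s") auto
  qed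
  then show "rp_param P s (rp_coord P s y) = y" using co bary_inject by simp
qed

text \<open>For a maximal s these are the coordinates of the points with carrier s, which is where
  \<open>rp_g\<close> and \<open>rp_grad\<close> refer to the chart of s.\<close>

definition intr :: "'v set \<Rightarrow> (real^'n) set" where
  "intr s = {x. \<forall>v\<in>s. 0 < lam s x v}"

lemma intr_subset: "s \<in> rp_max P \<Longrightarrow> intr s \<subseteq> rp_dom P s"
  by (auto simp: intr_def dom_iff less_imp_le)

lemma carrier_intr: "s \<in> rp_max P \<Longrightarrow> x \<in> intr s \<Longrightarrow> rp_carrier P (rp_param P s x) = s"
  using carrier_param[of s x] intr_subset[of s] by (auto simp: intr_def)

lemma intr_iff: "s \<in> rp_max P \<Longrightarrow> x \<in> intr s \<longleftrightarrow> x \<in> rp_dom P s \<and> rp_carrier P (rp_param P s x) = s"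
  using carrier_param[of s x] intr_subset[of s] by (auto simp: intr_def)

lemma open_intr: assumes s: "s \<in> rp_max P" shows "open (intr s)"
proof -
  have "intr s = (\<Inter>v\<in>s. {x. 0 < lam s x v})" by (auto simp: intr_def)
  also have "open \<dots>" using continuous_lam[OF s] max_finite[OF s]
    by (intro open_INT ballI open_Collect_less continuous_on_const) auto
  finally show ?thesis .
qed

lemma convex_dom: assumes s: "s \<in> rp_max P" shows "convex (rp_dom P s)"
  by (auto simp: convex_alt dom_iff[OF s] lam_convex[OF s])

lemma intr_segment:
  assumes s: "s \<in> rp_max P" and "x \<in> rp_dom P s" "z \<in> intr s" "0 < t" "t \<le> 1"
  shows "(1 - t) *\<^sub>R x + t *\<^sub>R z \<in> intr s"
  using assms by (auto simp: intr_def dom_iff[OF s] lam_convex[OF s] intro!: add_nonneg_pos)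

lemma convex_intr: assumes s: "s \<in> rp_max P" shows "convex (intr s)"
  unfolding convex_alt
proof (intro ballI allI impI)
  fix x y u assume "x \<in> intr s" "y \<in> intr s" "0 \<le> u \<and> u \<le> (1::real)"
  then show "(1 - u) *\<^sub>R x + u *\<^sub>R y \<in> intr s"
    using intr_segment[OF s, of x y u] intr_subset[OF s] by (cases "u = 0") auto
qed

lemma intr_nonempty: assumes s: "s \<in> rp_max P" shows "intr s \<noteq> {}"
proof -
  let ?x = "\<Sum>v\<in>s. (1 / real (card s)) *\<^sub>R vert s v"
  have c: "card s > 0" using card_max[OF s] by simp
  have "lam s ?x v = 1 / real (card s)" if "v \<in> s" for v
    by (rule lam_unique[OF s _ _ that]) (use c in auto)
  then have "?x \<in> intr s" using c by (simp add: intr_def)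
  then show ?thesis by blast
qed

lemma compact_dom: assumes s: "s \<in> rp_max P" shows "compact (rp_dom P s)"
proof -
  have "norm x \<le> (\<Sum>v\<in>s. norm (vert s v))" if x: "x \<in> rp_dom P s" for x
  proof -
    have le1: "lam s x v \<le> 1" if "v \<in> s" for v
      using member_le_sum[of v s "lam s x"] lam_sum[OF s, of x] x that max_finite[OF s] by (simp add: dom_iff[OF s])
    have "norm x = norm (\<Sum>v\<in>s. lam s x v *\<^sub>R vert s v)" using lam_rep[OF s] by simp
    also have "\<dots> \<le> (\<Sum>v\<in>s. norm (lam s x v *\<^sub>R vert s v))" by (rule norm_sum)
    also have "\<dots> \<le> (\<Sum>v\<in>s. norm (vert s v))"
      using x le1 by (intro sum_mono) (auto simp: dom_iff[OF s] intro!: mult_left_le_one_le)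
    finally show ?thesis .
  qed
  then have "bounded (rp_dom P s)" unfolding bounded_iff by blast
  then show ?thesis using closed_rp_dom[OF max_finite[OF s], of P] compact_eq_bounded_closed by blast
qed

text \<open>The dimension is at least 1, so s has a second vertex w, and the barycentric coordinate
  of v takes the values 1 at v and 0 at w.\<close>

lemma lamlin_nonzero: assumes s: "s \<in> rp_max P" "v \<in> s" shows "\<exists>h. lamlin s v h \<noteq> 0"
proof -
  have "card (s - {v}) > 0" using card_max[OF s(1)] max_finite[OF s(1)] s(2) by simp
  then have "s - {v} \<noteq> {}" by (metis card.empty less_irrefl)
  then obtain w where w: "w \<in> s" "w \<noteq> v" by blast
  have "lamlin s v (vert s v) - lamlin s v (vert s w) = 1"
    using lam_vert[OF s s(2)] lam_vert[OF s w(1)] w by (simp add: lamlin_def)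
  then show ?thesis by (metis diff_zero zero_neq_one)
qed

lemma negligible_lam_zero:
  assumes s: "s \<in> rp_max P" and v: "v \<in> s" shows "negligible {x. lam s x v = 0}"
proof -
  have lin: "linear (lamlin s v)" by (rule linear_lamlin[OF s v])
  define w where "w = adjoint (lamlin s v) 1"
  have w: "lamlin s v x = w \<bullet> x" for x using adjoint_works[OF lin, of x 1] by (simp add: w_def inner_commute)
  then have "w \<noteq> 0" using lamlin_nonzero[OF s v] by auto
  moreover have "{x. lam s x v = 0} = {x. w \<bullet> x = - lam s 0 v}"
  proof (rule Collect_cong)
    fix x
    have "lam s x v = lam s 0 v + w \<bullet> x" using lam_add[OF s v, of 0 x] w[of x] by simp
    then show "(lam s x v = 0) = (w \<bullet> x = - lam s 0 v)" by linarith
  qed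
  ultimately show ?thesis by (simp add: negligible_hyperplane)
qed

lemma negligible_boundary: assumes s: "s \<in> rp_max P" shows "negligible (rp_dom P s - intr s)"
proof -
  have "negligible (\<Union>v\<in>s. {x. lam s x v = 0})" using max_finite[OF s] negligible_lam_zero[OF s] by (intro negligible_Union) auto
  then show ?thesis
    by (rule negligible_subset) (auto simp: intr_def dom_iff[OF s] less_le)
qed

subsection \<open>Cells, null sets and paths of bounded speed\<close>

lemma bary_lip: "locally_lipschitz UNIV dist bary_dist (rp_bary P)"
proof -
  have "rp_bary P = inv_into (rp_space P) (rp_triang P)" by (auto simp: rp_bary_def)
  then show ?thesis using triang_homeo unfolding lipschitz_homeomorphism_def by simp
qed

lemma emb_lip: "locally_lipschitz UNIV dist dist emb"
proof -
  have "emb = rp_embed P \<circ> rp_bary P" by (auto simp: emb_def)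
  moreover have "locally_lipschitz UNIV dist dist (rp_embed P \<circ> rp_bary P)"
    by (rule locally_lipschitz_compose[OF bary_lip embed_lip]) (auto simp: bary_space bary_dist_nonneg)
  ultimately show ?thesis by simp
qed

lemma continuous_emb: "continuous_on UNIV emb"
  using emb_lip by (rule locally_lipschitz_continuous)

lemma bary_component_le: "\<bar>rp_bary P x v - rp_bary P y v\<bar> \<le> bary_dist (rp_bary P x) (rp_bary P y)"
proof (cases "v \<in> supp (rp_bary P x) \<union> supp (rp_bary P y)")
  case True
  have "finite (supp (rp_bary P x) \<union> supp (rp_bary P y))"
    using simplex_finite[OF carrier_complex[of x]] simplex_finite[OF carrier_complex[of y]] by (simp add: rp_carrier_def)
  then have "(rp_bary P x v - rp_bary P y v)\<^sup>2 \<le> (\<Sum>v\<in>supp (rp_bary P x) \<union> supp (rp_bary P y). (rp_bary P x v - rp_bary P y v)\<^sup>2)"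
    using True by (intro member_le_sum) auto
  then show ?thesis unfolding bary_dist_def by (intro real_le_rsqrt) simp
next
  case False then show ?thesis using bary_dist_nonneg by (simp add: supp_def)
qed

lemma continuous_bary: "continuous_on UNIV (\<lambda>y. rp_bary P y v)"
proof (rule locally_lipschitz_continuous)
  show "locally_lipschitz UNIV dist dist (\<lambda>y. rp_bary P y v)"
    using bary_lip unfolding locally_lipschitz_def dist_real_def by (meson bary_component_le order_trans)
qed

lemma unembed_lip: "locally_lipschitz (range emb) dist dist (rp_triang P \<circ> inv_into (rp_space P) (rp_embed P))"
proof -
  have "locally_lipschitz (rp_space P) bary_dist dist (rp_triang P)"
    using triang_homeo unfolding lipschitz_homeomorphism_def by blast
  moreover have "inv_into (rp_space P) (rp_embed P) ` (rp_embed P ` rp_space P) \<subseteq> rp_space P"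
    by (auto intro: inv_into_into)
  ultimately show ?thesis unfolding emb_range using embed_inv_lip bary_dist_nonneg
    by (intro locally_lipschitz_compose[of _ dist bary_dist]) auto
qed

lemma unembed_emb: "(rp_triang P \<circ> inv_into (rp_space P) (rp_embed P)) (emb y) = y"
  unfolding emb_def comp_def using inv_into_f_f[OF embed_inj bary_space[of y]] triang_bary by simp

text \<open>\<open>emb\<close> is proper: its image is closed and its inverse on the image is
  continuous. Supports of cutoffs and finiteness of covers by cells rest on this.\<close>

lemma compact_emb_vimage: assumes "compact C" shows "compact (emb -` C)"
proof -
  have "emb -` C = (rp_triang P \<circ> inv_into (rp_space P) (rp_embed P)) ` (C \<inter> range emb)"
  proof
    show "emb -` C \<subseteq> (rp_triang P \<circ> inv_into (rp_space P) (rp_embed P)) ` (C \<inter> range emb)"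
      using unembed_emb by (metis (mono_tags, lifting) IntI imageI rangeI subsetI vimageD)
  qed (use unembed_emb in auto)
  moreover have "compact (C \<inter> range emb)"
    using assms closed_embed emb_range by (simp add: compact_Int_closed)
  moreover have "continuous_on (C \<inter> range emb) (rp_triang P \<circ> inv_into (rp_space P) (rp_embed P))"
    using locally_lipschitz_continuous[OF unembed_lip] by (rule continuous_on_subset) auto
  ultimately show ?thesis using compact_continuous_image by metis
qed

lemma param_lip: assumes s: "s \<in> rp_max P" shows "\<exists>L. L-lipschitz_on (rp_dom P s) (rp_param P s)"
proof -
  have eq: "rp_param P s = (rp_triang P \<circ> inv_into (rp_space P) (rp_embed P)) \<circ> rp_chart P s"
    by (auto simp: rp_param_def)
  have "1-lipschitz_on (rp_dom P s) (rp_chart P s)" by (intro lipschitz_onI) (auto simp: chart_dist[OF s])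
  then have 1: "locally_lipschitz (rp_dom P s) dist dist (rp_chart P s)" by (rule lipschitz_imp_locally_lipschitz)
  have 2: "rp_chart P s ` rp_dom P s \<subseteq> range emb" using emb_param[OF s] by (metis image_subsetI rangeI)
  have "locally_lipschitz (rp_dom P s) dist dist (rp_param P s)"
    unfolding eq by (rule locally_lipschitz_compose[OF 1 unembed_lip 2]) auto
  then show ?thesis using compact_dom[OF s] by (rule locally_lipschitz_compact)
qed

lemma continuous_param: "s \<in> rp_max P \<Longrightarrow> continuous_on (rp_dom P s) (rp_param P s)"
  using param_lip lipschitz_on_continuous_on by blast

text \<open>The same closed simplex as \<open>rp_cell\<close>, described by carriers instead of as
  an image.\<close>

definition cell :: "'v set \<Rightarrow> 'a set" where "cell s = {y. rp_carrier P y \<subseteq> s}"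

lemma cell_image: assumes s: "s \<in> rp_max P" shows "cell s = rp_param P s ` rp_dom P s"
proof
  show "cell s \<subseteq> rp_param P s ` rp_dom P s"
    unfolding cell_def using coord_dom[OF s] param_coord[OF s] by (metis (mono_tags, lifting) image_eqI mem_Collect_eq subsetI)
qed (auto simp: cell_def carrier_param[OF s])

lemma compact_cell: "s \<in> rp_max P \<Longrightarrow> compact (cell s)"
  unfolding cell_image using continuous_param compact_dom by (rule compact_continuous_image)

lemma ex_cell: "\<exists>s\<in>rp_max P. y \<in> cell s"
  using ex_max[OF carrier_complex[of y]] by (auto simp: cell_def)

lemma open_star: "open {y. v \<in> rp_carrier P y}"
  unfolding carrier_iff by (intro open_Collect_less continuous_on_const continuous_bary)

lemma open_star_face: "finite t \<Longrightarrow> open {y. t \<subseteq> rp_carrier P y}"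
proof -
  assume "finite t"
  moreover have "{y. t \<subseteq> rp_carrier P y} = (\<Inter>v\<in>t. {y. v \<in> rp_carrier P y})" by auto
  ultimately show ?thesis using open_star by (simp only:) (intro open_INT ballI)
qed

lemma open_simplex: assumes s: "s \<in> rp_max P" shows "open {y. rp_carrier P y = s}"
proof -
  have "{y. rp_carrier P y = s} = {y. s \<subseteq> rp_carrier P y}"
    using max_maximal[OF s carrier_complex] by auto
  then show ?thesis using open_star_face[OF max_finite[OF s]] by simp
qed

lemma star_meets_cell: "v \<in> rp_carrier P y \<Longrightarrow> y \<in> cell s \<Longrightarrow> v \<in> s"
  by (auto simp: cell_def)

text \<open>S may be infinite. A point outside the union lies in the open star of a vertex v, and
  this star meets only the finitely many cells whose simplexes contain v.\<close>

lemma closed_Union_cells: assumes "S \<subseteq> rp_max P" shows "closed (\<Union>s\<in>S. cell s)"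
proof -
  have "open (- (\<Union>s\<in>S. cell s))"
    unfolding open_subopen[of "- _"]
  proof
    fix y assume y: "y \<in> - (\<Union>s\<in>S. cell s)"
    obtain v where v: "v \<in> rp_carrier P y" using simplex_nonempty[OF carrier_complex[of y]] by blast
    have fin: "finite {s\<in>S. v \<in> s}" using finite_star[of v] assms by (rule_tac finite_subset) auto
    let ?T = "{y. v \<in> rp_carrier P y} - (\<Union>s\<in>{s\<in>S. v \<in> s}. cell s)"
    have "open ?T" using fin assms compact_cell
      by (intro open_Diff open_star closed_UN) (auto intro: compact_imp_closed)
    moreover have "y \<in> ?T" using v y by auto
    moreover have "?T \<subseteq> - (\<Union>s\<in>S. cell s)" using star_meets_cell by auto
    ultimately show "\<exists>T. open T \<and> y \<in> T \<and> T \<subseteq> - (\<Union>s\<in>S. cell s)" by blast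
  qed
  then show ?thesis by (simp add: closed_def)
qed

text \<open>A compact set is covered by finitely many open stars of vertices, each of which meets
  finitely many cells.\<close>

lemma finite_cells_compact: assumes "compact C" shows "finite {s \<in> rp_max P. cell s \<inter> C \<noteq> {}}"
proof -
  have "C \<subseteq> (\<Union>v\<in>UNIV. {y. v \<in> rp_carrier P y})" using simplex_nonempty[OF carrier_complex] by auto
  then obtain W where W: "finite W" "C \<subseteq> (\<Union>v\<in>W. {y. v \<in> rp_carrier P y})"
    by (rule compactE_image[OF assms open_star])
  have "{s \<in> rp_max P. cell s \<inter> C \<noteq> {}} \<subseteq> (\<Union>v\<in>W. {s \<in> rp_max P. v \<in> s})"
  proof
    fix s assume "s \<in> {s \<in> rp_max P. cell s \<inter> C \<noteq> {}}"
    then obtain y where y: "s \<in> rp_max P" "y \<in> cell s" "y \<in> C" by auto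
    then obtain v where "v \<in> W" "v \<in> rp_carrier P y" using W(2) by auto
    then show "s \<in> (\<Union>v\<in>W. {s \<in> rp_max P. v \<in> s})" using star_meets_cell y by auto
  qed
  moreover have "finite (\<Union>v\<in>W. {s \<in> rp_max P. v \<in> s})" using W(1) finite_star by simp
  ultimately show ?thesis by (rule finite_subset)
qed

section \<open>The volume measure and its null sets\<close>

lemma dom_lebesgue: "s \<in> rp_max P \<Longrightarrow> rp_dom P s \<in> sets lebesgue"
  using borel_closed[OF closed_rp_dom[OF max_finite, of s P]] by simp

lemma elliptic_dom: "s \<in> rp_max P \<Longrightarrow> AE x in lebesgue. x \<in> rp_dom P s \<longrightarrow> elliptic \<Lambda> (rp_metric P s x)"
  using elliptic_AE[of s] dom_lebesgue[of s] by (simp add: AE_restrict_space_iff)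

definition chart_trace :: "'v set \<Rightarrow> 'a set \<Rightarrow> (real^'n) set" where
  "chart_trace s A = {x \<in> rp_dom P s. rp_param P s x \<in> A}"

lemma sets_vol: "A \<in> sets (rp_vol P) \<longleftrightarrow> (\<forall>s\<in>rp_max P. chart_trace s A \<in> sets lebesgue)"
  unfolding sets_rp_vol[OF rp] chart_trace_def by simp

lemma space_vol [simp]: "space (rp_vol P) = UNIV"
  by (simp add: rp_vol_def)

lemma emeasure_vol:
  assumes "A \<in> sets (rp_vol P)"
  shows "emeasure (rp_vol P) A = (\<integral>\<^sup>+s. (\<integral>\<^sup>+x. ennreal (sqrt (det (rp_metric P s x))) * indicator (chart_trace s A) x \<partial>lebesgue) \<partial>count_space (rp_max P))"
  using assms emeasure_rp_vol[OF rp, of A] unfolding sets_rp_vol[OF rp] chart_trace_def by simp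

lemma det_measurable:
  assumes s: "s \<in> rp_max P"
  shows "(\<lambda>x. ennreal (sqrt (det (rp_metric P s x))) * indicator (rp_dom P s) x) \<in> borel_measurable lebesgue"
proof -
  have "(\<lambda>A::real^'n^'n. det A) \<in> borel_measurable borel"
    unfolding det_def by (intro borel_measurable_continuous_onI continuous_intros)
  from measurable_compose[OF metric_measurable[OF s] this]
  have "(\<lambda>x. ennreal (sqrt (det (rp_metric P s x)))) \<in> borel_measurable (lebesgue_on (rp_dom P s))"
    by (intro measurable_compose[OF _ measurable_ennreal] borel_measurable_sqrt) (simp add: o_def)
  then show ?thesis
    using dom_lebesgue[OF s] borel_measurable_restrict_space_iff_ennreal[of "rp_dom P s" lebesgue] by auto
qed

lemma weight_measurable:
  assumes s: "s \<in> rp_max P" and B: "B \<in> sets lebesgue" "B \<subseteq> rp_dom P s"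
  shows "(\<lambda>x. ennreal (sqrt (det (rp_metric P s x))) * indicator B x) \<in> borel_measurable lebesgue"
proof -
  have "(\<lambda>x. (ennreal (sqrt (det (rp_metric P s x))) * indicator (rp_dom P s) x) * indicator B x) \<in> borel_measurable lebesgue"
    using det_measurable[OF s] B(1) by (rule borel_measurable_times_ennreal[OF _ borel_measurable_indicator])
  moreover have "(\<lambda>x. (ennreal (sqrt (det (rp_metric P s x))) * indicator (rp_dom P s) x) * indicator B x) = (\<lambda>x. ennreal (sqrt (det (rp_metric P s x))) * indicator B x)"
    using B(2) by (intro ext) (auto split: split_indicator)
  ultimately show ?thesis by simp
qed

lemma weight_integral_zero_iff:
  assumes s: "s \<in> rp_max P" and B: "B \<in> sets lebesgue" "B \<subseteq> rp_dom P s"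
  shows "(\<integral>\<^sup>+x. ennreal (sqrt (det (rp_metric P s x))) * indicator B x \<partial>lebesgue) = 0 \<longleftrightarrow> negligible B"
proof -
  have "(\<integral>\<^sup>+x. ennreal (sqrt (det (rp_metric P s x))) * indicator B x \<partial>lebesgue) = 0 \<longleftrightarrow>
    (AE x in lebesgue. ennreal (sqrt (det (rp_metric P s x))) * indicator B x = 0)"
    by (rule nn_integral_0_iff_AE[OF weight_measurable[OF assms]])
  also have "\<dots> \<longleftrightarrow> (AE x in lebesgue. x \<notin> B)"
  proof
    assume "AE x in lebesgue. ennreal (sqrt (det (rp_metric P s x))) * indicator B x = 0"
    then show "AE x in lebesgue. x \<notin> B" using elliptic_dom[OF s]
    proof eventually_elim
      case (elim x)
      show ?case
      proof
        assume x: "x \<in> B"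
        then have "det (rp_metric P s x) > 0" using elim(2) B(2) elliptic_det_pos[OF _ Lambda] by blast
        then show False using elim(1) x by simp
      qed
    qed
  qed (auto elim!: eventually_mono)
  also have "\<dots> \<longleftrightarrow> negligible B"
    using B(1) by (simp add: AE_iff_null_sets negligible_iff_null_sets)
  finally show ?thesis .
qed

text \<open>By ellipticity the density is positive almost everywhere, so in every chart the volume
  and Lebesgue measure have the same null sets.\<close>

lemma null_vol_iff: "A \<in> null_sets (rp_vol P) \<longleftrightarrow> (\<forall>s\<in>rp_max P. negligible (chart_trace s A))"
proof
  have sub: "chart_trace s A \<subseteq> rp_dom P s" for s by (auto simp: chart_trace_def)
  {
    assume A: "A \<in> null_sets (rp_vol P)"
    then have S: "A \<in> sets (rp_vol P)" by blast
    have "emeasure (rp_vol P) A = 0" using A by blast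
    then have "(\<integral>\<^sup>+s. (\<integral>\<^sup>+x. ennreal (sqrt (det (rp_metric P s x))) * indicator (chart_trace s A) x \<partial>lebesgue) \<partial>count_space (rp_max P)) = 0"
      using emeasure_vol[OF S] by simp
    then have "\<forall>s\<in>rp_max P. (\<integral>\<^sup>+x. ennreal (sqrt (det (rp_metric P s x))) * indicator (chart_trace s A) x \<partial>lebesgue) = 0"
      by (subst (asm) nn_integral_0_iff_AE) (auto simp: AE_count_space)
    then show "\<forall>s\<in>rp_max P. negligible (chart_trace s A)"
      using S sub by (simp add: weight_integral_zero_iff sets_vol)
  next
    assume neg: "\<forall>s\<in>rp_max P. negligible (chart_trace s A)"
    then have S: "A \<in> sets (rp_vol P)" unfolding sets_vol by (auto intro: negligible_imp_sets)
    have "emeasure (rp_vol P) A = (\<integral>\<^sup>+s. 0 \<partial>count_space (rp_max P))"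
      unfolding emeasure_vol[OF S]
      using neg S sub by (intro nn_integral_cong) (simp add: weight_integral_zero_iff sets_vol)
    then show "A \<in> null_sets (rp_vol P)" using S by (simp add: null_sets_def)
  }
qed

text \<open>The reduction of almost everywhere statements on X to charts. Restricting to
  \<open>intr s\<close> loses only the boundary of the simplex, which is null, and at the remaining
  points the carrier is known to be s.\<close>

lemma AE_vol_iff: "(AE y in rp_vol P. R y) \<longleftrightarrow> (\<forall>s\<in>rp_max P. AE x in lebesgue. x \<in> intr s \<longrightarrow> R (rp_param P s x))"
proof -
  have neg: "negligible (chart_trace s {y. \<not> R y}) \<longleftrightarrow> (AE x in lebesgue. x \<in> intr s \<longrightarrow> R (rp_param P s x))" if s: "s \<in> rp_max P" for s
  proof
    assume "negligible (chart_trace s {y. \<not> R y})"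
    then have "AE x in lebesgue. x \<notin> chart_trace s {y. \<not> R y}" by (intro AE_not_in) (simp add: negligible_iff_null_sets)
    then show "AE x in lebesgue. x \<in> intr s \<longrightarrow> R (rp_param P s x)"
      by eventually_elim (use intr_subset[OF s] in \<open>auto simp: chart_trace_def\<close>)
  next
    assume "AE x in lebesgue. x \<in> intr s \<longrightarrow> R (rp_param P s x)"
    then have "negligible {x. \<not> (x \<in> intr s \<longrightarrow> R (rp_param P s x))}"
      by (intro AE_lebesgue_negligible) simp
    then have "negligible ({x. \<not> (x \<in> intr s \<longrightarrow> R (rp_param P s x))} \<union> (rp_dom P s - intr s))"
      using negligible_boundary[OF s] by (rule negligible_Un)
    then show "negligible (chart_trace s {y. \<not> R y})" by (rule negligible_subset) (auto simp: chart_trace_def)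
  qed
  have "(AE y in rp_vol P. R y) \<longleftrightarrow> {y. \<not> R y} \<in> null_sets (rp_vol P)"
  proof
    assume "AE y in rp_vol P. R y"
    then obtain N where N: "N \<in> null_sets (rp_vol P)" "{y. \<not> R y} \<subseteq> N" by (auto simp: eventually_ae_filter)
    have "chart_trace s {y. \<not> R y} \<subseteq> chart_trace s N" for s using N(2) by (auto simp: chart_trace_def)
    then show "{y. \<not> R y} \<in> null_sets (rp_vol P)"
      using N(1) unfolding null_vol_iff by (meson negligible_subset)
  next
    assume "{y. \<not> R y} \<in> null_sets (rp_vol P)"
    then show "AE y in rp_vol P. R y" by (auto simp: eventually_ae_filter)
  qed
  then show ?thesis using neg by (simp add: null_vol_iff)
qed

lemma null_vol_AE: "A \<in> null_sets (rp_vol P) \<longleftrightarrow> (AE y in rp_vol P. y \<notin> A)"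
proof
  assume "AE y in rp_vol P. y \<notin> A"
  then obtain N where N: "N \<in> null_sets (rp_vol P)" "A \<subseteq> N" by (auto simp: eventually_ae_filter)
  have "chart_trace s A \<subseteq> chart_trace s N" for s using N(2) by (auto simp: chart_trace_def)
  then show "A \<in> null_sets (rp_vol P)" using N(1) unfolding null_vol_iff by (meson negligible_subset)
qed (rule AE_not_in)

lemma metric_intr: "s \<in> rp_max P \<Longrightarrow> x \<in> intr s \<Longrightarrow> rp_g P (rp_param P s x) = rp_metric P s x"
  using carrier_intr[of s x] coord_param[of s x] intr_subset[of s] by (auto simp: rp_g_def)

lemma AE_carrier_max: "AE y in rp_vol P. rp_carrier P y \<in> rp_max P"
  unfolding AE_vol_iff by (auto simp: carrier_intr)

lemma AE_elliptic: "AE y in rp_vol P. elliptic \<Lambda> (rp_g P y)"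
  unfolding AE_vol_iff
proof
  fix s assume s: "s \<in> rp_max P"
  show "AE x in lebesgue. x \<in> intr s \<longrightarrow> elliptic \<Lambda> (rp_g P (rp_param P s x))"
    using elliptic_dom[OF s] by eventually_elim (use metric_intr[OF s] intr_subset[OF s] in auto)
qed

text \<open>Speeds of paths need not be measurable, so upper bounds for lengths are obtained from paths whose
  speed is bounded by a constant. Any such bound survives concatenation up to a factor.\<close>

definition good_path :: "real \<Rightarrow> 'a set \<Rightarrow> (real \<Rightarrow> 'a) \<Rightarrow> bool" where
  "good_path C Z \<gamma> \<longleftrightarrow> (\<exists>L. L-lipschitz_on {0..1} \<gamma>) \<and>
     (AE t in lborel. t \<in> {0..1} \<longrightarrow> \<gamma> t \<notin> Z \<and> rp_carrier P (\<gamma> t) \<in> rp_max P \<and>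
        (\<exists>w. ((\<lambda>\<tau>. rp_coord P (rp_carrier P (\<gamma> t)) (\<gamma> \<tau>)) has_vector_derivative w) (at t) \<and> norm w \<le> C))"

text \<open>One constant C serves all null sets, as the supremum over null sets in
  \<open>rp_edist\<close> requires.\<close>

definition reach :: "real \<Rightarrow> 'a \<Rightarrow> 'a \<Rightarrow> bool" where
  "reach C x y \<longleftrightarrow> (\<forall>Z\<in>null_sets (rp_vol P). \<exists>\<gamma>. good_path C Z \<gamma> \<and> \<gamma> 0 = x \<and> \<gamma> 1 = y)"

lemma reach_mono: "reach C x y \<Longrightarrow> C \<le> D \<Longrightarrow> reach D x y"
proof -
  assume r: "reach C x y" and CD: "C \<le> D"
  have "good_path C Z \<gamma> \<Longrightarrow> good_path D Z \<gamma>" for Z \<gamma>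
    unfolding good_path_def using CD by (auto elim!: eventually_mono intro: order_trans)
  then show ?thesis using r unfolding reach_def by blast
qed

text \<open>Enlarging Z by the points where the metric is not elliptic keeps it null. Ellipticity
  then bounds the speed by \<Lambda> C almost everywhere on a parameter interval of length
  1.\<close>

lemma reach_edist: assumes r: "reach C x y" shows "rp_edist P x y \<le> ennreal (\<Lambda> * C)"
  unfolding rp_edist_def
proof (rule SUP_least)
  fix Z assume Z: "Z \<in> null_sets (rp_vol P)"
  have "{y. \<not> elliptic \<Lambda> (rp_g P y)} \<in> null_sets (rp_vol P)" unfolding null_vol_AE using AE_elliptic by simp
  then have "Z \<union> {y. \<not> elliptic \<Lambda> (rp_g P y)} \<in> null_sets (rp_vol P)" using Z by (rule null_sets.Un[rotated])
  then obtain \<gamma> where g: "good_path C (Z \<union> {y. \<not> elliptic \<Lambda> (rp_g P y)}) \<gamma>" "\<gamma> 0 = x" "\<gamma> 1 = y"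
    using r unfolding reach_def by blast
  have ae: "AE t in lborel. t \<in> {0..1} \<longrightarrow> \<gamma> t \<notin> Z \<union> {y. \<not> elliptic \<Lambda> (rp_g P y)} \<and> rp_carrier P (\<gamma> t) \<in> rp_max P \<and>
        (\<exists>w. ((\<lambda>\<tau>. rp_coord P (rp_carrier P (\<gamma> t)) (\<gamma> \<tau>)) has_vector_derivative w) (at t) \<and> norm w \<le> C)"
    using g(1) unfolding good_path_def by blast
  then have ael: "AE t in lebesgue. t \<in> {0..1} \<longrightarrow> \<gamma> t \<notin> Z \<union> {y. \<not> elliptic \<Lambda> (rp_g P y)} \<and> rp_carrier P (\<gamma> t) \<in> rp_max P \<and>
        (\<exists>w. ((\<lambda>\<tau>. rp_coord P (rp_carrier P (\<gamma> t)) (\<gamma> \<tau>)) has_vector_derivative w) (at t) \<and> norm w \<le> C)"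
    by (rule AE_completion)
  have "AE t in lebesgue. t \<notin> {t \<in> {0..1}. \<gamma> t \<in> Z}" using ael by (rule eventually_mono) auto
  then have "{t \<in> {0..1}. \<gamma> t \<in> Z} \<in> null_sets lebesgue"
    using AE_lebesgue_negligible negligible_iff_null_sets by blast
  then have tr: "\<gamma> \<in> transversal_paths Z x y" using g unfolding transversal_paths_def good_path_def by blast
  have "rp_length P \<gamma> \<le> (\<integral>\<^sup>+t. ennreal (\<Lambda> * C) * indicator {0..1::real} t \<partial>lebesgue)"
    unfolding rp_length_def
  proof (rule nn_integral_mono_AE)
    show "AE t in lebesgue. ennreal (rp_speed P \<gamma> t) * indicator {0..1} t \<le> ennreal (\<Lambda> * C) * indicator {0..1} t"
      using ael
    proof eventually_elim
      case (elim t)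
      show ?case
      proof (cases "t \<in> {0..1}")
        case True
        then obtain w where w: "((\<lambda>\<tau>. rp_coord P (rp_carrier P (\<gamma> t)) (\<gamma> \<tau>)) has_vector_derivative w) (at t)" "norm w \<le> C"
          and e: "elliptic \<Lambda> (rp_g P (\<gamma> t))" and m: "rp_carrier P (\<gamma> t) \<in> rp_max P" using elim by auto
        have "rp_speed P \<gamma> t = sqrt (w \<bullet> (rp_g P (\<gamma> t) *v w))"
          unfolding rp_speed_def Let_def vector_derivative_at[OF w(1)] using m by (simp add: rp_inner_def)
        also have "\<dots> \<le> sqrt ((\<Lambda> * norm w)\<^sup>2)"
          using elliptic_upper[OF e, of w] by (simp add: power_mult_distrib)
        also have "\<dots> \<le> \<Lambda> * C" using w(2) Lambda by simp
        finally show ?thesis using True by (simp add: ennreal_leI)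
      qed simp
    qed
  qed
  also have "\<dots> = ennreal (\<Lambda> * C)" by (simp add: nn_integral_cmult_indicator)
  finally show "(INF \<gamma>\<in>transversal_paths Z x y. rp_length P \<gamma>) \<le> ennreal (\<Lambda> * C)"
    using tr by (meson INF_lower order_trans)
qed

subsection \<open>Comparison of the intrinsic distance with the embedding\<close>

lemma intr_near:
  assumes s: "s \<in> rp_max P" and m: "m \<in> rp_dom P s" and r: "r > 0"
  shows "intr s \<inter> ball m r \<noteq> {}"
proof -
  obtain z where z: "z \<in> intr s" using intr_nonempty[OF s] by blast
  define e where "e = min 1 (r / (2 * (norm (z - m) + 1)))"
  have e: "0 < e" "e \<le> 1" "e \<le> r / (2 * (norm (z - m) + 1))" using r by (auto simp: e_def add_nonneg_pos)
  let ?p = "(1 - e) *\<^sub>R m + e *\<^sub>R z"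
  have "?p \<in> intr s" using intr_segment[OF s m z] e by blast
  moreover have "?p \<in> ball m r"
  proof -
    have "m - ?p = (- e) *\<^sub>R (z - m)" by (simp add: algebra_simps)
    then have "dist m ?p = e * norm (z - m)" using e unfolding dist_norm by simp
    also have "\<dots> \<le> e * (norm (z - m) + 1)" using e by simp
    also have "\<dots> \<le> r / (2 * (norm (z - m) + 1)) * (norm (z - m) + 1)" using e by (intro mult_right_mono) auto
    also have "\<dots> = r / 2" by (simp add: add_nonneg_pos field_simps add_nonneg_eq_0_iff)
    finally show ?thesis using r by simp
  qed
  ultimately show ?thesis by blast
qed

text \<open>The straight segment from x to y may run inside Z or inside the boundary. The path
  therefore bends at a point z of the open simplex near the midpoint; for almost every z both legs
  avoid the null set. Each leg is shorter than r and takes half of the parameter interval, hence the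
  speed bound 2 r.\<close>

lemma dom_reach:
  assumes s: "s \<in> rp_max P" and x: "x \<in> rp_dom P s" and y: "y \<in> rp_dom P s" and r: "dist x y < r"
  shows "reach (2 * r) (rp_param P s x) (rp_param P s y)"
  unfolding reach_def
proof
  fix Z assume Z: "Z \<in> null_sets (rp_vol P)"
  have r0: "r > 0" using r zero_le_dist[of x y] by linarith
  have "negligible (chart_trace s Z)" using Z s null_vol_iff by blast
  then have "AE x in lebesgue. x \<notin> chart_trace s Z" by (intro AE_not_in) (simp add: negligible_iff_null_sets)
  then have "AE x in lborel. x \<notin> chart_trace s Z" by (simp add: AE_completion_iff)
  from AE_lborel_null[OF this] obtain N where N: "N \<in> null_sets lborel" "\<forall>x. x \<notin> N \<longrightarrow> x \<notin> chart_trace s Z" by blast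
  define m where "m = (1 - 1/2) *\<^sub>R x + (1/2) *\<^sub>R y"
  have m: "m \<in> rp_dom P s" unfolding m_def using convexD_alt[OF convex_dom[OF s] x y, of "1/2"] by simp
  have "x - m = (1/2) *\<^sub>R (x - y)" "y - m = (1/2) *\<^sub>R (y - x)" by (simp_all add: m_def vec_eq_iff field_simps)
  then have xm: "dist x m < r / 2" "dist y m < r / 2" using r unfolding dist_norm by (simp_all add: norm_minus_commute)
  let ?U = "intr s \<inter> ball m (r / 2)"
  have "AE z in lborel. (AE t in lborel. (0::real) < t \<longrightarrow> x + t *\<^sub>R (z - x) \<notin> N) \<and> (AE t in lborel. (0::real) < t \<longrightarrow> y + t *\<^sub>R (z - y) \<notin> N)"
    using AE_segments_avoid[OF N(1), of x] AE_segments_avoid[OF N(1), of y] by (rule AE_conjI)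
  moreover have "open ?U" using open_intr[OF s] open_ball by (rule open_Int)
  moreover have "?U \<noteq> {}" using intr_near[OF s m] r0 by simp
  ultimately have "\<exists>z\<in>?U. (AE t in lborel. (0::real) < t \<longrightarrow> x + t *\<^sub>R (z - x) \<notin> N) \<and> (AE t in lborel. (0::real) < t \<longrightarrow> y + t *\<^sub>R (z - y) \<notin> N)"
    by (rule AE_lborel_open_witness)
  then obtain z where z: "z \<in> intr s" "dist m z < r / 2"
    and ax: "AE t in lborel. (0::real) < t \<longrightarrow> x + t *\<^sub>R (z - x) \<notin> N"
    and ay: "AE t in lborel. (0::real) < t \<longrightarrow> y + t *\<^sub>R (z - y) \<notin> N" by auto
  have zr: "norm (z - x) < r" "norm (y - z) < r"
    using dist_triangle_half_l[of x m r z] dist_triangle_half_l[of y m r z] xm z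
    by (simp_all add: dist_norm norm_minus_commute)
  define c where "c t = (if t \<le> 1/2 then x + (2 * t) *\<^sub>R (z - x) else z + (2 * t - 1) *\<^sub>R (y - z))" for t :: real
  have zd: "z \<in> rp_dom P s" using z(1) intr_subset[OF s] by blast
  \<comment> \<open>The second leg is rewritten as starting from its end point y, the form in which
    \<open>ay\<close> controls it.\<close>
  have c2: "z + (2 * t - 1) *\<^sub>R (y - z) = y + (2 - 2 * t) *\<^sub>R (z - y)" for t by (simp add: vec_eq_iff field_simps)
  have cI: "c t \<in> intr s" if "0 < t" "t < 1" for t
  proof (cases "t \<le> 1/2")
    case True
    have "c t = (1 - 2 * t) *\<^sub>R x + (2 * t) *\<^sub>R z" using True by (simp add: c_def vec_eq_iff field_simps)
    then show ?thesis using intr_segment[OF s x z(1), of "2 * t"] True that by simp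
  next
    case False
    have "c t = (1 - (2 - 2 * t)) *\<^sub>R y + (2 - 2 * t) *\<^sub>R z" using False unfolding c_def c2 by (simp add: vec_eq_iff field_simps)
    then show ?thesis using intr_segment[OF s y z(1), of "2 - 2 * t"] False that by simp
  qed
  have c01: "c 0 = x" "c 1 = y" by (simp_all add: c_def)
  have cD: "c t \<in> rp_dom P s" if "t \<in> {0..1}" for t
    using that cI[of t] intr_subset[OF s] c01 x y by (cases "t = 0"; cases "t = 1") auto
  have "\<exists>K. K-lipschitz_on {0..1} c"
  proof -
    have l: "(norm b)-lipschitz_on {0..1::real} (\<lambda>t. a + t *\<^sub>R b)" for a b :: "real^'n"
      by (intro lipschitz_onI) (auto simp: dist_norm simp flip: scaleR_diff_left)
    show ?thesis unfolding c_def using lipschitz_unit_join[OF l[of "z - x" x] l[of "y - z" z]] by simp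
  qed
  then obtain K where K: "K-lipschitz_on {0..1} c" by blast
  obtain L where L: "L-lipschitz_on (rp_dom P s) (rp_param P s)" using param_lip[OF s] by blast
  define \<gamma> where "\<gamma> = (\<lambda>t. rp_param P s (c t))"
  have lip: "(L * K)-lipschitz_on {0..1} \<gamma>" unfolding \<gamma>_def
    by (rule lipschitz_on_compose2[OF K]) (rule lipschitz_on_subset[OF L], use cD in auto)
  have ax': "AE t in lborel. (0::real) < 0 + 2 *\<^sub>R t \<longrightarrow> x + (0 + 2 *\<^sub>R t) *\<^sub>R (z - x) \<notin> N"
    by (rule AE_lborel_affine[OF ax]) simp
  have ay': "AE t in lborel. (0::real) < 2 + (-2) *\<^sub>R t \<longrightarrow> y + (2 + (-2) *\<^sub>R t) *\<^sub>R (z - y) \<notin> N"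
    by (rule AE_lborel_affine[OF ay]) simp
  have fin: "AE t in lborel. t \<notin> {0, 1/2, 1::real}" by (intro AE_not_in) (simp add: finite_imp_null_set_lborel)
  have "AE t in lborel. t \<in> {0..1} \<longrightarrow> \<gamma> t \<notin> Z \<and> rp_carrier P (\<gamma> t) \<in> rp_max P \<and>
        (\<exists>w. ((\<lambda>\<tau>. rp_coord P (rp_carrier P (\<gamma> t)) (\<gamma> \<tau>)) has_vector_derivative w) (at t) \<and> norm w \<le> 2 * r)"
    using ax' ay' fin
  proof eventually_elim
    case (elim t)
    show ?case
    proof (intro impI conjI)
      assume "t \<in> {0..1}"
      then have t: "0 < t" "t < 1" "t \<noteq> 1/2" using elim(3) by auto
      have I: "c t \<in> intr s" by (rule cI[OF t(1,2)])
      have car: "rp_carrier P (\<gamma> t) = s" unfolding \<gamma>_def by (rule carrier_intr[OF s I])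
      then show "rp_carrier P (\<gamma> t) \<in> rp_max P" using s by simp
      have "c t \<notin> N"
      proof (cases "t \<le> 1/2")
        case True then show ?thesis using elim(1) t by (simp add: c_def)
      next
        case False then show ?thesis using elim(2) t unfolding c_def c2 by simp
      qed
      then show "\<gamma> t \<notin> Z" using N(2) I intr_subset[OF s] unfolding chart_trace_def \<gamma>_def by blast
      have co: "rp_coord P s (\<gamma> \<tau>) = c \<tau>" if "0 < \<tau>" "\<tau> < 1" for \<tau>
        unfolding \<gamma>_def using cI[OF that] intr_subset[OF s] coord_param[OF s] by blast
      show "\<exists>w. ((\<lambda>\<tau>. rp_coord P (rp_carrier P (\<gamma> t)) (\<gamma> \<tau>)) has_vector_derivative w) (at t) \<and> norm w \<le> 2 * r"
      proof (cases "t < 1/2")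
        case True
        have "((\<lambda>\<tau>. x + (2 * \<tau>) *\<^sub>R (z - x)) has_vector_derivative 2 *\<^sub>R (z - x)) (at t)"
          by (auto intro!: derivative_eq_intros simp: has_vector_derivative_def)
        then have "((\<lambda>\<tau>. rp_coord P s (\<gamma> \<tau>)) has_vector_derivative 2 *\<^sub>R (z - x)) (at t)"
          by (rule has_vector_derivative_near[where T = "{0<..<1/2}"]) (use t True co in \<open>auto simp: c_def\<close>)
        then show ?thesis unfolding car using zr by (intro exI[of _ "2 *\<^sub>R (z - x)"]) auto
      next
        case False
        have "((\<lambda>\<tau>. z + (2 * \<tau> - 1) *\<^sub>R (y - z)) has_vector_derivative 2 *\<^sub>R (y - z)) (at t)"
          by (auto intro!: derivative_eq_intros simp: has_vector_derivative_def)
        then have "((\<lambda>\<tau>. rp_coord P s (\<gamma> \<tau>)) has_vector_derivative 2 *\<^sub>R (y - z)) (at t)"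
          by (rule has_vector_derivative_near[where T = "{1/2<..<1}"]) (use t False co in \<open>auto simp: c_def\<close>)
        then show ?thesis unfolding car using zr by (intro exI[of _ "2 *\<^sub>R (y - z)"]) auto
      qed
    qed
  qed
  then have "good_path (2 * r) Z \<gamma>" unfolding good_path_def using lip by blast
  then show "\<exists>\<gamma>. good_path (2 * r) Z \<gamma> \<and> \<gamma> 0 = rp_param P s x \<and> \<gamma> 1 = rp_param P s y"
    by (intro exI[of _ \<gamma>]) (simp add: \<gamma>_def c01)
qed

lemma good_path_join:
  assumes g1: "good_path C Z \<gamma>1" and g2: "good_path C Z \<gamma>2" and j: "\<gamma>1 1 = \<gamma>2 0"
  shows "good_path (2 * C) Z (\<lambda>t. if t \<le> 1/2 then \<gamma>1 (2 * t) else \<gamma>2 (2 * t - 1))" (is "good_path _ _ ?\<gamma>")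
proof -
  let ?Q = "\<lambda>\<gamma> t. t \<in> {0..1} \<longrightarrow> \<gamma> t \<notin> Z \<and> rp_carrier P (\<gamma> t) \<in> rp_max P \<and>
        (\<exists>w. ((\<lambda>\<tau>. rp_coord P (rp_carrier P (\<gamma> t)) (\<gamma> \<tau>)) has_vector_derivative w) (at t) \<and> norm w \<le> C)"
  have a1: "AE t in lborel. ?Q \<gamma>1 (0 + 2 *\<^sub>R t)" using g1 unfolding good_path_def by (intro AE_lborel_affine) auto
  have a2: "AE t in lborel. ?Q \<gamma>2 (-1 + 2 *\<^sub>R t)" using g2 unfolding good_path_def by (intro AE_lborel_affine) auto
  have fin: "AE t in lborel. t \<notin> {0, 1/2, 1::real}" by (intro AE_not_in) (simp add: finite_imp_null_set_lborel)
  have chain: "((\<lambda>\<tau>. f (a + 2 * \<tau>)) has_vector_derivative 2 *\<^sub>R w) (at t)"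
    if "(f has_vector_derivative w) (at (a + 2 * t))" for f :: "real \<Rightarrow> real^'n" and a t w
  proof -
    have "((\<lambda>\<tau>. a + 2 * \<tau>) has_real_derivative 2) (at t)" by (auto intro!: derivative_eq_intros)
    then show ?thesis using that vector_diff_chain_at[of "\<lambda>\<tau>. a + 2 * \<tau>" 2 t f w]
      by (simp add: has_real_derivative_iff_has_vector_derivative o_def)
  qed
  have "AE t in lborel. t \<in> {0..1} \<longrightarrow> ?\<gamma> t \<notin> Z \<and> rp_carrier P (?\<gamma> t) \<in> rp_max P \<and>
        (\<exists>w. ((\<lambda>\<tau>. rp_coord P (rp_carrier P (?\<gamma> t)) (?\<gamma> \<tau>)) has_vector_derivative w) (at t) \<and> norm w \<le> 2 * C)"
    using a1 a2 fin
  proof eventually_elim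
    case (elim t)
    show ?case
    proof
      assume "t \<in> {0..1}"
      then have t: "0 < t" "t < 1" "t \<noteq> 1/2" using elim(3) by auto
      show "?\<gamma> t \<notin> Z \<and> rp_carrier P (?\<gamma> t) \<in> rp_max P \<and>
        (\<exists>w. ((\<lambda>\<tau>. rp_coord P (rp_carrier P (?\<gamma> t)) (?\<gamma> \<tau>)) has_vector_derivative w) (at t) \<and> norm w \<le> 2 * C)"
      proof (cases "t < 1/2")
        case True
        then have e: "?\<gamma> t = \<gamma>1 (2 * t)" by simp
        obtain w where q: "\<gamma>1 (2 * t) \<notin> Z" "rp_carrier P (\<gamma>1 (2 * t)) \<in> rp_max P"
          "((\<lambda>\<tau>. rp_coord P (rp_carrier P (\<gamma>1 (2 * t))) (\<gamma>1 \<tau>)) has_vector_derivative w) (at (2 * t))" "norm w \<le> C"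
          using elim(1) t True by auto
        have "((\<lambda>\<tau>. rp_coord P (rp_carrier P (\<gamma>1 (2 * t))) (\<gamma>1 (0 + 2 * \<tau>))) has_vector_derivative 2 *\<^sub>R w) (at t)"
          by (rule chain) (use q in simp)
        then have "((\<lambda>\<tau>. rp_coord P (rp_carrier P (?\<gamma> t)) (?\<gamma> \<tau>)) has_vector_derivative 2 *\<^sub>R w) (at t)"
          unfolding e by (rule has_vector_derivative_near[where T = "{..<1/2}"]) (use True in auto)
        then show ?thesis using q e by (auto intro!: exI[of _ "2 *\<^sub>R w"])
      next
        case False
        then have e: "?\<gamma> t = \<gamma>2 (2 * t - 1)" using t by simp
        obtain w where q: "\<gamma>2 (2 * t - 1) \<notin> Z" "rp_carrier P (\<gamma>2 (2 * t - 1)) \<in> rp_max P"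
          "((\<lambda>\<tau>. rp_coord P (rp_carrier P (\<gamma>2 (2 * t - 1))) (\<gamma>2 \<tau>)) has_vector_derivative w) (at (2 * t - 1))" "norm w \<le> C"
          using elim(2) t False by auto
        have "((\<lambda>\<tau>. rp_coord P (rp_carrier P (\<gamma>2 (2 * t - 1))) (\<gamma>2 (-1 + 2 * \<tau>))) has_vector_derivative 2 *\<^sub>R w) (at t)"
          by (rule chain) (use q in simp)
        then have "((\<lambda>\<tau>. rp_coord P (rp_carrier P (?\<gamma> t)) (?\<gamma> \<tau>)) has_vector_derivative 2 *\<^sub>R w) (at t)"
          unfolding e by (rule has_vector_derivative_near[where T = "{1/2<..}"]) (use False t in auto)
        then show ?thesis using q e by (auto intro!: exI[of _ "2 *\<^sub>R w"])
      qed
    qed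
  qed
  moreover have "\<exists>L. L-lipschitz_on {0..1} ?\<gamma>"
  proof -
    obtain L M where "L-lipschitz_on {0..1} \<gamma>1" "M-lipschitz_on {0..1} \<gamma>2" using g1 g2 unfolding good_path_def by blast
    then show ?thesis using j by (rule lipschitz_unit_join)
  qed
  ultimately show ?thesis unfolding good_path_def by blast
qed

lemma reach_trans: assumes "reach C x y" "reach C y z" shows "reach (2 * C) x z"
  unfolding reach_def
proof
  fix Z assume Z: "Z \<in> null_sets (rp_vol P)"
  obtain \<gamma>1 where 1: "good_path C Z \<gamma>1" "\<gamma>1 0 = x" "\<gamma>1 1 = y" using assms(1) Z unfolding reach_def by blast
  obtain \<gamma>2 where 2: "good_path C Z \<gamma>2" "\<gamma>2 0 = y" "\<gamma>2 1 = z" using assms(2) Z unfolding reach_def by blast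
  let ?\<gamma> = "\<lambda>t. if t \<le> 1/2 then \<gamma>1 (2 * t) else \<gamma>2 (2 * t - 1)"
  have "good_path (2 * C) Z ?\<gamma>" by (rule good_path_join) (use 1 2 in simp_all)
  then show "\<exists>\<gamma>. good_path (2 * C) Z \<gamma> \<and> \<gamma> 0 = x \<and> \<gamma> 1 = z" by (intro exI[of _ ?\<gamma>]) (use 1 2 in simp)
qed

lemma cell_reach: assumes s: "s \<in> rp_max P" and x: "x \<in> cell s" and y: "y \<in> cell s" shows "\<exists>C. reach C x y"
proof -
  obtain p q where "p \<in> rp_dom P s" "q \<in> rp_dom P s" "x = rp_param P s p" "y = rp_param P s q"
    using x y unfolding cell_image[OF s] by blast
  then show ?thesis using dom_reach[OF s, of p q "dist p q + 1"] by auto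
qed

text \<open>A cell that contains one reachable point is reachable entirely. So the reachable set and
  its complement are both unions of cells, hence both closed, and X is connected.\<close>

lemma reach_all: "\<exists>C. reach C x y"
proof -
  define R where "R = {y. \<exists>C. reach C x y}"
  define S where "S = {s \<in> rp_max P. cell s \<subseteq> R}"
  have spread: "cell s \<subseteq> R" if s: "s \<in> rp_max P" and y: "y \<in> cell s" "y \<in> R" for s y
  proof
    fix z assume z: "z \<in> cell s"
    obtain C where C: "reach C x y" using y R_def by blast
    obtain D where D: "reach D y z" using cell_reach[OF s y(1) z] by blast
    have "reach (max C D) x y" "reach (max C D) y z" using C D by (auto intro: reach_mono)
    then show "z \<in> R" unfolding R_def using reach_trans by blast
  qed
  have R: "R = (\<Union>s\<in>S. cell s)"
  proof
    show "R \<subseteq> (\<Union>s\<in>S. cell s)"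
    proof
      fix y assume y: "y \<in> R"
      obtain s where "s \<in> rp_max P" "y \<in> cell s" using ex_cell by blast
      then show "y \<in> (\<Union>s\<in>S. cell s)" using spread y unfolding S_def by blast
    qed
  qed (auto simp: S_def)
  have nR: "- R = (\<Union>s\<in>rp_max P - S. cell s)"
  proof
    show "- R \<subseteq> (\<Union>s\<in>rp_max P - S. cell s)"
    proof
      fix y assume y: "y \<in> - R"
      obtain s where "s \<in> rp_max P" "y \<in> cell s" using ex_cell by blast
      then show "y \<in> (\<Union>s\<in>rp_max P - S. cell s)" using y unfolding S_def by blast
    qed
    show "(\<Union>s\<in>rp_max P - S. cell s) \<subseteq> - R" using spread unfolding S_def by blast
  qed
  have cR: "closed R" unfolding R by (rule closed_Union_cells) (auto simp: S_def)
  have cnR: "closed (- R)" unfolding nR by (rule closed_Union_cells) auto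
  have "R \<inter> UNIV = {} \<or> - R \<inter> UNIV = {}"
    by (rule connected_closedD[OF X_connected _ _ cR cnR]) auto
  moreover have "x \<in> R"
  proof -
    obtain s where "s \<in> rp_max P" "x \<in> cell s" using ex_cell by blast
    then show ?thesis unfolding R_def using cell_reach by blast
  qed
  ultimately have "y \<in> R" by auto
  then show ?thesis unfolding R_def by simp
qed

text \<open>Finiteness ensures that \<open>enn2real\<close> in \<open>rp_dist\<close> does not turn
  an infinite distance into 0.\<close>

lemma edist_finite: "rp_edist P x y < \<infinity>"
proof -
  obtain C where "reach C x y" using reach_all by blast
  then show ?thesis using reach_edist[of C x y] by (metis ennreal_less_top infinity_ennreal_def le_less_trans)
qed

text \<open>The factor 2 is the price of bending the paths in \<open>dom_reach\<close>; the strict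
  inequality assumed there is met by a margin that tends to 0.\<close>

lemma dist_param_le:
  assumes s: "s \<in> rp_max P" and x: "x \<in> rp_dom P s" and y: "y \<in> rp_dom P s"
  shows "rp_dist P (rp_param P s x) (rp_param P s y) \<le> 2 * \<Lambda> * dist x y"
proof -
  have "rp_dist P (rp_param P s x) (rp_param P s y) \<le> 2 * \<Lambda> * dist x y + e" if e: "e > 0" for e
  proof -
    define r where "r = dist x y + e / (2 * \<Lambda>)"
    have "rp_edist P (rp_param P s x) (rp_param P s y) \<le> ennreal (\<Lambda> * (2 * r))"
      by (intro reach_edist dom_reach[OF s x y]) (use e Lambda in \<open>simp add: r_def\<close>)
    then have "rp_dist P (rp_param P s x) (rp_param P s y) \<le> \<Lambda> * (2 * r)"
      unfolding rp_dist_def using e Lambda by (intro enn2real_leI) (auto simp: r_def)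
    also have "\<dots> = 2 * \<Lambda> * dist x y + e" using Lambda by (simp add: r_def field_simps)
    finally show ?thesis .
  qed
  then show ?thesis by (rule field_le_epsilon)
qed

text \<open>Near t the path stays in the open simplex s, where \<open>emb\<close> is the isometric
  affine chart applied to the coordinates. So the derivative of the embedded path lies in the span
  of the frame and has the same length as the coordinate derivative.\<close>

lemma coord_derivative:
  assumes s: "s \<in> rp_max P" and car: "rp_carrier P (\<gamma> t) = s" and T: "open T" "t \<in> T" "continuous_on T \<gamma>"
    and d: "((\<lambda>\<tau>. emb (\<gamma> \<tau>)) has_vector_derivative k) (at t)"
  shows "\<exists>w. ((\<lambda>\<tau>. rp_coord P s (\<gamma> \<tau>)) has_vector_derivative w) (at t) \<and> norm w = norm k"
proof -
  define A where "A e = (\<chi> i. e \<bullet> rp_frame P s i)" for e :: 'e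
  have "linear A" by (rule linearI) (auto simp: A_def vec_eq_iff inner_add_left)
  then have A: "bounded_linear A" using linear_conv_bounded_linear by blast
  have "((\<lambda>\<tau>. emb (\<gamma> \<tau>) - rp_origin P s) has_vector_derivative k) (at t)"
    using d by (auto intro!: derivative_eq_intros)
  then have "((\<lambda>\<tau>. A (emb (\<gamma> \<tau>) - rp_origin P s)) has_vector_derivative A k) (at t)"
    by (rule bounded_linear.has_vector_derivative[OF A])
  then have w: "((\<lambda>\<tau>. rp_coord P s (\<gamma> \<tau>)) has_vector_derivative A k) (at t)"
    by (simp add: rp_coord_def A_def emb_def)
  define B where "B x = (\<Sum>i\<in>UNIV. (x $ i) *\<^sub>R rp_frame P s i)" for x :: "real^'n"
  have "linear B" by (rule linearI) (auto simp: B_def scaleR_add_left sum.distrib scaleR_sum_right)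
  then have B: "bounded_linear B" using linear_conv_bounded_linear by blast
  have "((\<lambda>\<tau>. B (rp_coord P s (\<gamma> \<tau>))) has_vector_derivative B (A k)) (at t)"
    by (rule bounded_linear.has_vector_derivative[OF B w])
  then have "((\<lambda>\<tau>. rp_origin P s + B (rp_coord P s (\<gamma> \<tau>))) has_vector_derivative B (A k)) (at t)"
    by (auto intro!: derivative_eq_intros)
  moreover have "open (T \<inter> \<gamma> -` {y. rp_carrier P y = s})"
    using continuous_open_preimage[OF T(3,1) open_simplex[OF s]] .
  ultimately have "((\<lambda>\<tau>. emb (\<gamma> \<tau>)) has_vector_derivative B (A k)) (at t)"
  proof (rule has_vector_derivative_near)
    fix \<tau> assume "\<tau> \<in> T \<inter> \<gamma> -` {y. rp_carrier P y = s}"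
    then show "emb (\<gamma> \<tau>) = rp_origin P s + B (rp_coord P s (\<gamma> \<tau>))"
      using chart_coord[OF s, of "\<gamma> \<tau>"] by (simp add: rp_chart_def B_def)
  qed (use T car in simp)
  then have "k = B (A k)" using d by (rule vector_derivative_unique_at[rotated])
  then have "norm k = norm (A k)" using frame_sum_norm[OF s, of "A k"] by (simp add: B_def)
  then show ?thesis using w by (intro exI[of _ "A k"]) simp
qed

text \<open>The embedded path is projected onto the unit vector e that points from
  \<open>emb x\<close> to \<open>emb y\<close>. The derivative of the projection is at most the
  Euclidean speed, which by ellipticity is at most \<Lambda> times the Riemannian speed. The path
  meets the points where this argument fails only on a null set of parameters.\<close>

lemma emb_dist_le_length:
  assumes tr: "\<gamma> \<in> transversal_paths {y. \<not> (elliptic \<Lambda> (rp_g P y) \<and> rp_carrier P y \<in> rp_max P)} x y"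
  shows "ennreal (dist (emb x) (emb y) / \<Lambda>) \<le> rp_length P \<gamma>"
proof (cases "emb x = emb y")
  case False
  obtain L where L: "L-lipschitz_on {0..1} \<gamma>" and g: "\<gamma> 0 = x" "\<gamma> 1 = y"
    and null: "{t \<in> {0..1}. \<not> (elliptic \<Lambda> (rp_g P (\<gamma> t)) \<and> rp_carrier P (\<gamma> t) \<in> rp_max P)} \<in> null_sets lebesgue"
    using tr unfolding transversal_paths_def by auto
  have "locally_lipschitz {0..1} dist dist (emb \<circ> \<gamma>)"
    by (rule locally_lipschitz_compose[OF lipschitz_imp_locally_lipschitz[OF L] emb_lip]) auto
  then obtain K where K: "K-lipschitz_on {0..1} (emb \<circ> \<gamma>)" using locally_lipschitz_compact[OF _ compact_Icc] by blast
  \<comment> \<open>Constant continuation outside the unit interval, so that the lemmas on functions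
    of all real parameters apply.\<close>
  define c where "c t = emb (\<gamma> (max 0 (min 1 t)))" for t :: real
  have c: "K-lipschitz_on UNIV c"
  proof (rule lipschitz_onI)
    fix t u :: real
    have "dist (c t) (c u) \<le> K * dist (max 0 (min 1 t)) (max 0 (min 1 u))"
      using lipschitz_onD[OF K, of "max 0 (min 1 t)" "max 0 (min 1 u)"] by (simp add: c_def)
    also have "\<dots> \<le> K * dist t u" using lipschitz_on_nonneg[OF K] by (intro mult_left_mono) (auto simp: dist_real_def)
    finally show "dist (c t) (c u) \<le> K * dist t u" .
  qed (rule lipschitz_on_nonneg[OF K])
  define e where "e = (1 / norm (emb y - emb x)) *\<^sub>R (emb y - emb x)"
  have ne: "norm e = 1" using False by (simp add: e_def)
  have ee: "(emb y - emb x) \<bullet> e = norm (emb y - emb x)"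
    using False by (simp add: e_def power2_norm_eq_inner[symmetric] power2_eq_square)
  have "K-lipschitz_on UNIV (\<lambda>t. c t \<bullet> e)"
  proof (rule lipschitz_onI)
    fix t u
    have "dist (c t \<bullet> e) (c u \<bullet> e) \<le> dist (c t) (c u)"
      using Cauchy_Schwarz_ineq2[of "c t - c u" e] ne by (simp add: dist_norm inner_diff_left)
    also have "\<dots> \<le> K * dist t u" by (rule lipschitz_onD[OF c]) auto
    finally show "dist (c t \<bullet> e) (c u \<bullet> e) \<le> K * dist t u" .
  qed (rule lipschitz_on_nonneg[OF c])
  then have "\<exists>h::real \<Rightarrow> real. h \<in> borel_measurable borel \<and> (AE t in lborel. ((\<lambda>t. c t \<bullet> e) has_real_derivative h t) (at t)) \<and>
    ennreal \<bar>c 1 \<bullet> e - c 0 \<bullet> e\<bar> \<le> (\<integral>\<^sup>+t. ennreal \<bar>h t\<bar> * indicator {0..1} t \<partial>lborel)"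
    by (rule lipschitz_real_derivative) auto
  then obtain h :: "real \<Rightarrow> real" where [measurable]: "h \<in> borel_measurable borel"
    and h: "AE t in lborel. ((\<lambda>t. c t \<bullet> e) has_real_derivative h t) (at t)"
    and hi: "ennreal \<bar>c 1 \<bullet> e - c 0 \<bullet> e\<bar> \<le> (\<integral>\<^sup>+t. ennreal \<bar>h t\<bar> * indicator {0..1} t \<partial>lborel)" by blast
  obtain k where k: "AE t in lborel. (c has_vector_derivative k t) (at t)" using AE_curve_derivative[OF c] by blast
  have fin: "AE t in lborel. t \<notin> {0, 1::real}" by (intro AE_not_in) (simp add: finite_imp_null_set_lborel)
  have "AE t in lebesgue. ennreal \<bar>h t\<bar> * indicator {0..1} t \<le> ennreal \<Lambda> * (ennreal (rp_speed P \<gamma> t) * indicator {0..1} t)"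
    using AE_completion[OF h] AE_completion[OF k] AE_completion[OF fin] AE_not_in[OF null]
  proof eventually_elim
    case (elim t)
    show ?case
    proof (cases "t \<in> {0..1}")
      case True
      then have t: "t \<in> {0<..<1}" using elim(3) by auto
      let ?s = "rp_carrier P (\<gamma> t)"
      have ell: "elliptic \<Lambda> (rp_g P (\<gamma> t))" and s: "?s \<in> rp_max P" using elim(4) True by auto
      have "((\<lambda>\<tau>. emb (\<gamma> \<tau>)) has_vector_derivative k t) (at t)"
        by (rule has_vector_derivative_near[OF elim(2), of "{0<..<1}"]) (use t in \<open>auto simp: c_def\<close>)
      moreover have "continuous_on {0<..<1} \<gamma>"
        using lipschitz_on_continuous_on[OF L] by (rule continuous_on_subset) auto
      ultimately obtain w where w: "((\<lambda>\<tau>. rp_coord P ?s (\<gamma> \<tau>)) has_vector_derivative w) (at t)" "norm w = norm (k t)"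
        using coord_derivative[OF s, of \<gamma> t "{0<..<1}" "k t"] t by auto
      have "((\<lambda>t. c t \<bullet> e) has_vector_derivative (k t \<bullet> e)) (at t)"
        by (rule bounded_linear.has_vector_derivative[OF bounded_linear_inner_left elim(2)])
      then have "h t = k t \<bullet> e" using elim(1)
        by (metis has_real_derivative_iff_has_vector_derivative vector_derivative_unique_at)
      then have "\<bar>h t\<bar> \<le> norm w" using Cauchy_Schwarz_ineq2[of "k t" e] ne w(2) by simp
      also have "\<dots> \<le> \<Lambda> * sqrt (w \<bullet> (rp_g P (\<gamma> t) *v w))"
      proof -
        have "norm w = sqrt ((norm w)\<^sup>2)" by simp
        also have "\<dots> \<le> sqrt (\<Lambda>\<^sup>2 * (w \<bullet> (rp_g P (\<gamma> t) *v w)))"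
          by (rule real_sqrt_le_mono[OF elliptic_lower[OF ell Lambda]])
        also have "\<dots> = \<Lambda> * sqrt (w \<bullet> (rp_g P (\<gamma> t) *v w))" using Lambda by (simp add: real_sqrt_mult)
        finally show ?thesis .
      qed
      also have "sqrt (w \<bullet> (rp_g P (\<gamma> t) *v w)) = rp_speed P \<gamma> t"
        unfolding rp_speed_def Let_def vector_derivative_at[OF w(1)] using s by (simp add: rp_inner_def)
      finally show ?thesis using True Lambda by (simp add: ennreal_mult'[symmetric] ennreal_leI)
    qed simp
  qed
  \<comment> \<open>The factor \<Lambda> moves to the side of the measurable function h before
    integration, since the speed is not known to be measurable and a constant could not be taken out
    of its integral.\<close>
  then have "AE t in lebesgue. ennreal (\<bar>h t\<bar> / \<Lambda>) * indicator {0..1} t \<le> ennreal (rp_speed P \<gamma> t) * indicator {0..1} t"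
  proof eventually_elim
    case (elim t)
    show ?case
    proof (cases "t \<in> {0..1}")
      case True
      then have "ennreal \<bar>h t\<bar> \<le> ennreal (\<Lambda> * rp_speed P \<gamma> t)" using elim Lambda by (simp add: ennreal_mult')
      then have "\<bar>h t\<bar> \<le> \<Lambda> * rp_speed P \<gamma> t \<or> (h t = 0)"
        by (cases "0 \<le> \<Lambda> * rp_speed P \<gamma> t") (auto simp: ennreal_neg)
      then have "\<bar>h t\<bar> / \<Lambda> \<le> rp_speed P \<gamma> t \<or> h t = 0" using Lambda by (simp add: field_simps)
      then show ?thesis using True by (auto intro: ennreal_leI)
    qed simp
  qed
  then have "(\<integral>\<^sup>+t. ennreal (\<bar>h t\<bar> / \<Lambda>) * indicator {0..1} t \<partial>lebesgue) \<le> rp_length P \<gamma>"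
    unfolding rp_length_def by (rule nn_integral_mono_AE)
  moreover have "(\<integral>\<^sup>+t. ennreal (\<bar>h t\<bar> / \<Lambda>) * indicator {0..1} t \<partial>lebesgue) = (\<integral>\<^sup>+t. ennreal (1 / \<Lambda>) * (ennreal \<bar>h t\<bar> * indicator {0..1} t) \<partial>lborel)"
    unfolding nn_integral_completion using Lambda
    by (intro nn_integral_cong) (simp add: ennreal_mult'[symmetric] mult.assoc[symmetric])
  moreover have "\<dots> = ennreal (1 / \<Lambda>) * (\<integral>\<^sup>+t. ennreal \<bar>h t\<bar> * indicator {0..1} t \<partial>lborel)"
    by (rule nn_integral_cmult) measurable
  moreover have "ennreal (dist (emb x) (emb y) / \<Lambda>) \<le> ennreal (1 / \<Lambda>) * (\<integral>\<^sup>+t. ennreal \<bar>h t\<bar> * indicator {0..1} t \<partial>lborel)"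
  proof -
    have "\<bar>c 1 \<bullet> e - c 0 \<bullet> e\<bar> = dist (emb x) (emb y)"
      using ee g by (simp add: c_def inner_diff_left[symmetric] dist_norm norm_minus_commute)
    then have "ennreal (dist (emb x) (emb y) / \<Lambda>) = ennreal (1 / \<Lambda>) * ennreal \<bar>c 1 \<bullet> e - c 0 \<bullet> e\<bar>"
      using Lambda by (simp add: ennreal_mult'[symmetric])
    then show ?thesis using hi by (simp add: mult_left_mono)
  qed
  ultimately show ?thesis by simp
qed simp

text \<open>For a lower bound of the supremum in \<open>rp_edist\<close> one null set suffices: the
  points on the skeleton together with those where the metric is not elliptic.\<close>

lemma emb_dist_le: "dist (emb x) (emb y) \<le> \<Lambda> * rp_dist P x y"
proof -
  let ?Z = "{y. \<not> (elliptic \<Lambda> (rp_g P y) \<and> rp_carrier P y \<in> rp_max P)}"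
  have "?Z \<in> null_sets (rp_vol P)" unfolding null_vol_AE using AE_elliptic AE_carrier_max by eventually_elim simp
  then have "(INF \<gamma>\<in>transversal_paths ?Z x y. rp_length P \<gamma>) \<le> rp_edist P x y"
    unfolding rp_edist_def by (rule SUP_upper)
  moreover have "ennreal (dist (emb x) (emb y) / \<Lambda>) \<le> (INF \<gamma>\<in>transversal_paths ?Z x y. rp_length P \<gamma>)"
    by (rule INF_greatest) (rule emb_dist_le_length)
  ultimately have "ennreal (dist (emb x) (emb y) / \<Lambda>) \<le> rp_edist P x y" by simp
  also have "\<dots> = ennreal (rp_dist P x y)" unfolding rp_dist_def using edist_finite[of x y] by simp
  finally have "dist (emb x) (emb y) / \<Lambda> \<le> rp_dist P x y" by (simp add: rp_dist_def)
  then show ?thesis using Lambda by (simp add: field_simps)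
qed

subsection \<open>Exhaustion, measurability and integration\<close>

lemma vert_dom: "s \<in> rp_max P \<Longrightarrow> v \<in> s \<Longrightarrow> vert s v \<in> rp_dom P s"
  by (simp add: dom_iff lam_vert)

text \<open>The star is a union of images of convex sets, one for each maximal simplex that contains
  v, and all of them contain the vertex v itself.\<close>

lemma connected_star: "connected {y. v \<in> rp_carrier P y}"
proof -
  define Q where "Q s = rp_param P s ` {x \<in> rp_dom P s. 0 < lam s x v}" for s
  have star: "{y. v \<in> rp_carrier P y} = (\<Union>s\<in>{s \<in> rp_max P. v \<in> s}. Q s)"
  proof
    show "{y. v \<in> rp_carrier P y} \<subseteq> (\<Union>s\<in>{s \<in> rp_max P. v \<in> s}. Q s)"
    proof
      fix y assume y: "y \<in> {y. v \<in> rp_carrier P y}"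
      obtain s where s: "s \<in> rp_max P" "y \<in> cell s" using ex_cell by blast
      then obtain x where x: "x \<in> rp_dom P s" "y = rp_param P s x" unfolding cell_image[OF s(1)] by blast
      have "v \<in> s" "0 < lam s x v" using y x carrier_param[OF s(1) x(1)] by auto
      then show "y \<in> (\<Union>s\<in>{s \<in> rp_max P. v \<in> s}. Q s)" using s x unfolding Q_def by blast
    qed
    show "(\<Union>s\<in>{s \<in> rp_max P. v \<in> s}. Q s) \<subseteq> {y. v \<in> rp_carrier P y}"
      by (auto simp: Q_def carrier_param)
  qed
  have con: "connected (Q s)" if s: "s \<in> rp_max P" "v \<in> s" for s
  proof -
    have "convex {x \<in> rp_dom P s. 0 < lam s x v}" unfolding convex_alt
    proof (intro ballI allI impI)
      fix x y and u :: real assume x: "x \<in> {x \<in> rp_dom P s. 0 < lam s x v}" and y: "y \<in> {x \<in> rp_dom P s. 0 < lam s x v}" and u: "0 \<le> u \<and> u \<le> 1"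
      have "(1 - u) *\<^sub>R x + u *\<^sub>R y \<in> rp_dom P s" using convex_dom[OF s(1)] x y u unfolding convex_alt by blast
      moreover have "0 < (1 - u) * lam s x v + u * lam s y v"
      proof (cases "u = 0")
        case False then show ?thesis using x y u by (intro add_nonneg_pos) auto
      qed (use x in simp)
      ultimately show "(1 - u) *\<^sub>R x + u *\<^sub>R y \<in> {x \<in> rp_dom P s. 0 < lam s x v}"
        by (simp add: lam_convex[OF s])
    qed
    then show ?thesis unfolding Q_def
      by (intro connected_continuous_image[OF continuous_on_subset[OF continuous_param[OF s(1)]]] convex_connected) auto
  qed
  show ?thesis
  proof (cases "{s \<in> rp_max P. v \<in> s} = {}")
    case False
    then obtain s0 where s0: "s0 \<in> rp_max P" "v \<in> s0" by blast
    have same: "rp_param P s (vert s v) = rp_param P s0 (vert s0 v)" if s: "s \<in> rp_max P" "v \<in> s" for s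
    proof (rule bary_inject, rule ext)
      fix w show "rp_bary P (rp_param P s (vert s v)) w = rp_bary P (rp_param P s0 (vert s0 v)) w"
        using bary_param[OF s(1) vert_dom[OF s], of w] bary_param[OF s0(1) vert_dom[OF s0], of w]
          lam_vert[OF s(1) _ s(2), of w] lam_vert[OF s0(1) _ s0(2), of w] s s0 by (cases "w = v") auto
    qed
    have "rp_param P s0 (vert s0 v) \<in> Q s" if s: "s \<in> rp_max P" "v \<in> s" for s
      unfolding same[OF s, symmetric] Q_def using vert_dom[OF s] lam_vert[OF s s(2)] by auto
    then have "rp_param P s0 (vert s0 v) \<in> (\<Inter>s\<in>{s \<in> rp_max P. v \<in> s}. Q s)" by blast
    then have "connected (\<Union>s\<in>{s \<in> rp_max P. v \<in> s}. Q s)"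
      using con by (intro connected_Union) auto
    then show ?thesis unfolding star .
  next
    case True
    then have "{y. v \<in> rp_carrier P y} = {}" unfolding star by blast
    then show ?thesis by (simp only: connected_empty)
  qed
qed

definition stars :: "'v set \<Rightarrow> 'a set" where "stars W = (\<Union>v\<in>W. {y. v \<in> rp_carrier P y})"

lemma open_stars: "open (stars W)"
  unfolding stars_def using open_star by blast

text \<open>Starting from a nonempty star, the labels that can be joined to v0 by a finite connected
  union of stars are closed under meeting stars. If they missed a vertex, their stars and the
  remaining ones would separate X.\<close>

lemma connected_stars:
  assumes "finite W" shows "\<exists>W'. W \<subseteq> W' \<and> finite W' \<and> connected (stars W')"
proof -
  obtain v0 where v0: "{y. v0 \<in> rp_carrier P y} \<noteq> {}"
    using simplex_nonempty[OF carrier_complex] by fastforce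
  define R where "R = {w. \<exists>W. finite W \<and> v0 \<in> W \<and> w \<in> W \<and> connected (stars W)}"
  have stars_insert: "stars (insert w W) = {y. w \<in> rp_carrier P y} \<union> stars W" for w W by (auto simp: stars_def)
  have v0R: "v0 \<in> R" unfolding R_def
    by (intro CollectI exI[of _ "{v0}"]) (use connected_star[of v0] in \<open>simp add: stars_def\<close>)
  have step: "w' \<in> R" if w: "w \<in> R" and meet: "{y. w \<in> rp_carrier P y} \<inter> {y. w' \<in> rp_carrier P y} \<noteq> {}" for w w'
  proof -
    obtain W where W: "finite W" "v0 \<in> W" "w \<in> W" "connected (stars W)" using w R_def by blast
    have "{y. w' \<in> rp_carrier P y} \<inter> stars W \<noteq> {}" using meet W(3) unfolding stars_def by blast
    then have "connected (stars (insert w' W))" unfolding stars_insert using connected_star W(4) by (intro connected_Un)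
    then show ?thesis unfolding R_def using W by (intro CollectI exI[of _ "insert w' W"]) auto
  qed
  have "stars R \<inter> UNIV = {} \<or> stars (-R) \<inter> UNIV = {}"
  proof (rule connectedD[OF X_connected open_stars open_stars])
    show "stars R \<inter> stars (- R) \<inter> UNIV = {}" using step unfolding stars_def by blast
    show "UNIV \<subseteq> stars R \<union> stars (- R)"
      using simplex_nonempty[OF carrier_complex] unfolding stars_def by fastforce
  qed
  moreover have "stars R \<noteq> {}" using v0R v0 unfolding stars_def by blast
  ultimately have e: "stars (- R) = {}" by blast
  have R: "w \<in> R" for w
  proof (rule ccontr)
    assume w: "w \<notin> R"
    \<comment> \<open>A label that is not a vertex has an empty star, which can be added to any
      connected union.\<close>
    then have "{y. w \<in> rp_carrier P y} = {}" using e unfolding stars_def by blast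
    then have "connected (stars {w, v0})" unfolding stars_insert using connected_star[of v0] by (simp add: stars_def)
    then have "w \<in> R" unfolding R_def by (intro CollectI exI[of _ "{w, v0}"]) auto
    then show False using w by blast
  qed
  have "\<forall>w. \<exists>W. finite W \<and> v0 \<in> W \<and> w \<in> W \<and> connected (stars W)" using R unfolding R_def by blast
  then obtain F where F: "\<And>w. finite (F w) \<and> v0 \<in> F w \<and> w \<in> F w \<and> connected (stars (F w))" by metis
  let ?W = "\<Union>w\<in>insert v0 W. F w"
  have "stars ?W = \<Union>((\<lambda>w. stars (F w)) ` insert v0 W)" unfolding stars_def by blast
  moreover have "connected (\<Union>((\<lambda>w. stars (F w)) ` insert v0 W))"
  proof (rule connected_Union)
    show "\<And>S. S \<in> (\<lambda>w. stars (F w)) ` insert v0 W \<Longrightarrow> connected S" using F by blast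
    obtain y where "v0 \<in> rp_carrier P y" using v0 by blast
    then have "y \<in> stars (F w)" for w using F unfolding stars_def by blast
    then show "\<Inter>((\<lambda>w. stars (F w)) ` insert v0 W) \<noteq> {}" by blast
  qed
  ultimately have "connected (stars ?W)" by simp
  moreover have "W \<subseteq> ?W" using F by blast
  moreover have "finite ?W" using F assms by simp
  ultimately show ?thesis by blast
qed

text \<open>\<open>local_gradient\<close> speaks only about connected relatively compact open sets,
  whereas a finite union of cells need not be connected. It is enlarged to a connected finite union
  of open stars.\<close>

lemma exhaust_subdomain:
  assumes "finite S" "S \<subseteq> rp_max P"
  shows "\<exists>U. rel_compact_subdomain U \<and> (\<Union>s\<in>S. cell s) \<subseteq> U"
proof -
  have "finite (\<Union>S)"
  proof (rule finite_Union[OF assms(1)])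
    fix s assume "s \<in> S" then show "finite s" using assms(2) max_finite by auto
  qed
  from connected_stars[OF this] obtain W where W: "\<Union>S \<subseteq> W" "finite W" "connected (stars W)" by auto
  have "cell s \<subseteq> stars W" if "s \<in> S" for s
  proof
    fix y assume y: "y \<in> cell s"
    obtain v where "v \<in> rp_carrier P y" using simplex_nonempty[OF carrier_complex[of y]] by blast
    then show "y \<in> stars W" using y that W(1) unfolding cell_def stars_def by blast
  qed
  moreover have "compact (closure (stars W))"
  proof -
    let ?F = "\<Union>v\<in>W. {s \<in> rp_max P. v \<in> s}"
    have "finite ?F" using W(2) finite_star by simp
    then have c: "compact (\<Union>s\<in>?F. cell s)" using compact_cell by (intro compact_UN) auto
    have "stars W \<subseteq> (\<Union>s\<in>?F. cell s)"
    proof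
      fix y assume "y \<in> stars W"
      then obtain v where v: "v \<in> W" "v \<in> rp_carrier P y" unfolding stars_def by blast
      obtain s where "s \<in> rp_max P" "y \<in> cell s" using ex_cell by blast
      then show "y \<in> (\<Union>s\<in>?F. cell s)" using v star_meets_cell by blast
    qed
    then have "closure (stars W) \<subseteq> (\<Union>s\<in>?F. cell s)" using c by (intro closure_minimal compact_imp_closed)
    then have "(\<Union>s\<in>?F. cell s) \<inter> closure (stars W) = closure (stars W)" by (rule Int_absorb1)
    then show ?thesis using compact_Int_closed[OF c closed_closure[of "stars W"]] by (simp only:)
  qed
  ultimately show ?thesis using W(3) open_stars unfolding rel_compact_subdomain_def by blast
qed

section \<open>Measurability and integration in charts\<close>

lemma intr_lebesgue: "s \<in> rp_max P \<Longrightarrow> intr s \<in> sets lebesgue"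
  using open_intr[of s] by simp

lemma param_measurable:
  assumes s: "s \<in> rp_max P" shows "rp_param P s \<in> measurable (lebesgue_on (intr s)) (rp_vol P)"
proof (rule measurableI)
  fix A assume A: "A \<in> sets (rp_vol P)"
  have "rp_param P s -` A \<inter> space (lebesgue_on (intr s)) = chart_trace s A \<inter> intr s"
    using intr_subset[OF s] by (auto simp: chart_trace_def)
  moreover have "chart_trace s A \<inter> intr s \<in> sets lebesgue" using A s intr_lebesgue[OF s] by (auto simp: sets_vol)
  ultimately show "rp_param P s -` A \<inter> space (lebesgue_on (intr s)) \<in> sets (lebesgue_on (intr s))"
    using intr_lebesgue[OF s] by (auto simp: sets_restrict_space_iff)
qed auto

lemma chart_trace_sets_intr:
  assumes s: "s \<in> rp_max P"
  shows "chart_trace s A \<in> sets lebesgue \<longleftrightarrow> chart_trace s A \<inter> intr s \<in> sets lebesgue"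
proof
  assume "chart_trace s A \<inter> intr s \<in> sets lebesgue"
  moreover have "chart_trace s A - intr s \<in> sets lebesgue"
    by (rule negligible_imp_sets, rule negligible_subset[OF negligible_boundary[OF s]]) (auto simp: chart_trace_def)
  ultimately have "(chart_trace s A \<inter> intr s) \<union> (chart_trace s A - intr s) \<in> sets lebesgue" by (rule sets.Un)
  then show "chart_trace s A \<in> sets lebesgue" by (simp add: Int_Diff_Un)
qed (use intr_lebesgue[OF s] in auto)

lemma borel_measurable_volI:
  fixes h :: "'a \<Rightarrow> 'b::topological_space"
  assumes h: "\<And>s. s \<in> rp_max P \<Longrightarrow> (\<lambda>x. h (rp_param P s x)) \<in> borel_measurable (lebesgue_on (intr s))"
  shows "h \<in> borel_measurable (rp_vol P)"
proof (rule measurableI)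
  fix A :: "'b set" assume A: "A \<in> sets borel"
  have "chart_trace s (h -` A) \<in> sets lebesgue" if s: "s \<in> rp_max P" for s
  proof -
    have "(\<lambda>x. h (rp_param P s x)) -` A \<inter> space (lebesgue_on (intr s)) \<in> sets (lebesgue_on (intr s))"
      using h[OF s] A by (rule measurable_sets)
    moreover have "(\<lambda>x. h (rp_param P s x)) -` A \<inter> space (lebesgue_on (intr s)) = chart_trace s (h -` A) \<inter> intr s"
      using intr_subset[OF s] by (auto simp: chart_trace_def)
    ultimately have "chart_trace s (h -` A) \<inter> intr s \<in> sets lebesgue"
      using intr_lebesgue[OF s] by (auto simp: sets_restrict_space_iff)
    then show ?thesis using chart_trace_sets_intr[OF s] by blast
  qed
  then show "h -` A \<inter> space (rp_vol P) \<in> sets (rp_vol P)" by (simp add: sets_vol)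
qed auto

text \<open>\<open>rp_vol P\<close> is complete, because sets whose traces are Lebesgue null have
  Lebesgue measurable traces.\<close>

lemma borel_measurable_vol_AE:
  fixes h :: "'a \<Rightarrow> 'b::topological_space"
  assumes h: "h \<in> borel_measurable (rp_vol P)" and eq: "AE y in rp_vol P. h y = k y"
  shows "k \<in> borel_measurable (rp_vol P)"
proof (rule measurableI)
  fix A :: "'b set" assume A: "A \<in> sets borel"
  have hA: "h -` A \<in> sets (rp_vol P)" using measurable_sets[OF h A] by simp
  obtain N where N: "N \<in> null_sets (rp_vol P)" "{y. h y \<noteq> k y} \<subseteq> N" using eq by (auto simp: eventually_ae_filter)
  have sub: "k -` A \<inter> N \<in> sets (rp_vol P)"
  proof -
    have "negligible (chart_trace s (k -` A \<inter> N))" if "s \<in> rp_max P" for s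
      using N(1) that unfolding null_vol_iff by (elim ballE[of _ _ s] negligible_subset) (auto simp: chart_trace_def)
    then have "k -` A \<inter> N \<in> null_sets (rp_vol P)" unfolding null_vol_iff by blast
    then show ?thesis by blast
  qed
  have "h y = k y" if "y \<notin> N" for y using N(2) that by auto
  then have e: "k -` A \<inter> space (rp_vol P) = (h -` A - N) \<union> (k -` A \<inter> N)" by auto
  show "k -` A \<inter> space (rp_vol P) \<in> sets (rp_vol P)"
    unfolding e by (intro sets.Un sets.Diff hA sub null_setsD2[OF N(1)])
qed auto

definition weight :: "'v set \<Rightarrow> real^'n \<Rightarrow> real" where "weight s x = sqrt (det (rp_metric P s x))"

lemma weight_measurable_intr: assumes s: "s \<in> rp_max P" shows "weight s \<in> borel_measurable (lebesgue_on (intr s))"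
proof -
  have "(\<lambda>A::real^'n^'n. det A) \<in> borel_measurable borel"
    unfolding det_def by (intro borel_measurable_continuous_onI continuous_intros)
  moreover have "rp_metric P s \<in> borel_measurable (lebesgue_on (intr s))"
    using metric_measurable[OF s] intr_subset[OF s] by (rule measurable_restrict_mono)
  ultimately have "(\<lambda>x. det (rp_metric P s x)) \<in> borel_measurable (lebesgue_on (intr s))"
    by (rule measurable_compose[rotated])
  then show ?thesis unfolding weight_def by (rule measurable_compose[OF _ borel_measurable_sqrt])
qed

text \<open>A change of variables: the volume restricted to the open simplex is the image under
  \<open>rp_param P s\<close> of Lebesgue measure with the density \<open>weight s\<close>. Sets
  inside the open simplex s have empty traces on all other maximal simplexes, so a single term of
  the sum remains.\<close>

lemma nn_integral_simplex:
  assumes s: "s \<in> rp_max P" and h: "h \<in> borel_measurable (rp_vol P)"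
  shows "(\<integral>\<^sup>+y. h y * indicator {y. rp_carrier P y = s} y \<partial>rp_vol P) = (\<integral>\<^sup>+x. ennreal (weight s x) * h (rp_param P s x) \<partial>lebesgue_on (intr s))"
proof -
  let ?O = "{y. rp_carrier P y = s}"
  let ?D = "density (lebesgue_on (intr s)) (\<lambda>x. ennreal (weight s x))"
  have wm: "(\<lambda>x. ennreal (weight s x)) \<in> borel_measurable (lebesgue_on (intr s))"
    using weight_measurable_intr[OF s] by (rule measurable_compose) auto
  have pm: "rp_param P s \<in> measurable ?D (rp_vol P)" using param_measurable[OF s] by simp
  have tr: "chart_trace t (A \<inter> ?O) = (if t = s then chart_trace s A \<inter> intr s else {})" if t: "t \<in> rp_max P" for t A
  proof (cases "t = s")
    case True then show ?thesis using intr_iff[OF s] by (auto simp: chart_trace_def)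
  next
    case False
    have "rp_carrier P (rp_param P t x) \<noteq> s" if "x \<in> rp_dom P t" for x
      using carrier_param[OF t that] max_maximal[OF s max_complex[OF t]] False by auto
    then show ?thesis using False by (auto simp: chart_trace_def)
  qed
  have O: "?O \<in> sets (rp_vol P)"
    unfolding sets_vol using tr[of _ UNIV] intr_lebesgue[OF s] intr_subset[OF s] dom_lebesgue[OF s]
    by (auto simp: chart_trace_def intro!: sets.Int)
  have "density (rp_vol P) (indicator ?O) = distr ?D (rp_vol P) (rp_param P s)"
  proof (rule measure_eqI)
    fix A assume "A \<in> sets (density (rp_vol P) (indicator ?O))"
    then have A: "A \<in> sets (rp_vol P)" by simp
    have "emeasure (density (rp_vol P) (indicator ?O)) A = (\<integral>\<^sup>+y. indicator ?O y * indicator A y \<partial>rp_vol P)"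
      using A O by (intro emeasure_density) auto
    also have "\<dots> = (\<integral>\<^sup>+y. indicator (A \<inter> ?O) y \<partial>rp_vol P)"
      by (intro nn_integral_cong) (auto simp: indicator_def)
    also have "\<dots> = emeasure (rp_vol P) (A \<inter> ?O)" using A O by simp
    also have "\<dots> = (\<integral>\<^sup>+t. (\<integral>\<^sup>+x. ennreal (sqrt (det (rp_metric P t x))) * indicator (chart_trace t (A \<inter> ?O)) x \<partial>lebesgue) \<partial>count_space (rp_max P))"
      by (rule emeasure_vol) (use A O in auto)
    also have "\<dots> = (\<integral>\<^sup>+t. (\<integral>\<^sup>+x. ennreal (weight s x) * indicator (chart_trace s A \<inter> intr s) x \<partial>lebesgue) * indicator {s} t \<partial>count_space (rp_max P))"
      by (intro nn_integral_cong) (auto simp: tr weight_def)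
    also have "\<dots> = (\<integral>\<^sup>+x. ennreal (weight s x) * indicator (chart_trace s A \<inter> intr s) x \<partial>lebesgue)"
      using s by (subst nn_integral_cmult_indicator) auto
    also have "\<dots> = (\<integral>\<^sup>+x. ennreal (weight s x) * indicator (chart_trace s A) x \<partial>lebesgue_on (intr s))"
      using intr_lebesgue[OF s] by (subst nn_integral_restrict_space) (auto simp: indicator_inter_arith mult.assoc intro!: nn_integral_cong)
    also have "\<dots> = emeasure ?D (rp_param P s -` A \<inter> space ?D)"
    proof -
      have "rp_param P s -` A \<inter> space ?D \<in> sets (lebesgue_on (intr s))" using measurable_sets[OF pm A] by simp
      then show ?thesis using wm intr_subset[OF s]
        by (subst emeasure_density) (auto simp: chart_trace_def indicator_def intro!: nn_integral_cong)
    qed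
    also have "\<dots> = emeasure (distr ?D (rp_vol P) (rp_param P s)) A" using pm A by (simp add: emeasure_distr)
    finally show "emeasure (density (rp_vol P) (indicator ?O)) A = emeasure (distr ?D (rp_vol P) (rp_param P s)) A" .
  qed simp
  moreover have "(\<integral>\<^sup>+y. h y * indicator ?O y \<partial>rp_vol P) = (\<integral>\<^sup>+y. h y \<partial>density (rp_vol P) (indicator ?O))"
    using h O by (subst nn_integral_density) (auto simp: mult.commute)
  moreover have "(\<integral>\<^sup>+y. h y \<partial>distr ?D (rp_vol P) (rp_param P s)) = (\<integral>\<^sup>+x. h (rp_param P s x) \<partial>?D)"
    using pm h by (subst nn_integral_distr) auto
  moreover have "(\<integral>\<^sup>+x. h (rp_param P s x) \<partial>?D) = (\<integral>\<^sup>+x. ennreal (weight s x) * h (rp_param P s x) \<partial>lebesgue_on (intr s))"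
    using wm measurable_compose[OF param_measurable[OF s] h] by (rule nn_integral_density)
  ultimately show ?thesis by simp
qed

text \<open>By \<open>elliptic_det_bounds\<close> a common bound of the volume density and of its
  reciprocal.\<close>

definition dbound :: real where "dbound = sqrt (fact CARD('n) * (\<Lambda>\<^sup>2) ^ CARD('n))"

lemma dbound_pos: "dbound > 0" unfolding dbound_def using Lambda by simp

lemma weight_bounds:
  assumes s: "s \<in> rp_max P"
  shows "AE x in lebesgue. x \<in> intr s \<longrightarrow> weight s x \<le> dbound \<and> 1 / dbound \<le> weight s x"
  using elliptic_dom[OF s]
proof eventually_elim
  case (elim x)
  show ?case
  proof
    assume "x \<in> intr s"
    then have e: "elliptic \<Lambda> (rp_metric P s x)" using elim intr_subset[OF s] by blast
    show "weight s x \<le> dbound \<and> 1 / dbound \<le> weight s x"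
      using real_sqrt_le_mono[OF elliptic_det_bounds(1)[OF e Lambda]] real_sqrt_le_mono[OF elliptic_det_bounds(2)[OF e Lambda]]
      by (simp add: weight_def dbound_def real_sqrt_divide)
  qed
qed

text \<open>For maximal simplexes this is the union of the open simplexes, which differs from the
  union of the cells by a null set only.\<close>

definition opens :: "'v set set \<Rightarrow> 'a set" where "opens S = {y. rp_carrier P y \<in> S}"

lemma open_opens: "S \<subseteq> rp_max P \<Longrightarrow> open (opens S)"
proof -
  assume "S \<subseteq> rp_max P"
  moreover have "opens S = (\<Union>s\<in>S. {y. rp_carrier P y = s})" by (auto simp: opens_def)
  ultimately show ?thesis using open_simplex by (simp only:) (intro open_UN, auto)
qed

lemma continuous_vol_measurable:
  fixes h :: "'a \<Rightarrow> 'b::{second_countable_topology}"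
  assumes "continuous_on UNIV h" shows "h \<in> borel_measurable (rp_vol P)"
proof (rule borel_measurable_volI)
  fix s assume s: "s \<in> rp_max P"
  have "continuous_on (intr s) (\<lambda>x. h (rp_param P s x))"
    by (rule continuous_on_compose2[OF assms continuous_on_subset[OF continuous_param[OF s] intr_subset[OF s]]]) auto
  then show "(\<lambda>x. h (rp_param P s x)) \<in> borel_measurable (lebesgue_on (intr s))"
    by (rule continuous_imp_measurable_on_sets_lebesgue[OF _ intr_lebesgue[OF s]])
qed

lemma open_vol: "open V \<Longrightarrow> V \<in> sets (rp_vol P)"
  unfolding sets_vol
proof
  fix s assume V: "open V" and s: "s \<in> rp_max P"
  have "openin (top_of_set (rp_dom P s)) (rp_dom P s \<inter> rp_param P s -` V)"
    using continuous_param[OF s] V by (rule continuous_openin_preimage_gen)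
  then obtain T where "open T" "rp_dom P s \<inter> rp_param P s -` V = T \<inter> rp_dom P s" unfolding openin_open by auto
  moreover have "chart_trace s V = rp_dom P s \<inter> rp_param P s -` V" by (auto simp: chart_trace_def)
  ultimately show "chart_trace s V \<in> sets lebesgue" using dom_lebesgue[OF s] by auto
qed

lemma emeasure_opens_finite:
  assumes S: "finite S" "S \<subseteq> rp_max P" shows "emeasure (rp_vol P) (opens S) < \<infinity>"
proof -
  have fin: "emeasure (rp_vol P) {y. rp_carrier P y = s} < \<infinity>" if s: "s \<in> rp_max P" for s
  proof -
    have "emeasure (rp_vol P) {y. rp_carrier P y = s} = (\<integral>\<^sup>+y. 1 * indicator {y. rp_carrier P y = s} y \<partial>rp_vol P)"
      using open_vol[OF open_simplex[OF s]] by simp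
    also have "\<dots> = (\<integral>\<^sup>+x. ennreal (weight s x) * 1 \<partial>lebesgue_on (intr s))" by (rule nn_integral_simplex[OF s]) simp
    also have "\<dots> \<le> (\<integral>\<^sup>+x. ennreal dbound \<partial>lebesgue_on (intr s))"
    proof (rule nn_integral_mono_AE)
      show "AE x in lebesgue_on (intr s). ennreal (weight s x) * 1 \<le> ennreal dbound"
        using weight_bounds[OF s] intr_lebesgue[OF s] by (subst AE_restrict_space_iff) (auto elim!: eventually_mono intro!: ennreal_leI)
    qed
    also have "\<dots> < \<infinity>"
    proof -
      have "bounded (intr s)" using compact_dom[OF s] intr_subset[OF s] compact_imp_bounded bounded_subset by blast
      then have "emeasure lborel (intr s) < \<infinity>" by (rule emeasure_bounded_finite)
      then have "emeasure lebesgue (intr s) < \<infinity>" using open_intr[OF s] by simp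
      then show ?thesis using intr_lebesgue[OF s] by (simp add: emeasure_restrict_space ennreal_mult_less_top)
    qed
    finally show ?thesis .
  qed
  have "opens S = (\<Union>s\<in>S. {y. rp_carrier P y = s})" by (auto simp: opens_def)
  then have "emeasure (rp_vol P) (opens S) \<le> (\<Sum>s\<in>S. emeasure (rp_vol P) {y. rp_carrier P y = s})"
    using S open_simplex open_vol by (simp only:) (intro emeasure_subadditive_finite, auto)
  also have "\<dots> < \<infinity>" using S fin by (auto simp: less_top)
  finally show ?thesis .
qed

text \<open>The nearest-point projection extends a function on the simplex to the whole coordinate
  space without increasing its Lipschitz constant, so that the results on Lipschitz functions on
  \<open>UNIV\<close> apply.\<close>

definition pull :: "'v set \<Rightarrow> ('a \<Rightarrow> real) \<Rightarrow> real^'n \<Rightarrow> real" where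
  "pull s u x = u (rp_param P s (closest_point (rp_dom P s) x))"

lemma dom_nonempty: "s \<in> rp_max P \<Longrightarrow> rp_dom P s \<noteq> {}"
  using intr_nonempty[of s] intr_subset[of s] by blast

lemma pull_dom: "x \<in> rp_dom P s \<Longrightarrow> pull s u x = u (rp_param P s x)"
  by (simp add: pull_def closest_point_self)

lemma pull_lipschitz:
  assumes s: "s \<in> rp_max P" and u: "rp_lipschitz_on P U u" and U: "cell s \<subseteq> U"
  shows "\<exists>L. L-lipschitz_on UNIV (pull s u)"
proof -
  obtain L where L: "\<And>x y. x \<in> U \<Longrightarrow> y \<in> U \<Longrightarrow> \<bar>u x - u y\<bar> \<le> L * rp_dist P x y"
    using u unfolding rp_lipschitz_on_def by blast
  have cl: "closed (rp_dom P s)" using closed_rp_dom[OF max_finite[OF s]] .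
  have "dist (pull s u x) (pull s u y) \<le> (\<bar>L\<bar> * (2 * \<Lambda>)) * dist x y" for x y
  proof -
    let ?c = "closest_point (rp_dom P s)"
    have c: "?c x \<in> rp_dom P s" "?c y \<in> rp_dom P s" using closest_point_in_set[OF cl dom_nonempty[OF s]] by auto
    have U': "rp_param P s (?c x) \<in> U" "rp_param P s (?c y) \<in> U" using c U unfolding cell_image[OF s] by auto
    have "dist (pull s u x) (pull s u y) \<le> L * rp_dist P (rp_param P s (?c x)) (rp_param P s (?c y))"
      unfolding pull_def dist_real_def by (rule L[OF U'])
    also have "\<dots> \<le> \<bar>L\<bar> * rp_dist P (rp_param P s (?c x)) (rp_param P s (?c y))"
      by (intro mult_right_mono) (auto simp: rp_dist_def)
    also have "\<dots> \<le> \<bar>L\<bar> * (2 * \<Lambda> * dist (?c x) (?c y))" by (intro mult_left_mono dist_param_le[OF s c]) simp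
    also have "\<dots> \<le> \<bar>L\<bar> * (2 * \<Lambda> * dist x y)"
      using closest_point_lipschitz[OF convex_dom[OF s] cl dom_nonempty[OF s]] Lambda by (intro mult_left_mono) auto
    finally show ?thesis by (simp add: mult.assoc)
  qed
  then show ?thesis using Lambda by (intro exI[of _ "\<bar>L\<bar> * (2 * \<Lambda>)"] lipschitz_onI) auto
qed

text \<open>The covector of the coordinate derivatives, that is, \<open>rp_grad\<close> before its
  index is raised.\<close>

definition part :: "('a \<Rightarrow> real) \<Rightarrow> 'a \<Rightarrow> real^'n" where
  "part u y = (\<chi> j. deriv (\<lambda>t. u (rp_param P (rp_carrier P y) (rp_coord P (rp_carrier P y) y + t *\<^sub>R axis j 1))) 0)"

text \<open>\<open>deriv\<close> has a value even where no derivative exists; this predicate records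
  genuine differentiability along the coordinate axes.\<close>

definition has_part :: "('a \<Rightarrow> real) \<Rightarrow> 'a \<Rightarrow> real^'n \<Rightarrow> bool" where
  "has_part u y p \<longleftrightarrow> (\<forall>j. ((\<lambda>t. u (rp_param P (rp_carrier P y) (rp_coord P (rp_carrier P y) y + t *\<^sub>R axis j 1))) has_real_derivative p $ j) (at 0))"

lemma grad_part: "rp_grad P u y = matrix_inv (rp_g P y) *v part u y"
  by (simp add: rp_grad_def part_def Let_def)

lemma has_part_part: "has_part u y p \<Longrightarrow> part u y = p"
  unfolding has_part_def part_def by (simp add: vec_eq_iff DERIV_imp_deriv)

lemma has_part_intr:
  assumes s: "s \<in> rp_max P" and x: "x \<in> intr s"
  shows "has_part u (rp_param P s x) p \<longleftrightarrow> (\<forall>j. ((\<lambda>t. u (rp_param P s (x + t *\<^sub>R axis j 1))) has_real_derivative p $ j) (at 0))"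
  using carrier_intr[OF s x] coord_param[OF s] x intr_subset[OF s] unfolding has_part_def by auto

lemma eventually_intr:
  assumes s: "s \<in> rp_max P" and x: "x \<in> intr s"
  shows "eventually (\<lambda>t. x + t *\<^sub>R h \<in> intr s) (nhds (0::real))"
proof -
  have "continuous_on UNIV (\<lambda>t::real. x + t *\<^sub>R h)" by (intro continuous_intros)
  then have "open ((\<lambda>t::real. x + t *\<^sub>R h) -` intr s)" using open_intr[OF s] by (rule open_vimage[rotated])
  then show ?thesis using x by (auto simp: eventually_nhds)
qed

text \<open>A Borel representative of \<open>part u\<close> in the chart of s, defined on the whole
  coordinate space.\<close>

definition pdv :: "'v set \<Rightarrow> ('a \<Rightarrow> real) \<Rightarrow> real^'n \<Rightarrow> real^'n" where
  "pdv s u x = (\<chi> j. dir_deriv (axis j 1) (pull s u) x)"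

lemma AE_has_part:
  assumes s: "s \<in> rp_max P" and u: "rp_lipschitz_on P U u" and U: "cell s \<subseteq> U"
  shows "AE x in lebesgue. x \<in> intr s \<longrightarrow> has_part u (rp_param P s x) (pdv s u x)"
proof -
  obtain L where L: "L-lipschitz_on UNIV (pull s u)" using pull_lipschitz[OF assms] by blast
  have "AE x in lborel. \<forall>j\<in>UNIV. ((\<lambda>t. pull s u (x + t *\<^sub>R axis j 1)) has_real_derivative dir_deriv (axis j 1) (pull s u) x) (at 0)"
    by (rule AE_finite_allI) (auto intro: AE_dir_deriv[OF L])
  from AE_completion[OF this] show ?thesis
  proof eventually_elim
    case (elim x)
    show ?case
    proof
      assume x: "x \<in> intr s"
      show "has_part u (rp_param P s x) (pdv s u x)"
        unfolding has_part_intr[OF s x]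
      proof
        fix j
        have d: "((\<lambda>t. pull s u (x + t *\<^sub>R axis j 1)) has_real_derivative pdv s u x $ j) (at 0)"
          using elim by (simp add: pdv_def)
        have ev: "eventually (\<lambda>t. pull s u (x + t *\<^sub>R axis j 1) = u (rp_param P s (x + t *\<^sub>R axis j 1))) (nhds 0)"
          using eventually_intr[OF s x, of "axis j 1"] by eventually_elim (use intr_subset[OF s] pull_dom in blast)
        show "((\<lambda>t. u (rp_param P s (x + t *\<^sub>R axis j 1))) has_real_derivative pdv s u x $ j) (at 0)"
          by (rule iffD1[OF DERIV_cong_ev[OF refl ev refl] d])
      qed
    qed
  qed
qed

lemma pdv_measurable:
  assumes s: "s \<in> rp_max P" and u: "rp_lipschitz_on P U u" and U: "cell s \<subseteq> U"
  shows "pdv s u \<in> borel_measurable borel"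
proof (rule vec_borel_measurable)
  fix i
  obtain L where L: "L-lipschitz_on UNIV (pull s u)" using pull_lipschitz[OF assms] by blast
  show "(\<lambda>x. pdv s u x $ i) \<in> borel_measurable borel"
    using dir_deriv_measurable[OF lipschitz_on_continuous_on[OF L], of "axis i 1"] by (simp add: pdv_def)
qed

lemma grad_measurable:
  assumes S: "S \<subseteq> rp_max P" and u: "rp_lipschitz_on P U u" and U: "\<And>s. s \<in> S \<Longrightarrow> cell s \<subseteq> U"
  shows "(\<lambda>y. indicator (opens S) y *\<^sub>R rp_grad P u y) \<in> borel_measurable (rp_vol P)"
proof (rule borel_measurable_volI)
  fix s assume s: "s \<in> rp_max P"
  show "(\<lambda>x. indicator (opens S) (rp_param P s x) *\<^sub>R rp_grad P u (rp_param P s x)) \<in> borel_measurable (lebesgue_on (intr s))"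
  proof (cases "s \<in> S")
    case True
    \<comment> \<open>Cramer's rule for \<open>rp_grad\<close>: a quotient of polynomials in the
      entries of the metric and of \<open>pdv s u\<close>, all of which are measurable.\<close>
    let ?F = "\<lambda>x. (\<chi> k. det (\<chi> i j. if j = k then pdv s u x $ i else rp_metric P s x $ i $ j) / det (rp_metric P s x)) :: real^'n"
    have pm: "pdv s u \<in> borel_measurable (lebesgue_on (intr s))"
      using pdv_measurable[OF s u U[OF True]] by (intro measurable_restrict_space1 measurable_completion) simp
    have gm: "rp_metric P s \<in> borel_measurable (lebesgue_on (intr s))"
      using metric_measurable[OF s] intr_subset[OF s] by (rule measurable_restrict_mono)
    have e1: "(\<lambda>x. pdv s u x $ i) \<in> borel_measurable (lebesgue_on (intr s))" for i by (rule vec_nth_borel_measurable[OF pm])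
    have e2: "(\<lambda>x. rp_metric P s x $ i $ j) \<in> borel_measurable (lebesgue_on (intr s))" for i j
      by (rule vec_nth_borel_measurable[OF vec_nth_borel_measurable[OF gm]])
    have "?F \<in> borel_measurable (lebesgue_on (intr s))"
    proof (rule vec_borel_measurable)
      fix k
      have "(\<lambda>x. (\<chi> i j. if j = k then pdv s u x $ i else rp_metric P s x $ i $ j) $ i $ j) \<in> borel_measurable (lebesgue_on (intr s))" for i j
        using e1 e2 by (cases "j = k") auto
      then show "(\<lambda>x. ?F x $ k) \<in> borel_measurable (lebesgue_on (intr s))"
        unfolding det_def vec_lambda_beta using e1 e2
        by (intro borel_measurable_divide borel_measurable_sum borel_measurable_times borel_measurable_prod borel_measurable_const) auto
    qed
    then show ?thesis
    proof (rule lebesgue_on_measurable_AE[OF intr_lebesgue[OF s]])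
      show "AE x in lebesgue. x \<in> intr s \<longrightarrow> ?F x = indicator (opens S) (rp_param P s x) *\<^sub>R rp_grad P u (rp_param P s x)"
        using AE_has_part[OF s u U[OF True]] elliptic_dom[OF s]
      proof eventually_elim
        case (elim x)
        show ?case
        proof
          assume x: "x \<in> intr s"
          have p: "part u (rp_param P s x) = pdv s u x" using elim x has_part_part by blast
          have e: "elliptic \<Lambda> (rp_metric P s x)" using elim x intr_subset[OF s] by blast
          show "?F x = indicator (opens S) (rp_param P s x) *\<^sub>R rp_grad P u (rp_param P s x)"
            using True carrier_intr[OF s x] elliptic_inv_cramer[OF e Lambda, of "pdv s u x"]
            by (simp add: opens_def grad_part p metric_intr[OF s x])
        qed
      qed
    qed
  next
    case False
    have "indicator (opens S) (rp_param P s x) *\<^sub>R rp_grad P u (rp_param P s x) = 0" if "x \<in> intr s" for x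
      using False carrier_intr[OF s that] by (simp add: opens_def)
    then have "(\<lambda>x. indicator (opens S) (rp_param P s x) *\<^sub>R rp_grad P u (rp_param P s x)) \<in> borel_measurable (lebesgue_on (intr s)) \<longleftrightarrow>
      (\<lambda>x. 0 :: real^'n) \<in> borel_measurable (lebesgue_on (intr s))" by (intro measurable_cong) auto
    then show ?thesis by simp
  qed
qed

lemma g_measurable: "rp_g P \<in> borel_measurable (rp_vol P)"
proof (rule borel_measurable_volI)
  fix s assume s: "s \<in> rp_max P"
  have "rp_metric P s \<in> borel_measurable (lebesgue_on (intr s))"
    using metric_measurable[OF s] intr_subset[OF s] by (rule measurable_restrict_mono)
  moreover have "(\<lambda>x. rp_g P (rp_param P s x)) \<in> borel_measurable (lebesgue_on (intr s)) \<longleftrightarrow> rp_metric P s \<in> borel_measurable (lebesgue_on (intr s))"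
    by (intro measurable_cong) (simp add: metric_intr[OF s])
  ultimately show "(\<lambda>x. rp_g P (rp_param P s x)) \<in> borel_measurable (lebesgue_on (intr s))" by simp
qed

lemma inner_measurable:
  assumes v: "v \<in> borel_measurable (rp_vol P)" and w: "w \<in> borel_measurable (rp_vol P)"
  shows "(\<lambda>y. rp_inner P y (v y) (w y)) \<in> borel_measurable (rp_vol P)"
proof -
  have "(\<lambda>y. \<Sum>i\<in>UNIV. v y $ i * (\<Sum>j\<in>UNIV. rp_g P y $ i $ j * w y $ j)) \<in> borel_measurable (rp_vol P)"
    by (intro borel_measurable_sum borel_measurable_times vec_nth_borel_measurable v w g_measurable)
  then show ?thesis by (simp add: rp_inner_def inner_vec_def matrix_vector_mult_def)
qed

subsection \<open>Cutoff and test functions\<close>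

text \<open>The squared distance is used because it is smooth also at the centre p and a quadratic
  polynomial along the coordinate lines of every chart.\<close>

definition cutoff :: "'e \<Rightarrow> real \<Rightarrow> 'a \<Rightarrow> real" where
  "cutoff p R y = max 0 (1 - (dist (emb y) p)\<^sup>2 / R\<^sup>2)"

text \<open>The differential of the square of \<open>cutoff p R\<close> in the chart of the carrier:
  twice the cutoff times the differential of 1 - |emb y - p|^2 / R^2.\<close>

definition cutoff_grad :: "'e \<Rightarrow> real \<Rightarrow> 'a \<Rightarrow> real^'n" where
  "cutoff_grad p R y = (\<chi> j. - (4 / R\<^sup>2) * cutoff p R y * ((emb y - p) \<bullet> rp_frame P (rp_carrier P y) j))"

lemma cutoff_bounds: "0 \<le> cutoff p R y" "cutoff p R y \<le> 1"
  by (simp_all add: cutoff_def)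

lemma cutoff_zero: "R > 0 \<Longrightarrow> R \<le> dist (emb y) p \<Longrightarrow> cutoff p R y = 0"
  by (simp add: cutoff_def power_mono)

text \<open>With the distances truncated at R the positive part disappears, and a difference of
  squares of numbers up to R is at most 2 R times the difference of the numbers.\<close>

lemma cutoff_lipschitz:
  assumes R: "R > 0" shows "\<bar>cutoff p R x - cutoff p R y\<bar> \<le> (2 / R) * dist (emb x) (emb y)"
proof -
  define a b where "a = min R (dist (emb x) p)" and "b = min R (dist (emb y) p)"
  have c: "cutoff p R z = 1 - (min R (dist (emb z) p))\<^sup>2 / R\<^sup>2" for z
  proof (cases "R \<le> dist (emb z) p")
    case True then show ?thesis using R cutoff_zero[OF R True] by simp
  next
    case False
    then have "(dist (emb z) p)\<^sup>2 \<le> R\<^sup>2" by (intro power_mono) auto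
    then show ?thesis using False R by (simp add: cutoff_def min_def)
  qed
  have "cutoff p R x - cutoff p R y = (b - a) * (b + a) / R\<^sup>2"
    unfolding c a_def[symmetric] b_def[symmetric] by (simp add: power2_eq_square diff_divide_distrib[symmetric] algebra_simps)
  moreover have "\<bar>b - a\<bar> \<le> dist (emb x) (emb y)"
    using dist_triangle[of "emb x" p "emb y"] dist_triangle[of "emb y" p "emb x"] unfolding a_def b_def
    by (simp add: dist_commute min_def) linarith
  moreover have "\<bar>b + a\<bar> \<le> 2 * R" using R zero_le_dist[of "emb x" p] zero_le_dist[of "emb y" p] unfolding a_def b_def by linarith
  ultimately have "\<bar>cutoff p R x - cutoff p R y\<bar> \<le> dist (emb x) (emb y) * (2 * R) / R\<^sup>2"
    using R by (simp add: abs_mult abs_divide divide_right_mono mult_mono)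
  then show ?thesis using R by (simp add: power2_eq_square field_simps)
qed

lemma norm_frame_coeffs_le:
  assumes s: "s \<in> rp_max P" shows "norm (\<chi> j. d \<bullet> rp_frame P s j) \<le> norm d"
proof -
  let ?a = "\<chi> j. d \<bullet> rp_frame P s j"
  have "norm ?a * norm ?a = ?a \<bullet> ?a" by (simp add: power2_norm_eq_inner[symmetric] power2_eq_square)
  also have "\<dots> = d \<bullet> (\<Sum>i\<in>UNIV. (?a $ i) *\<^sub>R rp_frame P s i)"
    by (simp add: inner_vec_def inner_sum_right)
  also have "\<dots> \<le> norm d * norm ?a" using norm_cauchy_schwarz[of d "\<Sum>i\<in>UNIV. (?a $ i) *\<^sub>R rp_frame P s i"] frame_sum_norm[OF s, of ?a] by simp
  finally show ?thesis by (cases "?a = 0") auto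
qed

text \<open>The factor \<open>cutoff p R y\<close> on the right lets the cross term be absorbed into
  the energy weighted with the square of the cutoff.\<close>

lemma norm_cutoff_grad:
  assumes R: "R > 0" and s: "rp_carrier P y \<in> rp_max P" shows "norm (cutoff_grad p R y) \<le> (4 / R) * cutoff p R y"
proof (cases "R \<le> dist (emb y) p")
  case True
  then have "cutoff_grad p R y = 0" by (simp add: cutoff_grad_def vec_eq_iff cutoff_zero[OF R])
  then show ?thesis using R cutoff_bounds[of p R y] by simp
next
  case False
  have "cutoff_grad p R y = (- (4 / R\<^sup>2) * cutoff p R y) *\<^sub>R (\<chi> j. (emb y - p) \<bullet> rp_frame P (rp_carrier P y) j)"
    by (simp add: cutoff_grad_def vec_eq_iff)
  then have "norm (cutoff_grad p R y) = (4 / R\<^sup>2 * cutoff p R y) * norm (\<chi> j. (emb y - p) \<bullet> rp_frame P (rp_carrier P y) j)"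
    using cutoff_bounds[of p R y] by (simp add: abs_mult)
  also have "\<dots> \<le> (4 / R\<^sup>2 * cutoff p R y) * R"
    using False norm_frame_coeffs_le[OF s, of "emb y - p"] cutoff_bounds[of p R y]
    by (intro mult_left_mono) (auto simp: dist_norm)
  also have "\<dots> = (4 / R) * cutoff p R y" using R by (simp add: power2_eq_square)
  finally show ?thesis .
qed

lemma has_part_cutoff:
  assumes s: "s \<in> rp_max P" and x: "x \<in> intr s" and R: "R > 0"
  shows "has_part (\<lambda>y. (cutoff p R y)\<^sup>2) (rp_param P s x) (cutoff_grad p R (rp_param P s x))"
  unfolding has_part_intr[OF s x]
proof
  fix j
  let ?q = "\<lambda>t. 1 - (dist (rp_chart P s x + t *\<^sub>R rp_frame P s j) p)\<^sup>2 / R\<^sup>2"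
  let ?a = "rp_chart P s x - p" and ?b = "rp_frame P s j"
  have xd: "x \<in> rp_dom P s" using x intr_subset[OF s] by blast
  have q: "?q = (\<lambda>t. 1 - (?a \<bullet> ?a + 2 * t * (?a \<bullet> ?b) + t\<^sup>2 * (?b \<bullet> ?b)) / R\<^sup>2)"
  proof
    fix t
    have "rp_chart P s x + t *\<^sub>R rp_frame P s j - p = ?a + t *\<^sub>R ?b" by simp
    then show "?q t = 1 - (?a \<bullet> ?a + 2 * t * (?a \<bullet> ?b) + t\<^sup>2 * (?b \<bullet> ?b)) / R\<^sup>2"
      unfolding dist_norm power2_norm_eq_inner
      by (simp only: inner_add_left inner_add_right inner_scaleR_left inner_scaleR_right inner_commute[of ?b ?a] power2_eq_square) (simp add: algebra_simps)
  qed
  have "(?q has_real_derivative - (2 * (?a \<bullet> ?b)) / R\<^sup>2) (at 0)" unfolding q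
  proof -
    define k where "k = 1 / R\<^sup>2"
    have "((\<lambda>t. 1 - (?a \<bullet> ?a + 2 * t * (?a \<bullet> ?b) + t\<^sup>2 * (?b \<bullet> ?b)) * k) has_real_derivative - (2 * (?a \<bullet> ?b)) * k) (at 0)"
      by (auto intro!: derivative_eq_intros)
    then show "((\<lambda>t. 1 - (?a \<bullet> ?a + 2 * t * (?a \<bullet> ?b) + t\<^sup>2 * (?b \<bullet> ?b)) / R\<^sup>2) has_real_derivative - (2 * (?a \<bullet> ?b)) / R\<^sup>2) (at 0)"
      unfolding k_def times_divide_eq_right mult_1_right .
  qed
  from DERIV_chain2[OF max_square_deriv this]
  have d: "((\<lambda>t. (max 0 (?q t))\<^sup>2) has_real_derivative 2 * max 0 (?q 0) * (- (2 * (?a \<bullet> ?b)) / R\<^sup>2)) (at 0)" .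
  have ch: "rp_chart P s (x + t *\<^sub>R axis j 1) = rp_chart P s x + t *\<^sub>R ?b" for t
  proof -
    have "((t *\<^sub>R axis j 1 :: real^'n) $ i) *\<^sub>R rp_frame P s i = (if i = j then t *\<^sub>R ?b else 0)" for i by (simp add: axis_def)
    then have "rp_chart P s (x + t *\<^sub>R axis j 1) - rp_chart P s x = t *\<^sub>R ?b" unfolding chart_diff by simp
    then show ?thesis by (simp add: algebra_simps)
  qed
  have ev: "eventually (\<lambda>t. (max 0 (?q t))\<^sup>2 = (cutoff p R (rp_param P s (x + t *\<^sub>R axis j 1)))\<^sup>2) (nhds 0)"
    using eventually_intr[OF s x, of "axis j 1"]
  proof eventually_elim
    case (elim t)
    then have "x + t *\<^sub>R axis j 1 \<in> rp_dom P s" using intr_subset[OF s] by blast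
    then show ?case by (simp add: cutoff_def emb_param[OF s] ch)
  qed
  have "cutoff_grad p R (rp_param P s x) $ j = 2 * max 0 (?q 0) * (- (2 * (?a \<bullet> ?b)) / R\<^sup>2)"
    using R by (simp add: cutoff_grad_def carrier_intr[OF s x] emb_param[OF s xd] cutoff_def)
  then show "((\<lambda>t. (cutoff p R (rp_param P s (x + t *\<^sub>R axis j 1)))\<^sup>2) has_real_derivative cutoff_grad p R (rp_param P s x) $ j) (at 0)"
    using iffD1[OF DERIV_cong_ev[OF refl ev refl] d] by simp
qed

lemma continuous_cutoff: "continuous_on UNIV (cutoff p R)"
  unfolding cutoff_def[abs_def] by (cases "R = 0") (auto intro!: continuous_intros continuous_emb)

text \<open>The value 0 outside U is imposed because u is controlled on U only; U will contain the
  cells that meet the support of the cutoff.\<close>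

definition test_fun :: "'e \<Rightarrow> real \<Rightarrow> real \<Rightarrow> 'a set \<Rightarrow> ('a \<Rightarrow> real) \<Rightarrow> 'a \<Rightarrow> real" where
  "test_fun p R e U u y = (if y \<in> U then (cutoff p R y)\<^sup>2 * smooth_pos e (u y) else 0)"

lemma test_fun_nonneg: "0 \<le> test_fun p R e U u y"
  by (simp add: test_fun_def smooth_pos_nonneg)

text \<open>A product of Lipschitz functions is Lipschitz only where the factors are bounded. On
  each compact cell boundedness follows from the continuity of \<open>pull s u\<close>.\<close>

lemma lipschitz_bounded_cells:
  assumes S: "finite S" "S \<subseteq> rp_max P" and u: "rp_lipschitz_on P U u" and U: "\<And>s. s \<in> S \<Longrightarrow> cell s \<subseteq> U"
  shows "\<exists>M. \<forall>s\<in>S. \<forall>y\<in>cell s. \<bar>u y\<bar> \<le> M"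
proof -
  have "\<exists>M. \<forall>y\<in>cell s. \<bar>u y\<bar> \<le> M" if s: "s \<in> S" for s
  proof -
    have sm: "s \<in> rp_max P" using s S by blast
    obtain L where "L-lipschitz_on UNIV (pull s u)" using pull_lipschitz[OF sm u U[OF s]] by blast
    then have "continuous_on (rp_dom P s) (pull s u)" using lipschitz_on_continuous_on continuous_on_subset by blast
    then have "bounded (pull s u ` rp_dom P s)" using compact_dom[OF sm] compact_continuous_image compact_imp_bounded by blast
    then obtain M where "\<forall>x\<in>rp_dom P s. \<bar>pull s u x\<bar> \<le> M" unfolding bounded_iff by auto
    then have "\<forall>x\<in>rp_dom P s. \<bar>u (rp_param P s x)\<bar> \<le> M" by (simp add: pull_dom)
    then show ?thesis unfolding cell_image[OF sm] by blast
  qed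
  then obtain M where M: "\<And>s. s \<in> S \<Longrightarrow> \<forall>y\<in>cell s. \<bar>u y\<bar> \<le> M s" by metis
  have "\<bar>u y\<bar> \<le> (\<Sum>s\<in>S. \<bar>M s\<bar>)" if "s \<in> S" "y \<in> cell s" for s y
  proof -
    have "\<bar>u y\<bar> \<le> \<bar>M s\<bar>" using M[OF that(1)] that(2) by force
    also have "\<dots> \<le> (\<Sum>s\<in>S. \<bar>M s\<bar>)" using S(1) that(1) by (intro member_le_sum) auto
    finally show ?thesis .
  qed
  then show ?thesis by blast
qed

lemma test_fun_Lip_c:
  assumes R: "R > 0" and e: "e > 0" and S: "finite S" "S \<subseteq> rp_max P"
    and u: "rp_lipschitz_on P U u" and U: "\<And>s. s \<in> S \<Longrightarrow> cell s \<subseteq> U"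
    and cov: "\<And>y. dist (emb y) p \<le> R \<Longrightarrow> \<exists>s\<in>S. y \<in> cell s"
  shows "test_fun p R e U u \<in> Lip_c P"
proof -
  let ?C = "emb -` cball p R" and ?\<rho> = "test_fun p R e U u"
  have C: "compact ?C" by (intro compact_emb_vimage compact_cball)
  have out: "?\<rho> y = 0" if "y \<notin> ?C" for y
    using that cutoff_zero[OF R, of y p] by (simp add: test_fun_def dist_commute)
  have "{y. ?\<rho> y \<noteq> 0} \<subseteq> ?C" using out by blast
  then have "closure {y. ?\<rho> y \<noteq> 0} \<subseteq> ?C" by (rule closure_minimal[OF _ compact_imp_closed[OF C]])
  then have "?C \<inter> closure {y. ?\<rho> y \<noteq> 0} = closure {y. ?\<rho> y \<noteq> 0}" by (rule Int_absorb1)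
  then have cpt: "compact (closure {y. ?\<rho> y \<noteq> 0})"
    using compact_Int_closed[OF C closed_closure[of "{y. ?\<rho> y \<noteq> 0}"]] by (simp only:)
  obtain M0 where M0: "\<forall>s\<in>S. \<forall>y\<in>cell s. \<bar>u y\<bar> \<le> M0" using lipschitz_bounded_cells[OF S u U] by blast
  \<comment> \<open>By \<open>smooth_pos_le\<close> this bounds \<open>smooth_pos e (u y)\<close> at
    all points of the ball.\<close>
  define M where "M = \<bar>M0\<bar> + e"
  have CU: "y \<in> U" and regM: "smooth_pos e (u y) \<le> M" if "y \<in> ?C" for y
  proof -
    have "dist (emb y) p \<le> R" using that by (simp add: dist_commute)
    then obtain s where s: "s \<in> S" "y \<in> cell s" using cov by blast
    then show "y \<in> U" using U by blast
    have "\<bar>u y\<bar> \<le> \<bar>M0\<bar>" using M0 s by force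
    moreover have "smooth_pos e (u y) \<le> \<bar>u y\<bar> + e"
    proof -
      have "smooth_pos e (u y) \<le> smooth_pos e \<bar>u y\<bar>" unfolding smooth_pos_def by simp
      then show ?thesis using smooth_pos_le[OF e, of "\<bar>u y\<bar>"] by simp
    qed
    ultimately show "smooth_pos e (u y) \<le> M" unfolding M_def by simp
  qed
  have M: "0 \<le> M" using e by (simp add: M_def)
  obtain L where L: "\<And>x y. x \<in> U \<Longrightarrow> y \<in> U \<Longrightarrow> \<bar>u x - u y\<bar> \<le> L * rp_dist P x y"
    using u unfolding rp_lipschitz_on_def by blast
  have d0: "0 \<le> rp_dist P x y" for x y by (simp add: rp_dist_def)
  have c2: "\<bar>(cutoff p R x)\<^sup>2 - (cutoff p R y)\<^sup>2\<bar> \<le> 4 / R * \<Lambda> * rp_dist P x y" for x y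
  proof -
    have "(cutoff p R x)\<^sup>2 - (cutoff p R y)\<^sup>2 = (cutoff p R x - cutoff p R y) * (cutoff p R x + cutoff p R y)"
      by (simp add: power2_eq_square algebra_simps)
    then have "\<bar>(cutoff p R x)\<^sup>2 - (cutoff p R y)\<^sup>2\<bar> = \<bar>cutoff p R x - cutoff p R y\<bar> * (cutoff p R x + cutoff p R y)"
      using cutoff_bounds[of p R x] cutoff_bounds[of p R y] by (simp add: abs_mult)
    also have "\<dots> \<le> (2 / R * dist (emb x) (emb y)) * 2"
      using cutoff_bounds[of p R x] cutoff_bounds[of p R y] R by (intro mult_mono cutoff_lipschitz[OF R]) auto
    also have "\<dots> \<le> (2 / R * (\<Lambda> * rp_dist P x y)) * 2"
      using R by (intro mult_right_mono mult_left_mono emb_dist_le) auto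
    finally show ?thesis by simp
  qed
  let ?K = "4 / R * \<Lambda> * M + \<bar>L\<bar>"
  have K1: "4 / R * \<Lambda> * rp_dist P x y * M \<le> ?K * rp_dist P x y" for x y
    using d0[of x y] by (simp add: algebra_simps)
  \<comment> \<open>If y lies outside ?C its cutoff is 0, so the difference of the squared cutoffs
    still controls the left side without any information on u at y.\<close>
  have one: "\<bar>?\<rho> x - ?\<rho> y\<bar> \<le> ?K * rp_dist P x y" if x: "x \<in> ?C" for x y
  proof (cases "y \<in> ?C")
    case True
    have "?\<rho> x - ?\<rho> y = ((cutoff p R x)\<^sup>2 - (cutoff p R y)\<^sup>2) * smooth_pos e (u x) + (cutoff p R y)\<^sup>2 * (smooth_pos e (u x) - smooth_pos e (u y))"
      using CU[OF x] CU[OF True] by (simp add: test_fun_def algebra_simps)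
    then have "\<bar>?\<rho> x - ?\<rho> y\<bar> \<le> \<bar>(cutoff p R x)\<^sup>2 - (cutoff p R y)\<^sup>2\<bar> * smooth_pos e (u x) + (cutoff p R y)\<^sup>2 * \<bar>smooth_pos e (u x) - smooth_pos e (u y)\<bar>"
      using abs_triangle_ineq[of "((cutoff p R x)\<^sup>2 - (cutoff p R y)\<^sup>2) * smooth_pos e (u x)" "(cutoff p R y)\<^sup>2 * (smooth_pos e (u x) - smooth_pos e (u y))"]
        smooth_pos_nonneg[of e "u x"] by (simp add: abs_mult)
    also have "\<dots> \<le> (4 / R * \<Lambda> * rp_dist P x y) * M + 1 * (\<bar>L\<bar> * rp_dist P x y)"
    proof (intro add_mono mult_mono)
      have "\<bar>smooth_pos e (u x) - smooth_pos e (u y)\<bar> \<le> L * rp_dist P x y"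
        using smooth_pos_lipschitz[OF e, of "u x" "u y"] L[OF CU[OF x] CU[OF True]] by linarith
      also have "\<dots> \<le> \<bar>L\<bar> * rp_dist P x y" using d0 by (intro mult_right_mono) auto
      finally show "\<bar>smooth_pos e (u x) - smooth_pos e (u y)\<bar> \<le> \<bar>L\<bar> * rp_dist P x y" .
      show "(cutoff p R y)\<^sup>2 \<le> 1" using cutoff_bounds[of p R y] by (simp add: power_le_one)
    qed (use c2 regM[OF x] smooth_pos_nonneg d0 R Lambda in auto)
    finally show ?thesis by (simp add: algebra_simps)
  next
    case False
    have cy: "cutoff p R y = 0" using False cutoff_zero[OF R, of y p] by (simp add: dist_commute)
    have "\<bar>?\<rho> x - ?\<rho> y\<bar> = \<bar>(cutoff p R x)\<^sup>2 - (cutoff p R y)\<^sup>2\<bar> * smooth_pos e (u x)"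
      using out[OF False] CU[OF x] cy smooth_pos_nonneg[of e "u x"] by (simp add: test_fun_def)
    also have "\<dots> \<le> (4 / R * \<Lambda> * rp_dist P x y) * M"
      using c2 regM[OF x] smooth_pos_nonneg d0 R Lambda by (intro mult_mono) auto
    also have "\<dots> \<le> ?K * rp_dist P x y" by (rule K1)
    finally show ?thesis .
  qed
  have "\<exists>K'. \<forall>x y. \<bar>?\<rho> x - ?\<rho> y\<bar> \<le> K' * rp_dist P x y"
  proof (intro exI allI)
    fix x y
    show "\<bar>?\<rho> x - ?\<rho> y\<bar> \<le> ?K * rp_dist P x y"
    proof (cases "x \<in> ?C")
      case x: False
      show ?thesis
      proof (cases "y \<in> ?C")
        case True
        have cx: "cutoff p R x = 0" using x cutoff_zero[OF R, of x p] by (simp add: dist_commute)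
        have "\<bar>?\<rho> x - ?\<rho> y\<bar> = \<bar>(cutoff p R x)\<^sup>2 - (cutoff p R y)\<^sup>2\<bar> * smooth_pos e (u y)"
          using out[OF x] CU[OF True] cx smooth_pos_nonneg[of e "u y"] by (simp add: test_fun_def)
        also have "\<dots> \<le> (4 / R * \<Lambda> * rp_dist P x y) * M"
          using c2 regM[OF True] smooth_pos_nonneg d0 R Lambda by (intro mult_mono) auto
        also have "\<dots> \<le> ?K * rp_dist P x y" by (rule K1)
        finally show ?thesis .
      next
        case False
        have "0 \<le> ?K * rp_dist P x y" using d0 R Lambda M by (intro mult_nonneg_nonneg add_nonneg_nonneg) auto
        then show ?thesis using out[OF x] out[OF False] by simp
      qed
    qed (rule one)
  qed
  then show ?thesis using cpt unfolding Lip_c_def rp_lipschitz_on_def by auto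
qed

lemma has_part_test_fun:
  assumes R: "R > 0" and e: "e > 0" and s: "s \<in> rp_max P" and x: "x \<in> intr s" and U: "cell s \<subseteq> U"
    and u: "has_part u (rp_param P s x) q"
  shows "has_part (test_fun p R e U u) (rp_param P s x)
    (((cutoff p R (rp_param P s x))\<^sup>2 * smooth_pos_deriv e (u (rp_param P s x))) *\<^sub>R q + smooth_pos e (u (rp_param P s x)) *\<^sub>R cutoff_grad p R (rp_param P s x))"
  unfolding has_part_intr[OF s x]
proof
  fix j
  let ?y = "\<lambda>t. rp_param P s (x + t *\<^sub>R axis j 1)"
  have du: "((\<lambda>t. u (?y t)) has_real_derivative q $ j) (at 0)" using u unfolding has_part_intr[OF s x] by blast
  have dc: "((\<lambda>t. (cutoff p R (?y t))\<^sup>2) has_real_derivative cutoff_grad p R (rp_param P s x) $ j) (at 0)"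
    using has_part_cutoff[OF s x R, of p] unfolding has_part_intr[OF s x] by blast
  have dr: "((\<lambda>t. smooth_pos e (u (?y t))) has_real_derivative smooth_pos_deriv e (u (?y 0)) * q $ j) (at 0)"
    by (rule DERIV_chain2[OF smooth_pos_deriv[OF e] du])
  have d: "((\<lambda>t. (cutoff p R (?y t))\<^sup>2 * smooth_pos e (u (?y t))) has_real_derivative
    (cutoff_grad p R (rp_param P s x) $ j * smooth_pos e (u (?y 0)) + (smooth_pos_deriv e (u (?y 0)) * q $ j) * (cutoff p R (?y 0))\<^sup>2)) (at 0)"
    by (rule DERIV_mult[OF dc dr])
  have ev: "eventually (\<lambda>t. (cutoff p R (?y t))\<^sup>2 * smooth_pos e (u (?y t)) = test_fun p R e U u (?y t)) (nhds 0)"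
    using eventually_intr[OF s x, of "axis j 1"]
  proof eventually_elim
    case (elim t)
    then have "?y t \<in> cell s" using intr_subset[OF s] unfolding cell_image[OF s] by blast
    then show ?case using U by (auto simp: test_fun_def)
  qed
  have "(((cutoff p R (rp_param P s x))\<^sup>2 * smooth_pos_deriv e (u (rp_param P s x))) *\<^sub>R q + smooth_pos e (u (rp_param P s x)) *\<^sub>R cutoff_grad p R (rp_param P s x)) $ j
    = cutoff_grad p R (rp_param P s x) $ j * smooth_pos e (u (?y 0)) + (smooth_pos_deriv e (u (?y 0)) * q $ j) * (cutoff p R (?y 0))\<^sup>2"
    by simp
  then show "((\<lambda>t. test_fun p R e U u (?y t)) has_real_derivative
    (((cutoff p R (rp_param P s x))\<^sup>2 * smooth_pos_deriv e (u (rp_param P s x))) *\<^sub>R q + smooth_pos e (u (rp_param P s x)) *\<^sub>R cutoff_grad p R (rp_param P s x)) $ j) (at 0)"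
    using iffD1[OF DERIV_cong_ev[OF refl ev refl] d] by (simp only:)
qed

lemma has_part_zero:
  assumes s: "s \<in> rp_max P" and x: "x \<in> intr s" and z: "\<And>y. y \<in> cell s \<Longrightarrow> \<rho> y = 0"
  shows "has_part \<rho> (rp_param P s x) 0"
  unfolding has_part_intr[OF s x]
proof
  fix j
  have ev: "eventually (\<lambda>t. (0::real) = \<rho> (rp_param P s (x + t *\<^sub>R axis j 1))) (nhds 0)"
    using eventually_intr[OF s x, of "axis j 1"]
  proof eventually_elim
    case (elim t)
    then have "rp_param P s (x + t *\<^sub>R axis j 1) \<in> cell s" using intr_subset[OF s] unfolding cell_image[OF s] by blast
    then show ?case using z by simp
  qed
  show "((\<lambda>t. \<rho> (rp_param P s (x + t *\<^sub>R axis j 1))) has_real_derivative 0 $ j) (at 0)"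
    using iffD1[OF DERIV_cong_ev[OF refl ev refl] DERIV_const] by simp
qed

subsection \<open>Vanishing of the gradient\<close>

text \<open>The metric cancels against its inverse, so pairing with a gradient sees only the
  coordinate derivatives.\<close>

lemma inner_grad: "elliptic \<Lambda> (rp_g P y) \<Longrightarrow> rp_inner P y v (rp_grad P u y) = v \<bullet> part u y"
  by (simp add: rp_inner_def grad_part elliptic_mult_inv[OF _ Lambda])

lemma cutoff_grad_measurable: "cutoff_grad p R \<in> borel_measurable (rp_vol P)"
proof (rule borel_measurable_volI)
  fix s assume s: "s \<in> rp_max P"
  let ?F = "\<lambda>x. (\<chi> j. - (4 / R\<^sup>2) * cutoff p R (rp_param P s x) * ((rp_chart P s x - p) \<bullet> rp_frame P s j)) :: real^'n"
  have cp: "continuous_on (intr s) (\<lambda>x. cutoff p R (rp_param P s x))"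
    by (rule continuous_on_compose2[OF continuous_cutoff continuous_on_subset[OF continuous_param[OF s] intr_subset[OF s]]]) auto
  have "continuous_on (intr s) ?F"
    unfolding rp_chart_def by (intro continuous_intros cp)
  then have "?F \<in> borel_measurable (lebesgue_on (intr s))"
    by (rule continuous_imp_measurable_on_sets_lebesgue[OF _ intr_lebesgue[OF s]])
  moreover have "cutoff_grad p R (rp_param P s x) = ?F x" if "x \<in> intr s" for x
    using that carrier_intr[OF s that] emb_param[OF s, of x] intr_subset[OF s] by (auto simp: cutoff_grad_def)
  ultimately show "(\<lambda>x. cutoff_grad p R (rp_param P s x)) \<in> borel_measurable (lebesgue_on (intr s))"
    by (subst measurable_cong[where g = ?F]) auto
qed

lemma opens_subset_cells: "opens S \<subseteq> (\<Union>s\<in>S. cell s)"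
  by (auto simp: opens_def cell_def)

lemma lipschitz_measurable_opens:
  assumes S: "S \<subseteq> rp_max P" and u: "rp_lipschitz_on P U u" and U: "\<And>s. s \<in> S \<Longrightarrow> cell s \<subseteq> U"
  shows "(\<lambda>y. indicator (opens S) y *\<^sub>R u y) \<in> borel_measurable (rp_vol P)"
proof (rule borel_measurable_volI)
  fix s assume s: "s \<in> rp_max P"
  show "(\<lambda>x. indicator (opens S) (rp_param P s x) *\<^sub>R u (rp_param P s x)) \<in> borel_measurable (lebesgue_on (intr s))"
  proof (cases "s \<in> S")
    case True
    obtain L where L: "L-lipschitz_on UNIV (pull s u)" using pull_lipschitz[OF s u U[OF True]] by blast
    have "continuous_on (intr s) (pull s u)" using lipschitz_on_continuous_on[OF L] by (rule continuous_on_subset) auto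
    then have "pull s u \<in> borel_measurable (lebesgue_on (intr s))"
      by (rule continuous_imp_measurable_on_sets_lebesgue[OF _ intr_lebesgue[OF s]])
    moreover have "indicator (opens S) (rp_param P s x) *\<^sub>R u (rp_param P s x) = pull s u x" if "x \<in> intr s" for x
      using that True carrier_intr[OF s that] intr_subset[OF s] by (auto simp: opens_def pull_dom)
    ultimately show ?thesis by (subst measurable_cong[where g = "pull s u"]) auto
  next
    case False
    have "indicator (opens S) (rp_param P s x) *\<^sub>R u (rp_param P s x) = 0" if "x \<in> intr s" for x
      using False carrier_intr[OF s that] by (simp add: opens_def)
    then show ?thesis by (subst measurable_cong[where g = "\<lambda>x. 0"]) auto
  qed
qed

text \<open>\<open>caccioppoli_limit\<close> on the open simplexes of S, the finitely many maximal
  simplexes whose cells meet the ball. With D = 4 \<Lambda> / R its constant 4 D^2, doubled because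
  (f + e)^2 \<le> 2 f^2 + 2 e^2, becomes 128 \<Lambda>^2 / R^2.\<close>

lemma energy_bound:
  assumes f: "f \<in> borel_measurable (rp_vol P)" "integrable (rp_vol P) (\<lambda>y. (f y)\<^sup>2)" "AE y in rp_vol P. 0 \<le> f y"
    and G: "local_gradient P f G"
    and weak: "\<forall>\<rho>\<in>Lip_c P. (\<forall>y. 0 \<le> \<rho> y) \<longrightarrow> (\<integral>y. rp_inner P y (G y) (rp_grad P \<rho> y) \<partial>rp_vol P) \<le> 0"
    and R: "R > 0"
  shows "\<exists>S. finite S \<and> S \<subseteq> rp_max P \<and> (\<forall>y. dist (emb y) p \<le> R \<longrightarrow> (\<exists>s\<in>S. y \<in> cell s)) \<and>
    (\<forall>s\<in>rp_max P. \<forall>y\<in>cell s. dist (emb y) p \<le> R \<longrightarrow> s \<in> S) \<and>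
    (\<lambda>y. indicator (opens S) y *\<^sub>R G y) \<in> borel_measurable (rp_vol P) \<and>
    (\<integral>\<^sup>+y. ennreal ((cutoff p R y)\<^sup>2 * rp_inner P y (G y) (G y)) * indicator (opens S) y \<partial>rp_vol P)
      \<le> ennreal (128 * \<Lambda>\<^sup>2 / R\<^sup>2 * (\<integral>y. (f y)\<^sup>2 \<partial>rp_vol P))"
proof -
  let ?M = "rp_vol P" and ?C = "emb -` cball p R"
  have C: "compact ?C" by (intro compact_emb_vimage compact_cball)
  define S where "S = {s \<in> rp_max P. cell s \<inter> ?C \<noteq> {}}"
  have S: "finite S" "S \<subseteq> rp_max P" using finite_cells_compact[OF C] unfolding S_def by auto
  have cov: "\<exists>s\<in>S. y \<in> cell s" if "dist (emb y) p \<le> R" for y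
  proof -
    obtain s where "s \<in> rp_max P" "y \<in> cell s" using ex_cell by blast
    moreover have "y \<in> ?C" using that by (simp add: dist_commute)
    ultimately show ?thesis unfolding S_def by blast
  qed
  have cov2: "s \<in> S" if "s \<in> rp_max P" "y \<in> cell s" "dist (emb y) p \<le> R" for s y
  proof -
    have "y \<in> ?C" using that by (simp add: dist_commute)
    then show ?thesis using that unfolding S_def by blast
  qed
  obtain U where U: "rel_compact_subdomain U" "(\<Union>s\<in>S. cell s) \<subseteq> U" using exhaust_subdomain[OF S] by blast
  have cU: "cell s \<subseteq> U" if "s \<in> S" for s using U(2) that by blast
  have NU: "opens S \<subseteq> U" using opens_subset_cells U(2) by blast
  have sg: "sobolev_gradient P U f G" using G U(1) unfolding local_gradient_def by blast
  then obtain u0 where u0: "\<And>k. rp_lipschitz_on P U (u0 k)" "\<And>k. sobolev_norm2 P U (u0 k) (rp_grad P (u0 k)) < \<infinity>"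
    "(\<lambda>k. sobolev_norm2 P U (\<lambda>y. u0 k y - f y) (\<lambda>y. rp_grad P (u0 k) y - G y)) \<longlonglongrightarrow> 0"
    unfolding sobolev_gradient_def by blast
  have "eventually (\<lambda>k. sobolev_norm2 P U (\<lambda>y. u0 k y - f y) (\<lambda>y. rp_grad P (u0 k) y - G y) < 1) sequentially"
    using u0(3) by (rule order_tendstoD) simp
  then obtain k0 where k0: "\<And>k. k \<ge> k0 \<Longrightarrow> sobolev_norm2 P U (\<lambda>y. u0 k y - f y) (\<lambda>y. rp_grad P (u0 k) y - G y) < 1"
    unfolding eventually_sequentially by blast
  \<comment> \<open>Dropping the first k0 terms makes every Sobolev error finite, so the error terms
    are integrable for all k.\<close>
  define u where "u k = u0 (k + k0)" for k
  define E where "E k = sobolev_norm2 P U (\<lambda>y. u k y - f y) (\<lambda>y. rp_grad P (u k) y - G y)" for k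
  have uL: "rp_lipschitz_on P U (u k)" for k using u0(1) by (simp add: u_def)
  have E1: "E k < 1" for k using k0 by (simp add: E_def u_def)
  have E0: "E \<longlonglongrightarrow> 0" unfolding E_def u_def by (rule LIMSEQ_ignore_initial_segment[OF u0(3)])
  let ?N = "opens S"
  have N: "?N \<in> sets ?M" using open_vol[OF open_opens[OF S(2)]] .
  define Q where "Q = restrict_space ?M ?N"
  have spQ: "space Q = ?N" by (simp add: Q_def space_restrict_space)
  have AEQ: "AE y in Q. H y" if "AE y in ?M. H y" for H
    unfolding Q_def using that N by (subst AE_restrict_space_iff) (auto elim: eventually_mono)
  have mQ: "h \<in> borel_measurable Q" if "h \<in> borel_measurable ?M" for h :: "'a \<Rightarrow> real"
    unfolding Q_def using that by (rule measurable_restrict_space1)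
  have nnQ: "(\<integral>\<^sup>+y. h y \<partial>Q) = (\<integral>\<^sup>+y. h y * indicator ?N y \<partial>?M)" for h
    unfolding Q_def using N by (intro nn_integral_restrict_space) simp
  have finQ: "finite_measure Q"
    by (rule finite_measureI) (use emeasure_opens_finite[OF S] N in \<open>simp add: spQ, simp add: Q_def emeasure_restrict_space\<close>)
  define GN where "GN = (\<lambda>y. indicator ?N y *\<^sub>R G y)"
  have GN: "GN \<in> borel_measurable ?M"
  proof -
    have "(\<lambda>y. indicator U y *\<^sub>R G y) \<in> borel_measurable ?M" using sg unfolding sobolev_gradient_def set_borel_measurable_def by blast
    from borel_measurable_scaleR[OF borel_measurable_indicator[OF N] this]
    have "(\<lambda>y. (indicator ?N y :: real) *\<^sub>R (indicator U y *\<^sub>R G y)) \<in> borel_measurable ?M" .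
    moreover have "(\<lambda>y. (indicator ?N y :: real) *\<^sub>R (indicator U y *\<^sub>R G y)) = GN"
    proof
      fix y show "(indicator ?N y :: real) *\<^sub>R (indicator U y *\<^sub>R G y) = GN y"
        using NU by (cases "y \<in> ?N") (auto simp: GN_def)
    qed
    ultimately show ?thesis by simp
  qed
  define VN where "VN k = (\<lambda>y. indicator ?N y *\<^sub>R rp_grad P (u k) y)" for k
  have VN: "VN k \<in> borel_measurable ?M" for k unfolding VN_def by (rule grad_measurable[OF S(2) uL cU])
  \<comment> \<open>The notation of \<open>caccioppoli_limit\<close>. In addition, V is the energy
    density of \<open>u k\<close>; it enters through the bound of A by 2 V + 2 B, which makes A
    integrable.\<close>
  define A where "A = (\<lambda>y. rp_inner P y (G y) (G y))"
  define I where "I k = (\<lambda>y. rp_inner P y (G y) (rp_grad P (u k) y))" for k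
  define V where "V k = (\<lambda>y. rp_inner P y (rp_grad P (u k) y) (rp_grad P (u k) y))" for k
  define B where "B k = (\<lambda>y. rp_inner P y (rp_grad P (u k) y - G y) (rp_grad P (u k) y - G y))" for k
  define c where "c = (\<lambda>y. G y \<bullet> cutoff_grad p R y)"
  have mA: "A \<in> borel_measurable Q"
    by (subst measurable_cong[where g = "\<lambda>y. rp_inner P y (GN y) (GN y)"]) (auto simp: spQ A_def GN_def intro!: mQ inner_measurable GN[unfolded GN_def])
  have mI: "I k \<in> borel_measurable Q" for k
    by (subst measurable_cong[where g = "\<lambda>y. rp_inner P y (GN y) (VN k y)"]) (auto simp: spQ I_def GN_def VN_def intro!: mQ inner_measurable GN[unfolded GN_def] VN[unfolded VN_def])
  have mV: "V k \<in> borel_measurable Q" for k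
    by (subst measurable_cong[where g = "\<lambda>y. rp_inner P y (VN k y) (VN k y)"]) (auto simp: spQ V_def VN_def intro!: mQ inner_measurable VN[unfolded VN_def])
  have mB: "B k \<in> borel_measurable Q" for k
  proof -
    have "(\<lambda>y. rp_inner P y (VN k y - GN y) (VN k y - GN y)) \<in> borel_measurable Q"
      by (intro mQ inner_measurable borel_measurable_diff GN VN)
    then show ?thesis by (subst measurable_cong[where g = "\<lambda>y. rp_inner P y (VN k y - GN y) (VN k y - GN y)"]) (auto simp: spQ B_def GN_def VN_def)
  qed
  have mc: "c \<in> borel_measurable Q"
  proof -
    have "(\<lambda>y. GN y \<bullet> cutoff_grad p R y) \<in> borel_measurable Q"
      by (intro mQ borel_measurable_inner GN cutoff_grad_measurable)
    then show ?thesis by (subst measurable_cong[where g = "\<lambda>y. GN y \<bullet> cutoff_grad p R y"]) (auto simp: spQ c_def GN_def)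
  qed
  have mu: "u k \<in> borel_measurable Q" for k
  proof -
    have "(\<lambda>y. indicator ?N y *\<^sub>R u k y) \<in> borel_measurable Q" by (intro mQ lipschitz_measurable_opens[OF S(2) uL cU])
    then show ?thesis by (subst measurable_cong[where g = "\<lambda>y. indicator ?N y *\<^sub>R u k y"]) (auto simp: spQ)
  qed
  have mf: "f \<in> borel_measurable Q" by (rule mQ[OF f(1)])
  have mcut: "cutoff p R \<in> borel_measurable Q" by (intro mQ continuous_vol_measurable continuous_cutoff)
  have ell: "AE y in Q. elliptic \<Lambda> (rp_g P y)" by (rule AEQ[OF AE_elliptic])
  have pos: "elliptic \<Lambda> (rp_g P y) \<Longrightarrow> 0 \<le> rp_inner P y v v" for y v
    unfolding rp_inner_def by (rule elliptic_nonneg)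
  have A0: "AE y in Q. 0 \<le> A y" using ell by eventually_elim (simp add: A_def pos)
  have V0: "AE y in Q. 0 \<le> V k y" for k using ell by eventually_elim (simp add: V_def pos)
  have B0: "AE y in Q. 0 \<le> B k y" for k using ell by eventually_elim (simp add: B_def pos)
  have EQ: "(\<integral>\<^sup>+y. ennreal ((u k y - f y)\<^sup>2 + B k y) \<partial>Q) \<le> E k" for k
    unfolding nnQ E_def sobolev_norm2_def B_def using NU by (intro nn_integral_mono) (auto simp: indicator_def)
  have uE: "(\<integral>\<^sup>+y. ennreal ((u k y - f y)\<^sup>2) \<partial>Q) \<le> E k" for k
  proof -
    have "(\<integral>\<^sup>+y. ennreal ((u k y - f y)\<^sup>2) \<partial>Q) \<le> (\<integral>\<^sup>+y. ennreal ((u k y - f y)\<^sup>2 + B k y) \<partial>Q)"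
      using B0[of k] by (intro nn_integral_mono_AE) (auto elim!: eventually_mono intro!: ennreal_leI)
    then show ?thesis using EQ order_trans by blast
  qed
  have BE: "(\<integral>\<^sup>+y. ennreal (B k y) \<partial>Q) \<le> E k" for k
  proof -
    have "(\<integral>\<^sup>+y. ennreal (B k y) \<partial>Q) \<le> (\<integral>\<^sup>+y. ennreal ((u k y - f y)\<^sup>2 + B k y) \<partial>Q)"
      by (intro nn_integral_mono ennreal_leI) simp
    then show ?thesis using EQ order_trans by blast
  qed
  have Efin: "E k < \<infinity>" for k using E1[of k] by (rule less_trans) simp
  have iu: "integrable Q (\<lambda>y. (u k y - f y)\<^sup>2)" for k
    using mu[of k] mf le_less_trans[OF uE Efin] by (intro integrableI_nonneg) auto
  have iB: "integrable Q (B k)" for k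
    using mB[of k] le_less_trans[OF BE Efin] B0 by (intro integrableI_nonneg) auto
  have iV: "integrable Q (V k)" for k
  proof (rule integrableI_nonneg[OF mV V0])
    have "(\<integral>\<^sup>+y. ennreal (V k y) \<partial>Q) \<le> sobolev_norm2 P U (u k) (rp_grad P (u k))"
      unfolding nnQ sobolev_norm2_def V_def using NU by (intro nn_integral_mono) (auto simp: indicator_def intro!: ennreal_leI)
    then show "(\<integral>\<^sup>+y. ennreal (V k y) \<partial>Q) < \<infinity>" using u0(2) unfolding u_def by (rule le_less_trans)
  qed
  have iA: "integrable Q A"
  proof (rule Bochner_Integration.integrable_bound)
    show "integrable Q (\<lambda>y. 2 * V 0 y + 2 * B 0 y)" using iV iB by simp
    show "AE y in Q. norm (A y) \<le> norm (2 * V 0 y + 2 * B 0 y)"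
      using ell A0
    proof eventually_elim
      case (elim y)
      have "A y \<le> 2 * V 0 y + 2 * B 0 y"
        using elliptic_diff[OF elim(1), of "rp_grad P (u 0) y" "rp_grad P (u 0) y - G y"]
        by (simp add: A_def V_def B_def rp_inner_def)
      then show ?case using elim by simp
    qed
  qed (rule mA)
  have if2: "integrable Q (\<lambda>y. (f y)\<^sup>2)"
    unfolding Q_def by (rule iffD2[OF integrable_restrict_space integrable_mult_indicator[OF N f(2)]]) (use N in simp)
  have f2le: "(\<integral>y. (f y)\<^sup>2 \<partial>Q) \<le> (\<integral>y. (f y)\<^sup>2 \<partial>?M)"
  proof -
    have "(\<integral>y. (f y)\<^sup>2 \<partial>Q) = (\<integral>y. indicator ?N y *\<^sub>R (f y)\<^sup>2 \<partial>?M)"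
      unfolding Q_def using N by (intro integral_restrict_space) simp
    also have "\<dots> \<le> (\<integral>y. (f y)\<^sup>2 \<partial>?M)"
      using N f(2) by (intro integral_mono integrable_mult_indicator) (auto simp: indicator_def)
    finally show ?thesis .
  qed
  have CS: "AE y in Q. \<bar>I k y - A y\<bar> \<le> sqrt (A y * B k y)" for k
    using ell
  proof eventually_elim
    case (elim y)
    have "I k y - A y = G y \<bullet> (rp_g P y *v (rp_grad P (u k) y - G y))"
      by (simp add: I_def A_def rp_inner_def matrix_vector_mult_diff_distrib inner_diff_right)
    then have "(I k y - A y)\<^sup>2 \<le> A y * B k y"
      using elliptic_cauchy_schwarz[OF elim Lambda, of "G y" "rp_grad P (u k) y - G y"] by (simp add: A_def B_def rp_inner_def)
    then show ?case by (intro real_le_rsqrt) simp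
  qed
  \<comment> \<open>The factor 4 / R comes from \<open>norm_cutoff_grad\<close>, and \<Lambda> from
    comparing the Euclidean norm of G with its Riemannian norm.\<close>
  define D where "D = 4 * \<Lambda> / R"
  have D: "D > 0" using R Lambda by (simp add: D_def)
  have cb: "AE y in Q. \<bar>c y\<bar> \<le> D * cutoff p R y * sqrt (A y)"
    using ell AEQ[OF AE_carrier_max]
  proof eventually_elim
    case (elim y)
    have "norm (G y) = sqrt ((norm (G y))\<^sup>2)" by simp
    also have "\<dots> \<le> sqrt (\<Lambda>\<^sup>2 * A y)"
      unfolding A_def rp_inner_def by (rule real_sqrt_le_mono[OF elliptic_lower[OF elim(1) Lambda]])
    also have "\<dots> = \<Lambda> * sqrt (A y)" using Lambda by (simp add: real_sqrt_mult)
    finally have g: "norm (G y) \<le> \<Lambda> * sqrt (A y)" .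
    have "\<bar>c y\<bar> \<le> norm (G y) * norm (cutoff_grad p R y)" unfolding c_def by (rule Cauchy_Schwarz_ineq2)
    also have "\<dots> \<le> (\<Lambda> * sqrt (A y)) * ((4 / R) * cutoff p R y)"
      using g norm_cutoff_grad[OF R elim(2), of p] by (intro mult_mono) (auto intro: order_trans[OF norm_ge_zero g])
    finally show ?case by (simp add: D_def mult_ac)
  qed
  have ineq: "(\<integral>y. (cutoff p R y)\<^sup>2 * smooth_pos_deriv e (u k y) * I k y + smooth_pos e (u k y) * c y \<partial>Q) \<le> 0" if e: "e > 0" for e k
  proof -
    let ?X = "\<lambda>y. (cutoff p R y)\<^sup>2 * smooth_pos_deriv e (u k y) * I k y + smooth_pos e (u k y) * c y"
    let ?\<rho> = "test_fun p R e U (u k)"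
    have [measurable]: "smooth_pos e \<in> borel_measurable borel" "smooth_pos_deriv e \<in> borel_measurable borel"
      using smooth_pos_continuous[OF e] smooth_pos_deriv_continuous[OF e] by (auto intro: borel_measurable_continuous_onI)
    have mX: "?X \<in> borel_measurable Q" using mcut mu[of k] mI[of k] mc by measurable
    then have mX': "(\<lambda>y. indicator ?N y *\<^sub>R ?X y) \<in> borel_measurable ?M"
      unfolding Q_def using N by (subst (asm) borel_measurable_restrict_space_iff) auto
    \<comment> \<open>On the simplexes of S the product rule gives the differential of the test
      function; on every other cell the test function vanishes, since that cell does not meet the
      ball.\<close>
    have "AE y in ?M. indicator ?N y *\<^sub>R ?X y = rp_inner P y (G y) (rp_grad P ?\<rho> y)"
      unfolding AE_vol_iff
    proof
      fix s assume s: "s \<in> rp_max P"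
      show "AE x in lebesgue. x \<in> intr s \<longrightarrow> indicator ?N (rp_param P s x) *\<^sub>R ?X (rp_param P s x) = rp_inner P (rp_param P s x) (G (rp_param P s x)) (rp_grad P ?\<rho> (rp_param P s x))"
      proof (cases "s \<in> S")
        case True
        show ?thesis
          using AE_has_part[OF s uL[of k] cU[OF True]] elliptic_dom[OF s]
        proof eventually_elim
          case (elim x)
          show ?case
          proof
            assume x: "x \<in> intr s"
            let ?y = "rp_param P s x"
            have e1: "elliptic \<Lambda> (rp_g P ?y)" using elim(2) x intr_subset[OF s] metric_intr[OF s x] by auto
            have p: "has_part (u k) ?y (pdv s (u k) x)" using elim(1) x by blast
            have pr: "part ?\<rho> ?y = ((cutoff p R ?y)\<^sup>2 * smooth_pos_deriv e (u k ?y)) *\<^sub>R pdv s (u k) x + smooth_pos e (u k ?y) *\<^sub>R cutoff_grad p R ?y"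
              by (rule has_part_part[OF has_part_test_fun[OF R e s x cU[OF True] p]])
            have "I k ?y = G ?y \<bullet> pdv s (u k) x" unfolding I_def inner_grad[OF e1] has_part_part[OF p] ..
            then show "indicator ?N ?y *\<^sub>R ?X ?y = rp_inner P ?y (G ?y) (rp_grad P ?\<rho> ?y)"
              unfolding inner_grad[OF e1] pr using True carrier_intr[OF s x] by (simp add: opens_def c_def inner_add_right)
          qed
        qed
      next
        case False
        have z: "?\<rho> y = 0" if "y \<in> cell s" for y
        proof -
          have "\<not> dist (emb y) p \<le> R" using cov2[OF s that] False by blast
          then show ?thesis using cutoff_zero[OF R, of y p] by (simp add: test_fun_def)
        qed
        have "indicator ?N (rp_param P s x) *\<^sub>R ?X (rp_param P s x) = rp_inner P (rp_param P s x) (G (rp_param P s x)) (rp_grad P ?\<rho> (rp_param P s x))"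
          if x: "x \<in> intr s" for x
          using has_part_part[OF has_part_zero[OF s x z]] False carrier_intr[OF s x]
          by (simp add: opens_def grad_part rp_inner_def)
        then show ?thesis by simp
      qed
    qed
    then have "(\<integral>y. indicator ?N y *\<^sub>R ?X y \<partial>?M) = (\<integral>y. rp_inner P y (G y) (rp_grad P ?\<rho> y) \<partial>?M)"
      using mX' borel_measurable_vol_AE[OF mX'] by (intro integral_cong_AE) auto
    also have "\<dots> \<le> 0" using weak test_fun_Lip_c[OF R e S uL cU cov] test_fun_nonneg by auto
    finally show ?thesis unfolding Q_def using N by (subst integral_restrict_space) auto
  qed
  have main: "(\<integral>y. (cutoff p R y)\<^sup>2 * A y \<partial>Q) \<le> 4 * D\<^sup>2 * (\<integral>y. (f y + e)\<^sup>2 \<partial>Q)" if e: "e > 0" for e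
    by (rule caccioppoli_limit[OF finQ mf mA mc mcut mu mI mB if2 iA iu integral_tendsto_zero[OF iu _ uE E0] iB integral_tendsto_zero[OF iB B0 BE E0]
      AEQ[OF f(3)] A0 B0 CS cb cutoff_bounds D e ineq[OF e]]) auto
  define a where "a = (\<integral>y. (f y)\<^sup>2 \<partial>Q)"
  define m where "m = measure Q (space Q)"
  interpret finite_measure Q by (rule finQ)
  have fe: "(\<integral>y. (f y + e)\<^sup>2 \<partial>Q) \<le> 2 * a + 2 * e\<^sup>2 * m" for e
  proof -
    have b: "(t + e)\<^sup>2 \<le> 2 * t\<^sup>2 + 2 * e\<^sup>2" for t
      using sum_squares_ge_zero[of "t - e" 0] by (simp add: power2_eq_square algebra_simps)
    have "(\<integral>y. (f y + e)\<^sup>2 \<partial>Q) \<le> (\<integral>y. 2 * (f y)\<^sup>2 + 2 * e\<^sup>2 \<partial>Q)"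
    proof (rule integral_mono)
      show i: "integrable Q (\<lambda>y. 2 * (f y)\<^sup>2 + 2 * e\<^sup>2)" using if2 by simp
      show "integrable Q (\<lambda>y. (f y + e)\<^sup>2)"
        by (rule Bochner_Integration.integrable_bound[OF i]) (use mf b in auto)
    qed (rule b)
    also have "\<dots> = 2 * a + 2 * e\<^sup>2 * m" using if2 by (simp add: a_def m_def)
    finally show ?thesis .
  qed
  have "(\<integral>y. (cutoff p R y)\<^sup>2 * A y \<partial>Q) \<le> 8 * D\<^sup>2 * a"
  proof (rule field_le_epsilon)
    fix z :: real assume z: "z > 0"
    have m: "0 \<le> m" by (simp add: m_def)
    \<comment> \<open>Chosen so that 8 D^2 e^2 m is at most z, where 1 is added to m because the
      measure may be 0.\<close>
    define e where "e = sqrt (z / (8 * D\<^sup>2 * (m + 1)))"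
    have ep: "z / (8 * D\<^sup>2 * (m + 1)) > 0" using z D m by simp
    then have e: "e > 0" "e\<^sup>2 = z / (8 * D\<^sup>2 * (m + 1))" by (auto simp: e_def)
    have "(\<integral>y. (cutoff p R y)\<^sup>2 * A y \<partial>Q) \<le> 4 * D\<^sup>2 * (2 * a + 2 * e\<^sup>2 * m)"
      using main[OF e(1)] mult_left_mono[OF fe[of e], of "4 * D\<^sup>2"] by simp
    also have "\<dots> = 8 * D\<^sup>2 * a + 8 * D\<^sup>2 * e\<^sup>2 * m" by (simp add: algebra_simps)
    also have "8 * D\<^sup>2 * e\<^sup>2 * m = z * (m / (m + 1))" unfolding e(2) using D by simp
    also have "\<dots> \<le> z" by (rule mult_left_le) (use z m in auto)
    finally show "(\<integral>y. (cutoff p R y)\<^sup>2 * A y \<partial>Q) \<le> 8 * D\<^sup>2 * a + z" by simp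
  qed
  also have "\<dots> \<le> 8 * D\<^sup>2 * (\<integral>y. (f y)\<^sup>2 \<partial>?M)" unfolding a_def using f2le by (intro mult_left_mono) auto
  also have "8 * D\<^sup>2 * (\<integral>y. (f y)\<^sup>2 \<partial>?M) = 128 * \<Lambda>\<^sup>2 / R\<^sup>2 * (\<integral>y. (f y)\<^sup>2 \<partial>?M)"
    by (simp add: D_def power2_eq_square)
  finally have bd: "(\<integral>y. (cutoff p R y)\<^sup>2 * A y \<partial>Q) \<le> 128 * \<Lambda>\<^sup>2 / R\<^sup>2 * (\<integral>y. (f y)\<^sup>2 \<partial>?M)" .
  have icA: "integrable Q (\<lambda>y. (cutoff p R y)\<^sup>2 * A y)"
  proof (rule Bochner_Integration.integrable_bound[OF iA])
    have "\<bar>(cutoff p R y)\<^sup>2 * A y\<bar> \<le> \<bar>A y\<bar>" for y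
      using cutoff_bounds[of p R y] by (simp add: abs_mult mult_left_le_one_le power_le_one)
    then show "AE y in Q. norm ((cutoff p R y)\<^sup>2 * A y) \<le> norm (A y)" by simp
  qed (use mcut mA in measurable)
  have "(\<integral>\<^sup>+y. ennreal ((cutoff p R y)\<^sup>2 * A y) \<partial>Q) = ennreal (\<integral>y. (cutoff p R y)\<^sup>2 * A y \<partial>Q)"
    using A0 by (intro nn_integral_eq_integral[OF icA]) (auto elim!: eventually_mono)
  then have "(\<integral>\<^sup>+y. ennreal ((cutoff p R y)\<^sup>2 * A y) * indicator ?N y \<partial>?M) \<le> ennreal (128 * \<Lambda>\<^sup>2 / R\<^sup>2 * (\<integral>y. (f y)\<^sup>2 \<partial>?M))"
    unfolding nnQ using bd by (simp add: ennreal_leI)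
  then show ?thesis
    using S cov cov2 GN unfolding A_def GN_def by (intro exI[of _ S]) blast
qed

text \<open>The ball of radius r stays fixed while R tends to infinity. The energy on it does not
  depend on R but is bounded by a multiple of 1 / R^2.\<close>

lemma gradient_zero:
  assumes f: "f \<in> borel_measurable (rp_vol P)" "integrable (rp_vol P) (\<lambda>y. (f y)\<^sup>2)" "AE y in rp_vol P. 0 \<le> f y"
    and G: "local_gradient P f G"
    and weak: "\<forall>\<rho>\<in>Lip_c P. (\<forall>y. 0 \<le> \<rho> y) \<longrightarrow> (\<integral>y. rp_inner P y (G y) (rp_grad P \<rho> y) \<partial>rp_vol P) \<le> 0"
  shows "AE y in rp_vol P. G y = 0"
proof -
  \<comment> \<open>Any centre serves, even one outside the image of X, because the balls around it
    exhaust the Euclidean space.\<close>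
  let ?M = "rp_vol P" and ?p = "0 :: 'e"
  note eb = energy_bound[OF f G weak]
  have ball: "AE y in ?M. dist (emb y) ?p \<le> r \<longrightarrow> G y = 0" if r: "r > 0" for r
  proof -
    obtain S where S: "S \<subseteq> rp_max P" "\<forall>s\<in>rp_max P. \<forall>y\<in>cell s. dist (emb y) ?p \<le> r \<longrightarrow> s \<in> S"
      "(\<lambda>y. indicator (opens S) y *\<^sub>R G y) \<in> borel_measurable ?M" using eb[OF r, where p = ?p] by blast
    define W where "W = {y. dist (emb y) ?p \<le> r}"
    have "closed W" unfolding W_def by (intro closed_Collect_le continuous_intros continuous_emb)
    then have "open (- W)" by (simp add: open_closed)
    then have "- W \<in> sets ?M" by (rule open_vol)
    then have W: "W \<in> sets ?M" using sets.compl_sets[of "- W" ?M] by (simp add: Compl_eq_Diff_UNIV[symmetric])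
    define H where "H = (\<lambda>y. indicator W y *\<^sub>R (indicator (opens S) y *\<^sub>R G y))"
    have H: "H \<in> borel_measurable ?M" unfolding H_def by (rule borel_measurable_scaleR[OF borel_measurable_indicator[OF W] S(3)])
    define J where "J = (\<integral>\<^sup>+y. ennreal (rp_inner P y (H y) (H y)) \<partial>?M)"
    \<comment> \<open>Twice the constant 128: for R at least 2 r the cutoff is at least 3/4 on the
      ball of radius r, and its square exceeds 1/2.\<close>
    define K where "K = 256 * \<Lambda>\<^sup>2 * (\<integral>y. (f y)\<^sup>2 \<partial>?M)"
    have K: "0 \<le> K" unfolding K_def by (intro mult_nonneg_nonneg integral_nonneg_AE) auto
    have JR: "J \<le> ennreal (K / R\<^sup>2)" if R: "R \<ge> 2 * r" for R
    proof -
      have R0: "R > 0" using R r by simp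
      obtain T where T: "\<forall>s\<in>rp_max P. \<forall>y\<in>cell s. dist (emb y) ?p \<le> R \<longrightarrow> s \<in> T"
        "(\<integral>\<^sup>+y. ennreal ((cutoff ?p R y)\<^sup>2 * rp_inner P y (G y) (G y)) * indicator (opens T) y \<partial>?M) \<le> ennreal (128 * \<Lambda>\<^sup>2 / R\<^sup>2 * (\<integral>y. (f y)\<^sup>2 \<partial>?M))"
        "T \<subseteq> rp_max P" "(\<lambda>y. indicator (opens T) y *\<^sub>R G y) \<in> borel_measurable ?M"
        using eb[OF R0, where p = ?p] by blast
      have "J \<le> (\<integral>\<^sup>+y. 2 * (ennreal ((cutoff ?p R y)\<^sup>2 * rp_inner P y (G y) (G y)) * indicator (opens T) y) \<partial>?M)"
        unfolding J_def
      proof (rule nn_integral_mono_AE)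
        show "AE y in ?M. ennreal (rp_inner P y (H y) (H y)) \<le> 2 * (ennreal ((cutoff ?p R y)\<^sup>2 * rp_inner P y (G y) (G y)) * indicator (opens T) y)"
          using AE_elliptic AE_carrier_max
        proof eventually_elim
          case (elim y)
          show ?case
          proof (cases "y \<in> W \<inter> opens S")
            case True
            then have d: "dist (emb y) ?p \<le> r" by (simp add: W_def)
            have "dist (emb y) ?p \<le> R" using d R r by linarith
            then have yT: "y \<in> opens T" using T(1)[rule_format, OF elim(2), of y] by (simp add: opens_def cell_def)
            have "(dist (emb y) ?p)\<^sup>2 \<le> r\<^sup>2" using d by (intro power_mono) auto
            also have "r\<^sup>2 \<le> (R / 2)\<^sup>2" using R r by (intro power_mono) auto
            finally have "(dist (emb y) ?p)\<^sup>2 / R\<^sup>2 \<le> 1 / 4" using R0 by (simp add: divide_le_eq power_divide)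
            then have "3 / 4 \<le> cutoff ?p R y" unfolding cutoff_def le_max_iff_disj by linarith
            then have "(3 / 4)\<^sup>2 \<le> (cutoff ?p R y)\<^sup>2" by (intro power_mono) auto
            then have h: "1 / 2 \<le> (cutoff ?p R y)\<^sup>2" by (simp add: power2_eq_square)
            have g0: "0 \<le> rp_inner P y (G y) (G y)" unfolding rp_inner_def by (rule elliptic_nonneg[OF elim(1)])
            have "rp_inner P y (H y) (H y) = rp_inner P y (G y) (G y)" using True by (simp add: H_def)
            also have "\<dots> \<le> 2 * ((cutoff ?p R y)\<^sup>2 * rp_inner P y (G y) (G y))" using mult_right_mono[OF h g0] by simp
            finally have "ennreal (rp_inner P y (H y) (H y)) \<le> ennreal (2 * ((cutoff ?p R y)\<^sup>2 * rp_inner P y (G y) (G y)))" by (rule ennreal_leI)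
            also have "\<dots> = 2 * ennreal ((cutoff ?p R y)\<^sup>2 * rp_inner P y (G y) (G y))"
              by (subst ennreal_mult') auto
            finally show ?thesis using yT by simp
          next
            case False
            then have "H y = 0" by (auto simp: H_def)
            then show ?thesis by (simp add: rp_inner_def)
          qed
        qed
      qed
      also have "\<dots> = 2 * (\<integral>\<^sup>+y. ennreal ((cutoff ?p R y)\<^sup>2 * rp_inner P y (G y) (G y)) * indicator (opens T) y \<partial>?M)"
      proof (rule nn_integral_cmult)
        let ?GT = "\<lambda>y. indicator (opens T) y *\<^sub>R G y"
        have "(\<lambda>y. ennreal ((cutoff ?p R y)\<^sup>2 * rp_inner P y (?GT y) (?GT y))) \<in> borel_measurable ?M"
          using inner_measurable[OF T(4) T(4)] continuous_vol_measurable[OF continuous_cutoff[of ?p R]] by measurable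
        moreover have "(\<lambda>y. ennreal ((cutoff ?p R y)\<^sup>2 * rp_inner P y (?GT y) (?GT y))) = (\<lambda>y. ennreal ((cutoff ?p R y)\<^sup>2 * rp_inner P y (G y) (G y)) * indicator (opens T) y)"
          by (auto simp: indicator_def rp_inner_def)
        ultimately show "(\<lambda>y. ennreal ((cutoff ?p R y)\<^sup>2 * rp_inner P y (G y) (G y)) * indicator (opens T) y) \<in> borel_measurable ?M" by simp
      qed
      also have "\<dots> \<le> 2 * ennreal (128 * \<Lambda>\<^sup>2 / R\<^sup>2 * (\<integral>y. (f y)\<^sup>2 \<partial>?M))" using T(2) by (rule mult_left_mono) simp
      also have "\<dots> = ennreal (2 * (128 * \<Lambda>\<^sup>2 / R\<^sup>2 * (\<integral>y. (f y)\<^sup>2 \<partial>?M)))" by (subst ennreal_mult') auto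
      also have "2 * (128 * \<Lambda>\<^sup>2 / R\<^sup>2 * (\<integral>y. (f y)\<^sup>2 \<partial>?M)) = K / R\<^sup>2" by (simp add: K_def)
      finally show ?thesis .
    qed
    have "J \<le> 0"
    proof (rule LIMSEQ_le_const)
      have "(\<lambda>n. K * (1 / real (Suc n)) * (1 / real (Suc n))) \<longlonglongrightarrow> K * 0 * 0"
        using LIMSEQ_inverse_real_of_nat by (intro tendsto_intros) (auto simp: inverse_eq_divide)
      then have "(\<lambda>n. K / (real (Suc n))\<^sup>2) \<longlonglongrightarrow> 0" by (simp add: power2_eq_square)
      then have "(\<lambda>n. ennreal (K / (real (Suc n))\<^sup>2)) \<longlonglongrightarrow> ennreal 0" by (rule tendsto_ennrealI)
      then show "(\<lambda>n. ennreal (K / (real (Suc n))\<^sup>2)) \<longlonglongrightarrow> 0" by simp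
      obtain n0 where n0: "2 * r \<le> real n0" using real_arch_simple by blast
      show "\<exists>N. \<forall>n\<ge>N. J \<le> ennreal (K / (real (Suc n))\<^sup>2)"
        using n0 by (intro exI[of _ n0] allI impI JR) auto
    qed
    then have "J = 0" by simp
    moreover have "(J = 0) = (AE y in ?M. ennreal (rp_inner P y (H y) (H y)) = 0)"
      unfolding J_def using inner_measurable[OF H H] by (intro nn_integral_0_iff_AE) auto
    ultimately have "AE y in ?M. ennreal (rp_inner P y (H y) (H y)) = 0" by simp
    then show ?thesis using AE_elliptic AE_carrier_max
    proof eventually_elim
      case (elim y)
      show ?case
      proof
        assume d: "dist (emb y) ?p \<le> r"
        have "y \<in> opens S" using S(2)[rule_format, OF elim(3), of y] d by (simp add: opens_def cell_def)
        then have "H y = G y" using d by (simp add: H_def W_def)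
        then have "\<not> 0 < G y \<bullet> (rp_g P y *v G y)" using elim(1) by (simp add: rp_inner_def ennreal_eq_0_iff)
        then show "G y = 0" using elliptic_pos[OF elim(2) Lambda] by blast
      qed
    qed
  qed
  have "AE y in ?M. \<forall>n::nat. dist (emb y) ?p \<le> real (Suc n) \<longrightarrow> G y = 0"
    unfolding AE_all_countable by (intro allI ball) simp
  then show ?thesis
  proof eventually_elim
    case (elim y)
    obtain n :: nat where "dist (emb y) ?p \<le> real n" using real_arch_simple by blast
    then have "dist (emb y) ?p \<le> real (Suc n)" by simp
    then show ?case using elim by blast
  qed
qed

subsection \<open>Approximation on a single simplex\<close>

text \<open>The lower bound 1 / \<open>dbound\<close> of the density turns bounds for volume
  integrals into bounds for Lebesgue integrals in the chart.\<close>

lemma nn_integral_simplex_le: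
  assumes s: "s \<in> rp_max P" and h: "h \<in> borel_measurable (rp_vol P)"
  shows "(\<integral>\<^sup>+x. h (rp_param P s x) \<partial>lebesgue_on (intr s)) \<le> ennreal dbound * (\<integral>\<^sup>+y. h y * indicator {y. rp_carrier P y = s} y \<partial>rp_vol P)"
proof -
  have wm: "(\<lambda>x. ennreal (weight s x)) \<in> borel_measurable (lebesgue_on (intr s))"
    using weight_measurable_intr[OF s] by (rule measurable_compose) auto
  have hm: "(\<lambda>x. h (rp_param P s x)) \<in> borel_measurable (lebesgue_on (intr s))"
    using measurable_compose[OF param_measurable[OF s] h] .
  have "(\<integral>\<^sup>+x. h (rp_param P s x) \<partial>lebesgue_on (intr s)) \<le> (\<integral>\<^sup>+x. ennreal dbound * (ennreal (weight s x) * h (rp_param P s x)) \<partial>lebesgue_on (intr s))"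
  proof (rule nn_integral_mono_AE)
    have "AE x in lebesgue_on (intr s). 1 / dbound \<le> weight s x"
      using weight_bounds[OF s] intr_lebesgue[OF s] by (subst AE_restrict_space_iff) (auto elim!: eventually_mono)
    then show "AE x in lebesgue_on (intr s). h (rp_param P s x) \<le> ennreal dbound * (ennreal (weight s x) * h (rp_param P s x))"
    proof eventually_elim
      case (elim x)
      have "1 \<le> ennreal (dbound * weight s x)" using elim dbound_pos by (simp add: field_simps)
      also have "\<dots> = ennreal dbound * ennreal (weight s x)" using dbound_pos by (intro ennreal_mult') simp
      finally have "1 * h (rp_param P s x) \<le> (ennreal dbound * ennreal (weight s x)) * h (rp_param P s x)" by (rule mult_right_mono) simp
      then show ?case by (simp add: mult.assoc)
    qed
  qed
  also have "\<dots> = ennreal dbound * (\<integral>\<^sup>+x. ennreal (weight s x) * h (rp_param P s x) \<partial>lebesgue_on (intr s))"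
    using wm hm by (intro nn_integral_cmult) auto
  finally show ?thesis unfolding nn_integral_simplex[OF s h] .
qed

lemma nn_integral_intr_lborel:
  assumes s: "s \<in> rp_max P" and g: "g \<in> borel_measurable borel" and eq: "AE x in lebesgue. x \<in> intr s \<longrightarrow> h x = g x"
  shows "(\<integral>\<^sup>+x. g x * indicator (intr s) x \<partial>lborel) = (\<integral>\<^sup>+x. h x \<partial>lebesgue_on (intr s))"
proof -
  have "(\<integral>\<^sup>+x. h x \<partial>lebesgue_on (intr s)) = (\<integral>\<^sup>+x. h x * indicator (intr s) x \<partial>lebesgue)"
    using intr_lebesgue[OF s] by (intro nn_integral_restrict_space) simp
  also have "\<dots> = (\<integral>\<^sup>+x. g x * indicator (intr s) x \<partial>lebesgue)"
    using eq by (intro nn_integral_cong_AE) (auto elim!: eventually_mono simp: indicator_def)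
  also have "\<dots> = (\<integral>\<^sup>+x. g x * indicator (intr s) x \<partial>lborel)" by (rule nn_integral_completion)
  finally show ?thesis by simp
qed

text \<open>With a vanishing limit gradient both \<open>u k\<close> - f and the gradients of
  \<open>u k\<close> tend to 0 in L^2 of the volume. Bounded density, ellipticity and finite measure
  turn this into L^1 convergence of values and partial derivatives in each chart, so the limit is
  constant there. One sequence serves all simplexes of S, which is what the comparison across a face
  needs.\<close>

lemma simplex_limits:
  assumes f: "f \<in> borel_measurable (rp_vol P)" and G: "local_gradient P f G" and G0: "AE y in rp_vol P. G y = 0"
    and S: "finite S" "S \<subseteq> rp_max P"
  shows "\<exists>u U. (\<forall>k. rp_lipschitz_on P U (u k)) \<and> (\<forall>s\<in>S. cell s \<subseteq> U) \<and>
    (\<forall>s\<in>S. \<exists>c. (AE x in lebesgue. x \<in> intr s \<longrightarrow> f (rp_param P s x) = c) \<and>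
      (\<lambda>k. \<integral>\<^sup>+x. ennreal \<bar>pull s (u k) x - c\<bar> * indicator (intr s) x \<partial>lborel) \<longlonglongrightarrow> 0 \<and>
      (\<forall>j. (\<lambda>k. \<integral>\<^sup>+x. ennreal \<bar>dir_deriv (axis j 1) (pull s (u k)) x\<bar> * indicator (intr s) x \<partial>lborel) \<longlonglongrightarrow> 0))"
proof -
  let ?M = "rp_vol P"
  obtain U where U: "rel_compact_subdomain U" "(\<Union>s\<in>S. cell s) \<subseteq> U" using exhaust_subdomain[OF S] by blast
  have sg: "sobolev_gradient P U f G" using G U(1) unfolding local_gradient_def by blast
  then obtain u0 where u0: "\<And>k. rp_lipschitz_on P U (u0 k)"
    "(\<lambda>k. sobolev_norm2 P U (\<lambda>y. u0 k y - f y) (\<lambda>y. rp_grad P (u0 k) y - G y)) \<longlonglongrightarrow> 0"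
    unfolding sobolev_gradient_def by blast
  have "eventually (\<lambda>k. sobolev_norm2 P U (\<lambda>y. u0 k y - f y) (\<lambda>y. rp_grad P (u0 k) y - G y) < 1) sequentially"
    using u0(2) by (rule order_tendstoD) simp
  then obtain k0 where k0: "\<And>k. k \<ge> k0 \<Longrightarrow> sobolev_norm2 P U (\<lambda>y. u0 k y - f y) (\<lambda>y. rp_grad P (u0 k) y - G y) < 1"
    unfolding eventually_sequentially by blast
  define u where "u k = u0 (k + k0)" for k
  define E where "E k = sobolev_norm2 P U (\<lambda>y. u k y - f y) (\<lambda>y. rp_grad P (u k) y - G y)" for k
  have uL: "rp_lipschitz_on P U (u k)" for k using u0(1) by (simp add: u_def)
  have E1: "E k < 1" for k using k0 by (simp add: E_def u_def)
  have E0: "E \<longlonglongrightarrow> 0" unfolding E_def u_def by (rule LIMSEQ_ignore_initial_segment[OF u0(2)])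
  define e where "e k = enn2real (E k)" for k
  have Ee: "E k = ennreal (e k)" for k using E1[of k] unfolding e_def by (metis ennreal_enn2real ennreal_one_less_top order.strict_trans)
  have e0: "0 \<le> e k" for k by (simp add: e_def)
  have elim: "e \<longlonglongrightarrow> 0"
  proof -
    have "(\<lambda>k. ennreal (e k)) \<longlonglongrightarrow> ennreal 0" using E0 by (simp add: Ee[symmetric])
    then show ?thesis by (subst (asm) tendsto_ennreal_iff) (auto simp: e0)
  qed
  have main: "\<exists>c. (AE x in lebesgue. x \<in> intr s \<longrightarrow> f (rp_param P s x) = c) \<and>
      (\<lambda>k. \<integral>\<^sup>+x. ennreal \<bar>pull s (u k) x - c\<bar> * indicator (intr s) x \<partial>lborel) \<longlonglongrightarrow> 0 \<and>
      (\<forall>j. (\<lambda>k. \<integral>\<^sup>+x. ennreal \<bar>dir_deriv (axis j 1) (pull s (u k)) x\<bar> * indicator (intr s) x \<partial>lborel) \<longlonglongrightarrow> 0)"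
    if sS: "s \<in> S" for s
  proof -
    have s: "s \<in> rp_max P" and cU: "cell s \<subseteq> U" using sS S U(2) by auto
    let ?O = "opens {s}"
    have OU: "?O \<subseteq> U" using cU unfolding opens_def cell_def by auto
    have Oe: "{y. rp_carrier P y = s} = ?O" by (auto simp: opens_def)
    have O: "?O \<in> sets ?M" using open_vol[OF open_opens[of "{s}"]] s by simp
    have "\<forall>k. \<exists>l. l-lipschitz_on UNIV (pull s (u k))" using pull_lipschitz[OF s uL cU] by (intro allI)
    then obtain L :: "nat \<Rightarrow> real" where "\<forall>k. (L k)-lipschitz_on UNIV (pull s (u k))" by (rule choice[THEN exE])
    then have L: "(L k)-lipschitz_on UNIV (pull s (u k))" for k by simp
    have fm: "(\<lambda>x. f (rp_param P s x)) \<in> borel_measurable (lebesgue_on (intr s))"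
      using measurable_compose[OF param_measurable[OF s] f] .
    then have "(\<lambda>x. if x \<in> intr s then f (rp_param P s x) else 0) \<in> borel_measurable lebesgue"
      using intr_lebesgue[OF s] by (simp add: borel_measurable_if)
    \<comment> \<open>In the chart f is only Lebesgue measurable; fs is a Borel version of it, as
      required by \<open>AE_const_of_sequence\<close>.\<close>
    then obtain fs where fs: "fs \<in> borel_measurable lborel" "AE x in lborel. (if x \<in> intr s then f (rp_param P s x) else 0) = fs x"
      using completion_ex_borel_measurable_real by blast
    then have fsb: "fs \<in> borel_measurable borel" by simp
    have fse: "AE x in lebesgue. x \<in> intr s \<longrightarrow> f (rp_param P s x) = fs x"
      using AE_completion[OF fs(2)] by eventually_elim auto
    \<comment> \<open>The integrand of the Sobolev error on the open simplex, with the gradient of f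
      replaced by its value 0. The indicators make each term measurable on X.\<close>
    define H where "H k = (\<lambda>y. (indicator ?O y *\<^sub>R u k y - indicator ?O y *\<^sub>R f y)\<^sup>2
      + rp_inner P y (indicator ?O y *\<^sub>R rp_grad P (u k) y) (indicator ?O y *\<^sub>R rp_grad P (u k) y))" for k
    have sub1: "{s} \<subseteq> rp_max P" using s by simp
    have cU1: "\<And>t. t \<in> {s} \<Longrightarrow> cell t \<subseteq> U" using cU by simp
    have Hm: "H k \<in> borel_measurable ?M" for k
    proof -
      have 1: "(\<lambda>y. indicator ?O y *\<^sub>R u k y) \<in> borel_measurable ?M" by (rule lipschitz_measurable_opens[OF sub1 uL cU1])
      have 2: "(\<lambda>y. indicator ?O y *\<^sub>R f y) \<in> borel_measurable ?M" by (rule borel_measurable_scaleR[OF borel_measurable_indicator[OF O] f])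
      have 3: "(\<lambda>y. indicator ?O y *\<^sub>R rp_grad P (u k) y) \<in> borel_measurable ?M" by (rule grad_measurable[OF sub1 uL cU1])
      show ?thesis unfolding H_def by (intro borel_measurable_add borel_measurable_power borel_measurable_diff inner_measurable 1 2 3)
    qed
    have HE: "(\<integral>\<^sup>+x. ennreal (H k (rp_param P s x)) \<partial>lebesgue_on (intr s)) \<le> ennreal (dbound * e k)" for k
    proof -
      have 1: "(\<integral>\<^sup>+x. ennreal (H k (rp_param P s x)) \<partial>lebesgue_on (intr s)) \<le> ennreal dbound * (\<integral>\<^sup>+y. ennreal (H k y) * indicator {y. rp_carrier P y = s} y \<partial>?M)"
        using Hm[of k] by (intro nn_integral_simplex_le[OF s]) auto
      have 2: "(\<integral>\<^sup>+y. ennreal (H k y) * indicator {y. rp_carrier P y = s} y \<partial>?M) \<le> E k"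
        unfolding E_def sobolev_norm2_def
      proof (rule nn_integral_mono_AE)
        show "AE y in ?M. ennreal (H k y) * indicator {y. rp_carrier P y = s} y
          \<le> ennreal ((u k y - f y)\<^sup>2 + rp_inner P y (rp_grad P (u k) y - G y) (rp_grad P (u k) y - G y)) * indicator U y"
          using G0
        proof eventually_elim
          case (elim y)
          show ?case
          proof (cases "y \<in> ?O")
            case True
            then show ?thesis using OU elim by (auto simp: H_def Oe)
          next
            case False
            then show ?thesis unfolding Oe by simp
          qed
        qed
      qed
      have "ennreal dbound * E k = ennreal (dbound * e k)" unfolding Ee using dbound_pos by (simp add: ennreal_mult')
      then show ?thesis using order_trans[OF 1 mult_left_mono[OF 2]] by simp
    qed
    have fin: "emeasure (restrict_space lborel (intr s)) (space (restrict_space lborel (intr s))) < \<infinity>"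
    proof -
      have "bounded (intr s)" using compact_dom[OF s] intr_subset[OF s] compact_imp_bounded bounded_subset by blast
      then have "emeasure lborel (intr s) < \<infinity>" by (rule emeasure_bounded_finite)
      then show ?thesis using open_intr[OF s] by (simp add: emeasure_restrict_space space_restrict_space)
    qed
    have nnr: "(\<integral>\<^sup>+x. h x \<partial>restrict_space lborel (intr s)) = (\<integral>\<^sup>+x. h x * indicator (intr s) x \<partial>lborel)" for h
      using open_intr[OF s] by (intro nn_integral_restrict_space) simp
    have pullb: "pull s (u k) \<in> borel_measurable borel" for k
      by (rule borel_measurable_continuous_onI[OF lipschitz_on_continuous_on[OF L]])
    have lim1: "(\<lambda>k. \<integral>\<^sup>+x. ennreal \<bar>pull s (u k) x - fs x\<bar> * indicator (intr s) x \<partial>lborel) \<longlonglongrightarrow> 0"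
      unfolding nnr[symmetric]
    proof (rule L2_imp_L1_tendsto[OF fin])
      show "(\<lambda>x. pull s (u k) x - fs x) \<in> borel_measurable (restrict_space lborel (intr s))" for k
        using pullb fsb by (intro measurable_restrict_space1) auto
      show "(\<lambda>k. dbound * e k) \<longlonglongrightarrow> 0" using tendsto_mult_left[OF elim, of dbound] by simp
      show "0 \<le> dbound * e k" for k using dbound_pos e0 by simp
      show "(\<integral>\<^sup>+x. ennreal ((pull s (u k) x - fs x)\<^sup>2) \<partial>restrict_space lborel (intr s)) \<le> ennreal (dbound * e k)" for k
      proof -
        have "(\<integral>\<^sup>+x. ennreal ((pull s (u k) x - fs x)\<^sup>2) * indicator (intr s) x \<partial>lborel)
          = (\<integral>\<^sup>+x. ennreal ((u k (rp_param P s x) - f (rp_param P s x))\<^sup>2) \<partial>lebesgue_on (intr s))"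
        proof (rule nn_integral_intr_lborel[OF s])
          show "(\<lambda>x. ennreal ((pull s (u k) x - fs x)\<^sup>2)) \<in> borel_measurable borel" using pullb[of k] fsb by measurable
          show "AE x in lebesgue. x \<in> intr s \<longrightarrow> ennreal ((u k (rp_param P s x) - f (rp_param P s x))\<^sup>2) = ennreal ((pull s (u k) x - fs x)\<^sup>2)"
            using fse by eventually_elim (use intr_subset[OF s] in \<open>auto simp: pull_dom\<close>)
        qed
        also have "\<dots> \<le> (\<integral>\<^sup>+x. ennreal (H k (rp_param P s x)) \<partial>lebesgue_on (intr s))"
        proof (rule nn_integral_mono_AE)
          have "AE x in lebesgue_on (intr s). x \<in> intr s \<and> elliptic \<Lambda> (rp_metric P s x)"
            using elliptic_dom[OF s] intr_lebesgue[OF s] intr_subset[OF s]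
            by (subst AE_restrict_space_iff) (auto elim!: eventually_mono)
          then show "AE x in lebesgue_on (intr s). ennreal ((u k (rp_param P s x) - f (rp_param P s x))\<^sup>2) \<le> ennreal (H k (rp_param P s x))"
          proof eventually_elim
            case (elim x)
            then have x: "x \<in> intr s" and el: "elliptic \<Lambda> (rp_g P (rp_param P s x))" using metric_intr[OF s] by auto
            show ?case using elliptic_nonneg[OF el] carrier_intr[OF s x]
              by (intro ennreal_leI) (simp add: H_def opens_def rp_inner_def)
          qed
        qed
        also have "\<dots> \<le> ennreal (dbound * e k)" by (rule HE)
        finally show ?thesis unfolding nnr .
      qed
    qed
    have lim2: "(\<lambda>k. \<integral>\<^sup>+x. ennreal \<bar>dir_deriv (axis j 1) (pull s (u k)) x\<bar> * indicator (intr s) x \<partial>lborel) \<longlonglongrightarrow> 0" for j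
      unfolding nnr[symmetric]
    proof (rule L2_imp_L1_tendsto[OF fin])
      have ddb: "dir_deriv (axis j 1) (pull s (u k)) \<in> borel_measurable borel" for k
        by (rule dir_deriv_measurable[OF lipschitz_on_continuous_on[OF L]])
      show "dir_deriv (axis j 1) (pull s (u k)) \<in> borel_measurable (restrict_space lborel (intr s))" for k
        using ddb by (intro measurable_restrict_space1) auto
      show "(\<lambda>k. \<Lambda>\<^sup>2 * (dbound * e k)) \<longlonglongrightarrow> 0" using tendsto_mult_left[OF elim, of "\<Lambda>\<^sup>2 * dbound"] by (simp add: mult.assoc)
      show "0 \<le> \<Lambda>\<^sup>2 * (dbound * e k)" for k using dbound_pos e0 by simp
      show "(\<integral>\<^sup>+x. ennreal ((dir_deriv (axis j 1) (pull s (u k)) x)\<^sup>2) \<partial>restrict_space lborel (intr s)) \<le> ennreal (\<Lambda>\<^sup>2 * (dbound * e k))" for k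
      proof -
        have "(\<integral>\<^sup>+x. ennreal ((dir_deriv (axis j 1) (pull s (u k)) x)\<^sup>2) * indicator (intr s) x \<partial>lborel)
          = (\<integral>\<^sup>+x. ennreal ((pdv s (u k) x $ j)\<^sup>2) \<partial>lebesgue_on (intr s))"
          by (rule nn_integral_intr_lborel[OF s]) (use ddb[of k] in \<open>auto simp: pdv_def\<close>)
        also have "\<dots> \<le> (\<integral>\<^sup>+x. ennreal (\<Lambda>\<^sup>2) * ennreal (H k (rp_param P s x)) \<partial>lebesgue_on (intr s))"
        proof (rule nn_integral_mono_AE)
          have "AE x in lebesgue. x \<in> intr s \<longrightarrow> x \<in> intr s \<and> elliptic \<Lambda> (rp_metric P s x) \<and> has_part (u k) (rp_param P s x) (pdv s (u k) x)"
            using elliptic_dom[OF s] AE_has_part[OF s uL[of k] cU] by eventually_elim (use intr_subset[OF s] in auto)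
          then have "AE x in lebesgue_on (intr s). x \<in> intr s \<and> elliptic \<Lambda> (rp_metric P s x) \<and> has_part (u k) (rp_param P s x) (pdv s (u k) x)"
            using intr_lebesgue[OF s] by (subst AE_restrict_space_iff) auto
          then show "AE x in lebesgue_on (intr s). ennreal ((pdv s (u k) x $ j)\<^sup>2) \<le> ennreal (\<Lambda>\<^sup>2) * ennreal (H k (rp_param P s x))"
          proof eventually_elim
            case (elim x)
            let ?y = "rp_param P s x"
            have x: "x \<in> intr s" and el: "elliptic \<Lambda> (rp_g P ?y)" and hp: "has_part (u k) ?y (pdv s (u k) x)"
              using elim metric_intr[OF s] by auto
            have q: "pdv s (u k) x = rp_g P ?y *v rp_grad P (u k) ?y"
              using has_part_part[OF hp] elliptic_mult_inv[OF el Lambda] by (simp add: grad_part)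
            have "(pdv s (u k) x $ j)\<^sup>2 \<le> (norm (pdv s (u k) x))\<^sup>2"
              using component_le_norm_cart[of "pdv s (u k) x" j] by (simp add: abs_le_square_iff[symmetric])
            also have "\<dots> \<le> \<Lambda>\<^sup>2 * rp_inner P ?y (rp_grad P (u k) ?y) (rp_grad P (u k) ?y)"
              unfolding rp_inner_def q by (rule elliptic_norm_mult[OF el Lambda])
            also have "\<dots> \<le> \<Lambda>\<^sup>2 * H k ?y"
              using carrier_intr[OF s x] by (intro mult_left_mono) (auto simp: H_def opens_def)
            finally have "ennreal ((pdv s (u k) x $ j)\<^sup>2) \<le> ennreal (\<Lambda>\<^sup>2 * H k ?y)" by (rule ennreal_leI)
            then show ?case by (simp add: ennreal_mult')
          qed
        qed
        also have "\<dots> = ennreal (\<Lambda>\<^sup>2) * (\<integral>\<^sup>+x. ennreal (H k (rp_param P s x)) \<partial>lebesgue_on (intr s))"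
          using measurable_compose[OF param_measurable[OF s] Hm[of k]] by (intro nn_integral_cmult) auto
        also have "\<dots> \<le> ennreal (\<Lambda>\<^sup>2) * ennreal (dbound * e k)" by (rule mult_left_mono[OF HE]) simp
        also have "\<dots> = ennreal (\<Lambda>\<^sup>2 * (dbound * e k))" by (simp add: ennreal_mult')
        finally show ?thesis unfolding nnr .
      qed
    qed
    have "\<exists>c. AE x in lborel. x \<in> intr s \<longrightarrow> fs x = c"
      by (rule AE_const_of_sequence[OF open_intr[OF s] convex_intr[OF s] fsb _ lim2 lim1]) (use L in blast)
    then obtain c where c: "AE x in lborel. x \<in> intr s \<longrightarrow> fs x = c" by blast
    have "AE x in lebesgue. x \<in> intr s \<longrightarrow> f (rp_param P s x) = c"
      using fse AE_completion[OF c] by eventually_elim auto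
    moreover have "(\<integral>\<^sup>+x. ennreal \<bar>pull s (u k) x - fs x\<bar> * indicator (intr s) x \<partial>lborel) = (\<integral>\<^sup>+x. ennreal \<bar>pull s (u k) x - c\<bar> * indicator (intr s) x \<partial>lborel)" for k
      using c by (intro nn_integral_cong_AE) (auto elim!: eventually_mono simp: indicator_def)
    ultimately show ?thesis using lim1 lim2 by auto
  qed
  show ?thesis using uL U(2) main by (intro exI[of _ u] exI[of _ U]) blast
qed

subsection \<open>Crossing a face\<close>

lemma lam_lipschitz:
  assumes "s \<in> rp_max P" "v \<in> s" shows "\<exists>K. K-lipschitz_on UNIV (\<lambda>x. lam s x v)"
proof -
  obtain B where B: "B > 0" "\<And>x. norm (lamlin s v x) \<le> B * norm x"
    using linear_bounded_pos[OF linear_lamlin[OF assms]] by blast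
  have "lam s x v - lam s y v = lamlin s v (x - y)" for x y using lam_add[OF assms, of y "x - y"] by simp
  then have "B-lipschitz_on UNIV (\<lambda>x. lam s x v)" using B by (intro lipschitz_onI) (auto simp: dist_norm)
  then show ?thesis by blast
qed

lemma lam_along:
  assumes "s \<in> rp_max P" "v \<in> s" shows "lam s (x + \<tau> *\<^sub>R w) v = lam s x v + \<tau> * lamlin s v w"
  using lam_add[OF assms, of x "\<tau> *\<^sub>R w"] linear_scale[OF linear_lamlin[OF assms], of \<tau> w] by simp

lemma ex_transversal_axis:
  assumes "s \<in> rp_max P" "a \<in> s" shows "\<exists>\<kappa> i. lamlin s a (\<kappa> *\<^sub>R axis i 1) = 1"
proof -
  have lin: "linear (lamlin s a)" by (rule linear_lamlin[OF assms])
  have "\<exists>i. lamlin s a (axis i 1) \<noteq> 0"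
  proof (rule ccontr)
    assume "\<not> ?thesis"
    then have "lamlin s a b = 0" if "b \<in> Basis" for b using that by (auto simp: Basis_vec_def)
    then have "lamlin s a = (\<lambda>x. 0)" by (intro linear_eq_stdbasis[OF lin]) (auto intro: linearI)
    then show False using lamlin_nonzero[OF assms] by auto
  qed
  then obtain i where i: "lamlin s a (axis i 1) \<noteq> 0" by blast
  have "lamlin s a ((1 / lamlin s a (axis i 1)) *\<^sub>R axis i 1) = 1" using linear_scale[OF lin] i by simp
  then show ?thesis by blast
qed

text \<open>The functions \<open>v k\<close> are extended beyond the face \<open>lam s x a = 0\<close> constantly along \<open>w\<close>. The extension
  has no derivative in the direction \<open>w\<close> there, so integrating along \<open>w\<close> carries the limit \<open>c\<close> to
  the values on the face. Choosing \<open>w\<close> as a multiple of a coordinate axis avoids Rademacher's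
  theorem: only partial derivatives occur.\<close>

lemma face_limit:
  fixes v :: "nat \<Rightarrow> real^'n \<Rightarrow> real"
  assumes s: "s \<in> rp_max P" and a: "a \<in> s" and p: "\<And>b. b \<in> s - {a} \<Longrightarrow> 0 < lam s p b"
    and lip: "\<And>k. \<exists>L. L-lipschitz_on UNIV (v k)"
    and v0: "(\<lambda>k. \<integral>\<^sup>+x. ennreal \<bar>v k x - c\<bar> * indicator (intr s) x \<partial>lborel) \<longlonglongrightarrow> 0"
    and d0: "\<And>j. (\<lambda>k. \<integral>\<^sup>+x. ennreal \<bar>dir_deriv (axis j 1) (v k) x\<bar> * indicator (intr s) x \<partial>lborel) \<longlonglongrightarrow> 0"
    and w: "lamlin s a w = 1" "w = \<kappa> *\<^sub>R axis i 1"
  shows "\<exists>\<rho>>0. \<forall>\<theta>. 0 < \<theta> \<longrightarrow> \<theta> < \<rho> \<longrightarrow>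
    (\<lambda>k. \<integral>\<^sup>+x. ennreal \<bar>v k (x - lam s x a *\<^sub>R w) - c\<bar> * indicator {x. dist x p < \<rho> \<and> - 2 * \<theta> < lam s x a \<and> lam s x a < - \<theta>} x \<partial>lborel) \<longlonglongrightarrow> 0"
proof -
  let ?Pos = "{x. \<forall>b\<in>s - {a}. 0 < lam s x b}"
  have "?Pos = (\<Inter>b\<in>s - {a}. {x. 0 < lam s x b})" by auto
  also have "open \<dots>" using continuous_lam[OF s] max_finite[OF s]
    by (intro open_INT ballI open_Collect_less continuous_on_const) auto
  finally have "open ?Pos" .
  moreover have "p \<in> ?Pos" using p by blast
  ultimately obtain r where r: "r > 0" "ball p r \<subseteq> ?Pos" using openE by blast
  have intrI: "x \<in> intr s" if "x \<in> ball p r" "0 < lam s x a" for x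
    using that r(2) unfolding intr_def by auto
  \<comment> \<open>A point within \<rho> of p, moved by at most 3 \<rho> times w, remains in the
    ball of radius r.\<close>
  define \<rho> where "\<rho> = r / (1 + 3 * norm w)"
  have nw: "1 + 3 * norm w > 0" by (simp add: add_pos_nonneg)
  have \<rho>: "\<rho> > 0" "\<rho> * (1 + 3 * norm w) = r" using r(1) nw by (auto simp: \<rho>_def)
  have \<rho>r: "\<rho> \<le> r" using mult_left_mono[of 1 "1 + 3 * norm w" \<rho>] \<rho> by simp
  obtain K where K: "K-lipschitz_on UNIV (\<lambda>x. lam s x a)" using lam_lipschitz[OF s a] by blast
  define V where "V k x = v k (x + max 0 (- lam s x a) *\<^sub>R w)" for k x
  have foldlip: "(1 + K * norm w)-lipschitz_on UNIV (\<lambda>x. x + max 0 (- lam s x a) *\<^sub>R w)"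
  proof (rule lipschitz_on_add)
    show "1-lipschitz_on UNIV (\<lambda>x::real^'n. x)" by (rule lipschitz_on_id)
    show "(K * norm w)-lipschitz_on UNIV (\<lambda>x. max 0 (- lam s x a) *\<^sub>R w)"
    proof (rule lipschitz_onI)
      fix x y :: "real^'n"
      have "\<bar>max 0 (- lam s x a) - max 0 (- lam s y a)\<bar> \<le> \<bar>lam s x a - lam s y a\<bar>" by (auto simp: max_def abs_real_def)
      also have "\<dots> \<le> K * dist x y" using lipschitz_onD[OF K, of x y] by (simp add: dist_real_def)
      finally have "\<bar>max 0 (- lam s x a) - max 0 (- lam s y a)\<bar> * norm w \<le> K * dist x y * norm w" by (rule mult_right_mono) simp
      then show "dist (max 0 (- lam s x a) *\<^sub>R w) (max 0 (- lam s y a) *\<^sub>R w) \<le> K * norm w * dist x y"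
        by (simp add: dist_norm scaleR_diff_left[symmetric] mult_ac)
    qed (use lipschitz_on_nonneg[OF K] in simp)
  qed
  have Vlip: "\<exists>L. L-lipschitz_on UNIV (V k)" for k
  proof -
    obtain L where L: "L-lipschitz_on UNIV (v k)" using lip by blast
    have "(L * (1 + K * norm w))-lipschitz_on UNIV (\<lambda>x. v k (x + max 0 (- lam s x a) *\<^sub>R w))"
      by (rule lipschitz_on_compose2[OF foldlip lipschitz_on_subset[OF L]]) simp
    then show ?thesis unfolding V_def[abs_def] by blast
  qed
  have meas: "\<And>h. \<exists>L. L-lipschitz_on UNIV h \<Longrightarrow> h \<in> borel_measurable borel" for h :: "real^'n \<Rightarrow> real"
    using lipschitz_on_continuous_on borel_measurable_continuous_onI by blast
  show ?thesis
  proof (intro exI conjI allI impI)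
    show "\<rho> > 0" by (rule \<rho>)
    fix \<theta> :: real assume \<theta>: "0 < \<theta>" "\<theta> < \<rho>"
    \<comment> \<open>On the strip the coordinate of a lies between -2 \<theta> and -\<theta>. The
      shift adds 3 \<theta> to it and so lands inside the simplex.\<close>
    define W where "W = (3 * \<theta>) *\<^sub>R w"
    let ?R = "{x. dist x p < \<rho> \<and> - 2 * \<theta> < lam s x a \<and> lam s x a < - \<theta>}"
    have along: "lam s (x + \<tau> *\<^sub>R W) a = lam s x a + \<tau> * (3 * \<theta>)" for x \<tau>
      unfolding W_def using lam_along[OF s a, of x "\<tau> * (3 * \<theta>)" w] w(1) by simp
    have dV: "AE x in lborel. x \<in> ball p r \<longrightarrow> ennreal \<bar>dir_deriv W (V k) x\<bar> \<le> ennreal \<bar>dir_deriv W (v k) x\<bar> * indicator (intr s) x" for k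
    proof -
      obtain L where L: "L-lipschitz_on UNIV (v k)" using lip by blast
      have "AE x in lebesgue. x \<notin> {x. lam s x a = 0}"
        using negligible_lam_zero[OF s a] by (intro AE_not_in) (simp add: negligible_iff_null_sets)
      then have "AE x in lborel. x \<notin> {x. lam s x a = 0}" by (simp add: AE_completion_iff)
      then show ?thesis using AE_dir_deriv[OF L, of W]
      proof eventually_elim
        case (elim x)
        have cont: "continuous_on UNIV (\<lambda>\<tau>. lam s x a + \<tau> * (3 * \<theta>))" by (intro continuous_intros)
        show ?case
        proof
          assume x: "x \<in> ball p r"
          consider "lam s x a > 0" | "lam s x a < 0" using elim(1) by force
          then show "ennreal \<bar>dir_deriv W (V k) x\<bar> \<le> ennreal \<bar>dir_deriv W (v k) x\<bar> * indicator (intr s) x"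
          proof cases
            case 1
            have "open {\<tau>. 0 < lam s x a + \<tau> * (3 * \<theta>)}" by (intro open_Collect_less cont continuous_on_const)
            then have "eventually (\<lambda>\<tau>. 0 < lam s x a + \<tau> * (3 * \<theta>)) (nhds 0)" using 1 by (auto simp: eventually_nhds)
            then have ev: "eventually (\<lambda>\<tau>. v k (x + \<tau> *\<^sub>R W) = V k (x + \<tau> *\<^sub>R W)) (nhds 0)"
              by eventually_elim (simp add: V_def along max_def)
            have "((\<lambda>\<tau>. V k (x + \<tau> *\<^sub>R W)) has_real_derivative dir_deriv W (v k) x) (at 0)"
              by (rule iffD1[OF DERIV_cong_ev[OF refl ev refl] elim(2)])
            then have "dir_deriv W (V k) x = dir_deriv W (v k) x" by (rule dir_deriv_eq)
            then show ?thesis using intrI[OF x 1] by simp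
          next
            case 2
            have "open {\<tau>. lam s x a + \<tau> * (3 * \<theta>) < 0}" by (intro open_Collect_less cont continuous_on_const)
            then have "eventually (\<lambda>\<tau>. lam s x a + \<tau> * (3 * \<theta>) < 0) (nhds 0)" using 2 by (auto simp: eventually_nhds)
            then have ev: "eventually (\<lambda>\<tau>. v k (x - lam s x a *\<^sub>R w) = V k (x + \<tau> *\<^sub>R W)) (nhds 0)"
            proof eventually_elim
              case (elim \<tau>)
              have e: "x + \<tau> *\<^sub>R W + max 0 (- lam s (x + \<tau> *\<^sub>R W) a) *\<^sub>R w = x - lam s x a *\<^sub>R w"
                using elim unfolding along by (simp add: max_def W_def scaleR_add_left scaleR_diff_left)
              show ?case unfolding V_def e ..
            qed
            have "((\<lambda>\<tau>. V k (x + \<tau> *\<^sub>R W)) has_real_derivative 0) (at 0)"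
              by (rule iffD1[OF DERIV_cong_ev[OF refl ev refl] DERIV_const])
            then have "dir_deriv W (V k) x = 0" by (rule dir_deriv_eq)
            then show ?thesis by simp
          qed
        qed
      qed
    qed
    have bound: "(\<integral>\<^sup>+x. ennreal \<bar>v k (x - lam s x a *\<^sub>R w) - c\<bar> * indicator ?R x \<partial>lborel)
      \<le> ennreal \<bar>3 * \<theta> * \<kappa>\<bar> * (\<integral>\<^sup>+x. ennreal \<bar>dir_deriv (axis i 1) (v k) x\<bar> * indicator (intr s) x \<partial>lborel)
        + (\<integral>\<^sup>+x. ennreal \<bar>v k x - c\<bar> * indicator (intr s) x \<partial>lborel)" for k
    proof -
      obtain L where L: "L-lipschitz_on UNIV (v k)" using lip by blast
      obtain L' where L': "L'-lipschitz_on UNIV (V k)" using Vlip by blast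
      have [measurable]: "v k \<in> borel_measurable borel" "V k \<in> borel_measurable borel" "intr s \<in> sets borel"
        by (rule meas[OF lip], rule meas[OF Vlip], use open_intr[OF s] in simp)
      have [measurable]: "ball p r \<in> sets borel" by simp
      have "(\<integral>\<^sup>+x. ennreal \<bar>v k (x - lam s x a *\<^sub>R w) - c\<bar> * indicator ?R x \<partial>lborel)
        \<le> (\<integral>\<^sup>+x. ennreal \<bar>V k (x + W) - V k x\<bar> * indicator (ball p r) x * indicator (ball p r) (x + W)
           + ennreal \<bar>v k (x + W) - c\<bar> * indicator (intr s) (x + W) \<partial>lborel)"
      proof (rule nn_integral_mono)
        fix x
        show "ennreal \<bar>v k (x - lam s x a *\<^sub>R w) - c\<bar> * indicator ?R x
          \<le> ennreal \<bar>V k (x + W) - V k x\<bar> * indicator (ball p r) x * indicator (ball p r) (x + W)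
           + ennreal \<bar>v k (x + W) - c\<bar> * indicator (intr s) (x + W)"
        proof (cases "x \<in> ?R")
          case True
          have l: "lam s (x + W) a = lam s x a + 3 * \<theta>" using along[of x 1] by simp
          have lp: "0 < lam s (x + W) a" using True \<theta> unfolding l by simp
          have b1: "x \<in> ball p r" using True \<rho>r by (simp add: dist_commute)
          have "norm W = 3 * \<theta> * norm w" using \<theta> by (simp add: W_def)
          also have "\<dots> \<le> 3 * \<rho> * norm w" using \<theta> by (intro mult_right_mono) auto
          finally have "norm W \<le> \<rho> * (3 * norm w)" by simp
          moreover have "dist p (x + W) \<le> dist p x + norm W"
            using norm_triangle_ineq4[of "p - x" W] by (simp add: dist_norm diff_diff_add)
          moreover have "\<rho> + \<rho> * (3 * norm w) = r" using \<rho>(2) by (simp add: algebra_simps)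
          ultimately have b2: "x + W \<in> ball p r" using True by (simp add: dist_commute)
          have V1: "V k (x + W) = v k (x + W)" using lp by (simp add: V_def max_def)
          have V2: "V k x = v k (x - lam s x a *\<^sub>R w)" using True \<theta> by (simp add: V_def max_def)
          have "ennreal \<bar>v k (x - lam s x a *\<^sub>R w) - c\<bar> \<le> ennreal (\<bar>V k (x + W) - V k x\<bar> + \<bar>v k (x + W) - c\<bar>)"
            unfolding V1 V2 by (rule ennreal_leI) linarith
          then show ?thesis using True b1 b2 intrI[OF b2 lp] by simp
        qed simp
      qed
      also have "\<dots> = (\<integral>\<^sup>+x. ennreal \<bar>V k (x + W) - V k x\<bar> * indicator (ball p r) x * indicator (ball p r) (x + W) \<partial>lborel)
        + (\<integral>\<^sup>+x. ennreal \<bar>v k (x + W) - c\<bar> * indicator (intr s) (x + W) \<partial>lborel)"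
        by (rule nn_integral_add) measurable
      also have "(\<integral>\<^sup>+x. ennreal \<bar>v k (x + W) - c\<bar> * indicator (intr s) (x + W) \<partial>lborel) = (\<integral>\<^sup>+x. ennreal \<bar>v k x - c\<bar> * indicator (intr s) x \<partial>lborel)"
        by (rule nn_integral_lborel_translate) measurable
      also have "(\<integral>\<^sup>+x. ennreal \<bar>V k (x + W) - V k x\<bar> * indicator (ball p r) x * indicator (ball p r) (x + W) \<partial>lborel)
        \<le> (\<integral>\<^sup>+x. ennreal \<bar>dir_deriv W (V k) x\<bar> * indicator (ball p r) x \<partial>lborel)"
        by (rule translation_L1_bound[OF L' convex_ball]) simp
      also have "\<dots> \<le> (\<integral>\<^sup>+x. ennreal \<bar>dir_deriv W (v k) x\<bar> * indicator (intr s) x \<partial>lborel)"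
        using dV[of k] by (intro nn_integral_mono_AE) (auto elim!: eventually_mono simp: indicator_def)
      also have "\<dots> = ennreal \<bar>3 * \<theta> * \<kappa>\<bar> * (\<integral>\<^sup>+x. ennreal \<bar>dir_deriv (axis i 1) (v k) x\<bar> * indicator (intr s) x \<partial>lborel)"
        unfolding W_def w(2) scaleR_scaleR by (rule nn_integral_dir_deriv_scale[OF L]) measurable
      finally show ?thesis by (simp add: add_right_mono)
    qed
    have "(\<lambda>k. ennreal \<bar>3 * \<theta> * \<kappa>\<bar> * (\<integral>\<^sup>+x. ennreal \<bar>dir_deriv (axis i 1) (v k) x\<bar> * indicator (intr s) x \<partial>lborel)
        + (\<integral>\<^sup>+x. ennreal \<bar>v k x - c\<bar> * indicator (intr s) x \<partial>lborel)) \<longlonglongrightarrow> ennreal \<bar>3 * \<theta> * \<kappa>\<bar> * 0 + 0"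
      by (intro tendsto_add v0 ennreal_tendsto_cmult d0) simp
    then have lim: "(\<lambda>k. ennreal \<bar>3 * \<theta> * \<kappa>\<bar> * (\<integral>\<^sup>+x. ennreal \<bar>dir_deriv (axis i 1) (v k) x\<bar> * indicator (intr s) x \<partial>lborel)
        + (\<integral>\<^sup>+x. ennreal \<bar>v k x - c\<bar> * indicator (intr s) x \<partial>lborel)) \<longlonglongrightarrow> 0" by simp
    show "(\<lambda>k. \<integral>\<^sup>+x. ennreal \<bar>v k (x - lam s x a *\<^sub>R w) - c\<bar> * indicator ?R x \<partial>lborel) \<longlonglongrightarrow> 0"
      by (rule tendsto_sandwich[OF _ _ tendsto_const lim]) (use bound in auto)
  qed
qed

text \<open>The affine bijection that identifies the common face of \<open>s\<close> and \<open>s'\<close> and takes \<open>w\<close> to \<open>w'\<close>.\<close>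

definition jump :: "'v set \<Rightarrow> 'v set \<Rightarrow> 'v \<Rightarrow> real^'n \<Rightarrow> real^'n \<Rightarrow> real^'n \<Rightarrow> real^'n" where
  "jump s s' a w w' x = (\<Sum>v\<in>s - {a}. lam s (x - lam s x a *\<^sub>R w) v *\<^sub>R vert s' v) + lam s x a *\<^sub>R w'"

text \<open>z projects x along w to the face hyperplane of s, and q is the point on that of s' with
  the same barycentric coordinates. The height above the face is kept, so exchanging the roles of s
  and s' gives the inverse map.\<close>

lemma jump_facts:
  assumes s: "s \<in> rp_max P" "a \<in> s" "lamlin s a w = 1" and s': "s' \<in> rp_max P" "a' \<in> s'" "lamlin s' a' w' = 1"
    and face: "s - {a} = s' - {a'}"
  defines "z \<equiv> \<lambda>x. x - lam s x a *\<^sub>R w" and "q \<equiv> \<lambda>x. \<Sum>v\<in>s - {a}. lam s (x - lam s x a *\<^sub>R w) v *\<^sub>R vert s' v"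
  shows "lam s (z x) a = 0" and "\<And>v. v \<in> s - {a} \<Longrightarrow> lam s' (q x) v = lam s (z x) v" and "lam s' (q x) a' = 0"
    and "lam s' (jump s s' a w w' x) a' = lam s x a"
    and "jump s s' a w w' x - lam s' (jump s s' a w w' x) a' *\<^sub>R w' = q x"
    and "jump s' s a' w' w (jump s s' a w w' x) = x"
proof -
  have fin: "finite s" "finite s'" using s s' max_finite by auto
  show z0: "lam s (z x) a = 0"
    using lam_along[OF s(1,2), of x "- lam s x a" w] s(3) by (simp add: z_def)
  have sum1: "(\<Sum>v\<in>s - {a}. lam s (z x) v) = 1"
    using lam_sum[OF s(1), of "z x"] z0 fin s(2) by (simp add: sum.remove)
  define c where "c v = (if v = a' then 0 else lam s (z x) v)" for v
  have c1: "sum c s' = 1"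
    using fin s'(2) sum1 unfolding face by (simp add: sum.remove[of s' a'] c_def)
  have c2: "q x = (\<Sum>v\<in>s'. c v *\<^sub>R vert s' v)"
    using fin s'(2) unfolding q_def face by (simp add: sum.remove[of s' a'] c_def z_def)
  have qc: "lam s' (q x) v = c v" if "v \<in> s'" for v by (rule lam_unique[OF s'(1) c1 c2 that])
  show qv: "\<And>v. v \<in> s - {a} \<Longrightarrow> lam s' (q x) v = lam s (z x) v" using qc unfolding face by (auto simp: c_def)
  show q0: "lam s' (q x) a' = 0" using qc[OF s'(2)] by (simp add: c_def)
  have j: "jump s s' a w w' x = q x + lam s x a *\<^sub>R w'" by (simp add: jump_def q_def)
  show ja: "lam s' (jump s s' a w w' x) a' = lam s x a"
    unfolding j using lam_along[OF s'(1,2), of "q x" "lam s x a" w'] q0 s'(3) by simp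
  show jq: "jump s s' a w w' x - lam s' (jump s s' a w w' x) a' *\<^sub>R w' = q x" unfolding ja by (simp add: j)
  have "jump s' s a' w' w (jump s s' a w w' x) = (\<Sum>v\<in>s' - {a'}. lam s' (q x) v *\<^sub>R vert s v) + lam s x a *\<^sub>R w"
    unfolding jump_def[of s' s] jq by (simp only: ja)
  also have "(\<Sum>v\<in>s' - {a'}. lam s' (q x) v *\<^sub>R vert s v) = (\<Sum>v\<in>s - {a}. lam s (z x) v *\<^sub>R vert s v)"
    unfolding face[symmetric] using qv by (intro sum.cong) auto
  also have "\<dots> = z x" using lam_rep[OF s(1), of "z x"] z0 fin s(2) by (simp add: sum.remove)
  also have "z x + lam s x a *\<^sub>R w = x" by (simp add: z_def)
  finally show "jump s' s a' w' w (jump s s' a w w' x) = x" .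
qed

lemma jump_lipschitz:
  assumes s: "s \<in> rp_max P" and a: "a \<in> s" shows "\<exists>L. L-lipschitz_on UNIV (jump s s' a w w')"
proof -
  have sc: "\<exists>L. L-lipschitz_on UNIV (\<lambda>x. lam s x v *\<^sub>R b)" if v: "v \<in> s" for v and b :: "real^'n"
  proof -
    obtain K where K: "K-lipschitz_on UNIV (\<lambda>x. lam s x v)" using lam_lipschitz[OF s v] by blast
    have "(K * norm b)-lipschitz_on UNIV (\<lambda>x. lam s x v *\<^sub>R b)"
    proof (rule lipschitz_onI)
      fix x y :: "real^'n"
      show "dist (lam s x v *\<^sub>R b) (lam s y v *\<^sub>R b) \<le> K * norm b * dist x y"
        using mult_right_mono[OF lipschitz_onD[OF K, of x y], of "norm b"]
        by (simp add: dist_norm scaleR_diff_left[symmetric] mult_ac)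
    qed (use lipschitz_on_nonneg[OF K] in simp)
    then show ?thesis by blast
  qed
  have jx: "jump s s' a w w' x = (\<Sum>v\<in>s - {a}. lam s x v *\<^sub>R vert s' v + lam s x a *\<^sub>R ((- lamlin s v w) *\<^sub>R vert s' v)) + lam s x a *\<^sub>R w'" for x
  proof -
    have "lam s (x - lam s x a *\<^sub>R w) v = lam s x v - lam s x a * lamlin s v w" if "v \<in> s" for v
      using lam_along[OF s that, of x "- lam s x a" w] by simp
    then have "(\<Sum>v\<in>s - {a}. lam s (x - lam s x a *\<^sub>R w) v *\<^sub>R vert s' v)
      = (\<Sum>v\<in>s - {a}. lam s x v *\<^sub>R vert s' v + lam s x a *\<^sub>R ((- lamlin s v w) *\<^sub>R vert s' v))"
      by (intro sum.cong) (auto simp: scaleR_diff_left)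
    then show ?thesis by (simp add: jump_def)
  qed
  have "jump s s' a w w' = (\<lambda>x. (\<Sum>v\<in>s - {a}. lam s x v *\<^sub>R vert s' v + lam s x a *\<^sub>R ((- lamlin s v w) *\<^sub>R vert s' v)) + lam s x a *\<^sub>R w')"
    by (rule ext) (rule jx)
  moreover have "\<exists>L. L-lipschitz_on UNIV (\<lambda>x. (\<Sum>v\<in>s - {a}. lam s x v *\<^sub>R vert s' v + lam s x a *\<^sub>R ((- lamlin s v w) *\<^sub>R vert s' v)) + lam s x a *\<^sub>R w')"
  proof -
    have "\<exists>L. L-lipschitz_on UNIV (\<lambda>x. lam s x v *\<^sub>R vert s' v + lam s x a *\<^sub>R ((- lamlin s v w) *\<^sub>R vert s' v))" if vs: "v \<in> s - {a}" for v
    proof -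
      obtain L where L: "L-lipschitz_on UNIV (\<lambda>x. lam s x v *\<^sub>R vert s' v)" using sc[of v "vert s' v"] vs by blast
      obtain M where M: "M-lipschitz_on UNIV (\<lambda>x. lam s x a *\<^sub>R ((- lamlin s v w) *\<^sub>R vert s' v))"
        using sc[OF a, of "(- lamlin s v w) *\<^sub>R vert s' v"] by blast
      show ?thesis by (rule exI, rule lipschitz_on_add[OF L M])
    qed
    note terms = this
    have "\<exists>L. L-lipschitz_on UNIV (\<lambda>x. \<Sum>v\<in>s - {a}. lam s x v *\<^sub>R vert s' v + lam s x a *\<^sub>R ((- lamlin s v w) *\<^sub>R vert s' v))"
      by (rule lipschitz_on_sum_ex[OF _ terms]) (use max_finite[OF s] in simp_all)
    then obtain L where L: "L-lipschitz_on UNIV (\<lambda>x. \<Sum>v\<in>s - {a}. lam s x v *\<^sub>R vert s' v + lam s x a *\<^sub>R ((- lamlin s v w) *\<^sub>R vert s' v))"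
      by blast
    obtain M where M: "M-lipschitz_on UNIV (\<lambda>x. lam s x a *\<^sub>R w')" using sc[OF a, of w'] by blast
    show ?thesis by (rule exI, rule lipschitz_on_add[OF L M])
  qed
  ultimately show ?thesis by (simp only:)
qed

text \<open>The preimage of a null set under the jump is its image under the inverse jump, which is
  Lipschitz.\<close>

lemma AE_jump:
  assumes s: "s \<in> rp_max P" "a \<in> s" "lamlin s a w = 1" and s': "s' \<in> rp_max P" "a' \<in> s'" "lamlin s' a' w' = 1"
    and face: "s - {a} = s' - {a'}" and Q: "AE x in lborel. Q x"
  shows "AE x in lborel. Q (jump s s' a w w' x)"
proof -
  obtain N where N: "N \<in> null_sets lborel" "\<forall>x. x \<notin> N \<longrightarrow> Q x" using AE_lborel_null[OF Q] by blast
  obtain L where L: "L-lipschitz_on UNIV (jump s' s a' w' w)" using jump_lipschitz[OF s'(1,2)] by blast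
  have "negligible N" using N(1) negligible_iff_null_sets null_sets_completionI by blast
  then have "negligible (jump s' s a' w' w ` N)" using L by (rule negligible_lipschitz_image) simp
  then have "AE x in lebesgue. x \<notin> jump s' s a' w' w ` N" by (intro AE_not_in) (simp add: negligible_iff_null_sets)
  then have "AE x in lborel. x \<notin> jump s' s a' w' w ` N" by (simp add: AE_completion_iff)
  then show ?thesis
  proof eventually_elim
    case (elim x)
    have "jump s s' a w w' x \<notin> N" using elim jump_facts(6)[OF s s' face, of x] by (metis imageI)
    then show ?case using N(2) by blast
  qed
qed

lemma intr_const_unique:
  assumes s: "s \<in> rp_max P" and "AE x in lebesgue. x \<in> intr s \<longrightarrow> h x = c" "AE x in lebesgue. x \<in> intr s \<longrightarrow> h x = d"
  shows "c = d"
proof -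
  have "AE x in lebesgue. x \<in> intr s \<longrightarrow> c = d" using assms(2,3) by eventually_elim auto
  then have "AE x in lborel. x \<in> intr s \<longrightarrow> c = d" by (simp only: AE_completion_iff)
  from AE_lborel_open_witness[OF this open_intr[OF s] intr_nonempty[OF s]] show ?thesis by blast
qed

lemma face_barycenter:
  assumes s: "s \<in> rp_max P" and a: "a \<in> s"
  defines "p \<equiv> \<Sum>v\<in>s - {a}. (1 / real CARD('n)) *\<^sub>R vert s v"
  shows "lam s p a = 0" and "\<And>v. v \<in> s - {a} \<Longrightarrow> lam s p v = 1 / real CARD('n)"
proof -
  define c where "c v = (if v = a then 0 else 1 / real CARD('n))" for v
  have fin: "finite s" and card: "card (s - {a}) = CARD('n)" using max_finite[OF s] card_max[OF s] a by auto
  have "sum c s = (\<Sum>v\<in>s - {a}. 1 / real CARD('n))" using fin a by (simp add: sum.remove[of s a] c_def)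
  also have "\<dots> = 1" using card by simp
  finally have 1: "sum c s = 1" .
  have 2: "p = (\<Sum>v\<in>s. c v *\<^sub>R vert s v)" using fin a by (simp add: sum.remove[of s a] c_def p_def)
  have "lam s p v = c v" if "v \<in> s" for v by (rule lam_unique[OF s 1 2 that])
  then show "lam s p a = 0" "\<And>v. v \<in> s - {a} \<Longrightarrow> lam s p v = 1 / real CARD('n)" using a by (auto simp: c_def)
qed

text \<open>\<open>face_limit\<close> on either side says that the values of the same
  \<open>u k\<close> on the common face tend to the constant of that side. After transporting one of
  the two statements by \<open>jump\<close> and passing to a subsequence, a single point of the face
  satisfies both.\<close>

lemma adjacent_const:
  assumes f: "f \<in> borel_measurable (rp_vol P)" and G: "local_gradient P f G" and G0: "AE y in rp_vol P. G y = 0"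
    and s: "s \<in> rp_max P" and s': "s' \<in> rp_max P" and card: "card (s \<inter> s') = CARD('n)"
    and c: "AE x in lebesgue. x \<in> intr s \<longrightarrow> f (rp_param P s x) = c"
    and c': "AE x in lebesgue. x \<in> intr s' \<longrightarrow> f (rp_param P s' x) = c'"
  shows "c = c'"
proof -
  have single: "\<exists>a\<in>t. t - {a} = s \<inter> s'" if t: "t \<in> rp_max P" "s \<inter> s' \<subseteq> t" for t
  proof -
    have "card (t - s \<inter> s') = 1" using card_max[OF t(1)] card t(2) max_finite[OF t(1)] by (simp add: card_Diff_subset finite_subset)
    then obtain a where "t - s \<inter> s' = {a}" by (rule card_1_singletonE)
    then show ?thesis using t(2) by (intro bexI[of _ a]) auto
  qed
  obtain a where a: "a \<in> s" "s - {a} = s \<inter> s'" using single[OF s] by auto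
  obtain a' where a': "a' \<in> s'" "s' - {a'} = s \<inter> s'" using single[OF s'] by auto
  have face: "s - {a} = s' - {a'}" using a a' by simp
  obtain u U where u: "\<And>k. rp_lipschitz_on P U (u k)" and U: "cell s \<subseteq> U" "cell s' \<subseteq> U"
    and lims: "\<forall>t\<in>{s, s'}. \<exists>c. (AE x in lebesgue. x \<in> intr t \<longrightarrow> f (rp_param P t x) = c) \<and>
      (\<lambda>k. \<integral>\<^sup>+x. ennreal \<bar>pull t (u k) x - c\<bar> * indicator (intr t) x \<partial>lborel) \<longlonglongrightarrow> 0 \<and>
      (\<forall>j. (\<lambda>k. \<integral>\<^sup>+x. ennreal \<bar>dir_deriv (axis j 1) (pull t (u k)) x\<bar> * indicator (intr t) x \<partial>lborel) \<longlonglongrightarrow> 0)"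
    using simplex_limits[OF f G G0, of "{s, s'}"] s s' by auto
  obtain d where d: "AE x in lebesgue. x \<in> intr s \<longrightarrow> f (rp_param P s x) = d"
    and l1: "(\<lambda>k. \<integral>\<^sup>+x. ennreal \<bar>pull s (u k) x - d\<bar> * indicator (intr s) x \<partial>lborel) \<longlonglongrightarrow> 0"
    and l2: "\<And>j. (\<lambda>k. \<integral>\<^sup>+x. ennreal \<bar>dir_deriv (axis j 1) (pull s (u k)) x\<bar> * indicator (intr s) x \<partial>lborel) \<longlonglongrightarrow> 0"
    using lims by auto
  obtain d' where d': "AE x in lebesgue. x \<in> intr s' \<longrightarrow> f (rp_param P s' x) = d'"
    and l1': "(\<lambda>k. \<integral>\<^sup>+x. ennreal \<bar>pull s' (u k) x - d'\<bar> * indicator (intr s') x \<partial>lborel) \<longlonglongrightarrow> 0"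
    and l2': "\<And>j. (\<lambda>k. \<integral>\<^sup>+x. ennreal \<bar>dir_deriv (axis j 1) (pull s' (u k)) x\<bar> * indicator (intr s') x \<partial>lborel) \<longlonglongrightarrow> 0"
    using lims by auto
  have cd: "c = d" by (rule intr_const_unique[OF s c d])
  have cd': "c' = d'" by (rule intr_const_unique[OF s' c' d'])
  have lip: "\<exists>L. L-lipschitz_on UNIV (pull s (u k))" for k by (rule pull_lipschitz[OF s u U(1)])
  have lip': "\<exists>L. L-lipschitz_on UNIV (pull s' (u k))" for k by (rule pull_lipschitz[OF s' u U(2)])
  obtain \<kappa> i where wi: "lamlin s a (\<kappa> *\<^sub>R axis i 1) = 1" using ex_transversal_axis[OF s a(1)] by blast
  obtain \<kappa>' i' where wi': "lamlin s' a' (\<kappa>' *\<^sub>R axis i' 1) = 1" using ex_transversal_axis[OF s' a'(1)] by blast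
  define w where "w = (\<kappa> *\<^sub>R axis i 1 :: real^'n)"
  define w' where "w' = (\<kappa>' *\<^sub>R axis i' 1 :: real^'n)"
  have w: "lamlin s a w = 1" and w': "lamlin s' a' w' = 1" using wi wi' by (simp_all add: w_def w'_def)
  define p where "p = (\<Sum>v\<in>s - {a}. (1 / real CARD('n)) *\<^sub>R vert s v)"
  define p' where "p' = (\<Sum>v\<in>s' - {a'}. (1 / real CARD('n)) *\<^sub>R vert s' v)"
  note pb = face_barycenter[OF s a(1), folded p_def] and pb' = face_barycenter[OF s' a'(1), folded p'_def]
  have pp: "0 < lam s p b" if "b \<in> s - {a}" for b using pb(2)[OF that] by simp
  have pp': "0 < lam s' p' b" if "b \<in> s' - {a'}" for b using pb'(2)[OF that] by simp
  obtain \<rho> where \<rho>: "\<rho> > 0" and fl: "\<forall>\<theta>. 0 < \<theta> \<longrightarrow> \<theta> < \<rho> \<longrightarrow>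
    (\<lambda>k. \<integral>\<^sup>+x. ennreal \<bar>pull s (u k) (x - lam s x a *\<^sub>R w) - d\<bar> * indicator {x. dist x p < \<rho> \<and> - 2 * \<theta> < lam s x a \<and> lam s x a < - \<theta>} x \<partial>lborel) \<longlonglongrightarrow> 0"
    using face_limit[OF s a(1) pp lip l1 l2 w w_def] by blast
  obtain \<rho>' where \<rho>': "\<rho>' > 0" and fl': "\<forall>\<theta>. 0 < \<theta> \<longrightarrow> \<theta> < \<rho>' \<longrightarrow>
    (\<lambda>k. \<integral>\<^sup>+x. ennreal \<bar>pull s' (u k) (x - lam s' x a' *\<^sub>R w') - d'\<bar> * indicator {x. dist x p' < \<rho>' \<and> - 2 * \<theta> < lam s' x a' \<and> lam s' x a' < - \<theta>} x \<partial>lborel) \<longlonglongrightarrow> 0"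
    using face_limit[OF s' a'(1) pp' lip' l1' l2' w' w'_def] by blast
  define m where "m = min \<rho> \<rho>'"
  define D where "D = 1 + norm w + norm w'"
  \<comment> \<open>So small that x0, at distance (3/2) \<theta> times the norm of w from p, and its
    counterpart near p' lie within the radii obtained from \<open>face_limit\<close>.\<close>
  define \<theta> where "\<theta> = m / (2 * D)"
  have m: "m > 0" "m \<le> \<rho>" "m \<le> \<rho>'" using \<rho> \<rho>' by (auto simp: m_def)
  have nn: "D > 0" by (simp add: D_def add_pos_nonneg)
  have \<theta>0: "\<theta> > 0" using m nn by (simp add: \<theta>_def)
  have \<theta>m: "2 * \<theta> * D = m" using nn by (simp add: \<theta>_def)
  have tm: "2 * \<theta> + 2 * (\<theta> * norm w) + 2 * (\<theta> * norm w') = m" using \<theta>m unfolding D_def by (simp add: algebra_simps)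
  have t0: "0 \<le> \<theta> * norm w" "0 \<le> \<theta> * norm w'" using \<theta>0 by auto
  have \<theta>: "\<theta> < \<rho>" "\<theta> < \<rho>'" using tm t0 m \<theta>0 by linarith+
  let ?R = "{x. dist x p < \<rho> \<and> - 2 * \<theta> < lam s x a \<and> lam s x a < - \<theta>}"
  let ?R' = "{x. dist x p' < \<rho>' \<and> - 2 * \<theta> < lam s' x a' \<and> lam s' x a' < - \<theta>}"
  let ?z = "\<lambda>x. x - lam s x a *\<^sub>R w" and ?z' = "\<lambda>x. x - lam s' x a' *\<^sub>R w'"
  let ?j = "jump s s' a w w'"
  have cl: "continuous_on UNIV (\<lambda>x. lam s x v)" if "v \<in> s" for v by (rule continuous_lam[OF s that])
  have cl': "continuous_on UNIV (\<lambda>x. lam s' x v)" if "v \<in> s'" for v by (rule continuous_lam[OF s' that])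
  have cz: "continuous_on UNIV ?z" and cz': "continuous_on UNIV ?z'" by (intro continuous_intros cl cl' a a')+
  have oR: "open ?R" and oR': "open ?R'"
    by (intro open_Collect_conj open_Collect_less continuous_intros cl cl' a a')+
  have pm: "(\<lambda>x. pull s (u k) (?z x) - d) \<in> borel_measurable borel" for k
  proof -
    obtain L where "L-lipschitz_on UNIV (pull s (u k))" using lip by blast
    then have "continuous_on UNIV (pull s (u k))" by (rule lipschitz_on_continuous_on)
    then have "continuous_on UNIV (\<lambda>x. pull s (u k) (?z x))" by (rule continuous_on_compose2[OF _ cz]) simp
    then show ?thesis by (intro borel_measurable_continuous_onI continuous_intros)
  qed
  have pm': "(\<lambda>x. pull s' (u k) (?z' x) - d') \<in> borel_measurable borel" for k
  proof -
    obtain L where "L-lipschitz_on UNIV (pull s' (u k))" using lip' by blast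
    then have "continuous_on UNIV (pull s' (u k))" by (rule lipschitz_on_continuous_on)
    then have "continuous_on UNIV (\<lambda>x. pull s' (u k) (?z' x))" by (rule continuous_on_compose2[OF _ cz']) simp
    then show ?thesis by (intro borel_measurable_continuous_onI continuous_intros)
  qed
  have oRb: "?R \<in> sets borel" "?R' \<in> sets borel" using oR oR' by auto
  obtain r1 :: "nat \<Rightarrow> nat" where r1: "strict_mono r1" "AE x in lborel. x \<in> ?R \<longrightarrow> (\<lambda>k. pull s (u (r1 k)) (?z x) - d) \<longlonglongrightarrow> 0"
    using subseq_AE_restrict[OF pm oRb(1) fl[rule_format, OF \<theta>0 \<theta>(1)]] by blast
  have fl2: "(\<lambda>k. \<integral>\<^sup>+x. ennreal \<bar>pull s' (u (r1 k)) (?z' x) - d'\<bar> * indicator ?R' x \<partial>lborel) \<longlonglongrightarrow> 0"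
    using LIMSEQ_subseq_LIMSEQ[OF fl'[rule_format, OF \<theta>0 \<theta>(2)] r1(1)] by (simp add: o_def)
  \<comment> \<open>The second subsequence is taken inside the first, since both limits are needed
    along the same indices.\<close>
  obtain r2 :: "nat \<Rightarrow> nat" where r2: "strict_mono r2" "AE x in lborel. x \<in> ?R' \<longrightarrow> (\<lambda>k. pull s' (u (r1 (r2 k))) (?z' x) - d') \<longlonglongrightarrow> 0"
    using subseq_AE_restrict[OF pm' oRb(2) fl2] by blast
  have r2j: "AE x in lborel. ?j x \<in> ?R' \<longrightarrow> (\<lambda>k. pull s' (u (r1 (r2 k))) (?z' (?j x)) - d') \<longlonglongrightarrow> 0"
    by (rule AE_jump[OF s a(1) w s' a'(1) w' face r2(2)])
  let ?T = "{x. \<forall>v\<in>s - {a}. 0 < lam s (?z x) v}"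
  have "?T = (\<Inter>v\<in>s - {a}. {x. 0 < lam s (?z x) v})" by auto
  also have "open \<dots>" using max_finite[OF s]
    by (intro open_INT ballI open_Collect_less continuous_on_const continuous_on_compose2[OF cl cz]) auto
  finally have oT: "open ?T" .
  have "continuous_on UNIV ?j" using jump_lipschitz[OF s a(1)] lipschitz_on_continuous_on by blast
  then have oj: "open (?j -` ?R')" using oR' by (rule open_vimage[rotated])
  \<comment> \<open>The point below the barycenter of the face at height -(3/2) \<theta>, in the
    middle of the strip between -2 \<theta> and -\<theta>.\<close>
  define x0 where "x0 = p + (- (3/2 * \<theta>)) *\<^sub>R w"
  have lx0: "lam s x0 a = - (3/2 * \<theta>)" unfolding x0_def using lam_along[OF s a(1), of p "- (3/2 * \<theta>)" w] pb(1) w by simp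
  have zx0: "?z x0 = p" unfolding lx0 by (simp add: x0_def)
  have jx0: "?j x0 = p' + (- (3/2 * \<theta>)) *\<^sub>R w'"
    unfolding jump_def zx0 unfolding lx0 using pb(2) by (simp add: p'_def face)
  have h: "3 * (\<theta> * norm w) < \<rho> * 2" "3 * (\<theta> * norm w') < \<rho>' * 2" using tm t0 m \<theta>0 by linarith+
  have "x0 \<in> ?R"
    using lx0 \<theta>0 h(1) by (simp add: x0_def dist_norm mult.assoc)
  moreover have "?j x0 \<in> ?R'"
  proof -
    have "lam s' (?j x0) a' = - (3/2 * \<theta>)" unfolding jump_facts(4)[OF s a(1) w s' a'(1) w' face] by (rule lx0)
    moreover have "dist (?j x0) p' < \<rho>'" unfolding jx0 using \<theta>0 h(2) by (simp add: dist_norm mult.assoc)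
    ultimately show ?thesis using \<theta>0 by simp
  qed
  moreover have "x0 \<in> ?T" unfolding mem_Collect_eq zx0 using pp by blast
  ultimately have ne: "?R \<inter> ?j -` ?R' \<inter> ?T \<noteq> {}" by blast
  have op: "open (?R \<inter> ?j -` ?R' \<inter> ?T)" using oR oj oT by (intro open_Int)
  from AE_lborel_open_witness[OF AE_conjI[OF r1(2) r2j] op ne]
  obtain x where x: "x \<in> ?R" "?j x \<in> ?R'" "x \<in> ?T" "(\<lambda>k. pull s (u (r1 k)) (?z x) - d) \<longlonglongrightarrow> 0"
    "(\<lambda>k. pull s' (u (r1 (r2 k))) (?z' (?j x)) - d') \<longlonglongrightarrow> 0" by auto
  note jf = jump_facts[OF s a(1) w s' a'(1) w' face, where x = x]
  let ?q = "\<Sum>v\<in>s - {a}. lam s (?z x) v *\<^sub>R vert s' v"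
  have zd: "?z x \<in> rp_dom P s" unfolding dom_iff[OF s]
  proof
    fix v assume "v \<in> s"
    then show "0 \<le> lam s (?z x) v" using x(3) jf(1) by (cases "v = a") (auto intro: less_imp_le)
  qed
  have qd: "?q \<in> rp_dom P s'" unfolding dom_iff[OF s']
  proof
    fix v assume v: "v \<in> s'"
    show "0 \<le> lam s' ?q v"
    proof (cases "v = a'")
      case False
      then have "v \<in> s - {a}" using v face by blast
      then show ?thesis using jf(2) x(3) by (auto intro: less_imp_le)
    qed (use jf(3) in simp)
  qed
  \<comment> \<open>The two charts describe the same point of X, so every \<open>u k\<close> has one
    common value there.\<close>
  have "rp_param P s (?z x) = rp_param P s' ?q"
  proof (rule bary_inject, rule ext)
    fix v
    show "rp_bary P (rp_param P s (?z x)) v = rp_bary P (rp_param P s' ?q) v"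
      unfolding bary_param[OF s zd] bary_param[OF s' qd]
    proof (cases "v \<in> s - {a}")
      case True
      then have "v \<in> s" "v \<in> s'" using face by auto
      then show "(if v \<in> s then lam s (?z x) v else 0) = (if v \<in> s' then lam s' ?q v else 0)" using jf(2)[OF True] by simp
    next
      case False
      then have "v \<notin> s \<or> v = a" "v \<notin> s' \<or> v = a'" using face by auto
      then show "(if v \<in> s then lam s (?z x) v else 0) = (if v \<in> s' then lam s' ?q v else 0)" using jf(1) jf(3) by auto
    qed
  qed
  then have same: "pull s (u k) (?z x) = pull s' (u k) ?q" for k using zd qd by (simp add: pull_dom)
  have "(\<lambda>k. pull s (u (r1 (r2 k))) (?z x) - d) \<longlonglongrightarrow> 0" using LIMSEQ_subseq_LIMSEQ[OF x(4) r2(1)] by (simp add: o_def)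
  then have A: "(\<lambda>k. pull s' (u (r1 (r2 k))) ?q) \<longlonglongrightarrow> d" unfolding same by (simp add: LIM_zero_iff)
  have B: "(\<lambda>k. pull s' (u (r1 (r2 k))) ?q) \<longlonglongrightarrow> d'" using x(5) unfolding jf(5) by (simp add: LIM_zero_iff)
  have "d = d'" by (rule LIMSEQ_unique[OF A B])
  then show ?thesis using cd cd' by simp
qed

text \<open>Chainability for the open set X makes the complement of the (n-2)-skeleton connected. It
  is covered by two closed unions of cells, those carrying the constant of s0 and the others. At a
  common point outside the skeleton two distinct maximal simplexes would share exactly n vertices,
  and \<open>adjacent_const\<close> excludes different constants.\<close>

lemma constant_of_gradient_zero:
  assumes f: "f \<in> borel_measurable (rp_vol P)" and G: "local_gradient P f G" and G0: "AE y in rp_vol P. G y = 0"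
  shows "\<exists>c. AE y in rp_vol P. f y = c"
proof -
  have "\<exists>c. AE x in lebesgue. x \<in> intr s \<longrightarrow> f (rp_param P s x) = c" if s: "s \<in> rp_max P" for s
    using simplex_limits[OF f G G0, of "{s}"] s by auto
  then obtain c where c: "\<And>s. s \<in> rp_max P \<Longrightarrow> AE x in lebesgue. x \<in> intr s \<longrightarrow> f (rp_param P s x) = c s" by metis
  obtain s0 where s0: "s0 \<in> rp_max P" using ex_cell by blast
  define S where "S = {s \<in> rp_max P. c s = c s0}"
  let ?K = "rp_skeleton P (int CARD('n) - 2)"
  have con: "connected (UNIV - ?K)" using adm X_connected unfolding rp_admissible_def by blast
  \<comment> \<open>A k-simplex has k + 1 vertices, so a point outside the (n-2)-skeleton has a
    carrier with at least n vertices.\<close>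
  have big: "CARD('n) \<le> card (rp_carrier P y)" if "y \<notin> ?K" for y
  proof (rule ccontr)
    assume "\<not> CARD('n) \<le> card (rp_carrier P y)"
    then have "int (card (rp_carrier P y)) \<le> (int CARD('n) - 2) + 1" by simp
    moreover have "y \<in> rp_cell P (rp_carrier P y)"
      unfolding rp_cell_def using bary_space[of y] triang_bary[of y] by (auto simp: rp_carrier_def intro!: image_eqI[of _ _ "rp_bary P y"])
    ultimately show False using that carrier_complex[of y] unfolding rp_skeleton_def by blast
  qed
  have small: "y \<notin> ?K" if y: "rp_carrier P y \<in> rp_max P" for y
  proof
    assume "y \<in> ?K"
    then obtain t where t: "t \<in> rp_complex P" "int (card t) \<le> (int CARD('n) - 2) + 1" "y \<in> rp_cell P t"
      unfolding rp_skeleton_def by blast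
    then obtain \<alpha> where "\<alpha> \<in> rp_space P" "supp \<alpha> \<subseteq> t" "y = rp_triang P \<alpha>" unfolding rp_cell_def by blast
    then have "rp_carrier P y \<subseteq> t" using bary_triang by (simp add: rp_carrier_def)
    then have "card (rp_carrier P y) \<le> card t" using simplex_finite[OF t(1)] by (intro card_mono)
    then show False using t(2) card_max[OF y] by simp
  qed
  have pt: "\<exists>y. y \<in> cell s \<and> y \<notin> ?K" if s: "s \<in> rp_max P" for s
  proof -
    obtain x where x: "x \<in> intr s" using intr_nonempty[OF s] by blast
    have "rp_carrier P (rp_param P s x) = s" by (rule carrier_intr[OF s x])
    then show ?thesis using small[of "rp_param P s x"] s by (intro exI[of _ "rp_param P s x"]) (simp add: cell_def)
  qed
  let ?A = "\<Union>s\<in>S. cell s" and ?B = "\<Union>s\<in>rp_max P - S. cell s"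
  have cA: "closed ?A" by (rule closed_Union_cells) (auto simp: S_def)
  have cB: "closed ?B" by (rule closed_Union_cells) auto
  have disj: "?A \<inter> ?B \<inter> (UNIV - ?K) = {}"
  proof (rule ccontr)
    assume "\<not> ?thesis"
    then obtain y s s' where y: "y \<notin> ?K" "s \<in> S" "y \<in> cell s" "s' \<in> rp_max P" "s' \<notin> S" "y \<in> cell s'" by blast
    have s: "s \<in> rp_max P" "c s = c s0" using y(2) by (auto simp: S_def)
    have ne: "s \<noteq> s'" using y(2,5) by blast
    have "rp_carrier P y \<subseteq> s \<inter> s'" using y(3,6) by (auto simp: cell_def)
    then have "card (rp_carrier P y) \<le> card (s \<inter> s')" using max_finite[OF s(1)] by (intro card_mono) auto
    then have ge: "CARD('n) \<le> card (s \<inter> s')" using big[OF y(1)] by simp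
    have "s \<inter> s' \<noteq> s" using max_maximal[OF s(1) max_complex[OF y(4)]] ne by blast
    then have "s \<inter> s' \<subset> s" by blast
    then have "card (s \<inter> s') < card s" by (rule psubset_card_mono[OF max_finite[OF s(1)]])
    then have "card (s \<inter> s') = CARD('n)" using ge card_max[OF s(1)] by simp
    from adjacent_const[OF f G G0 s(1) y(4) this c[OF s(1)] c[OF y(4)]]
    have "s' \<in> S" using s(2) y(4) by (simp add: S_def)
    then show False using y(5) by blast
  qed
  have cov: "UNIV - ?K \<subseteq> ?A \<union> ?B"
  proof
    fix y
    obtain s where "s \<in> rp_max P" "y \<in> cell s" using ex_cell by blast
    then show "y \<in> ?A \<union> ?B" by (cases "s \<in> S") auto
  qed
  have "?A \<inter> (UNIV - ?K) = {} \<or> ?B \<inter> (UNIV - ?K) = {}" by (rule connected_closedD[OF con disj cov cA cB])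
  moreover have "?A \<inter> (UNIV - ?K) \<noteq> {}"
  proof -
    have "s0 \<in> S" using s0 by (simp add: S_def)
    then show ?thesis using pt[OF s0] by blast
  qed
  ultimately have B: "?B \<inter> (UNIV - ?K) = {}" by blast
  have all: "c s = c s0" if s: "s \<in> rp_max P" for s
  proof (rule ccontr)
    assume "c s \<noteq> c s0"
    then have "s \<in> rp_max P - S" using s by (simp add: S_def)
    then show False using pt[OF s] B by blast
  qed
  have "AE y in rp_vol P. f y = c s0" unfolding AE_vol_iff
  proof
    fix s assume s: "s \<in> rp_max P"
    show "AE x in lebesgue. x \<in> intr s \<longrightarrow> f (rp_param P s x) = c s0" using c[OF s] unfolding all[OF s] .
  qed
  then show ?thesis by blast
qed

end

theorem theorem1p1:
  fixes P :: "('a::metric_space, 'v, 'e::euclidean_space, 'n::finite) riem_poly"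
    and f :: "'a \<Rightarrow> real"
  assumes "riemannian_polyhedron P"
    and "rp_complete P"
    and "rp_admissible P"
    and "rp_boundary P = {}"
    and "f \<in> W12_loc P \<inter> L2 P"
    and "AE y in rp_vol P. 0 \<le> f y"
    and "weakly_subharmonic P f"
  shows "\<exists>c. AE y in rp_vol P. f y = c"
proof -
  obtain \<Lambda> where L: "\<Lambda> > 0" "\<forall>s\<in>rp_max P. AE x in lebesgue_on (rp_dom P s).
        transpose (rp_metric P s x) = rp_metric P s x \<and>
        (\<forall>\<xi>. (norm \<xi>)\<^sup>2 / \<Lambda>\<^sup>2 \<le> \<xi> \<bullet> (rp_metric P s x *v \<xi>) \<and>
             \<xi> \<bullet> (rp_metric P s x *v \<xi>) \<le> \<Lambda>\<^sup>2 * (norm \<xi>)\<^sup>2)"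
    using assms(1) unfolding riemannian_polyhedron_def by blast
  interpret riem_polyhedron P \<Lambda>
    by standard (use assms(1,3) L in \<open>auto simp: elliptic_def\<close>)
  have f: "f \<in> borel_measurable (rp_vol P)" "integrable (rp_vol P) (\<lambda>y. (f y)\<^sup>2)"
    using assms(5) unfolding L2_def by auto
  obtain G where G: "local_gradient P f G"
    "\<forall>\<rho>\<in>Lip_c P. (\<forall>y. 0 \<le> \<rho> y) \<longrightarrow> (\<integral>y. rp_inner P y (G y) (rp_grad P \<rho> y) \<partial>rp_vol P) \<le> 0"
    using assms(7) unfolding weakly_subharmonic_def by blast
  show ?thesis
    by (rule constant_of_gradient_zero[OF f(1) G(1) gradient_zero[OF f assms(6) G]])
qed

end
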